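(* Let $\Bbbk$ be a field, let $m$ be odd, and let $A:=\Bbbk\langle z_1,\ldots,z_m\rangle/(1+\widetilde K_m)$, the quotient of the free associative algebra by the two-sided ideal generated by $1+\widetilde K_m$. Let $$b_m:A^m\longrightarrow A,\qquad b_m(a_1,\ldots,a_m)=\sum_{i=1}^m[a_i,z_i],$$ $$J_m:A\longrightarrow A^m,\qquad J_m(a)_i:=\sum_{p z_iq\in 1+\widetilde K_m}qap,$$ and let $\bar b_m:A^m/\operatorname{im}J_m\to A$ be the map induced by $b_m$. Then $$\operatorname{HH}_q(A)\cong\begin{cases}A/[A,A],&q=0,\\ \ker\left(\bar b_m:A^m/\operatorname{im} J_m\to A\right),&q=1,\\ 0,&q\ge2.\end{cases}$$
   Context: The continuants $\widetilde K_j$ are the elements of the free algebra $\Bbbk\langle z_1,\dots,z_m\rangle$ defined recursively by $\widetilde K_{-1}:=0$, $\widetilde K_0:=1$, $\widetilde K_j:=\widetilde K_{j-1}z_j+\widetilde K_{j-2}$ for $j\ge1$. In the definition of $J_m$, the sum runs over all occurrences of the letter $z_i$ in the monomials of $1+\widetilde K_m$, each occurrence being written as $p z_i q$ with $p,q$ words (and the coefficient of the monomial implicitly included). The composition $b_m\circ J_m$ is zero, so $\bar b_m$ is well defined. Here $[a,b]=ab-ba$, $[A,A]$ is the $\Bbbk$-linear span of all commutators, and $\operatorname{HH}_q(A)=\operatorname{Tor}_q^{A^e}(A,A)$ with $A^e=A\otimes_\Bbbk A^{\mathrm{op}}$ is the Hochschild homology of $A$ over $\Bbbk$; isomorphisms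 are of $\Bbbk$-vector spaces. *)

theory Defs
  imports "HOL-Algebra.Module" "HOL-Algebra.QuotRing" "HOL-Library.Poly_Mapping"
begin

section \<open>Linear algebra over rings that need not be commutative\<close>

text \<open>
  The ground field is the type \<open>'k\<close>, of class field.  A vector space or an algebra over it is a
  record of type \<open>('k, 'a) module\<close>; for a mere vector space the fields \<open>mult\<close> and \<open>one\<close> carry no
  information.
\<close>

definition ground :: "('k::field, 'k) module" where
  "ground = \<lparr>carrier = UNIV, mult = (*), one = 1, zero = 0, add = (+), smult = (*)\<rparr>"

text \<open>The locale \<open>module\<close> of the library requires a commutative ring of scalars.\<close>

definition left_module :: "('r, 's) ring_scheme \<Rightarrow> ('r, 'a, 't) module_scheme \<Rightarrow> bool" where
  "left_module R M \<longleftrightarrow> ring R \<and> abelian_group M \<and>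
     (\<forall>r\<in>carrier R. \<forall>x\<in>carrier M. r \<odot>\<^bsub>M\<^esub> x \<in> carrier M) \<and>
     (\<forall>r\<in>carrier R. \<forall>s\<in>carrier R. \<forall>x\<in>carrier M.
        (r \<oplus>\<^bsub>R\<^esub> s) \<odot>\<^bsub>M\<^esub> x = r \<odot>\<^bsub>M\<^esub> x \<oplus>\<^bsub>M\<^esub> s \<odot>\<^bsub>M\<^esub> x) \<and>
     (\<forall>r\<in>carrier R. \<forall>x\<in>carrier M. \<forall>y\<in>carrier M.
        r \<odot>\<^bsub>M\<^esub> (x \<oplus>\<^bsub>M\<^esub> y) = r \<odot>\<^bsub>M\<^esub> x \<oplus>\<^bsub>M\<^esub> r \<odot>\<^bsub>M\<^esub> y) \<and>
     (\<forall>r\<in>carrier R. \<forall>s\<in>carrier R. \<forall>x\<in>carrier M.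
        (r \<otimes>\<^bsub>R\<^esub> s) \<odot>\<^bsub>M\<^esub> x = r \<odot>\<^bsub>M\<^esub> (s \<odot>\<^bsub>M\<^esub> x)) \<and>
     (\<forall>x\<in>carrier M. \<one>\<^bsub>R\<^esub> \<odot>\<^bsub>M\<^esub> x = x)"

definition mod_hom ::
    "('r, 's) ring_scheme \<Rightarrow> ('r, 'a, 't) module_scheme \<Rightarrow> ('r, 'b, 'u) module_scheme \<Rightarrow> ('a \<Rightarrow> 'b) set" where
  "mod_hom R M N = {h. h \<in> carrier M \<rightarrow> carrier N \<and>
     (\<forall>x\<in>carrier M. \<forall>y\<in>carrier M. h (x \<oplus>\<^bsub>M\<^esub> y) = h x \<oplus>\<^bsub>N\<^esub> h y) \<and>
     (\<forall>r\<in>carrier R. \<forall>x\<in>carrier M. h (r \<odot>\<^bsub>M\<^esub> x) = r \<odot>\<^bsub>N\<^esub> h x)}"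

definition vs_iso :: "('k::field, 'a) module \<Rightarrow> ('k, 'b) module \<Rightarrow> bool" (infix "\<cong>\<^sub>v" 50) where
  "V \<cong>\<^sub>v W \<longleftrightarrow> (\<exists>h\<in>mod_hom ground V W. bij_betw h (carrier V) (carrier W))"

definition vspan :: "('k::field, 'a) module \<Rightarrow> 'a set \<Rightarrow> 'a set" where
  "vspan V S = \<Inter>{W. submodule W ground V \<and> S \<subseteq> W}"

text \<open>
  The quotient of a vector space by a subspace, and also of an algebra by a two-sided ideal: in the
  second case the multiplication and the unit are the usual ones of the quotient ring.
\<close>

definition vquot :: "('k::field, 'a) module \<Rightarrow> 'a set \<Rightarrow> ('k, 'a set) module" (infixl "'/\<^sub>v" 65) where
  "V /\<^sub>v W = ring.extend (V Quot W) (module.fields (\<lambda>c X. \<Union>x\<in>X. W +>\<^bsub>V\<^esub> c \<odot>\<^bsub>V\<^esub> x))"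

text \<open>The value on a coset \<open>X\<close> of a map \<open>f\<close> that is constant on \<open>X\<close>.\<close>

definition on_coset :: "('a \<Rightarrow> 'b) \<Rightarrow> 'a set \<Rightarrow> 'b" where
  "on_coset f X = the_elem (f ` X)"

definition vkernel :: "('k::field, 'a) module \<Rightarrow> ('k, 'b) module \<Rightarrow> ('a \<Rightarrow> 'b) \<Rightarrow> ('k, 'a) module" where
  "vkernel V W f = V\<lparr>carrier := {x \<in> carrier V. f x = \<zero>\<^bsub>W\<^esub>}\<rparr>"

definition vpower :: "('k::field, 'a) module \<Rightarrow> nat \<Rightarrow> ('k, nat \<Rightarrow> 'a) module" where
  "vpower V m =
     \<lparr>carrier = {1..m} \<rightarrow>\<^sub>E carrier V,
      mult = (\<lambda>f g. \<lambda>i\<in>{1..m}. f i \<otimes>\<^bsub>V\<^esub> g i), one = (\<lambda>i\<in>{1..m}. \<one>\<^bsub>V\<^esub>),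
      zero = (\<lambda>i\<in>{1..m}. \<zero>\<^bsub>V\<^esub>), add = (\<lambda>f g. \<lambda>i\<in>{1..m}. f i \<oplus>\<^bsub>V\<^esub> g i),
      smult = (\<lambda>c f. \<lambda>i\<in>{1..m}. c \<odot>\<^bsub>V\<^esub> f i)\<rparr>"


section \<open>Free vector spaces, monoid algebras and tensor products\<close>

definition free_space :: "'x set \<Rightarrow> ('k::field, 'x \<Rightarrow>\<^sub>0 'k) module" where
  "free_space X =
     \<lparr>carrier = {f. Poly_Mapping.keys f \<subseteq> X}, mult = undefined, one = undefined,
      zero = 0, add = (+), smult = (\<lambda>c. Poly_Mapping.map ((*) c))\<rparr>"

definition monoid_algebra :: "('g, 's) monoid_scheme \<Rightarrow> ('k::field, 'g \<Rightarrow>\<^sub>0 'k) module" where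
  "monoid_algebra G = (free_space (carrier G))
     \<lparr>mult := (\<lambda>f g. \<Sum>u\<in>Poly_Mapping.keys f. \<Sum>v\<in>Poly_Mapping.keys g.
         Poly_Mapping.single (u \<otimes>\<^bsub>G\<^esub> v) (Poly_Mapping.lookup f u * Poly_Mapping.lookup g v)),
      one := Poly_Mapping.single \<one>\<^bsub>G\<^esub> 1\<rparr>"

text \<open>
  The tensor product over a \<open>'k\<close>-algebra \<open>R\<close> of a right module \<open>M\<close> and a left module \<open>N\<close>, as a
  \<open>'k\<close>-vector space: the free vector space on the pairs modulo the relations of \<open>R\<close>-balanced
  \<open>'k\<close>-bilinearity.  For a right module \<open>M\<close>, \<open>r \<odot>\<^bsub>M\<^esub> x\<close> stands for \<open>x\<cdot>r\<close>.  The scalar \<open>c\<close> acts on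
  \<open>M\<close> and \<open>N\<close> as the element \<open>c \<odot>\<^bsub>R\<^esub> \<one>\<^bsub>R\<^esub>\<close> of \<open>R\<close>.
\<close>

definition tensor_rel ::
    "('k::field, 'r) module \<Rightarrow> ('r, 'a) module \<Rightarrow> ('r, 'b) module \<Rightarrow> ('a \<times> 'b \<Rightarrow>\<^sub>0 'k) set" where
  "tensor_rel R M N =
     (let t = (\<lambda>x y. Poly_Mapping.single (x, y) (1::'k)) in
      {t (x \<oplus>\<^bsub>M\<^esub> x') y - t x y - t x' y | x x' y. x \<in> carrier M \<and> x' \<in> carrier M \<and> y \<in> carrier N} \<union>
      {t x (y \<oplus>\<^bsub>N\<^esub> y') - t x y - t x y' | x y y'. x \<in> carrier M \<and> y \<in> carrier N \<and> y' \<in> carrier N} \<union>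
      {t (r \<odot>\<^bsub>M\<^esub> x) y - t x (r \<odot>\<^bsub>N\<^esub> y) | r x y. r \<in> carrier R \<and> x \<in> carrier M \<and> y \<in> carrier N} \<union>
      {t ((c \<odot>\<^bsub>R\<^esub> \<one>\<^bsub>R\<^esub>) \<odot>\<^bsub>M\<^esub> x) y - Poly_Mapping.single (x, y) c | c x y. x \<in> carrier M \<and> y \<in> carrier N})"

definition tensor_null ::
    "('k::field, 'r) module \<Rightarrow> ('r, 'a) module \<Rightarrow> ('r, 'b) module \<Rightarrow> ('a \<times> 'b \<Rightarrow>\<^sub>0 'k) set" where
  "tensor_null R M N = vspan (free_space (carrier M \<times> carrier N)) (tensor_rel R M N)"

definition tensor ::
    "('k::field, 'r) module \<Rightarrow> ('r, 'a) module \<Rightarrow> ('r, 'b) module \<Rightarrow> ('k, ('a \<times> 'b \<Rightarrow>\<^sub>0 'k) set) module" where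
  "tensor R M N = free_space (carrier M \<times> carrier N) /\<^sub>v tensor_null R M N"

text \<open>The map \<open>id \<otimes> g\<close> from \<open>tensor R M N\<close> to \<open>tensor R M N'\<close> given by \<open>g\<close> from \<open>N\<close> to \<open>N'\<close>.\<close>

definition tensor_map ::
    "('k::field, 'r) module \<Rightarrow> ('r, 'a) module \<Rightarrow> ('r, 'c) module \<Rightarrow> ('b \<Rightarrow> 'c)
       \<Rightarrow> ('a \<times> 'b \<Rightarrow>\<^sub>0 'k) set \<Rightarrow> ('a \<times> 'c \<Rightarrow>\<^sub>0 'k) set" where
  "tensor_map R M N' g = on_coset (\<lambda>f.
     tensor_null R M N' +>\<^bsub>free_space (carrier M \<times> carrier N')\<^esub>
       (\<Sum>(x, y)\<in>Poly_Mapping.keys f. Poly_Mapping.single (x, g y) (Poly_Mapping.lookup f (x, y))))"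


section \<open>Tor and Hochschild homology\<close>

text \<open>
  Projectivity is the lifting property.  Quantification over all types is not possible inside a
  definition; the types chosen for the test modules lose nothing, since they allow for the
  surjection onto \<open>P\<close> from the free module on the set \<open>carrier P\<close>, realised by finitely supported
  functions of type \<open>'p \<Rightarrow> 'r\<close>, and if this surjection splits then \<open>P\<close> is projective.
\<close>

definition projective_module :: "('r, 's) ring_scheme \<Rightarrow> ('r, 'p) module \<Rightarrow> bool" where
  "projective_module R P \<longleftrightarrow> left_module R P \<and>
     (\<forall>(M :: ('r, 'p \<Rightarrow> 'r) module) (N :: ('r, 'p) module) g f.
        left_module R M \<and> left_module R N \<and>
        g \<in> mod_hom R M N \<and> g ` carrier M = carrier N \<and> f \<in> mod_hom R P N
        \<longrightarrow> (\<exists>h\<in>mod_hom R P M. \<forall>x\<in>carrier P. g (h x) = f x))"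

definition projective_resolution ::
    "('r, 's) ring_scheme \<Rightarrow> ('r, 'a) module \<Rightarrow> (nat \<Rightarrow> ('r, 'p) module)
       \<Rightarrow> (nat \<Rightarrow> 'p \<Rightarrow> 'p) \<Rightarrow> ('p \<Rightarrow> 'a) \<Rightarrow> bool" where
  "projective_resolution R N P d \<epsilon> \<longleftrightarrow> left_module R N \<and>
     (\<forall>n. projective_module R (P n)) \<and>
     (\<forall>n. d n \<in> mod_hom R (P (Suc n)) (P n)) \<and> \<epsilon> \<in> mod_hom R (P 0) N \<and>
     \<epsilon> ` carrier (P 0) = carrier N \<and>
     d 0 ` carrier (P 1) = {x \<in> carrier (P 0). \<epsilon> x = \<zero>\<^bsub>N\<^esub>} \<and>
     (\<forall>n. d (Suc n) ` carrier (P (Suc (Suc n))) = {x \<in> carrier (P (Suc n)). d n x = \<zero>\<^bsub>P n\<^esub>})"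

text \<open>The homology in degree \<open>q\<close> of a complex with differentials \<open>\<delta> n\<close> from \<open>C (Suc n)\<close> to \<open>C n\<close>.\<close>

fun homology :: "(nat \<Rightarrow> ('k::field, 'a) module) \<Rightarrow> (nat \<Rightarrow> 'a \<Rightarrow> 'a) \<Rightarrow> nat \<Rightarrow> ('k, 'a set) module" where
  "homology C \<delta> 0 = C 0 /\<^sub>v (\<delta> 0 ` carrier (C 1))"
| "homology C \<delta> (Suc n) =
     vkernel (C (Suc n)) (C n) (\<delta> n) /\<^sub>v (\<delta> (Suc n) ` carrier (C (Suc (Suc n))))"

text \<open>
  \<open>Tor R M P d q\<close> is \<open>Tor\<^sub>q(M, N)\<close> over \<open>R\<close>, computed with the projective resolution \<open>(P, d)\<close> of \<open>N\<close>.
\<close>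

definition Tor ::
    "('k::field, 'r) module \<Rightarrow> ('r, 'a) module \<Rightarrow> (nat \<Rightarrow> ('r, 'p) module) \<Rightarrow> (nat \<Rightarrow> 'p \<Rightarrow> 'p)
       \<Rightarrow> nat \<Rightarrow> ('k, ('a \<times> 'p \<Rightarrow>\<^sub>0 'k) set set) module" where
  "Tor R M P d = homology (\<lambda>n. tensor R M (P n)) (\<lambda>n. tensor_map R M (P n) (d n))"

definition opposite :: "('k, 'a) module \<Rightarrow> ('k, 'a) module" where
  "opposite A = A\<lparr>mult := (\<lambda>x y. y \<otimes>\<^bsub>A\<^esub> x)\<rparr>"

text \<open>
  The algebra \<open>A \<otimes> B\<close> over the ground field.  Its underlying vector space is \<open>tensor ground A B\<close>,
  and the product induced from the monoid algebra of \<open>A \<times> B\<close> is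
  \<open>(a \<otimes> b) (a' \<otimes> b') = a a' \<otimes> b b'\<close>.
\<close>

definition tensor_algebra ::
    "('k::field, 'a) module \<Rightarrow> ('k, 'b) module \<Rightarrow> ('k, ('a \<times> 'b \<Rightarrow>\<^sub>0 'k) set) module" where
  "tensor_algebra A B = monoid_algebra (A \<times>\<times> B) /\<^sub>v tensor_null ground A B"

definition enveloping :: "('k::field, 'a) module \<Rightarrow> ('k, ('a \<times> 'a \<Rightarrow>\<^sub>0 'k) set) module" where
  "enveloping A = tensor_algebra A (opposite A)"

text \<open>\<open>A\<close> as a left module over its enveloping algebra: \<open>(a \<otimes> b)\<cdot>x = a x b\<close>.\<close>

definition left_enveloping_module ::
    "('k::field, 'a) module \<Rightarrow> (('a \<times> 'a \<Rightarrow>\<^sub>0 'k) set, 'a) module" where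
  "left_enveloping_module A = ring.extend (ring.truncate A) (module.fields (\<lambda>e x.
     on_coset (\<lambda>f. \<Oplus>\<^bsub>A\<^esub>p\<in>Poly_Mapping.keys f.
       Poly_Mapping.lookup f p \<odot>\<^bsub>A\<^esub> (fst p \<otimes>\<^bsub>A\<^esub> x \<otimes>\<^bsub>A\<^esub> snd p)) e))"

text \<open>\<open>A\<close> as a right module over its enveloping algebra: \<open>x\<cdot>(a \<otimes> b) = b x a\<close>.\<close>

definition right_enveloping_module ::
    "('k::field, 'a) module \<Rightarrow> (('a \<times> 'a \<Rightarrow>\<^sub>0 'k) set, 'a) module" where
  "right_enveloping_module A = ring.extend (ring.truncate A) (module.fields (\<lambda>e x.
     on_coset (\<lambda>f. \<Oplus>\<^bsub>A\<^esub>p\<in>Poly_Mapping.keys f.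
       Poly_Mapping.lookup f p \<odot>\<^bsub>A\<^esub> (snd p \<otimes>\<^bsub>A\<^esub> x \<otimes>\<^bsub>A\<^esub> fst p)) e))"

text \<open>
  A resolution suitable for computing \<open>HH\<^sub>q(A) = Tor\<^sub>q(A, A)\<close> over the enveloping algebra, and the
  Hochschild homology computed with it.  The resolution is a parameter: a theorem about \<open>HH\<close> is to
  be stated for every projective resolution, with modules over an arbitrary type \<open>'p\<close>.
\<close>

definition bimodule_resolution ::
    "('k::field, 'a) module \<Rightarrow> (nat \<Rightarrow> (('a \<times> 'a \<Rightarrow>\<^sub>0 'k) set, 'p) module)
       \<Rightarrow> (nat \<Rightarrow> 'p \<Rightarrow> 'p) \<Rightarrow> ('p \<Rightarrow> 'a) \<Rightarrow> bool" where
  "bimodule_resolution A P d \<epsilon> \<longleftrightarrow>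
     projective_resolution (enveloping A) (left_enveloping_module A) P d \<epsilon>"

definition HH ::
    "('k::field, 'a) module \<Rightarrow> (nat \<Rightarrow> (('a \<times> 'a \<Rightarrow>\<^sub>0 'k) set, 'p) module) \<Rightarrow> (nat \<Rightarrow> 'p \<Rightarrow> 'p)
       \<Rightarrow> nat \<Rightarrow> ('k, ('a \<times> 'p \<Rightarrow>\<^sub>0 'k) set set) module" where
  "HH A P d q = Tor (enveloping A) (right_enveloping_module A) P d q"

definition commutator_space :: "('k::field, 'a) module \<Rightarrow> 'a set" where
  "commutator_space A =
     vspan A {a \<otimes>\<^bsub>A\<^esub> b \<ominus>\<^bsub>A\<^esub> b \<otimes>\<^bsub>A\<^esub> a | a b. a \<in> carrier A \<and> b \<in> carrier A}"


section \<open>The algebra defined by a continuant\<close>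

definition word_monoid :: "nat \<Rightarrow> nat list monoid" where
  "word_monoid m = \<lparr>carrier = lists {1..m}, mult = (@), one = []\<rparr>"

definition free_algebra :: "nat \<Rightarrow> ('k::field, nat list \<Rightarrow>\<^sub>0 'k) module" where
  "free_algebra m = monoid_algebra (word_monoid m)"

text \<open>
  With the indices shifted by one: \<open>shifted_continuant m (Suc j)\<close> is the \<open>j\<close>-th continuant, and
  \<open>shifted_continuant m 0\<close> is the continuant with index \<open>-1\<close>.
\<close>

fun shifted_continuant :: "nat \<Rightarrow> nat \<Rightarrow> (nat list \<Rightarrow>\<^sub>0 'k::field)" where
  "shifted_continuant m 0 = \<zero>\<^bsub>free_algebra m\<^esub>"
| "shifted_continuant m (Suc 0) = \<one>\<^bsub>free_algebra m\<^esub>"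
| "shifted_continuant m (Suc (Suc j)) =
     shifted_continuant m (Suc j) \<otimes>\<^bsub>free_algebra m\<^esub> Poly_Mapping.single [Suc j] 1
       \<oplus>\<^bsub>free_algebra m\<^esub> shifted_continuant m j"

definition relator :: "nat \<Rightarrow> (nat list \<Rightarrow>\<^sub>0 'k::field)" where
  "relator m = \<one>\<^bsub>free_algebra m\<^esub> \<oplus>\<^bsub>free_algebra m\<^esub> shifted_continuant m (Suc m)"

definition relator_ideal :: "nat \<Rightarrow> (nat list \<Rightarrow>\<^sub>0 'k::field) set" where
  "relator_ideal m = Idl\<^bsub>free_algebra m\<^esub> {relator m}"

definition continuant_algebra :: "nat \<Rightarrow> ('k::field, (nat list \<Rightarrow>\<^sub>0 'k) set) module" where
  "continuant_algebra m = free_algebra m /\<^sub>v relator_ideal m"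

definition word_class :: "nat \<Rightarrow> nat list \<Rightarrow> (nat list \<Rightarrow>\<^sub>0 'k::field) set" where
  "word_class m w = relator_ideal m +>\<^bsub>free_algebra m\<^esub> Poly_Mapping.single w 1"

definition b_map ::
    "nat \<Rightarrow> (nat \<Rightarrow> (nat list \<Rightarrow>\<^sub>0 'k::field) set) \<Rightarrow> (nat list \<Rightarrow>\<^sub>0 'k) set" where
  "b_map m a = (let A = continuant_algebra m in
     \<Oplus>\<^bsub>A\<^esub>i\<in>{1..m}. a i \<otimes>\<^bsub>A\<^esub> word_class m [i] \<ominus>\<^bsub>A\<^esub> word_class m [i] \<otimes>\<^bsub>A\<^esub> a i)"

text \<open>
  An occurrence \<open>p z\<^sub>i q\<close> of the letter \<open>z\<^sub>i\<close> in the relator is a monomial \<open>w\<close> of the relator with a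
  position \<open>j\<close> such that \<open>w ! j = i\<close>; then \<open>p = take j w\<close> and \<open>q = drop (Suc j) w\<close>.
\<close>

definition J_map ::
    "nat \<Rightarrow> (nat list \<Rightarrow>\<^sub>0 'k::field) set \<Rightarrow> nat \<Rightarrow> (nat list \<Rightarrow>\<^sub>0 'k) set" where
  "J_map m a = (let A = continuant_algebra m in
     (\<lambda>i\<in>{1..m}. \<Oplus>\<^bsub>A\<^esub>w\<in>Poly_Mapping.keys (relator m :: nat list \<Rightarrow>\<^sub>0 'k).
       \<Oplus>\<^bsub>A\<^esub>j\<in>{j. j < length w \<and> w ! j = i}.
         Poly_Mapping.lookup (relator m) w \<odot>\<^bsub>A\<^esub>
           (word_class m (drop (Suc j) w) \<otimes>\<^bsub>A\<^esub> a \<otimes>\<^bsub>A\<^esub> word_class m (take j w))))"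

definition b_bar ::
    "nat \<Rightarrow> (nat \<Rightarrow> (nat list \<Rightarrow>\<^sub>0 'k::field) set) set \<Rightarrow> (nat list \<Rightarrow>\<^sub>0 'k) set" where
  "b_bar m = on_coset (b_map m)"

end

theory Submission
  imports Defs
begin

text \<open>
  Let \<open>r = 1 + K\<^sub>m\<close> be the relator, where \<open>K\<^sub>j\<close> is the \<open>j\<close>-th continuant, and let \<open>E\<close> be the
  enveloping algebra of \<open>A\<close>.  The proof rests on a free resolution of length two,
  \<open>0 \<rightarrow> E \<rightarrow> E\<^sup>m \<rightarrow> E \<rightarrow> A \<rightarrow> 0\<close>.  Its last map is the multiplication, the middle one sends the
  \<open>i\<close>-th basis vector to \<open>z\<^sub>i \<otimes> 1 - 1 \<otimes> z\<^sub>i\<close>, and the first one sends \<open>1\<close> to the vector whose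
  \<open>i\<close>-th entry is the sum of \<open>p \<otimes> q\<close> over all occurrences \<open>p z\<^sub>i q\<close> of \<open>z\<^sub>i\<close> in \<open>r\<close>.

  Except for the injectivity of the first map, this is exact for every algebra with one defining
  relation.  Sending a word to the sum of \<open>p \<otimes> q\<close> over its occurrences \<open>p z\<^sub>i q\<close> gives maps
  \<open>D\<^sub>i\<close> from the free algebra to \<open>E\<close> which obey the Leibniz rule (\<open>D_mult\<close>) and the formula
  \<open>\<Sum>\<^sub>i D\<^sub>i f (z\<^sub>i \<otimes> 1 - 1 \<otimes> z\<^sub>i) = f \<otimes> 1 - 1 \<otimes> f\<close> (\<open>D_fundamental\<close>); on the ideal of \<open>r\<close> the
  vector \<open>D f\<close> is a multiple of \<open>D r\<close> (\<open>D_ideal\<close>).  If \<open>sec\<close> is a linear section of the quotient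
  map onto \<open>A\<close>, then \<open>a \<otimes> b \<mapsto> (1 \<otimes> b) D (sec a)\<close> is a contracting homotopy in degree \<open>0\<close>
  (\<open>homotopy_degree_0\<close>), and in degree \<open>1\<close> modulo the multiples of \<open>D r\<close> (\<open>homotopy_degree_1\<close>).

  The injectivity of the first map uses the shape of the continuant.  From
  \<open>r = 1 + K\<^bsub>m-1\<^esub> z\<^sub>m + K\<^bsub>m-2\<^esub>\<close>, where \<open>z\<^sub>m\<close> occurs only at the displayed place, the \<open>m\<close>-th entry of \<open>D r\<close> is
  \<open>K\<^bsub>m-1\<^esub> \<otimes> 1\<close>, so it is enough to find a linear left inverse of the right multiplication by
  \<open>K\<^bsub>m-1\<^esub>\<close> on \<open>A\<close>.  In the free algebra such a left inverse is division with remainder, because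
  \<open>K\<^bsub>m-1\<^esub>\<close> has the single longest word \<open>z\<^sub>1 \<dots> z\<^bsub>m-1\<^esub>\<close> (\<open>right_divide_mult\<close>).  To carry it over to
  \<open>A\<close> one needs representatives of the elements of \<open>A\<close> that depend linearly on them and are
  compatible with the multiplication by \<open>K\<^bsub>m-1\<^esub>\<close>.  They are obtained from a modified right action
  of the free algebra on itself: the letters \<open>z\<^sub>1, \<dots>, z\<^bsub>m-1\<^esub>\<close> act by multiplication, and the action
  of \<open>z\<^sub>m\<close> is changed by multiples of \<open>r\<close> in such a way that \<open>r\<close> acts as zero
  (\<open>twisted_action_relator\<close>).  Then the ideal of \<open>r\<close> acts as zero, and what \<open>f\<close> makes of \<open>1\<close> is a
  representative of the class of \<open>f\<close> that depends only on this class (\<open>normal_form\<close>).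

  Hochschild homology is taken with an arbitrary projective resolution.  Two projective resolutions
  are homotopy equivalent (\<open>resolutions_homotopy_equivalent\<close>), and this survives tensoring
  (\<open>Tor_independent\<close>), so the resolution above may be used.  The isomorphism of \<open>A \<otimes>\<^sub>E E\<^sup>k\<close> with
  \<open>A\<^sup>k\<close> turns its two maps into \<open>J\<^sub>m\<close> and \<open>b\<^sub>m\<close> (\<open>Tor_free\<close>, \<open>\<delta>_1\<close>, \<open>\<delta>_0\<close>).  Degree \<open>1\<close> is then the
  kernel of \<open>b\<^sub>m\<close> modulo the image of \<open>J\<^sub>m\<close>; degree \<open>0\<close> is \<open>A\<close> modulo the image of \<open>b\<^sub>m\<close>, which is
  \<open>[A, A]\<close> since \<open>[a, b] = b\<^sub>m (v)\<close> for the vector \<open>v\<close> obtained by letting \<open>D (sec b)\<close> act on \<open>a\<close>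
  (\<open>commutator_b_map\<close>); and degree \<open>2\<close> is the kernel of \<open>J\<^sub>m\<close>, which vanishes because
  the \<open>m\<close>-th entry of \<open>J\<^sub>m a\<close> is \<open>a K\<^bsub>m-1\<^esub>\<close> (\<open>J_map_injective\<close>).
\<close>

section \<open>Modules over noncommutative rings\<close>

lemma ground_simps [simp]:
  "carrier ground = UNIV" "a \<otimes>\<^bsub>ground\<^esub> b = a * b" "\<one>\<^bsub>ground\<^esub> = 1" "\<zero>\<^bsub>ground\<^esub> = 0"
  "a \<oplus>\<^bsub>ground\<^esub> b = a + b"
  by (simp_all add: ground_def)

lemma cring_ground: "cring (ground :: ('k::field, 'k) module)"
proof (rule cringI)
  show "abelian_group (ground :: ('k, 'k) module)"
  proof (rule abelian_groupI)
    fix x :: 'k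
    show "\<exists>y\<in>carrier ground. y \<oplus>\<^bsub>ground\<^esub> x = \<zero>\<^bsub>ground\<^esub>"
      by (rule bexI [of _ "- x"]) simp_all
  qed (simp_all add: algebra_simps)
  show "comm_monoid (ground :: ('k, 'k) module)"
    by (rule comm_monoidI) (simp_all add: algebra_simps)
qed (simp add: algebra_simps)

lemma ground_uminus [simp]: "\<ominus>\<^bsub>ground\<^esub> a = - (a :: 'k::field)"
proof -
  interpret cring "ground :: ('k, 'k) module" by (rule cring_ground)
  show ?thesis by (rule minus_equality) simp_all
qed

locale lmodule = R?: ring R + M?: abelian_group M for R (structure) and M (structure) +
  assumes smult_closed [simp, intro]:
      "\<lbrakk>r \<in> carrier R; x \<in> carrier M\<rbrakk> \<Longrightarrow> r \<odot>\<^bsub>M\<^esub> x \<in> carrier M"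
    and smult_l_distr:
      "\<lbrakk>r \<in> carrier R; s \<in> carrier R; x \<in> carrier M\<rbrakk> \<Longrightarrow>
      (r \<oplus> s) \<odot>\<^bsub>M\<^esub> x = r \<odot>\<^bsub>M\<^esub> x \<oplus>\<^bsub>M\<^esub> s \<odot>\<^bsub>M\<^esub> x"
    and smult_r_distr:
      "\<lbrakk>r \<in> carrier R; x \<in> carrier M; y \<in> carrier M\<rbrakk> \<Longrightarrow>
      r \<odot>\<^bsub>M\<^esub> (x \<oplus>\<^bsub>M\<^esub> y) = r \<odot>\<^bsub>M\<^esub> x \<oplus>\<^bsub>M\<^esub> r \<odot>\<^bsub>M\<^esub> y"
    and smult_assoc:
      "\<lbrakk>r \<in> carrier R; s \<in> carrier R; x \<in> carrier M\<rbrakk> \<Longrightarrow>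
      (r \<otimes> s) \<odot>\<^bsub>M\<^esub> x = r \<odot>\<^bsub>M\<^esub> (s \<odot>\<^bsub>M\<^esub> x)"
    and smult_one [simp]: "x \<in> carrier M \<Longrightarrow> \<one> \<odot>\<^bsub>M\<^esub> x = x"

lemma left_module_iff: "left_module R M \<longleftrightarrow> lmodule R M"
  by (simp add: left_module_def lmodule_def lmodule_axioms_def Ball_def)

lemma module_ground_iff: "module ground V \<longleftrightarrow> lmodule ground V"
  by (simp add: module_def lmodule_def lmodule_axioms_def module_axioms_def cring_ground
    cring.axioms(1))

context lmodule
begin

lemma smult_zero_left [simp]: "x \<in> carrier M \<Longrightarrow> \<zero> \<odot>\<^bsub>M\<^esub> x = \<zero>\<^bsub>M\<^esub>"
  using smult_l_distr [of \<zero> \<zero> x] by (metis M.add.l_cancel_one R.l_zero R.zero_closed smult_closed)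

lemma smult_zero_right [simp]: "r \<in> carrier R \<Longrightarrow> r \<odot>\<^bsub>M\<^esub> \<zero>\<^bsub>M\<^esub> = \<zero>\<^bsub>M\<^esub>"
  using smult_r_distr [of r "\<zero>\<^bsub>M\<^esub>" "\<zero>\<^bsub>M\<^esub>"] by (metis M.add.l_cancel_one M.l_zero M.zero_closed smult_closed)

lemma smult_uminus_right:
  "\<lbrakk>r \<in> carrier R; x \<in> carrier M\<rbrakk> \<Longrightarrow> r \<odot>\<^bsub>M\<^esub> (\<ominus>\<^bsub>M\<^esub> x) = \<ominus>\<^bsub>M\<^esub> (r \<odot>\<^bsub>M\<^esub> x)"
  by (rule M.minus_equality [symmetric])
    (simp_all add: smult_r_distr [symmetric] M.l_neg)

lemma smult_uminus_left:
  "\<lbrakk>r \<in> carrier R; x \<in> carrier M\<rbrakk> \<Longrightarrow> (\<ominus> r) \<odot>\<^bsub>M\<^esub> x = \<ominus>\<^bsub>M\<^esub> (r \<odot>\<^bsub>M\<^esub> x)"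
  by (rule M.minus_equality [symmetric])
    (simp_all add: smult_l_distr [symmetric] R.l_neg)

lemma smult_finsum_right:
  "\<lbrakk>r \<in> carrier R; f \<in> I \<rightarrow> carrier M\<rbrakk> \<Longrightarrow>
    r \<odot>\<^bsub>M\<^esub> (\<Oplus>\<^bsub>M\<^esub>i\<in>I. f i) = (\<Oplus>\<^bsub>M\<^esub>i\<in>I. r \<odot>\<^bsub>M\<^esub> f i)"
  by (induct I rule: infinite_finite_induct) (auto simp: smult_r_distr Pi_iff)

end

lemma mod_homI:
  assumes "\<And>x. x \<in> carrier M \<Longrightarrow> h x \<in> carrier N"
    and "\<And>x y. \<lbrakk>x \<in> carrier M; y \<in> carrier M\<rbrakk> \<Longrightarrow> h (x \<oplus>\<^bsub>M\<^esub> y) = h x \<oplus>\<^bsub>N\<^esub> h y"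
    and "\<And>r x. \<lbrakk>r \<in> carrier R; x \<in> carrier M\<rbrakk> \<Longrightarrow> h (r \<odot>\<^bsub>M\<^esub> x) = r \<odot>\<^bsub>N\<^esub> h x"
  shows "h \<in> mod_hom R M N"
  using assms by (simp add: mod_hom_def)

lemma mod_hom_closed: "\<lbrakk>h \<in> mod_hom R M N; x \<in> carrier M\<rbrakk> \<Longrightarrow> h x \<in> carrier N"
  and mod_hom_add: "\<lbrakk>h \<in> mod_hom R M N; x \<in> carrier M; y \<in> carrier M\<rbrakk> \<Longrightarrow> h (x \<oplus>\<^bsub>M\<^esub> y) = h x \<oplus>\<^bsub>N\<^esub> h y"
  and mod_hom_smult: "\<lbrakk>h \<in> mod_hom R M N; r \<in> carrier R; x \<in> carrier M\<rbrakk> \<Longrightarrow> h (r \<odot>\<^bsub>M\<^esub> x) = r \<odot>\<^bsub>N\<^esub> h x"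
  by (auto simp: mod_hom_def)

lemma mod_hom_id: "(\<lambda>x. x) \<in> mod_hom R M M"
  by (simp add: mod_hom_def)

lemma mod_hom_comp: "\<lbrakk>f \<in> mod_hom R M N; g \<in> mod_hom R N L\<rbrakk> \<Longrightarrow> (\<lambda>x. g (f x)) \<in> mod_hom R M L"
  by (auto simp: mod_hom_def Pi_iff)

locale mod_hom_pair = M?: lmodule R M + N?: lmodule R N for R (structure) and M (structure) and N (structure)
begin

lemma hom_zero:
  assumes "h \<in> mod_hom R M N" shows "h \<zero>\<^bsub>M\<^esub> = \<zero>\<^bsub>N\<^esub>"
  using mod_hom_add [OF assms, of "\<zero>\<^bsub>M\<^esub>" "\<zero>\<^bsub>M\<^esub>"] mod_hom_closed [OF assms, of "\<zero>\<^bsub>M\<^esub>"]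
  by simp

lemma hom_uminus:
  assumes "h \<in> mod_hom R M N" "x \<in> carrier M" shows "h (\<ominus>\<^bsub>M\<^esub> x) = \<ominus>\<^bsub>N\<^esub> h x"
  by (rule N.M.minus_equality [symmetric])
    (use assms(2) in \<open>simp_all add: mod_hom_add [OF assms(1), symmetric] M.M.l_neg
      hom_zero [OF assms(1)] mod_hom_closed [OF assms(1)]\<close>)

lemma hom_minus:
  assumes "h \<in> mod_hom R M N" "x \<in> carrier M" "y \<in> carrier M"
  shows "h (x \<ominus>\<^bsub>M\<^esub> y) = h x \<ominus>\<^bsub>N\<^esub> h y"
  using assms(2,3) by (simp add: a_minus_def hom_uminus [OF assms(1)] mod_hom_add [OF assms(1)])

lemma hom_finsum:
  assumes "h \<in> mod_hom R M N" "f \<in> I \<rightarrow> carrier M"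
  shows "h (\<Oplus>\<^bsub>M\<^esub>i\<in>I. f i) = (\<Oplus>\<^bsub>N\<^esub>i\<in>I. h (f i))"
  using assms(2)
proof (induct I rule: infinite_finite_induct)
  case (insert i I)
  then show ?case
    by (simp add: mod_hom_add [OF assms(1)] mod_hom_closed [OF assms(1)] Pi_iff)
qed (use hom_zero [OF assms(1)] in simp_all)

lemma hom_plus_hom:
  assumes "f \<in> mod_hom R M N" "g \<in> mod_hom R M N"
  shows "(\<lambda>x. f x \<oplus>\<^bsub>N\<^esub> g x) \<in> mod_hom R M N"
  by (intro mod_homI) (simp_all add: mod_hom_closed [OF assms(1)] mod_hom_closed [OF assms(2)]
    mod_hom_add [OF assms(1)] mod_hom_add [OF assms(2)] mod_hom_smult [OF assms(1)]
    mod_hom_smult [OF assms(2)] N.smult_r_distr N.M.add.m_ac)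

lemma hom_minus_hom:
  assumes "f \<in> mod_hom R M N" "g \<in> mod_hom R M N"
  shows "(\<lambda>x. f x \<ominus>\<^bsub>N\<^esub> g x) \<in> mod_hom R M N"
  by (intro mod_homI) (simp_all add: mod_hom_closed [OF assms(1)] mod_hom_closed [OF assms(2)]
    mod_hom_add [OF assms(1)] mod_hom_add [OF assms(2)] mod_hom_smult [OF assms(1)]
    mod_hom_smult [OF assms(2)] N.smult_r_distr N.M.add.m_ac a_minus_def N.smult_uminus_right
    N.M.minus_add)

lemma hom_zero_hom: "(\<lambda>x. \<zero>\<^bsub>N\<^esub>) \<in> mod_hom R M N"
  by (intro mod_homI) auto

lemma hom_finsum_hom:
  assumes "\<And>i. i \<in> I \<Longrightarrow> f i \<in> mod_hom R M N"
  shows "(\<lambda>x. \<Oplus>\<^bsub>N\<^esub>i\<in>I. f i x) \<in> mod_hom R M N"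
  using assms
proof (induct I rule: infinite_finite_induct)
  case (insert i I)
  have "(\<lambda>x. f i x \<oplus>\<^bsub>N\<^esub> (\<Oplus>\<^bsub>N\<^esub>i\<in>I. f i x)) \<in> mod_hom R M N"
    using insert by (intro hom_plus_hom) auto
  moreover have "(\<Oplus>\<^bsub>N\<^esub>i\<in>insert i I. f i x) = f i x \<oplus>\<^bsub>N\<^esub> (\<Oplus>\<^bsub>N\<^esub>i\<in>I. f i x)" if "x \<in> carrier M" for x
    using insert that by (intro N.M.finsum_insert) (auto intro: mod_hom_closed)
  ultimately show ?case
    by (auto simp: mod_hom_def)
qed (simp_all add: hom_zero_hom)

end

section \<open>Vector spaces, subspaces and quotients\<close>

locale vspace = lmodule ground V for V :: "('k::field, 'a) module" (structure)

lemma (in abelian_group) minus_zero_right [simp]: "x \<in> carrier G \<Longrightarrow> x \<ominus> \<zero> = x"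
  by (simp add: a_minus_def)

lemma (in abelian_group) minus_self [simp]: "x \<in> carrier G \<Longrightarrow> x \<ominus> x = \<zero>"
  by (simp add: a_minus_def r_neg)

lemma (in abelian_group) minus_eq_iff:
  "\<lbrakk>x \<in> carrier G; y \<in> carrier G; z \<in> carrier G\<rbrakk> \<Longrightarrow> x \<ominus> y = z \<longleftrightarrow> x = z \<oplus> y"
  by (metis a_assoc a_inv_closed a_minus_def l_neg r_neg r_zero)

lemma (in abelian_group) minus_telescope:
  "\<lbrakk>x \<in> carrier G; y \<in> carrier G; z \<in> carrier G\<rbrakk> \<Longrightarrow> (x \<ominus> y) \<oplus> (z \<ominus> x) = z \<ominus> y"
  by (simp add: a_minus_def a_ac r_neg1 r_neg2)

lemma (in abelian_group) minus_cancel_middle: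
  "\<lbrakk>x \<in> carrier G; y \<in> carrier G; z \<in> carrier G\<rbrakk> \<Longrightarrow> (x \<oplus> (y \<oplus> z)) \<ominus> y = z \<oplus> x"
  by (simp add: minus_eq_iff a_ac)

locale vsubspace = vspace V for W and V :: "('k::field, 'a) module" (structure) +
  assumes sub: "submodule W ground V"
begin

sublocale W: abelian_subgroup W V
  by (intro abelian_subgroupI3 additive_subgroup.intro submodule.axioms(1) [OF sub]
    M.abelian_group_axioms)

lemma sub_smult: "x \<in> W \<Longrightarrow> c \<odot>\<^bsub>V\<^esub> x \<in> W"
  using submodule.smult_closed [OF sub] by simp

lemma vquot_simps:
  "\<zero>\<^bsub>V /\<^sub>v W\<^esub> = W"
  "carrier (V /\<^sub>v W) = (\<lambda>x. W +>\<^bsub>V\<^esub> x) ` carrier V"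
  by (auto simp: vquot_def ring.defs module.defs FactRing_def A_RCOSETS_def')

lemma coset_eq_iff:
  assumes "x \<in> carrier V" "y \<in> carrier V"
  shows "W +>\<^bsub>V\<^esub> x = W +>\<^bsub>V\<^esub> y \<longleftrightarrow> x \<ominus>\<^bsub>V\<^esub> y \<in> W"
  using assms W.a_rcos_module [folded a_minus_def]
    W.a_repr_independence' W.a_rcos_self by metis

lemma coset_zero: "W +>\<^bsub>V\<^esub> \<zero>\<^bsub>V\<^esub> = W"
  by (rule M.a_coset_add_zero [OF W.a_subset])

lemma coset_eq_sub_iff: "x \<in> carrier V \<Longrightarrow> W +>\<^bsub>V\<^esub> x = W \<longleftrightarrow> x \<in> W"
  using coset_eq_iff [of x "\<zero>\<^bsub>V\<^esub>"] by (simp add: coset_zero)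

lemma vquot_add:
  assumes "x \<in> carrier V" "y \<in> carrier V"
  shows "(W +>\<^bsub>V\<^esub> x) \<oplus>\<^bsub>V /\<^sub>v W\<^esub> (W +>\<^bsub>V\<^esub> y) = W +>\<^bsub>V\<^esub> (x \<oplus>\<^bsub>V\<^esub> y)"
  using W.a_rcos_sum [OF assms]
  by (simp add: vquot_def ring.defs module.defs FactRing_def)

lemma mem_coset_iff:
  assumes "x \<in> carrier V"
  shows "y \<in> W +>\<^bsub>V\<^esub> x \<longleftrightarrow> y \<in> carrier V \<and> y \<ominus>\<^bsub>V\<^esub> x \<in> W"
  using assms W.a_rcos_module [folded a_minus_def]
    W.a_elemrcos_carrier by metis

lemma vquot_smult:
  assumes "x \<in> carrier V"
  shows "c \<odot>\<^bsub>V /\<^sub>v W\<^esub> (W +>\<^bsub>V\<^esub> x) = W +>\<^bsub>V\<^esub> (c \<odot>\<^bsub>V\<^esub> x)"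
proof -
  have "W +>\<^bsub>V\<^esub> (c \<odot>\<^bsub>V\<^esub> y) = W +>\<^bsub>V\<^esub> (c \<odot>\<^bsub>V\<^esub> x)" if "y \<in> W +>\<^bsub>V\<^esub> x" for y
  proof -
    have y: "y \<in> carrier V" "y \<ominus>\<^bsub>V\<^esub> x \<in> W"
      using that mem_coset_iff [OF assms] by auto
    have "c \<odot>\<^bsub>V\<^esub> y \<ominus>\<^bsub>V\<^esub> c \<odot>\<^bsub>V\<^esub> x = c \<odot>\<^bsub>V\<^esub> (y \<ominus>\<^bsub>V\<^esub> x)"
      using y(1) assms by (simp add: a_minus_def smult_r_distr smult_uminus_right)
    then show ?thesis
      using y assms by (simp add: coset_eq_iff sub_smult)
  qed
  moreover have "x \<in> W +>\<^bsub>V\<^esub> x"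
    by (rule W.a_rcos_self [OF assms])
  ultimately have "(\<Union>y\<in>W +>\<^bsub>V\<^esub> x. W +>\<^bsub>V\<^esub> (c \<odot>\<^bsub>V\<^esub> y)) = W +>\<^bsub>V\<^esub> (c \<odot>\<^bsub>V\<^esub> x)"
    by blast
  then show ?thesis
    by (simp add: vquot_def ring.defs module.defs)
qed

lemma coset_closed: "x \<in> carrier V \<Longrightarrow> W +>\<^bsub>V\<^esub> x \<in> carrier (V /\<^sub>v W)"
  by (simp add: vquot_simps)

lemma vquot_lmodule: "lmodule ground (V /\<^sub>v W)"
proof -
  have "abelian_group (V /\<^sub>v W)"
  proof (rule abelian_groupI)
    fix X assume "X \<in> carrier (V /\<^sub>v W)"
    then obtain x where x: "x \<in> carrier V" "X = W +>\<^bsub>V\<^esub> x" by (auto simp: vquot_simps)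
    have "(W +>\<^bsub>V\<^esub> (\<ominus>\<^bsub>V\<^esub> x)) \<oplus>\<^bsub>V /\<^sub>v W\<^esub> X = \<zero>\<^bsub>V /\<^sub>v W\<^esub>"
      using x by (simp add: vquot_add M.l_neg coset_zero vquot_simps(1))
    then show "\<exists>Y\<in>carrier (V /\<^sub>v W). Y \<oplus>\<^bsub>V /\<^sub>v W\<^esub> X = \<zero>\<^bsub>V /\<^sub>v W\<^esub>"
      using x(1) M.a_inv_closed coset_closed by blast
    show "\<zero>\<^bsub>V /\<^sub>v W\<^esub> \<oplus>\<^bsub>V /\<^sub>v W\<^esub> X = X"
      using x vquot_add [of "\<zero>\<^bsub>V\<^esub>" x] by (simp add: coset_zero vquot_simps(1))
  next
    show "\<zero>\<^bsub>V /\<^sub>v W\<^esub> \<in> carrier (V /\<^sub>v W)"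
      using coset_closed [of "\<zero>\<^bsub>V\<^esub>"] by (simp add: vquot_simps(1) coset_zero)
  qed (auto simp: vquot_simps(2) vquot_add M.add.m_ac)
  then show ?thesis
    unfolding lmodule_def lmodule_axioms_def
    by (auto simp: vquot_simps(2) vquot_add vquot_smult smult_l_distr [simplified]
        smult_r_distr [simplified] smult_assoc [simplified] smult_one [simplified] cring.axioms(1) [OF cring_ground])
qed

lemma vspace_vquot: "vspace (V /\<^sub>v W)"
  by (simp add: vspace_def vquot_lmodule)

lemma coset_hom: "(\<lambda>x. W +>\<^bsub>V\<^esub> x) \<in> mod_hom ground V (V /\<^sub>v W)"
  by (intro mod_homI) (simp_all add: coset_closed vquot_add vquot_smult)

lemma on_coset_const:
  assumes "x \<in> carrier V" "\<And>y. \<lbrakk>y \<in> carrier V; y \<ominus>\<^bsub>V\<^esub> x \<in> W\<rbrakk> \<Longrightarrow> f y = f x"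
  shows "on_coset f (W +>\<^bsub>V\<^esub> x) = f x"
proof -
  have "f y = f x" if "y \<in> W +>\<^bsub>V\<^esub> x" for y
    using that by (intro assms(2)) (simp_all add: mem_coset_iff [OF assms(1)])
  then have "f ` (W +>\<^bsub>V\<^esub> x) = {f x}"
    using W.a_rcos_self [OF assms(1)] by blast
  then show ?thesis by (simp add: on_coset_def)
qed

text \<open>
  The map induced on a quotient.  Maps out of tensor products and out of the enveloping algebra arise in
  this way.
\<close>

lemma on_coset_hom:
  assumes "lmodule ground U" "f \<in> mod_hom ground V U" "\<And>w. w \<in> W \<Longrightarrow> f w = \<zero>\<^bsub>U\<^esub>"
  shows "x \<in> carrier V \<Longrightarrow> on_coset f (W +>\<^bsub>V\<^esub> x) = f x"
    and "on_coset f \<in> mod_hom ground (V /\<^sub>v W) U"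
proof -
  interpret U: lmodule ground U by fact
  interpret mod_hom_pair ground V U ..
  show *: "on_coset f (W +>\<^bsub>V\<^esub> x) = f x" if x: "x \<in> carrier V" for x
  proof (rule on_coset_const [OF x])
    fix y assume y: "y \<in> carrier V" "y \<ominus>\<^bsub>V\<^esub> x \<in> W"
    then have "f y \<ominus>\<^bsub>U\<^esub> f x = \<zero>\<^bsub>U\<^esub>"
      using assms(3) hom_minus [OF assms(2) y(1) x] by metis
    then show "f y = f x"
      using y x mod_hom_closed [OF assms(2)] by (simp add: U.M.minus_eq_iff)
  qed
  show "on_coset f \<in> mod_hom ground (V /\<^sub>v W) U"
    by (intro mod_homI) (auto simp: vquot_simps(2) vquot_add vquot_smult * mod_hom_closed [OF assms(2)]
      mod_hom_add [OF assms(2)] mod_hom_smult [OF assms(2)])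
qed

end

lemma lmodule_ground_submoduleI:
  assumes "lmodule ground V" "H \<subseteq> carrier V" "\<zero>\<^bsub>V\<^esub> \<in> H"
    and "\<And>x y. \<lbrakk>x \<in> H; y \<in> H\<rbrakk> \<Longrightarrow> x \<oplus>\<^bsub>V\<^esub> y \<in> H" "\<And>c x. x \<in> H \<Longrightarrow> c \<odot>\<^bsub>V\<^esub> x \<in> H"
  shows "submodule H ground V"
proof (rule module.submoduleI)
  interpret lmodule ground V by fact
  show "module ground V" using assms(1) by (simp add: module_ground_iff)
  fix x assume x: "x \<in> H"
  then have "x \<in> carrier V" using assms(2) by blast
  then have "\<ominus>\<^bsub>V\<^esub> x = (- 1) \<odot>\<^bsub>V\<^esub> x"
    using smult_uminus_left [of 1 x] smult_one by simp
  then show "\<ominus>\<^bsub>V\<^esub> x \<in> H" using assms(5) [OF x] by simp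
qed (use assms in auto)

lemma submodule_closed:
  assumes "submodule H ground V"
  shows "H \<subseteq> carrier V" "\<zero>\<^bsub>V\<^esub> \<in> H" "\<lbrakk>x \<in> H; y \<in> H\<rbrakk> \<Longrightarrow> x \<oplus>\<^bsub>V\<^esub> y \<in> H" "x \<in> H \<Longrightarrow> c \<odot>\<^bsub>V\<^esub> x \<in> H"
  using subgroup.subset [OF submodule.axioms(1) [OF assms]]
    subgroup.one_closed [OF submodule.axioms(1) [OF assms]]
    subgroup.m_closed [OF submodule.axioms(1) [OF assms]]
    submodule.smult_closed [OF assms, of c] by auto

lemma (in vspace) vspan_props:
  assumes "S \<subseteq> carrier V"
  shows vspan_submodule: "submodule (vspan V S) ground V"
    and subset_vspan: "S \<subseteq> vspan V S"
    and vspan_least: "\<lbrakk>submodule W ground V; S \<subseteq> W\<rbrakk> \<Longrightarrow> vspan V S \<subseteq> W"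
proof -
  have c: "submodule (carrier V) ground V"
    by (rule lmodule_ground_submoduleI) (auto intro: lmodule_axioms smult_closed [simplified])
  show "submodule (vspan V S) ground V"
  proof (rule lmodule_ground_submoduleI)
    show "vspan V S \<subseteq> carrier V" using c assms by (auto simp: vspan_def)
  qed (auto simp: vspan_def lmodule_axioms intro: submodule_closed(2-4))
qed (auto simp: vspan_def)

lemma kernel_submodule:
  assumes "mod_hom_pair ground V U" "f \<in> mod_hom ground V U"
  shows "submodule {x \<in> carrier V. f x = \<zero>\<^bsub>U\<^esub>} ground V"
proof -
  interpret mod_hom_pair ground V U by fact
  show ?thesis
    by (rule lmodule_ground_submoduleI)
      (auto simp: M.lmodule_axioms hom_zero [OF assms(2)] mod_hom_add [OF assms(2)] mod_hom_smult [OF assms(2)]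
        N.smult_zero_right [simplified] M.smult_closed [simplified])
qed

lemma image_submodule:
  assumes "mod_hom_pair ground V U" "f \<in> mod_hom ground V U"
  shows "submodule (f ` carrier V) ground U"
proof -
  interpret mod_hom_pair ground V U by fact
  show ?thesis
  proof (rule lmodule_ground_submoduleI)
    show "\<zero>\<^bsub>U\<^esub> \<in> f ` carrier V"
      using hom_zero [OF assms(2)] by (metis M.M.zero_closed imageI)
  qed (auto simp: N.lmodule_axioms mod_hom_closed [OF assms(2)] mod_hom_add [OF assms(2), symmetric]
    mod_hom_smult [OF assms(2), symmetric] M.smult_closed [simplified])
qed

lemma vkernel_simps [simp]:
  "carrier (vkernel V U f) = {x \<in> carrier V. f x = \<zero>\<^bsub>U\<^esub>}"
  "x \<oplus>\<^bsub>vkernel V U f\<^esub> y = x \<oplus>\<^bsub>V\<^esub> y" "\<zero>\<^bsub>vkernel V U f\<^esub> = \<zero>\<^bsub>V\<^esub>"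
  "c \<odot>\<^bsub>vkernel V U f\<^esub> x = c \<odot>\<^bsub>V\<^esub> x"
  by (simp_all add: vkernel_def)

lemma coset_vkernel: "W +>\<^bsub>vkernel V U f\<^esub> x = W +>\<^bsub>V\<^esub> x"
  by (simp add: a_r_coset_def r_coset_def)

lemma lmodule_vkernel:
  assumes "mod_hom_pair ground V U" "f \<in> mod_hom ground V U"
  shows "lmodule ground (vkernel V U f)"
proof -
  interpret mod_hom_pair ground V U by fact
  have "module ground (V\<lparr>carrier := {x \<in> carrier V. f x = \<zero>\<^bsub>U\<^esub>}\<rparr>)"
    by (rule submodule.submodule_is_module [OF kernel_submodule [OF assms]])
      (simp add: module_ground_iff M.lmodule_axioms)
  then show ?thesis by (simp add: vkernel_def module_ground_iff)
qed

lemma vs_isoI: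
  assumes "f \<in> mod_hom ground V W" "g \<in> carrier W \<rightarrow> carrier V"
    and "\<And>x. x \<in> carrier V \<Longrightarrow> g (f x) = x" "\<And>y. y \<in> carrier W \<Longrightarrow> f (g y) = y"
  shows "V \<cong>\<^sub>v W"
  unfolding vs_iso_def
  by (rule bexI [of _ f], rule bij_betw_byWitness [of _ g])
    (use assms in \<open>auto simp: mod_hom_closed [OF assms(1)]\<close>)

lemma vs_iso_trans [trans]:
  assumes "V \<cong>\<^sub>v W" "W \<cong>\<^sub>v U"
  shows "V \<cong>\<^sub>v U"
proof -
  obtain f g where f: "f \<in> mod_hom ground V W" "bij_betw f (carrier V) (carrier W)"
    and g: "g \<in> mod_hom ground W U" "bij_betw g (carrier W) (carrier U)"
    using assms unfolding vs_iso_def by blast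
  then show ?thesis
    unfolding vs_iso_def
    using mod_hom_comp [OF f(1) g(1)] bij_betw_trans [OF f(2) g(2)] by (auto simp: comp_def)
qed

text \<open>
  The maps \<open>f\<close> and \<open>g\<close> need only be inverse to each other modulo the subspaces.  Homotopy equivalences
  induce maps on cycles of exactly this kind, with the boundaries as subspaces.
\<close>

lemma vquot_iso:
  assumes "vsubspace W V" "vsubspace W' V'"
    and f: "f \<in> mod_hom ground V V'" and g: "g \<in> mod_hom ground V' V"
    and fW: "\<And>x. x \<in> W \<Longrightarrow> f x \<in> W'" and gW: "\<And>x. x \<in> W' \<Longrightarrow> g x \<in> W"
    and gf: "\<And>x. x \<in> carrier V \<Longrightarrow> g (f x) \<ominus>\<^bsub>V\<^esub> x \<in> W"
    and fg: "\<And>y. y \<in> carrier V' \<Longrightarrow> f (g y) \<ominus>\<^bsub>V'\<^esub> y \<in> W'"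
  shows "V /\<^sub>v W \<cong>\<^sub>v V' /\<^sub>v W'"
proof -
  interpret V: vsubspace W V by fact
  interpret V': vsubspace W' V' by fact
  note f' = mod_hom_closed [OF f] and g' = mod_hom_closed [OF g]
  have f0: "on_coset (\<lambda>x. W' +>\<^bsub>V'\<^esub> f x) (W +>\<^bsub>V\<^esub> x) = W' +>\<^bsub>V'\<^esub> f x" if "x \<in> carrier V" for x
    using that by (rule V.on_coset_hom(1) [OF V'.vquot_lmodule mod_hom_comp [OF f V'.coset_hom], rotated])
      (simp add: V'.vquot_simps V'.coset_eq_sub_iff f' V.W.a_Hcarr fW)
  have g0: "on_coset (\<lambda>x. W +>\<^bsub>V\<^esub> g x) (W' +>\<^bsub>V'\<^esub> x) = W +>\<^bsub>V\<^esub> g x" if "x \<in> carrier V'" for x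
    using that by (rule V'.on_coset_hom(1) [OF V.vquot_lmodule mod_hom_comp [OF g V.coset_hom], rotated])
      (simp add: V.vquot_simps V.coset_eq_sub_iff g' V'.W.a_Hcarr gW)
  show ?thesis
  proof (rule vs_isoI)
    show "on_coset (\<lambda>x. W' +>\<^bsub>V'\<^esub> f x) \<in> mod_hom ground (V /\<^sub>v W) (V' /\<^sub>v W')"
      by (rule V.on_coset_hom(2) [OF V'.vquot_lmodule mod_hom_comp [OF f V'.coset_hom]])
        (simp add: V'.vquot_simps V'.coset_eq_sub_iff f' V.W.a_Hcarr fW)
    show "on_coset (\<lambda>x. W +>\<^bsub>V\<^esub> g x) \<in> carrier (V' /\<^sub>v W') \<rightarrow> carrier (V /\<^sub>v W)"
      by (auto simp: V'.vquot_simps V.vquot_simps g0 g')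
    fix X assume "X \<in> carrier (V /\<^sub>v W)"
    then obtain x where x: "x \<in> carrier V" "X = W +>\<^bsub>V\<^esub> x" by (auto simp: V.vquot_simps)
    then have "W +>\<^bsub>V\<^esub> g (f x) = X"
      using V.coset_eq_iff [OF g' [OF f'] x(1)] gf by simp
    then show "on_coset (\<lambda>x. W +>\<^bsub>V\<^esub> g x) (on_coset (\<lambda>x. W' +>\<^bsub>V'\<^esub> f x) X) = X"
      using x by (simp add: f0 g0 f')
  next
    fix Y assume "Y \<in> carrier (V' /\<^sub>v W')"
    then obtain y where y: "y \<in> carrier V'" "Y = W' +>\<^bsub>V'\<^esub> y" by (auto simp: V'.vquot_simps)
    then have "W' +>\<^bsub>V'\<^esub> f (g y) = Y"
      using V'.coset_eq_iff [OF f' [OF g'] y(1)] fg by simp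
    then show "on_coset (\<lambda>x. W' +>\<^bsub>V'\<^esub> f x) (on_coset (\<lambda>x. W +>\<^bsub>V\<^esub> g x) Y) = Y"
      using y by (simp add: f0 g0 g')
  qed
qed

section \<open>Complexes\<close>

definition chain_complex :: "(nat \<Rightarrow> ('k::field, 'a) module) \<Rightarrow> (nat \<Rightarrow> 'a \<Rightarrow> 'a) \<Rightarrow> bool" where
  "chain_complex C \<delta> \<longleftrightarrow> (\<forall>n. vspace (C n)) \<and> (\<forall>n. \<delta> n \<in> mod_hom ground (C (Suc n)) (C n)) \<and>
     (\<forall>n. \<forall>x\<in>carrier (C (Suc (Suc n))). \<delta> n (\<delta> (Suc n) x) = \<zero>\<^bsub>C n\<^esub>)"

definition chain_map where
  "chain_map R C \<delta> C' \<delta>' f \<longleftrightarrow> (\<forall>n. f n \<in> mod_hom R (C n) (C' n) \<and>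
     (\<forall>x\<in>carrier (C (Suc n)). \<delta>' n (f (Suc n) x) = f n (\<delta> n x)))"

text \<open>
  The term with \<open>g\<close> stands on the right-hand side, so that no subtraction is needed: with the groups
  depending on \<open>n\<close>, differences are more cumbersome than sums.
\<close>

definition homotopic where
  "homotopic R C \<delta> C' \<delta>' f g \<longleftrightarrow> (\<exists>s. (\<forall>n. s n \<in> mod_hom R (C n) (C' (Suc n))) \<and>
     (\<forall>x\<in>carrier (C 0). f 0 x = \<delta>' 0 (s 0 x) \<oplus>\<^bsub>C' 0\<^esub> g 0 x) \<and>
     (\<forall>n. \<forall>x\<in>carrier (C (Suc n)). f (Suc n) x =
        \<delta>' (Suc n) (s (Suc n) x) \<oplus>\<^bsub>C' (Suc n)\<^esub> s n (\<delta> n x) \<oplus>\<^bsub>C' (Suc n)\<^esub> g (Suc n) x))"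

definition homotopy_equivalent where
  "homotopy_equivalent R C \<delta> C' \<delta>' \<longleftrightarrow> (\<exists>f g. chain_map R C \<delta> C' \<delta>' f \<and> chain_map R C' \<delta>' C \<delta> g \<and>
     homotopic R C \<delta> C \<delta> (\<lambda>n x. g n (f n x)) (\<lambda>n x. x) \<and>
     homotopic R C' \<delta>' C' \<delta>' (\<lambda>n x. f n (g n x)) (\<lambda>n x. x))"

lemma chain_complex_vkernel:
  assumes "chain_complex C \<delta>"
  shows "vsubspace (\<delta> 0 ` carrier (C 1)) (C 0)"
    and "vsubspace (\<delta> (Suc n) ` carrier (C (Suc (Suc n)))) (vkernel (C (Suc n)) (C n) (\<delta> n))"
proof -
  have v: "vspace (C n)" and h: "\<delta> n \<in> mod_hom ground (C (Suc n)) (C n)"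
    and z: "\<And>x. x \<in> carrier (C (Suc (Suc n))) \<Longrightarrow> \<delta> n (\<delta> (Suc n) x) = \<zero>\<^bsub>C n\<^esub>" for n
    using assms by (auto simp: chain_complex_def)
  have p: "mod_hom_pair ground (C i) (C j)" for i j
    using v by (simp add: mod_hom_pair_def vspace_def)
  show "vsubspace (\<delta> 0 ` carrier (C 1)) (C 0)"
    using v image_submodule [OF p h, of 0] by (simp add: vsubspace_def vsubspace_axioms_def)
  have l: "lmodule ground (vkernel (C (Suc n)) (C n) (\<delta> n))"
    by (rule lmodule_vkernel [OF p h])
  note s = submodule_closed [OF image_submodule [OF p h [of "Suc n"]]]
  have "submodule (\<delta> (Suc n) ` carrier (C (Suc (Suc n)))) ground (vkernel (C (Suc n)) (C n) (\<delta> n))"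
    by (rule lmodule_ground_submoduleI [OF l]) (use s z in \<open>auto simp del: image_iff\<close>)
  then show "vsubspace (\<delta> (Suc n) ` carrier (C (Suc (Suc n)))) (vkernel (C (Suc n)) (C n) (\<delta> n))"
    using l by (simp add: vsubspace_def vspace_def vsubspace_axioms_def)
qed

lemma minus_vkernel:
  assumes "mod_hom_pair ground V U" "f \<in> mod_hom ground V U"
    and "x \<in> carrier V" "f x = \<zero>\<^bsub>U\<^esub>" "y \<in> carrier V" "f y = \<zero>\<^bsub>U\<^esub>"
  shows "x \<ominus>\<^bsub>vkernel V U f\<^esub> y = x \<ominus>\<^bsub>V\<^esub> y"
proof -
  interpret mod_hom_pair ground V U by fact
  interpret K: mod_hom_pair ground "vkernel V U f" V
    by (simp add: mod_hom_pair_def lmodule_vkernel [OF assms(1,2)] M.lmodule_axioms)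
  have "(\<lambda>x. x) \<in> mod_hom ground (vkernel V U f) V"
    by (simp add: mod_hom_def)
  then show ?thesis
    using K.hom_minus [of "\<lambda>x. x" x y] assms by simp
qed

text \<open>
  On a cycle the second term of the homotopy vanishes, so a map homotopic to the identity moves
  a cycle by a boundary.
\<close>

lemma homotopic_id_boundary:
  fixes C :: "nat \<Rightarrow> ('k::field, 'c) module"
  assumes cc: "chain_complex C \<delta>" and hm: "homotopic ground C \<delta> C \<delta> h (\<lambda>n x. x)"
    and gf: "\<And>n. h n \<in> mod_hom ground (C n) (C n)"
    and n: "n = Suc i" and x: "x \<in> carrier (C n)" "\<delta> i x = \<zero>\<^bsub>C i\<^esub>"
    and z: "\<delta> i (h n x) = \<zero>\<^bsub>C i\<^esub>"
  shows "h n x \<ominus>\<^bsub>vkernel (C (Suc i)) (C i) (\<delta> i)\<^esub> x \<in> \<delta> n ` carrier (C (Suc n))"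
proof -
  have d: "\<delta> n \<in> mod_hom ground (C (Suc n)) (C n)" for n
    using cc by (simp add: chain_complex_def)
  have p: "mod_hom_pair ground (C i) (C j)" for i j
    using cc by (simp add: mod_hom_pair_def vspace_def chain_complex_def)
  interpret mod_hom_pair ground "C n" "C i" by (rule p)
  obtain s where s: "\<And>n. s n \<in> mod_hom ground (C n) (C (Suc n))"
    "\<And>n x. x \<in> carrier (C (Suc n)) \<Longrightarrow> h (Suc n) x =
      \<delta> (Suc n) (s (Suc n) x) \<oplus>\<^bsub>C (Suc n)\<^esub> s n (\<delta> n x) \<oplus>\<^bsub>C (Suc n)\<^esub> x"
    using hm unfolding homotopic_def by blast
  have si0: "s i \<zero>\<^bsub>C i\<^esub> = \<zero>\<^bsub>C n\<^esub>"
    using mod_hom_pair.hom_zero [OF p s(1) [of i]] n by simp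
  have c: "\<delta> n (s n x) \<in> carrier (C n)"
    using mod_hom_closed [OF d] mod_hom_closed [OF s(1)] x(1) by blast
  have e: "h n x = \<delta> n (s n x) \<oplus>\<^bsub>C n\<^esub> x"
    using s(2) [of x i, folded n] x si0 c by simp
  have "h n x \<ominus>\<^bsub>vkernel (C (Suc i)) (C i) (\<delta> i)\<^esub> x = h n x \<ominus>\<^bsub>C n\<^esub> x"
    using minus_vkernel [OF p d, of "h n x" i x] z x n mod_hom_closed [OF gf [of n] x(1)] by simp
  also have "\<dots> = \<delta> n (s n x)"
    using e c x(1) mod_hom_closed [OF gf [of n] x(1)] by (simp add: M.M.minus_eq_iff)
  finally show ?thesis
    using mod_hom_closed [OF s(1) x(1)] by simp
qed

lemma homotopic_id_boundary_0:
  fixes C :: "nat \<Rightarrow> ('k::field, 'c) module"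
  assumes cc: "chain_complex C \<delta>" and hm: "homotopic ground C \<delta> C \<delta> h (\<lambda>n x. x)"
    and gf: "\<And>n. h n \<in> mod_hom ground (C n) (C n)"
    and x: "x \<in> carrier (C 0)"
  shows "h 0 x \<ominus>\<^bsub>C 0\<^esub> x \<in> \<delta> 0 ` carrier (C (Suc 0))"
proof -
  have d: "\<delta> n \<in> mod_hom ground (C (Suc n)) (C n)" for n
    using cc by (simp add: chain_complex_def)
  interpret lmodule ground "C 0" using cc by (simp add: vspace_def chain_complex_def)
  obtain s where s: "\<And>n. s n \<in> mod_hom ground (C n) (C (Suc n))"
    "\<And>x. x \<in> carrier (C 0) \<Longrightarrow> h 0 x = \<delta> 0 (s 0 x) \<oplus>\<^bsub>C 0\<^esub> x"
    using hm unfolding homotopic_def by blast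
  have c: "\<delta> 0 (s 0 x) \<in> carrier (C 0)"
    using mod_hom_closed [OF d] mod_hom_closed [OF s(1)] x(1) by blast
  have "h 0 x \<ominus>\<^bsub>C 0\<^esub> x = \<delta> 0 (s 0 x)"
    using s(2) [OF x] c x mod_hom_closed [OF gf x] by (simp add: M.minus_eq_iff)
  then show ?thesis
    using mod_hom_closed [OF s(1) x] by simp
qed

lemma homology_iso:
  assumes C: "chain_complex C \<delta>" and C': "chain_complex C' \<delta>'"
    and eq: "homotopy_equivalent ground C \<delta> C' \<delta>'"
  shows "homology C \<delta> q \<cong>\<^sub>v homology C' \<delta>' q"
proof -
  obtain f g where f: "chain_map ground C \<delta> C' \<delta>' f" and g: "chain_map ground C' \<delta>' C \<delta> g"
    and hC: "homotopic ground C \<delta> C \<delta> (\<lambda>n x. g n (f n x)) (\<lambda>n x. x)"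
    and hC': "homotopic ground C' \<delta>' C' \<delta>' (\<lambda>n x. f n (g n x)) (\<lambda>n x. x)"
    using eq unfolding homotopy_equivalent_def by blast
  have fh: "f n \<in> mod_hom ground (C n) (C' n)" and gh: "g n \<in> mod_hom ground (C' n) (C n)"
    and fd: "\<And>x. x \<in> carrier (C (Suc n)) \<Longrightarrow> \<delta>' n (f (Suc n) x) = f n (\<delta> n x)"
    and gd: "\<And>x. x \<in> carrier (C' (Suc n)) \<Longrightarrow> \<delta> n (g (Suc n) x) = g n (\<delta>' n x)" for n
    using f g by (auto simp: chain_map_def)
  note fc = mod_hom_closed [OF fh] and gc = mod_hom_closed [OF gh]
  have gfh: "(\<lambda>x. g n (f n x)) \<in> mod_hom ground (C n) (C n)"
    and fgh: "(\<lambda>x. f n (g n x)) \<in> mod_hom ground (C' n) (C' n)" for n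
    by (rule mod_hom_comp [OF fh gh], rule mod_hom_comp [OF gh fh])
  have im: "f n ` \<delta> n ` carrier (C (Suc n)) \<subseteq> \<delta>' n ` carrier (C' (Suc n))"
    "g n ` \<delta>' n ` carrier (C' (Suc n)) \<subseteq> \<delta> n ` carrier (C (Suc n))" for n
    by (auto simp: fd [symmetric] gd [symmetric] fc gc)
  show ?thesis
  proof (cases q)
    case 0
    have "C 0 /\<^sub>v (\<delta> 0 ` carrier (C 1)) \<cong>\<^sub>v C' 0 /\<^sub>v (\<delta>' 0 ` carrier (C' 1))"
    proof (rule vquot_iso [OF chain_complex_vkernel(1) [OF C] chain_complex_vkernel(1) [OF C'] fh gh])
      show "g 0 (f 0 x) \<ominus>\<^bsub>C 0\<^esub> x \<in> \<delta> 0 ` carrier (C 1)" if "x \<in> carrier (C 0)" for x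
        using homotopic_id_boundary_0 [OF C hC gfh that] by simp
      show "f 0 (g 0 x) \<ominus>\<^bsub>C' 0\<^esub> x \<in> \<delta>' 0 ` carrier (C' 1)" if "x \<in> carrier (C' 0)" for x
        using homotopic_id_boundary_0 [OF C' hC' fgh that] by simp
    qed (use im [of 0] in auto)
    then show ?thesis using 0 by simp
  next
    case (Suc n)
    have p: "mod_hom_pair ground (C i) (C j)" "mod_hom_pair ground (C' i) (C' j)"
      "mod_hom_pair ground (C i) (C' j)" "mod_hom_pair ground (C' i) (C j)" for i j
      using C C' by (simp_all add: mod_hom_pair_def vspace_def chain_complex_def)
    have f0: "f n \<zero>\<^bsub>C n\<^esub> = \<zero>\<^bsub>C' n\<^esub>" and g0: "g n \<zero>\<^bsub>C' n\<^esub> = \<zero>\<^bsub>C n\<^esub>" for n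
      using mod_hom_pair.hom_zero p fh gh by blast+
    have "vkernel (C (Suc n)) (C n) (\<delta> n) /\<^sub>v (\<delta> (Suc n) ` carrier (C (Suc (Suc n)))) \<cong>\<^sub>v
      vkernel (C' (Suc n)) (C' n) (\<delta>' n) /\<^sub>v (\<delta>' (Suc n) ` carrier (C' (Suc (Suc n))))"
    proof (rule vquot_iso [OF chain_complex_vkernel(2) [OF C] chain_complex_vkernel(2) [OF C'],
          where f = "f (Suc n)" and g = "g (Suc n)"])
      show "f (Suc n) \<in> mod_hom ground (vkernel (C (Suc n)) (C n) (\<delta> n)) (vkernel (C' (Suc n)) (C' n) (\<delta>' n))"
        by (intro mod_homI) (simp_all add: fc fd f0 mod_hom_add [OF fh] mod_hom_smult [OF fh])
      show "g (Suc n) \<in> mod_hom ground (vkernel (C' (Suc n)) (C' n) (\<delta>' n)) (vkernel (C (Suc n)) (C n) (\<delta> n))"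
        by (intro mod_homI) (simp_all add: gc gd g0 mod_hom_add [OF gh] mod_hom_smult [OF gh])
      show "g (Suc n) (f (Suc n) x) \<ominus>\<^bsub>vkernel (C (Suc n)) (C n) (\<delta> n)\<^esub> x
          \<in> \<delta> (Suc n) ` carrier (C (Suc (Suc n)))"
        if "x \<in> carrier (vkernel (C (Suc n)) (C n) (\<delta> n))" for x
        using that by (intro homotopic_id_boundary [OF C hC gfh]) (simp_all add: gd fd fc f0 g0)
      show "f (Suc n) (g (Suc n) x) \<ominus>\<^bsub>vkernel (C' (Suc n)) (C' n) (\<delta>' n)\<^esub> x
          \<in> \<delta>' (Suc n) ` carrier (C' (Suc (Suc n)))"
        if "x \<in> carrier (vkernel (C' (Suc n)) (C' n) (\<delta>' n))" for x
        using that by (intro homotopic_id_boundary [OF C' hC' fgh]) (simp_all add: gd fd gc f0 g0)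
    qed (use im [of "Suc n"] in auto)
    then show ?thesis using Suc by simp
  qed
qed

section \<open>Projective modules\<close>

definition finsupp :: "('r, 's) ring_scheme \<Rightarrow> 'p set \<Rightarrow> ('r, 'p \<Rightarrow> 'r) module" where
  "finsupp R X =
     \<lparr>carrier = {\<phi>. (\<forall>x. \<phi> x \<in> carrier R) \<and> finite {x. \<phi> x \<noteq> \<zero>\<^bsub>R\<^esub>} \<and> {x. \<phi> x \<noteq> \<zero>\<^bsub>R\<^esub>} \<subseteq> X},
      mult = undefined, one = undefined, zero = (\<lambda>x. \<zero>\<^bsub>R\<^esub>), add = (\<lambda>\<phi> \<psi> x. \<phi> x \<oplus>\<^bsub>R\<^esub> \<psi> x),
      smult = (\<lambda>r \<phi> x. r \<otimes>\<^bsub>R\<^esub> \<phi> x)\<rparr>"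

text \<open>
  On the free module \<open>finsupp R X\<close> this is the homomorphism that sends the basis vector at \<open>x\<close> to
  \<open>y x\<close>.
\<close>

definition combination where
  "combination R M y \<phi> = (\<Oplus>\<^bsub>M\<^esub>x\<in>{x. \<phi> x \<noteq> \<zero>\<^bsub>R\<^esub>}. \<phi> x \<odot>\<^bsub>M\<^esub> y x)"

lemma (in ring) lmodule_finsupp: "lmodule R (finsupp R X)"
proof -
  have fin: "finite {x. \<phi> x \<oplus> \<psi> x \<noteq> \<zero>} \<and> {x. \<phi> x \<oplus> \<psi> x \<noteq> \<zero>} \<subseteq> X"
    if "finite {x. \<phi> x \<noteq> \<zero>}" "finite {x. \<psi> x \<noteq> \<zero>}" "{x. \<phi> x \<noteq> \<zero>} \<subseteq> X" "{x. \<psi> x \<noteq> \<zero>} \<subseteq> X"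
    for \<phi> \<psi> :: "'x \<Rightarrow> 'a" and X
  proof -
    have "{x. \<phi> x \<oplus> \<psi> x \<noteq> \<zero>} \<subseteq> {x. \<phi> x \<noteq> \<zero>} \<union> {x. \<psi> x \<noteq> \<zero>}" by auto
    then show ?thesis using that by (meson finite_UnI finite_subset le_sup_iff order_trans)
  qed
  have sc: "finite {x. r \<otimes> \<phi> x \<noteq> \<zero>} \<and> {x. r \<otimes> \<phi> x \<noteq> \<zero>} \<subseteq> X"
    if "r \<in> carrier R" "finite {x. \<phi> x \<noteq> \<zero>}" "{x. \<phi> x \<noteq> \<zero>} \<subseteq> X" for \<phi> :: "'x \<Rightarrow> 'a" and r X
  proof -
    have "{x. r \<otimes> \<phi> x \<noteq> \<zero>} \<subseteq> {x. \<phi> x \<noteq> \<zero>}" using that by auto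
    then show ?thesis using that by (meson finite_subset order_trans)
  qed
  have "abelian_group (finsupp R X)"
  proof (rule abelian_groupI)
    fix \<phi> assume p: "\<phi> \<in> carrier (finsupp R X)"
    then have "(\<lambda>x. \<ominus> \<phi> x) \<in> carrier (finsupp R X)"
    proof -
      have "{x. \<ominus> \<phi> x \<noteq> \<zero>} \<subseteq> {x. \<phi> x \<noteq> \<zero>}" by auto
      then show ?thesis using p by (auto simp: finsupp_def elim: finite_subset)
    qed
    moreover have "(\<lambda>x. \<ominus> \<phi> x) \<oplus>\<^bsub>finsupp R X\<^esub> \<phi> = \<zero>\<^bsub>finsupp R X\<^esub>"
      using p by (auto simp: finsupp_def l_neg)
    ultimately show "\<exists>\<psi>\<in>carrier (finsupp R X). \<psi> \<oplus>\<^bsub>finsupp R X\<^esub> \<phi> = \<zero>\<^bsub>finsupp R X\<^esub>"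
      by blast
  next
    fix \<phi> \<psi> assume "\<phi> \<in> carrier (finsupp R X)" "\<psi> \<in> carrier (finsupp R X)"
    then show "\<phi> \<oplus>\<^bsub>finsupp R X\<^esub> \<psi> \<in> carrier (finsupp R X)"
      using fin [of \<phi> \<psi> X] by (simp add: finsupp_def)
  qed (auto simp: finsupp_def a_ac)
  then show ?thesis
    unfolding lmodule_def lmodule_axioms_def
    apply (simp add: finsupp_def ring_axioms l_distr r_distr m_assoc)
    using sc by blast
qed

context lmodule
begin

lemma combination_superset:
  assumes "\<phi> \<in> carrier (finsupp R X)" "y \<in> X \<rightarrow> carrier M" "finite S" "{x. \<phi> x \<noteq> \<zero>} \<subseteq> S" "S \<subseteq> X"
  shows "combination R M y \<phi> = (\<Oplus>\<^bsub>M\<^esub>x\<in>S. \<phi> x \<odot>\<^bsub>M\<^esub> y x)"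
  unfolding combination_def
proof (rule M.add.finprod_mono_neutral_cong_left)
  show "finite S" "{x. \<phi> x \<noteq> \<zero>} \<subseteq> S" by fact+
  have y: "y x \<in> carrier M" if "x \<in> S" for x using that assms(2,5) by auto
  show "\<phi> x \<odot>\<^bsub>M\<^esub> y x = \<zero>\<^bsub>M\<^esub>" if "x \<in> S - {x. \<phi> x \<noteq> \<zero>}" for x
    using that y by auto
  show "(\<lambda>x. \<phi> x \<odot>\<^bsub>M\<^esub> y x) \<in> S \<rightarrow> carrier M"
    using y assms(1) by (auto simp: finsupp_def)
qed simp

lemma combination_hom:
  assumes y: "y \<in> X \<rightarrow> carrier M"
  shows "combination R M y \<in> mod_hom R (finsupp R X) M"
proof (rule mod_homI)
  fix \<phi> assume p: "\<phi> \<in> carrier (finsupp R X)"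
  show "combination R M y \<phi> \<in> carrier M"
    unfolding combination_def using p y by (intro M.finsum_closed) (auto simp: finsupp_def)
next
  fix \<phi> \<psi> assume p: "\<phi> \<in> carrier (finsupp R X)" and q: "\<psi> \<in> carrier (finsupp R X)"
  let ?S = "{x. \<phi> x \<noteq> \<zero>} \<union> {x. \<psi> x \<noteq> \<zero>}"
  have S: "finite ?S" "?S \<subseteq> X" "{x. (\<phi> \<oplus>\<^bsub>finsupp R X\<^esub> \<psi>) x \<noteq> \<zero>} \<subseteq> ?S"
    using p q by (auto simp: finsupp_def)
  have pq: "\<phi> \<oplus>\<^bsub>finsupp R X\<^esub> \<psi> \<in> carrier (finsupp R X)"
    by (rule abelian_monoid.a_closed [OF abelian_group.axioms(1) p q])
      (use lmodule_finsupp in \<open>auto simp: lmodule_def\<close>)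
  have cl: "y x \<in> carrier M" "\<phi> x \<in> carrier R" "\<psi> x \<in> carrier R" if "x \<in> ?S" for x
    using that S(2) y p q by (auto simp: finsupp_def)
  have "combination R M y (\<phi> \<oplus>\<^bsub>finsupp R X\<^esub> \<psi>) = (\<Oplus>\<^bsub>M\<^esub>x\<in>?S. (\<phi> \<oplus>\<^bsub>finsupp R X\<^esub> \<psi>) x \<odot>\<^bsub>M\<^esub> y x)"
    by (rule combination_superset [OF pq y S(1,3,2)])
  also have "\<dots> = (\<Oplus>\<^bsub>M\<^esub>x\<in>?S. \<phi> x \<odot>\<^bsub>M\<^esub> y x \<oplus>\<^bsub>M\<^esub> \<psi> x \<odot>\<^bsub>M\<^esub> y x)"
    by (rule M.finsum_cong') (auto simp: finsupp_def smult_l_distr cl)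
  also have "\<dots> = (\<Oplus>\<^bsub>M\<^esub>x\<in>?S. \<phi> x \<odot>\<^bsub>M\<^esub> y x) \<oplus>\<^bsub>M\<^esub> (\<Oplus>\<^bsub>M\<^esub>x\<in>?S. \<psi> x \<odot>\<^bsub>M\<^esub> y x)"
    by (rule M.finsum_addf) (use cl in auto)
  also have "\<dots> = combination R M y \<phi> \<oplus>\<^bsub>M\<^esub> combination R M y \<psi>"
    using combination_superset [OF p y S(1) _ S(2)] combination_superset [OF q y S(1) _ S(2)] by simp
  finally show "combination R M y (\<phi> \<oplus>\<^bsub>finsupp R X\<^esub> \<psi>) = \<dots>" .
next
  fix r \<phi> assume r: "r \<in> carrier R" and p: "\<phi> \<in> carrier (finsupp R X)"
  let ?S = "{x. \<phi> x \<noteq> \<zero>}"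
  have S: "finite ?S" "?S \<subseteq> X" "{x. (r \<odot>\<^bsub>finsupp R X\<^esub> \<phi>) x \<noteq> \<zero>} \<subseteq> ?S"
    using p r by (auto simp: finsupp_def)
  have rp: "r \<odot>\<^bsub>finsupp R X\<^esub> \<phi> \<in> carrier (finsupp R X)"
    using lmodule.smult_closed [OF lmodule_finsupp r p] .
  have cl: "y x \<in> carrier M" "\<phi> x \<in> carrier R" if "x \<in> ?S" for x
    using that S(2) y p by (auto simp: finsupp_def)
  have "combination R M y (r \<odot>\<^bsub>finsupp R X\<^esub> \<phi>) = (\<Oplus>\<^bsub>M\<^esub>x\<in>?S. (r \<odot>\<^bsub>finsupp R X\<^esub> \<phi>) x \<odot>\<^bsub>M\<^esub> y x)"
    by (rule combination_superset [OF rp y S(1,3,2)])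
  also have "\<dots> = (\<Oplus>\<^bsub>M\<^esub>x\<in>?S. r \<odot>\<^bsub>M\<^esub> (\<phi> x \<odot>\<^bsub>M\<^esub> y x))"
    by (rule M.finsum_cong') (use r cl in \<open>auto simp: finsupp_def smult_assoc\<close>)
  also have "\<dots> = r \<odot>\<^bsub>M\<^esub> combination R M y \<phi>"
    unfolding combination_def by (rule smult_finsum_right [symmetric]) (use r cl in auto)
  finally show "combination R M y (r \<odot>\<^bsub>finsupp R X\<^esub> \<phi>) = \<dots>" .
qed

lemma combination_unit:
  assumes "x \<in> X" "y \<in> X \<rightarrow> carrier M"
  shows "(\<lambda>z. if z = x then \<one> else \<zero>) \<in> carrier (finsupp R X)"
    and "combination R M y (\<lambda>z. if z = x then \<one> else \<zero>) = y x"
proof -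
  have sub: "{z. (if z = x then \<one> else \<zero>) \<noteq> \<zero>} \<subseteq> {x}" by auto
  then have "finite {z. (if z = x then \<one> else \<zero>) \<noteq> \<zero>}"
    by (rule finite_subset) simp
  then show u: "(\<lambda>z. if z = x then \<one> else \<zero>) \<in> carrier (finsupp R X)"
    using assms(1) by (auto simp: finsupp_def)
  have "y x \<in> carrier M" using assms by auto
  then show "combination R M y (\<lambda>z. if z = x then \<one> else \<zero>) = y x"
    using combination_superset [OF u assms(2), of "{x}"] assms(1) sub by (simp add: Pi_def)
qed

end

text \<open>
  The lifting property of \<open>P\<close> is available only for test modules of two particular types.  This is
  enough to split the surjection onto \<open>P\<close> from the free module on \<open>carrier P\<close>, and through this free
  module lifts to modules of any type can be constructed, by choosing preimages of the basis.
\<close>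

lemma projective_lift:
  fixes R :: "('r, 's) ring_scheme" and P :: "('r, 'p) module"
  assumes P: "projective_module R P" and M: "lmodule R M" and N: "lmodule R N"
    and g: "g \<in> mod_hom R M N" and f: "f \<in> mod_hom R P N"
    and im: "f ` carrier P \<subseteq> g ` carrier M"
  shows "\<exists>h\<in>mod_hom R P M. \<forall>x\<in>carrier P. g (h x) = f x"
proof -
  let ?X = "carrier P" and ?F = "finsupp R (carrier P)"
  have lP: "lmodule R P" using P by (simp add: projective_module_def left_module_iff)
  interpret P: lmodule R P by fact
  interpret MN: mod_hom_pair R M N using M N by (simp add: mod_hom_pair_def)
  interpret PN: mod_hom_pair R P N using lP N by (simp add: mod_hom_pair_def)
  have lF: "lmodule R ?F" by (rule P.R.lmodule_finsupp)
  have id: "(\<lambda>x. x) \<in> ?X \<rightarrow> carrier P" by simp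
  have surj: "combination R P (\<lambda>x. x) ` carrier ?F = carrier P"
  proof
    show "combination R P (\<lambda>x. x) ` carrier ?F \<subseteq> carrier P"
      using mod_hom_closed [OF P.combination_hom [OF id]] by blast
    show "carrier P \<subseteq> combination R P (\<lambda>x. x) ` carrier ?F"
    proof
      fix x assume "x \<in> carrier P"
      from P.combination_unit [OF this id] show "x \<in> combination R P (\<lambda>x. x) ` carrier ?F"
        by (metis image_eqI)
    qed
  qed
  \<comment> \<open>The splitting: the identity of \<open>P\<close> lifted along the surjection from the free module.\<close>
  obtain h where h: "h \<in> mod_hom R P ?F" "\<And>x. x \<in> carrier P \<Longrightarrow> combination R P (\<lambda>x. x) (h x) = x"
    using P lP lF P.combination_hom [OF id] surj mod_hom_id [of R P]
    unfolding projective_module_def left_module_iff by blast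
  have "\<forall>x\<in>carrier P. \<exists>m\<in>carrier M. g m = f x"
    using im by (metis imageE image_subset_iff)
  then obtain y where y: "\<And>x. x \<in> carrier P \<Longrightarrow> y x \<in> carrier M \<and> g (y x) = f x"
    by metis
  then have y': "y \<in> ?X \<rightarrow> carrier M" by simp
  show ?thesis
  proof (intro bexI ballI)
    show "(\<lambda>x. combination R M y (h x)) \<in> mod_hom R P M"
      by (rule mod_hom_comp [OF h(1) MN.M.combination_hom [OF y']])
    fix x assume x: "x \<in> carrier P"
    let ?S = "{z. h x z \<noteq> \<zero>\<^bsub>R\<^esub>}"
    have S: "?S \<subseteq> carrier P" "\<And>z. h x z \<in> carrier R"
      using mod_hom_closed [OF h(1) x] by (auto simp: finsupp_def)
    have "g (combination R M y (h x)) = (\<Oplus>\<^bsub>N\<^esub>z\<in>?S. g (h x z \<odot>\<^bsub>M\<^esub> y z))"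
      unfolding combination_def using S y by (intro MN.hom_finsum [OF g]) auto
    also have "\<dots> = (\<Oplus>\<^bsub>N\<^esub>z\<in>?S. f (h x z \<odot>\<^bsub>P\<^esub> z))"
    proof (rule MN.N.M.finsum_cong' [OF refl])
      show "(\<lambda>z. f (h x z \<odot>\<^bsub>P\<^esub> z)) \<in> ?S \<rightarrow> carrier N"
        using S by (auto intro!: mod_hom_closed [OF f])
      show "g (h x z \<odot>\<^bsub>M\<^esub> y z) = f (h x z \<odot>\<^bsub>P\<^esub> z)" if "z \<in> ?S" for z
        using that S y by (simp add: mod_hom_smult [OF f] mod_hom_smult [OF g] subset_iff)
    qed
    also have "\<dots> = f (combination R P (\<lambda>x. x) (h x))"
      unfolding combination_def using S by (intro PN.hom_finsum [OF f, symmetric]) auto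
    finally show "g (combination R M y (h x)) = f x"
      using h(2) x by simp
  qed
qed

section \<open>Comparison of projective resolutions\<close>

lemma resolution_facts:
  assumes "projective_resolution R N P d \<epsilon>"
  shows "lmodule R N" "projective_module R (P n)" "lmodule R (P n)" "d n \<in> mod_hom R (P (Suc n)) (P n)"
    "\<epsilon> \<in> mod_hom R (P 0) N"
    "x \<in> carrier (P 0) \<Longrightarrow> \<epsilon> x = \<zero>\<^bsub>N\<^esub> \<Longrightarrow> x \<in> d 0 ` carrier (P 1)"
    "x \<in> carrier (P 1) \<Longrightarrow> \<epsilon> (d 0 x) = \<zero>\<^bsub>N\<^esub>"
    "x \<in> carrier (P (Suc n)) \<Longrightarrow> d n x = \<zero>\<^bsub>P n\<^esub> \<Longrightarrow> x \<in> d (Suc n) ` carrier (P (Suc (Suc n)))"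
    "x \<in> carrier (P (Suc (Suc n))) \<Longrightarrow> d n (d (Suc n) x) = \<zero>\<^bsub>P n\<^esub>"
    "\<epsilon> ` carrier (P 0) = carrier N"
proof -
  have e: "lmodule R N" "\<And>n. projective_module R (P n)" "\<And>n. d n \<in> mod_hom R (P (Suc n)) (P n)"
    "\<epsilon> \<in> mod_hom R (P 0) N" "\<epsilon> ` carrier (P 0) = carrier N"
    and e0: "d 0 ` carrier (P 1) = {x \<in> carrier (P 0). \<epsilon> x = \<zero>\<^bsub>N\<^esub>}"
    and eS: "\<And>n. d (Suc n) ` carrier (P (Suc (Suc n))) = {x \<in> carrier (P (Suc n)). d n x = \<zero>\<^bsub>P n\<^esub>}"
    using assms by (simp_all add: projective_resolution_def left_module_iff)
  show "lmodule R N" "projective_module R (P n)" "d n \<in> mod_hom R (P (Suc n)) (P n)"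
    "\<epsilon> \<in> mod_hom R (P 0) N" "\<epsilon> ` carrier (P 0) = carrier N"
    by (rule e)+
  show "lmodule R (P n)"
    using e(2) [of n] by (simp add: projective_module_def left_module_iff)
  show "x \<in> carrier (P 0) \<Longrightarrow> \<epsilon> x = \<zero>\<^bsub>N\<^esub> \<Longrightarrow> x \<in> d 0 ` carrier (P 1)"
    unfolding e0 by simp
  show "x \<in> carrier (P 1) \<Longrightarrow> \<epsilon> (d 0 x) = \<zero>\<^bsub>N\<^esub>"
    using e0 by blast
  show "x \<in> carrier (P (Suc n)) \<Longrightarrow> d n x = \<zero>\<^bsub>P n\<^esub> \<Longrightarrow> x \<in> d (Suc n) ` carrier (P (Suc (Suc n)))"
    unfolding eS by simp
  show "x \<in> carrier (P (Suc (Suc n))) \<Longrightarrow> d n (d (Suc n) x) = \<zero>\<^bsub>P n\<^esub>"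
    using eS [of n] by blast
qed

text \<open>
  The maps are built degree by degree.  The step needs that the map already built sends boundaries to
  boundaries, so this is part of the property \<open>A\<close> that is carried along the recursion.
\<close>

lemma lift_chain_map:
  assumes P: "projective_resolution R N P d \<epsilon>" and Q: "projective_resolution R N Q d' \<epsilon>'"
  shows "\<exists>f. chain_map R P d Q d' f \<and> (\<forall>x\<in>carrier (P 0). \<epsilon>' (f 0 x) = \<epsilon> x)"
proof -
  note p = resolution_facts [OF P] and q = resolution_facts [OF Q]
  have pair: "mod_hom_pair R (P i) (Q j)" for i j
    using p(3) q(3) by (simp add: mod_hom_pair_def)
  define A where "A n f \<longleftrightarrow> f \<in> mod_hom R (P n) (Q n) \<and>
    (\<forall>x\<in>carrier (P (Suc n)). f (d n x) \<in> d' n ` carrier (Q (Suc n))) \<and>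
    (n = 0 \<longrightarrow> (\<forall>x\<in>carrier (P 0). \<epsilon>' (f x) = \<epsilon> x))" for n f
  have base: "\<exists>f. A 0 f"
  proof -
    have "\<exists>f\<in>mod_hom R (P 0) (Q 0). \<forall>x\<in>carrier (P 0). \<epsilon>' (f x) = \<epsilon> x"
      by (rule projective_lift [OF p(2) q(3) p(1) q(5) p(5)]) (simp add: p(10) q(10))
    then obtain f where f: "f \<in> mod_hom R (P 0) (Q 0)" "\<forall>x\<in>carrier (P 0). \<epsilon>' (f x) = \<epsilon> x" ..
    have "f (d 0 x) \<in> d' 0 ` carrier (Q (Suc 0))" if x: "x \<in> carrier (P (Suc 0))" for x
      using q(6) [OF mod_hom_closed [OF f(1) mod_hom_closed [OF p(4) x]]] f(2)
        mod_hom_closed [OF p(4) x] p(7) x by simp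
    then show ?thesis using f unfolding A_def by auto
  qed
  have step: "\<exists>g. A (Suc n) g \<and> (\<forall>x\<in>carrier (P (Suc n)). d' n (g x) = f (d n x))" if A: "A n f" for f n
  proof -
    from A have f: "f \<in> mod_hom R (P n) (Q n)" by (simp add: A_def)
    have "\<exists>g\<in>mod_hom R (P (Suc n)) (Q (Suc n)). \<forall>x\<in>carrier (P (Suc n)). d' n (g x) = f (d n x)"
      by (rule projective_lift [OF p(2) q(3) q(3) q(4) mod_hom_comp [OF p(4) f]])
        (use A in \<open>auto simp: A_def\<close>)
    then obtain g where g: "g \<in> mod_hom R (P (Suc n)) (Q (Suc n))"
      "\<forall>x\<in>carrier (P (Suc n)). d' n (g x) = f (d n x)" ..
    have "g (d (Suc n) x) \<in> d' (Suc n) ` carrier (Q (Suc (Suc n)))" if x: "x \<in> carrier (P (Suc (Suc n)))" for x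
    proof (rule q(8))
      have dx: "d (Suc n) x \<in> carrier (P (Suc n))" by (rule mod_hom_closed [OF p(4) x])
      then show "g (d (Suc n) x) \<in> carrier (Q (Suc n))" by (rule mod_hom_closed [OF g(1)])
      show "d' n (g (d (Suc n) x)) = \<zero>\<^bsub>Q n\<^esub>"
        using g(2) dx p(9) [OF x] mod_hom_pair.hom_zero [OF pair f] by simp
    qed
    then show ?thesis
      using g unfolding A_def by auto
  qed
  have "\<exists>f. \<forall>n. A n (f n) \<and> (\<forall>x\<in>carrier (P (Suc n)). d' n (f (Suc n) x) = f n (d n x))"
    by (rule dependent_nat_choice [where P = A and
        Q = "\<lambda>n f g. \<forall>x\<in>carrier (P (Suc n)). d' n (g x) = f (d n x)", OF base step])
  then obtain f where f: "\<And>n. A n (f n)"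
    "\<And>n x. x \<in> carrier (P (Suc n)) \<Longrightarrow> d' n (f (Suc n) x) = f n (d n x)" by auto
  then have "chain_map R P d Q d' f" by (simp add: chain_map_def A_def)
  moreover have "\<forall>x\<in>carrier (P 0). \<epsilon>' (f 0 x) = \<epsilon> x"
    using f(1) [of 0] by (simp add: A_def)
  ultimately show ?thesis by auto
qed

text \<open>
  The difference \<open>k = f - g\<close> becomes zero under the augmentation.  If \<open>s\<^sub>n\<close> is constructed, then
  \<open>k - s\<^sub>n d\<close> maps to cycles of \<open>Q\<close>, hence to boundaries, and lifting it along the differential gives
  \<open>s\<^sub>n\<^sub>+\<^sub>1\<close>.  The second conjunct of \<open>A\<close> is what makes \<open>k - s\<^sub>n d\<close> map to cycles.
\<close>

lemma chain_map_homotopic: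
  assumes P: "projective_resolution R N P d \<epsilon>" and Q: "projective_resolution R N Q d' \<epsilon>'"
    and f: "chain_map R P d Q d' f" and g: "chain_map R P d Q d' g"
    and fg: "\<And>x. x \<in> carrier (P 0) \<Longrightarrow> \<epsilon>' (f 0 x) = \<epsilon>' (g 0 x)"
  shows "homotopic R P d Q d' f g"
proof -
  note p = resolution_facts [OF P] and q = resolution_facts [OF Q]
  have pair: "mod_hom_pair R (P i) (Q j)" "mod_hom_pair R (Q i) (Q j)" "mod_hom_pair R (Q i) N" for i j
    using p(1,3) q(3) by (simp_all add: mod_hom_pair_def)
  have fh: "f n \<in> mod_hom R (P n) (Q n)" and gh: "g n \<in> mod_hom R (P n) (Q n)"
    and fd: "\<And>x. x \<in> carrier (P (Suc n)) \<Longrightarrow> d' n (f (Suc n) x) = f n (d n x)"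
    and gd: "\<And>x. x \<in> carrier (P (Suc n)) \<Longrightarrow> d' n (g (Suc n) x) = g n (d n x)" for n
    using f g by (auto simp: chain_map_def)
  define k where "k n x = f n x \<ominus>\<^bsub>Q n\<^esub> g n x" for n x
  have kh: "k n \<in> mod_hom R (P n) (Q n)" for n
    unfolding k_def by (rule mod_hom_pair.hom_minus_hom [OF pair(1) fh gh])
  have kd: "d' n (k (Suc n) x) = k n (d n x)" if "x \<in> carrier (P (Suc n))" for n x
    unfolding k_def using mod_hom_pair.hom_minus [OF pair(2) q(4) mod_hom_closed [OF fh that] mod_hom_closed [OF gh that]]
    by (simp add: fd gd that)
  define A where "A n s \<longleftrightarrow> s \<in> mod_hom R (P n) (Q (Suc n)) \<and>
    (\<forall>x\<in>carrier (P (Suc n)). d' n (s (d n x)) = k n (d n x)) \<and>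
    (n = 0 \<longrightarrow> (\<forall>x\<in>carrier (P 0). d' 0 (s x) = k 0 x))" for n s
  have base: "\<exists>s. A 0 s"
  proof -
    have "k 0 x \<in> d' 0 ` carrier (Q 1)" if x: "x \<in> carrier (P 0)" for x
    proof (rule q(6))
      show "k 0 x \<in> carrier (Q 0)" by (rule mod_hom_closed [OF kh x])
      interpret N: lmodule R N by (rule p(1))
      show "\<epsilon>' (k 0 x) = \<zero>\<^bsub>N\<^esub>"
        unfolding k_def
        using mod_hom_pair.hom_minus [OF pair(3) q(5) mod_hom_closed [OF fh x] mod_hom_closed [OF gh x]]
          fg [OF x] mod_hom_closed [OF q(5) mod_hom_closed [OF gh x]] by simp
    qed
    then have "\<exists>s\<in>mod_hom R (P 0) (Q (Suc 0)). \<forall>x\<in>carrier (P 0). d' 0 (s x) = k 0 x"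
      by (intro projective_lift [OF p(2) q(3) q(3) q(4) kh]) auto
    then obtain s where s: "s \<in> mod_hom R (P 0) (Q (Suc 0))" "\<forall>x\<in>carrier (P 0). d' 0 (s x) = k 0 x" ..
    then show ?thesis unfolding A_def using mod_hom_closed [OF p(4) [of 0]] by auto
  qed
  have step: "\<exists>t. A (Suc n) t \<and>
      (\<forall>x\<in>carrier (P (Suc n)). d' (Suc n) (t x) = k (Suc n) x \<ominus>\<^bsub>Q (Suc n)\<^esub> s (d n x))"
    if A: "A n s" for s n
  proof -
    from A have s: "s \<in> mod_hom R (P n) (Q (Suc n))" by (simp add: A_def)
    let ?k = "\<lambda>x. k (Suc n) x \<ominus>\<^bsub>Q (Suc n)\<^esub> s (d n x)"
    have kk: "?k \<in> mod_hom R (P (Suc n)) (Q (Suc n))"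
      by (rule mod_hom_pair.hom_minus_hom [OF pair(1) kh mod_hom_comp [OF p(4) s]])
    have "?k x \<in> d' (Suc n) ` carrier (Q (Suc (Suc n)))" if x: "x \<in> carrier (P (Suc n))" for x
    proof (rule q(8))
      show "?k x \<in> carrier (Q (Suc n))" by (rule mod_hom_closed [OF kk x])
      have dx: "d n x \<in> carrier (P n)" by (rule mod_hom_closed [OF p(4) x])
      interpret Qn: lmodule R "Q n" by (rule q(3))
      have "d' n (?k x) = d' n (k (Suc n) x) \<ominus>\<^bsub>Q n\<^esub> d' n (s (d n x))"
        by (rule mod_hom_pair.hom_minus [OF pair(2) q(4) mod_hom_closed [OF kh x] mod_hom_closed [OF s dx]])
      also have "\<dots> = \<zero>\<^bsub>Q n\<^esub>"
        using A x kd [OF x] mod_hom_closed [OF kh dx] by (simp add: A_def)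
      finally show "d' n (?k x) = \<zero>\<^bsub>Q n\<^esub>" .
    qed
    then have "\<exists>t\<in>mod_hom R (P (Suc n)) (Q (Suc (Suc n))). \<forall>x\<in>carrier (P (Suc n)). d' (Suc n) (t x) = ?k x"
      by (intro projective_lift [OF p(2) q(3) q(3) q(4) kk]) auto
    then obtain t where t: "t \<in> mod_hom R (P (Suc n)) (Q (Suc (Suc n)))"
      "\<forall>x\<in>carrier (P (Suc n)). d' (Suc n) (t x) = ?k x" ..
    have "d' (Suc n) (t (d (Suc n) x)) = k (Suc n) (d (Suc n) x)" if x: "x \<in> carrier (P (Suc (Suc n)))" for x
    proof -
      have dx: "d (Suc n) x \<in> carrier (P (Suc n))" by (rule mod_hom_closed [OF p(4) x])
      interpret Qn: lmodule R "Q (Suc n)" by (rule q(3))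
      show ?thesis
        using t(2) dx p(9) [OF x] mod_hom_pair.hom_zero [OF pair(1) s] mod_hom_closed [OF kh dx] by simp
    qed
    then show ?thesis
      using t unfolding A_def by auto
  qed
  have "\<exists>s. \<forall>n. A n (s n) \<and>
    (\<forall>x\<in>carrier (P (Suc n)). d' (Suc n) (s (Suc n) x) = k (Suc n) x \<ominus>\<^bsub>Q (Suc n)\<^esub> s n (d n x))"
    by (rule dependent_nat_choice [where P = A and
        Q = "\<lambda>n s t. \<forall>x\<in>carrier (P (Suc n)). d' (Suc n) (t x) = k (Suc n) x \<ominus>\<^bsub>Q (Suc n)\<^esub> s (d n x)",
        OF base step])
  then obtain s where s: "\<And>n. A n (s n)" "\<And>n x. x \<in> carrier (P (Suc n)) \<Longrightarrow>
      d' (Suc n) (s (Suc n) x) = k (Suc n) x \<ominus>\<^bsub>Q (Suc n)\<^esub> s n (d n x)" by auto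
  have sh: "s n \<in> mod_hom R (P n) (Q (Suc n))" for n using s(1) by (simp add: A_def)
  show ?thesis
    unfolding homotopic_def
  proof (intro exI [of _ s] conjI allI ballI)
    fix x assume x: "x \<in> carrier (P 0)"
    interpret Q0: lmodule R "Q 0" by (rule q(3))
    have "d' 0 (s 0 x) = f 0 x \<ominus>\<^bsub>Q 0\<^esub> g 0 x"
      using s(1) [of 0] x by (simp add: A_def k_def)
    then show "f 0 x = d' 0 (s 0 x) \<oplus>\<^bsub>Q 0\<^esub> g 0 x"
      using mod_hom_closed [OF fh x] mod_hom_closed [OF gh x]
        mod_hom_closed [OF q(4) mod_hom_closed [OF sh x]] by (metis Q0.M.minus_eq_iff)
  next
    fix n x assume x: "x \<in> carrier (P (Suc n))"
    interpret Qn: lmodule R "Q (Suc n)" by (rule q(3))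
    have c: "s n (d n x) \<in> carrier (Q (Suc n))" "d' (Suc n) (s (Suc n) x) \<in> carrier (Q (Suc n))"
      using mod_hom_closed [OF sh mod_hom_closed [OF p(4) x]] mod_hom_closed [OF q(4) mod_hom_closed [OF sh x]] .
    have "k (Suc n) x = d' (Suc n) (s (Suc n) x) \<oplus>\<^bsub>Q (Suc n)\<^esub> s n (d n x)"
      using s(2) [OF x] c mod_hom_closed [OF kh x] by (metis Qn.M.minus_eq_iff)
    then show "f (Suc n) x = d' (Suc n) (s (Suc n) x) \<oplus>\<^bsub>Q (Suc n)\<^esub> s n (d n x) \<oplus>\<^bsub>Q (Suc n)\<^esub> g (Suc n) x"
      unfolding k_def using c mod_hom_closed [OF fh x] mod_hom_closed [OF gh x]
      by (metis Qn.M.minus_eq_iff Qn.M.a_closed)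
  qed (rule sh)
qed

lemma chain_map_id: "(\<And>n. \<delta> n \<in> mod_hom R (C (Suc n)) (C n)) \<Longrightarrow> chain_map R C \<delta> C \<delta> (\<lambda>n x. x)"
  by (simp add: chain_map_def mod_hom_id)

lemma chain_map_comp:
  assumes f: "chain_map R C \<delta> C' \<delta>' f" and g: "chain_map R C' \<delta>' C'' \<delta>'' g"
  shows "chain_map R C \<delta> C'' \<delta>'' (\<lambda>n x. g n (f n x))"
  using assms unfolding chain_map_def by (metis mod_hom_closed mod_hom_comp)

text \<open>
  Lifts of the identity in both directions; their composites and the identities are lifts of the same
  map and therefore homotopic.
\<close>

theorem resolutions_homotopy_equivalent:
  assumes P: "projective_resolution R N P d \<epsilon>" and Q: "projective_resolution R N Q d' \<epsilon>'"
  shows "homotopy_equivalent R P d Q d'"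
proof -
  obtain f where f: "chain_map R P d Q d' f" "\<forall>x\<in>carrier (P 0). \<epsilon>' (f 0 x) = \<epsilon> x"
    using lift_chain_map [OF P Q] by blast
  obtain g where g: "chain_map R Q d' P d g" "\<forall>x\<in>carrier (Q 0). \<epsilon> (g 0 x) = \<epsilon>' x"
    using lift_chain_map [OF Q P] by blast
  have f0: "f 0 x \<in> carrier (Q 0)" if "x \<in> carrier (P 0)" for x
    using f(1) that by (meson chain_map_def mod_hom_closed)
  have g0: "g 0 x \<in> carrier (P 0)" if "x \<in> carrier (Q 0)" for x
    using g(1) that by (meson chain_map_def mod_hom_closed)
  have "homotopic R P d P d (\<lambda>n x. g n (f n x)) (\<lambda>n x. x)"
    by (rule chain_map_homotopic [OF P P chain_map_comp [OF f(1) g(1)] chain_map_id])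
      (use f g f0 resolution_facts(4) [OF P] in auto)
  moreover have "homotopic R Q d' Q d' (\<lambda>n x. f n (g n x)) (\<lambda>n x. x)"
    by (rule chain_map_homotopic [OF Q Q chain_map_comp [OF g(1) f(1)] chain_map_id])
      (use f g g0 resolution_facts(4) [OF Q] in auto)
  ultimately show ?thesis using f(1) g(1) unfolding homotopy_equivalent_def by blast
qed

section \<open>Free vector spaces\<close>

lemma lookup_scale [simp]: "Poly_Mapping.lookup (Poly_Mapping.map ((*) c) f) k = (c::'k::field) * Poly_Mapping.lookup f k"
  by (simp add: Poly_Mapping.map.rep_eq when_def)

lemma scale_single [simp]: "Poly_Mapping.map ((*) c) (Poly_Mapping.single x a) = Poly_Mapping.single x ((c::'k::field) * a)"
  by simp

lemma keys_scale: "Poly_Mapping.keys (Poly_Mapping.map ((*) (c::'k::field)) f) \<subseteq> Poly_Mapping.keys f"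
  by (auto simp: in_keys_iff)

lemma free_space_simps [simp]:
  "carrier (free_space X) = {f. Poly_Mapping.keys f \<subseteq> X}" "\<zero>\<^bsub>free_space X\<^esub> = 0"
  "f \<oplus>\<^bsub>free_space X\<^esub> g = f + g" "c \<odot>\<^bsub>free_space X\<^esub> f = Poly_Mapping.map ((*) c) f"
  by (simp_all add: free_space_def)

lemma lmodule_free_space: "lmodule ground (free_space X :: ('k::field, 'x \<Rightarrow>\<^sub>0 'k) module)"
proof -
  have "abelian_group (free_space X :: ('k, 'x \<Rightarrow>\<^sub>0 'k) module)"
  proof (rule abelian_groupI)
    fix f g :: "'x \<Rightarrow>\<^sub>0 'k" assume f: "f \<in> carrier (free_space X)"
    show "\<exists>g\<in>carrier (free_space X). g \<oplus>\<^bsub>free_space X\<^esub> f = \<zero>\<^bsub>free_space X\<^esub>"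
      by (rule bexI [of _ "- f"]) (use f in auto)
    assume "g \<in> carrier (free_space X)"
    then show "f \<oplus>\<^bsub>free_space X\<^esub> g \<in> carrier (free_space X)"
      using f keys_add [of f g] by auto
  qed (auto simp: algebra_simps)
  then show ?thesis
    unfolding lmodule_def lmodule_axioms_def
    using keys_scale by (fastforce simp: cring.axioms(1) [OF cring_ground] intro!: poly_mapping_eqI
      simp: lookup_add algebra_simps)
qed

lemma free_space_uminus: "f \<in> carrier (free_space X) \<Longrightarrow> \<ominus>\<^bsub>free_space X\<^esub> f = - f"
proof -
  interpret lmodule ground "free_space X" by (rule lmodule_free_space)
  show "f \<in> carrier (free_space X) \<Longrightarrow> \<ominus>\<^bsub>free_space X\<^esub> f = - f"
    by (rule M.minus_equality) auto
qed

lemma free_space_minus: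
  "\<lbrakk>f \<in> carrier (free_space X); g \<in> carrier (free_space X)\<rbrakk> \<Longrightarrow> f \<ominus>\<^bsub>free_space X\<^esub> g = f - g"
  using free_space_uminus [of g X] by (simp add: a_minus_def)

lemma free_space_finsum:
  assumes "\<And>i. i \<in> I \<Longrightarrow> Poly_Mapping.keys (f i) \<subseteq> X"
  shows "(\<Oplus>\<^bsub>free_space X\<^esub>i\<in>I. f i) = (\<Sum>i\<in>I. f i)"
proof -
  interpret lmodule ground "free_space X" by (rule lmodule_free_space)
  show ?thesis using assms
    by (induct I rule: infinite_finite_induct) (simp_all add: Pi_def)
qed

lemma free_space_induct [consumes 1, case_names zero single]:
  assumes "f \<in> carrier (free_space X)"
    and "P 0"
    and "\<And>x c g. \<lbrakk>x \<in> X; Poly_Mapping.keys g \<subseteq> X; P g\<rbrakk> \<Longrightarrow> P (Poly_Mapping.single x c + g)"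
  shows "P f"
proof -
  have "\<forall>f. Poly_Mapping.keys f = S \<longrightarrow> S \<subseteq> X \<longrightarrow> P f" if "finite S" for S
    using that
  proof (induct S rule: finite_induct)
    case empty
    then show ?case using assms(2) by simp
  next
    case (insert x S)
    show ?case
    proof (intro allI impI)
      fix f :: "'a \<Rightarrow>\<^sub>0 'b" assume f: "Poly_Mapping.keys f = insert x S" "insert x S \<subseteq> X"
      let ?g = "f - Poly_Mapping.single x (Poly_Mapping.lookup f x)"
      have "Poly_Mapping.keys ?g = S"
        using f insert(2) by (auto simp: in_keys_iff lookup_minus lookup_single when_def split: if_splits)
      then have "P ?g" "Poly_Mapping.keys ?g \<subseteq> X"
        using insert(3) f by auto
      then have "P (Poly_Mapping.single x (Poly_Mapping.lookup f x) + ?g)"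
        using f(2) by (intro assms(3)) auto
      then show "P f" by simp
    qed
  qed
  from this [OF finite_keys [of f]] show ?thesis using assms(1) by simp
qed

definition linear_extension :: "('k::field, 'a) module \<Rightarrow> ('x \<Rightarrow> 'a) \<Rightarrow> ('x \<Rightarrow>\<^sub>0 'k) \<Rightarrow> 'a" where
  "linear_extension U \<phi> f = (\<Oplus>\<^bsub>U\<^esub>x\<in>Poly_Mapping.keys f. Poly_Mapping.lookup f x \<odot>\<^bsub>U\<^esub> \<phi> x)"

context vspace
begin

lemma linear_extension_superset:
  assumes "finite S" "Poly_Mapping.keys f \<subseteq> S" "\<phi> \<in> S \<rightarrow> carrier V"
  shows "linear_extension V \<phi> f = (\<Oplus>\<^bsub>V\<^esub>x\<in>S. Poly_Mapping.lookup f x \<odot>\<^bsub>V\<^esub> \<phi> x)"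
  unfolding linear_extension_def
proof (rule M.add.finprod_mono_neutral_cong_left)
  show "finite S" "Poly_Mapping.keys f \<subseteq> S" by fact+
  have c: "\<phi> x \<in> carrier V" if "x \<in> S" for x using that assms(3) by auto
  show "Poly_Mapping.lookup f x \<odot>\<^bsub>V\<^esub> \<phi> x = \<zero>\<^bsub>V\<^esub>" if "x \<in> S - Poly_Mapping.keys f" for x
    using that c smult_zero_left by (simp add: in_keys_iff)
  show "(\<lambda>x. Poly_Mapping.lookup f x \<odot>\<^bsub>V\<^esub> \<phi> x) \<in> S \<rightarrow> carrier V"
    using c by auto
qed simp

lemma linear_extension_hom:
  fixes \<phi> :: "'x \<Rightarrow> 'a"
  assumes \<phi>: "\<phi> \<in> X \<rightarrow> carrier V"
  shows "linear_extension V \<phi> \<in> mod_hom ground (free_space X) V"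
proof (rule mod_homI)
  fix f :: "'x \<Rightarrow>\<^sub>0 'k" assume f: "f \<in> carrier (free_space X)"
  then have c: "\<phi> x \<in> carrier V" if "x \<in> Poly_Mapping.keys f" for x using that \<phi> by auto
  then show "linear_extension V \<phi> f \<in> carrier V"
    unfolding linear_extension_def by (intro M.finsum_closed) auto
  fix r :: 'k
  have "linear_extension V \<phi> (r \<odot>\<^bsub>free_space X\<^esub> f) =
      (\<Oplus>\<^bsub>V\<^esub>x\<in>Poly_Mapping.keys f. (r * Poly_Mapping.lookup f x) \<odot>\<^bsub>V\<^esub> \<phi> x)"
    using keys_scale [of r f] c by (subst linear_extension_superset [of "Poly_Mapping.keys f"]) auto
  also have "\<dots> = (\<Oplus>\<^bsub>V\<^esub>x\<in>Poly_Mapping.keys f. r \<odot>\<^bsub>V\<^esub> (Poly_Mapping.lookup f x \<odot>\<^bsub>V\<^esub> \<phi> x))"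
    by (rule M.finsum_cong') (use c smult_assoc in auto)
  also have "\<dots> = r \<odot>\<^bsub>V\<^esub> linear_extension V \<phi> f"
    unfolding linear_extension_def by (rule smult_finsum_right [symmetric]) (use c in auto)
  finally show "linear_extension V \<phi> (r \<odot>\<^bsub>free_space X\<^esub> f) = r \<odot>\<^bsub>V\<^esub> linear_extension V \<phi> f" .
next
  fix f g :: "'x \<Rightarrow>\<^sub>0 'k" assume f: "f \<in> carrier (free_space X)" and g: "g \<in> carrier (free_space X)"
  let ?S = "Poly_Mapping.keys f \<union> Poly_Mapping.keys g"
  have c: "\<phi> x \<in> carrier V" if "x \<in> ?S" for x using that \<phi> f g by auto
  have \<phi>S: "\<phi> \<in> ?S \<rightarrow> carrier V" using c by auto
  have "linear_extension V \<phi> (f + g) =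
      (\<Oplus>\<^bsub>V\<^esub>x\<in>?S. (Poly_Mapping.lookup f x + Poly_Mapping.lookup g x) \<odot>\<^bsub>V\<^esub> \<phi> x)"
    using keys_add [of f g] \<phi>S by (subst linear_extension_superset [of ?S]) (simp_all add: lookup_add)
  also have "\<dots> = (\<Oplus>\<^bsub>V\<^esub>x\<in>?S. Poly_Mapping.lookup f x \<odot>\<^bsub>V\<^esub> \<phi> x \<oplus>\<^bsub>V\<^esub> Poly_Mapping.lookup g x \<odot>\<^bsub>V\<^esub> \<phi> x)"
    by (rule M.finsum_cong') (use c smult_l_distr in auto)
  also have "\<dots> = linear_extension V \<phi> f \<oplus>\<^bsub>V\<^esub> linear_extension V \<phi> g"
    using \<phi>S c by (subst M.finsum_addf) (auto simp: linear_extension_superset [of ?S])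
  finally show "linear_extension V \<phi> (f \<oplus>\<^bsub>free_space X\<^esub> g) = \<dots>" by simp
qed

lemma linear_extension_single:
  assumes "\<phi> x \<in> carrier V"
  shows "linear_extension V \<phi> (Poly_Mapping.single x c) = c \<odot>\<^bsub>V\<^esub> \<phi> x"
  using assms by (subst linear_extension_superset [of "{x}"]) (auto simp: smult_closed [simplified])

lemma linear_extension_one:
  assumes "\<phi> x \<in> carrier V"
  shows "linear_extension V \<phi> (Poly_Mapping.single x 1) = \<phi> x"
  using linear_extension_single [of \<phi> x 1] assms smult_one by simp

end

lemma free_space_hom_eqI:
  assumes "lmodule ground U" and f: "f \<in> mod_hom ground (free_space X) U" and g: "g \<in> mod_hom ground (free_space X) U"
    and eq: "\<And>x. x \<in> X \<Longrightarrow> f (Poly_Mapping.single x 1) = g (Poly_Mapping.single x 1)"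
    and z: "z \<in> carrier (free_space X)"
  shows "f z = g z"
proof -
  interpret mod_hom_pair ground "free_space X" U
    by (simp add: mod_hom_pair_def assms(1) lmodule_free_space)
  from z show ?thesis
  proof (induct z rule: free_space_induct)
    case zero
    then show ?case using hom_zero [OF f] hom_zero [OF g] by simp
  next
    case (single x c h)
    have e: "Poly_Mapping.single x c = c \<odot>\<^bsub>free_space X\<^esub> Poly_Mapping.single x 1" by simp
    have "h (c \<odot>\<^bsub>free_space X\<^esub> Poly_Mapping.single x 1) = c \<odot>\<^bsub>U\<^esub> h (Poly_Mapping.single x 1)"
      if "h \<in> mod_hom ground (free_space X) U" for h
      by (rule mod_hom_smult [OF that]) (use single(1) in simp_all)
    then have "f (Poly_Mapping.single x c) = g (Poly_Mapping.single x c)"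
      unfolding e using f g eq [OF single(1)] by metis
    then show ?case
      using single mod_hom_add [OF f, of "Poly_Mapping.single x c" h]
        mod_hom_add [OF g, of "Poly_Mapping.single x c" h] by simp
  qed
qed

section \<open>Tensor products\<close>

definition pure :: "('k::field, 'r) module \<Rightarrow> ('r, 'a) module \<Rightarrow> ('r, 'b) module \<Rightarrow> 'a \<Rightarrow> 'b
    \<Rightarrow> ('a \<times> 'b \<Rightarrow>\<^sub>0 'k) set" where
  "pure R M N x y = tensor_null R M N +>\<^bsub>free_space (carrier M \<times> carrier N)\<^esub> Poly_Mapping.single (x, y) 1"

locale tensor_pair =
  fixes R :: "('k::field, 'r) module" and M :: "('r, 'a) module" and N :: "('r, 'b) module"
  assumes M: "lmodule (opposite R) M" and N: "lmodule R N"
    and scalar_closed: "\<And>c. c \<odot>\<^bsub>R\<^esub> \<one>\<^bsub>R\<^esub> \<in> carrier R"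
begin

sublocale M: lmodule "opposite R" M by (rule M)
sublocale N: lmodule R N by (rule N)

lemma opp_carrier [simp]: "carrier (opposite R) = carrier R"
  by (simp add: opposite_def)

abbreviation "F \<equiv> free_space (carrier M \<times> carrier N) :: ('k, 'a \<times> 'b \<Rightarrow>\<^sub>0 'k) module"

sublocale F: vspace F by (simp add: vspace_def lmodule_free_space)

lemma M_smult: "\<lbrakk>r \<in> carrier R; x \<in> carrier M\<rbrakk> \<Longrightarrow> r \<odot>\<^bsub>M\<^esub> x \<in> carrier M"
  using M.smult_closed by simp

lemma single_closed: "\<lbrakk>x \<in> carrier M; y \<in> carrier N\<rbrakk> \<Longrightarrow> Poly_Mapping.single (x, y) c \<in> carrier F"
  by simp

lemma tensor_rel_closed: "tensor_rel R M N \<subseteq> carrier F"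
proof -
  have d: "f - g \<in> carrier F" if "f \<in> carrier F" "g \<in> carrier F" for f g
    using that F.M.minus_closed [OF that] by (simp only: free_space_minus)
  note d = d [OF d] d
  show ?thesis
    unfolding tensor_rel_def Let_def
    by (intro Un_least subsetI)
      (auto simp del: free_space_simps intro!: d(2) single_closed M_smult scalar_closed)
qed

sublocale T: vsubspace "tensor_null R M N" F
  by (simp add: vsubspace_def vsubspace_axioms_def F.vspace_axioms tensor_null_def
    F.vspan_submodule [OF tensor_rel_closed])

lemma tensor_vspace: "vspace (tensor R M N)"
  by (simp add: tensor_def T.vspace_vquot)

lemma tensor_lmodule: "lmodule ground (tensor R M N)"
  using tensor_vspace by (simp add: vspace_def)

lemma tensor_rel_null: "z \<in> tensor_rel R M N \<Longrightarrow> z \<in> tensor_null R M N"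
  unfolding tensor_null_def using F.subset_vspan [OF tensor_rel_closed] by blast

lemma pure_closed: "\<lbrakk>x \<in> carrier M; y \<in> carrier N\<rbrakk> \<Longrightarrow> pure R M N x y \<in> carrier (tensor R M N)"
  unfolding pure_def tensor_def by (rule T.coset_closed) simp

lemma coset_eqI:
  assumes "f \<in> carrier F" "g \<in> carrier F" "f - g \<in> tensor_rel R M N"
  shows "tensor_null R M N +>\<^bsub>F\<^esub> f = tensor_null R M N +>\<^bsub>F\<^esub> g"
  using assms by (subst T.coset_eq_iff) (simp_all add: free_space_minus tensor_rel_null del: free_space_simps)

lemma pure_add_left:
  assumes "x \<in> carrier M" "x' \<in> carrier M" "y \<in> carrier N"
  shows "pure R M N (x \<oplus>\<^bsub>M\<^esub> x') y = pure R M N x y \<oplus>\<^bsub>tensor R M N\<^esub> pure R M N x' y"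
  unfolding pure_def tensor_def
proof (subst T.vquot_add)
  show "tensor_null R M N +>\<^bsub>F\<^esub> Poly_Mapping.single (x \<oplus>\<^bsub>M\<^esub> x', y) 1 =
    tensor_null R M N +>\<^bsub>F\<^esub> (Poly_Mapping.single (x, y) 1 \<oplus>\<^bsub>F\<^esub> Poly_Mapping.single (x', y) 1)"
  proof (rule coset_eqI)
    have "Poly_Mapping.single (x \<oplus>\<^bsub>M\<^esub> x', y) 1 - (Poly_Mapping.single (x, y) 1 + Poly_Mapping.single (x', y) (1::'k))
        = Poly_Mapping.single (x \<oplus>\<^bsub>M\<^esub> x', y) 1 - Poly_Mapping.single (x, y) 1 - Poly_Mapping.single (x', y) 1"
      by simp
    then show "Poly_Mapping.single (x \<oplus>\<^bsub>M\<^esub> x', y) 1 - (Poly_Mapping.single (x, y) 1 \<oplus>\<^bsub>F\<^esub> Poly_Mapping.single (x', y) 1)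
        \<in> tensor_rel R M N"
      unfolding tensor_rel_def Let_def using assms by (auto simp del: diff_diff_eq)
  qed (use assms in \<open>auto simp del: free_space_simps intro!: F.M.a_closed single_closed\<close>)
qed (use assms in simp_all)

lemma pure_add_right:
  assumes "x \<in> carrier M" "y \<in> carrier N" "y' \<in> carrier N"
  shows "pure R M N x (y \<oplus>\<^bsub>N\<^esub> y') = pure R M N x y \<oplus>\<^bsub>tensor R M N\<^esub> pure R M N x y'"
  unfolding pure_def tensor_def
proof (subst T.vquot_add)
  show "tensor_null R M N +>\<^bsub>F\<^esub> Poly_Mapping.single (x, y \<oplus>\<^bsub>N\<^esub> y') 1 =
    tensor_null R M N +>\<^bsub>F\<^esub> (Poly_Mapping.single (x, y) 1 \<oplus>\<^bsub>F\<^esub> Poly_Mapping.single (x, y') 1)"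
  proof (rule coset_eqI)
    have "Poly_Mapping.single (x, y \<oplus>\<^bsub>N\<^esub> y') 1 - (Poly_Mapping.single (x, y) 1 + Poly_Mapping.single (x, y') (1::'k))
        = Poly_Mapping.single (x, y \<oplus>\<^bsub>N\<^esub> y') 1 - Poly_Mapping.single (x, y) 1 - Poly_Mapping.single (x, y') 1"
      by simp
    then show "Poly_Mapping.single (x, y \<oplus>\<^bsub>N\<^esub> y') 1 - (Poly_Mapping.single (x, y) 1 \<oplus>\<^bsub>F\<^esub> Poly_Mapping.single (x, y') 1)
        \<in> tensor_rel R M N"
      unfolding tensor_rel_def Let_def using assms by (auto simp del: diff_diff_eq)
  qed (use assms in \<open>auto simp del: free_space_simps intro!: F.M.a_closed single_closed\<close>)
qed (use assms in simp_all)

lemma pure_balanced: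
  assumes "r \<in> carrier R" "x \<in> carrier M" "y \<in> carrier N"
  shows "pure R M N (r \<odot>\<^bsub>M\<^esub> x) y = pure R M N x (r \<odot>\<^bsub>N\<^esub> y)"
  unfolding pure_def using assms M_smult
  by (intro coset_eqI) (auto simp: tensor_rel_def Let_def)

lemma pure_scalar:
  assumes "x \<in> carrier M" "y \<in> carrier N"
  shows "pure R M N ((c \<odot>\<^bsub>R\<^esub> \<one>\<^bsub>R\<^esub>) \<odot>\<^bsub>M\<^esub> x) y = c \<odot>\<^bsub>tensor R M N\<^esub> pure R M N x y"
  unfolding pure_def tensor_def using assms M_smult scalar_closed
  by (subst T.vquot_smult, simp, intro coset_eqI) (auto simp: tensor_rel_def Let_def)

text \<open>
  All identities between linear maps on tensor products are checked with this rule.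
\<close>

lemma tensor_hom_eqI:
  assumes U: "lmodule ground U" and f: "f \<in> mod_hom ground (tensor R M N) U" and g: "g \<in> mod_hom ground (tensor R M N) U"
    and eq: "\<And>x y. \<lbrakk>x \<in> carrier M; y \<in> carrier N\<rbrakk> \<Longrightarrow> f (pure R M N x y) = g (pure R M N x y)"
    and z: "z \<in> carrier (tensor R M N)"
  shows "f z = g z"
proof -
  obtain w where w: "w \<in> carrier F" "z = tensor_null R M N +>\<^bsub>F\<^esub> w"
    using z by (auto simp: tensor_def T.vquot_simps(2) simp del: free_space_simps)
  show ?thesis unfolding w(2)
  proof (rule free_space_hom_eqI [OF U mod_hom_comp [OF T.coset_hom] mod_hom_comp [OF T.coset_hom] _ w(1)])
    show "f \<in> mod_hom ground (F /\<^sub>v tensor_null R M N) U" "g \<in> mod_hom ground (F /\<^sub>v tensor_null R M N) U"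
      using f g by (simp_all add: tensor_def)
  qed (use eq in \<open>auto simp: pure_def\<close>)
qed

text \<open>
  The universal property of the tensor product.  The third conclusion speaks about the linear map
  before it passes to the quotient; it serves to recognise elements of the relation space as such.
\<close>

lemma tensor_extend:
  assumes U: "lmodule ground U"
    and cl: "\<And>x y. \<lbrakk>x \<in> carrier M; y \<in> carrier N\<rbrakk> \<Longrightarrow> \<beta> x y \<in> carrier U"
    and al: "\<And>x x' y. \<lbrakk>x \<in> carrier M; x' \<in> carrier M; y \<in> carrier N\<rbrakk> \<Longrightarrow> \<beta> (x \<oplus>\<^bsub>M\<^esub> x') y = \<beta> x y \<oplus>\<^bsub>U\<^esub> \<beta> x' y"
    and ar: "\<And>x y y'. \<lbrakk>x \<in> carrier M; y \<in> carrier N; y' \<in> carrier N\<rbrakk> \<Longrightarrow> \<beta> x (y \<oplus>\<^bsub>N\<^esub> y') = \<beta> x y \<oplus>\<^bsub>U\<^esub> \<beta> x y'"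
    and b: "\<And>r x y. \<lbrakk>r \<in> carrier R; x \<in> carrier M; y \<in> carrier N\<rbrakk> \<Longrightarrow> \<beta> (r \<odot>\<^bsub>M\<^esub> x) y = \<beta> x (r \<odot>\<^bsub>N\<^esub> y)"
    and s: "\<And>c x y. \<lbrakk>x \<in> carrier M; y \<in> carrier N\<rbrakk> \<Longrightarrow> \<beta> ((c \<odot>\<^bsub>R\<^esub> \<one>\<^bsub>R\<^esub>) \<odot>\<^bsub>M\<^esub> x) y = c \<odot>\<^bsub>U\<^esub> \<beta> x y"
  defines "h \<equiv> on_coset (linear_extension U (case_prod \<beta>))"
  shows "h \<in> mod_hom ground (tensor R M N) U"
    and "\<And>x y. \<lbrakk>x \<in> carrier M; y \<in> carrier N\<rbrakk> \<Longrightarrow> h (pure R M N x y) = \<beta> x y"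
    and "\<And>z. z \<in> tensor_null R M N \<Longrightarrow> linear_extension U (case_prod \<beta>) z = \<zero>\<^bsub>U\<^esub>"
proof -
  interpret U: vspace U using U by (simp add: vspace_def)
  interpret FU: mod_hom_pair ground F U by (simp add: mod_hom_pair_def U F.lmodule_axioms)
  let ?l = "linear_extension U (case_prod \<beta>)"
  have l: "?l \<in> mod_hom ground F U"
    by (rule U.linear_extension_hom) (use cl in auto)
  have ls: "?l (Poly_Mapping.single (x, y) c) = c \<odot>\<^bsub>U\<^esub> \<beta> x y" if "x \<in> carrier M" "y \<in> carrier N" for x y c
    using U.linear_extension_single [of "case_prod \<beta>" "(x, y)"] cl that by simp
  have l1: "?l (Poly_Mapping.single (x, y) 1) = \<beta> x y" if "x \<in> carrier M" "y \<in> carrier N" for x y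
    using U.linear_extension_one [of "case_prod \<beta>" "(x, y)"] cl that by simp
  have lm: "?l (f - g) = ?l f \<ominus>\<^bsub>U\<^esub> ?l g" if "f \<in> carrier F" "g \<in> carrier F" for f g
    using FU.hom_minus [OF l that] by (simp only: free_space_minus [OF that])
  have sc: "Poly_Mapping.single (x, y) c \<in> carrier F" if "x \<in> carrier M" "y \<in> carrier N" for x y c
    using that by simp
  have dc: "f - g \<in> carrier F" if "f \<in> carrier F" "g \<in> carrier F" for f g
    using that F.M.minus_closed [OF that] by (simp only: free_space_minus)
  have eq0: "a \<ominus>\<^bsub>U\<^esub> b = \<zero>\<^bsub>U\<^esub>" if "a = b" "b \<in> carrier U" for a b
    using that by simp
  have eq1: "(a \<oplus>\<^bsub>U\<^esub> b) \<ominus>\<^bsub>U\<^esub> a \<ominus>\<^bsub>U\<^esub> b = \<zero>\<^bsub>U\<^esub>" if "a \<in> carrier U" "b \<in> carrier U" for a b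
    using that by (simp add: U.M.minus_eq_iff U.M.add.m_comm)
  have rel: "?l z = \<zero>\<^bsub>U\<^esub>" if "z \<in> tensor_rel R M N" for z
    using that unfolding tensor_rel_def Let_def
    apply (elim UnE)
       apply (clarsimp simp del: free_space_simps simp: lm sc dc l1 al cl eq1)
      apply (clarsimp simp del: free_space_simps simp: lm sc dc l1 ar cl eq1)
     apply (clarsimp simp del: free_space_simps simp: lm sc dc l1 b cl M_smult)
    apply (clarsimp simp del: free_space_simps simp: lm sc dc ls s cl M_smult scalar_closed U.smult_closed [simplified]
      U.smult_one [simplified])
    done
  show null: "?l z = \<zero>\<^bsub>U\<^esub>" if "z \<in> tensor_null R M N" for z
  proof -
    have "tensor_null R M N \<subseteq> {z \<in> carrier F. ?l z = \<zero>\<^bsub>U\<^esub>}"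
      unfolding tensor_null_def
      by (rule F.vspan_least [OF tensor_rel_closed kernel_submodule [OF FU.mod_hom_pair_axioms l]])
        (use rel tensor_rel_closed in blast)
    then show ?thesis using that by blast
  qed
  show "h \<in> mod_hom ground (tensor R M N) U"
    unfolding h_def tensor_def by (rule T.on_coset_hom(2) [OF U l null])
  show "h (pure R M N x y) = \<beta> x y" if "x \<in> carrier M" "y \<in> carrier N" for x y
    unfolding h_def pure_def using T.on_coset_hom(1) [OF U l null sc [OF that]] l1 [OF that] by simp
qed

end

lemma tensor_map_hom:
  assumes "tensor_pair R M N" "tensor_pair R M N'" and g: "g \<in> mod_hom R N N'"
  shows "tensor_map R M N' g \<in> mod_hom ground (tensor R M N) (tensor R M N')"
    and "\<And>x y. \<lbrakk>x \<in> carrier M; y \<in> carrier N\<rbrakk> \<Longrightarrow> tensor_map R M N' g (pure R M N x y) = pure R M N' x (g y)"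
proof -
  interpret A: tensor_pair R M N by fact
  interpret B: tensor_pair R M N' by fact
  interpret T': vspace "tensor R M N'" by (rule B.tensor_vspace)
  note gc = mod_hom_closed [OF g]
  let ?\<beta> = "\<lambda>x y. pure R M N' x (g y)"
  note ext = A.tensor_extend [OF B.tensor_lmodule, of ?\<beta>]
  let ?q = "\<lambda>f. B.F /\<^sub>v tensor_null R M N'"
  \<comment> \<open>The explicit formula is the map that the universal property gives for \<open>(x, y) \<mapsto> x \<otimes> g y\<close>.\<close>
  have eq: "tensor_map R M N' g z = on_coset (linear_extension (tensor R M N') (case_prod ?\<beta>)) z"
    if z: "z \<in> carrier (tensor R M N)" for z
  proof -
    obtain w where w: "w \<in> carrier A.F" "z = tensor_null R M N +>\<^bsub>A.F\<^esub> w"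
      using z by (auto simp: tensor_def A.T.vquot_simps(2) simp del: free_space_simps)
    have "tensor_null R M N' +>\<^bsub>B.F\<^esub>
        (\<Sum>(x, y)\<in>Poly_Mapping.keys f. Poly_Mapping.single (x, g y) (Poly_Mapping.lookup f (x, y))) =
        linear_extension (tensor R M N') (case_prod ?\<beta>) f" if f: "f \<in> z" for f
    proof -
      have "f \<in> carrier A.F" using f w A.T.mem_coset_iff by blast
      then have k: "x \<in> carrier M" "y \<in> carrier N" if "(x, y) \<in> Poly_Mapping.keys f" for x y
        using that by auto
      interpret pr: mod_hom_pair ground B.F "tensor R M N'"
        by (simp add: mod_hom_pair_def B.tensor_lmodule lmodule_free_space)
      have h: "(\<lambda>x. tensor_null R M N' +>\<^bsub>B.F\<^esub> x) \<in> mod_hom ground B.F (tensor R M N')"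
        unfolding tensor_def by (rule B.T.coset_hom)
      have "(\<Sum>(x, y)\<in>Poly_Mapping.keys f. Poly_Mapping.single (x, g y) (Poly_Mapping.lookup f (x, y))) =
         (\<Oplus>\<^bsub>B.F\<^esub>p\<in>Poly_Mapping.keys f. Poly_Mapping.single (fst p, g (snd p)) (Poly_Mapping.lookup f p))"
        by (subst free_space_finsum) (use k gc in \<open>auto simp: case_prod_beta split: if_splits\<close>)
      moreover have "tensor_null R M N' +>\<^bsub>B.F\<^esub> \<dots> = (\<Oplus>\<^bsub>tensor R M N'\<^esub>p\<in>Poly_Mapping.keys f.
          tensor_null R M N' +>\<^bsub>B.F\<^esub> Poly_Mapping.single (fst p, g (snd p)) (Poly_Mapping.lookup f p))"
        by (rule pr.hom_finsum [OF h]) (use k gc in \<open>auto split: if_splits\<close>)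
      moreover have "\<dots> = linear_extension (tensor R M N') (case_prod ?\<beta>) f"
        unfolding linear_extension_def
      proof (rule T'.finsum_cong' [OF refl])
        show "(\<lambda>i. Poly_Mapping.lookup f i \<odot>\<^bsub>tensor R M N'\<^esub> (case i of (x, y) \<Rightarrow> pure R M N' x (g y)))
          \<in> Poly_Mapping.keys f \<rightarrow> carrier (tensor R M N')"
          using k gc by (auto intro!: T'.smult_closed B.pure_closed)
        fix p assume p: "p \<in> Poly_Mapping.keys f"
        then obtain x y where xy: "p = (x, y)" "x \<in> carrier M" "y \<in> carrier N" using k by (cases p) auto
        have "Poly_Mapping.single (x, g y) (Poly_Mapping.lookup f p) =
            Poly_Mapping.lookup f p \<odot>\<^bsub>B.F\<^esub> Poly_Mapping.single (x, g y) 1" by simp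
        then show "tensor_null R M N' +>\<^bsub>B.F\<^esub> Poly_Mapping.single (fst p, g (snd p)) (Poly_Mapping.lookup f p)
          = Poly_Mapping.lookup f p \<odot>\<^bsub>tensor R M N'\<^esub> (case p of (x, y) \<Rightarrow> pure R M N' x (g y))"
          using xy gc mod_hom_smult [OF h, of "Poly_Mapping.lookup f p" "Poly_Mapping.single (x, g y) 1"]
          by (simp add: pure_def)
      qed
      ultimately show ?thesis by simp
    qed
    then show ?thesis
      unfolding tensor_map_def on_coset_def by (metis (no_types, lifting) image_cong)
  qed
  have bh: "on_coset (linear_extension (tensor R M N') (case_prod ?\<beta>)) \<in> mod_hom ground (tensor R M N) (tensor R M N')"
    and bp: "\<lbrakk>x \<in> carrier M; y \<in> carrier N\<rbrakk> \<Longrightarrow> on_coset (linear_extension (tensor R M N') (case_prod ?\<beta>)) (pure R M N x y) = ?\<beta> x y" for x y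
    by (rule ext; simp add: B.pure_closed gc B.pure_add_left B.pure_add_right mod_hom_add [OF g]
        mod_hom_smult [OF g] B.pure_balanced B.pure_scalar)+
  interpret T: vspace "tensor R M N" by (rule A.tensor_vspace)
  show "tensor_map R M N' g \<in> mod_hom ground (tensor R M N) (tensor R M N')"
    by (intro mod_homI)
      (simp_all add: eq mod_hom_closed [OF bh] mod_hom_add [OF bh] mod_hom_smult [OF bh] T.smult_closed [simplified])
  show "\<lbrakk>x \<in> carrier M; y \<in> carrier N\<rbrakk> \<Longrightarrow> tensor_map R M N' g (pure R M N x y) = pure R M N' x (g y)" for x y
    by (simp add: eq A.pure_closed bp)
qed

section \<open>Homotopy invariance of Tor\<close>

lemma homotopic_cong:
  assumes "homotopic R C \<delta> C' \<delta>' f g"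
    and "\<And>n x. x \<in> carrier (C n) \<Longrightarrow> f' n x = f n x" "\<And>n x. x \<in> carrier (C n) \<Longrightarrow> g' n x = g n x"
  shows "homotopic R C \<delta> C' \<delta>' f' g'"
  using assms(1) unfolding homotopic_def by (simp add: assms(2,3))

locale tensor_complex =
  fixes R :: "('k::field, 'r) module" and M :: "('r, 'a) module" and P :: "nat \<Rightarrow> ('r, 'p) module"
    and d :: "nat \<Rightarrow> 'p \<Rightarrow> 'p"
  assumes pair: "\<And>n. tensor_pair R M (P n)" and d: "\<And>n. d n \<in> mod_hom R (P (Suc n)) (P n)"
begin

abbreviation "TP \<equiv> \<lambda>n. tensor R M (P n)"
abbreviation "Td \<equiv> \<lambda>n. tensor_map R M (P n) (d n)"

lemma Td_hom: "Td n \<in> mod_hom ground (TP (Suc n)) (TP n)"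
  by (rule tensor_map_hom(1) [OF pair pair d])

end

lemma tensor_chain_map:
  assumes "tensor_complex R M P d" "tensor_complex R M Q d'" and f: "chain_map R P d Q d' f"
  shows "chain_map ground (\<lambda>n. tensor R M (P n)) (\<lambda>n. tensor_map R M (P n) (d n))
     (\<lambda>n. tensor R M (Q n)) (\<lambda>n. tensor_map R M (Q n) (d' n)) (\<lambda>n. tensor_map R M (Q n) (f n))"
  unfolding chain_map_def
proof (intro allI conjI ballI)
  interpret P: tensor_complex R M P d by fact
  interpret Q: tensor_complex R M Q d' by fact
  have fh: "f n \<in> mod_hom R (P n) (Q n)" and fd: "\<And>x. x \<in> carrier (P (Suc n)) \<Longrightarrow> d' n (f (Suc n) x) = f n (d n x)" for n
    using f by (auto simp: chain_map_def)
  show Tf: "tensor_map R M (Q n) (f n) \<in> mod_hom ground (tensor R M (P n)) (tensor R M (Q n))" for n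
    by (rule tensor_map_hom(1) [OF P.pair Q.pair fh])
  note pm = tensor_map_hom(2) [OF P.pair P.pair P.d] tensor_map_hom(2) [OF P.pair Q.pair fh]
    tensor_map_hom(2) [OF Q.pair Q.pair Q.d]
  fix n x assume x: "x \<in> carrier (tensor R M (P (Suc n)))"
  show "tensor_map R M (Q n) (d' n) (tensor_map R M (Q (Suc n)) (f (Suc n)) x) =
      tensor_map R M (Q n) (f n) (tensor_map R M (P n) (d n) x)"
    by (rule tensor_pair.tensor_hom_eqI [OF P.pair tensor_pair.tensor_lmodule [OF Q.pair]
        mod_hom_comp [OF Tf Q.Td_hom] mod_hom_comp [OF P.Td_hom Tf] _ x])
      (simp add: pm mod_hom_closed [OF fh] mod_hom_closed [OF P.d] fd)
qed

text \<open>
  If \<open>s\<close> is a homotopy, then so is \<open>id \<otimes> s\<close>; on pure tensors the defining identities are images of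
  those of \<open>s\<close>.
\<close>

lemma tensor_homotopic:
  assumes "tensor_complex R M P d" "tensor_complex R M Q d'" and fg: "homotopic R P d Q d' f g"
    and f: "\<And>n. f n \<in> mod_hom R (P n) (Q n)" and g: "\<And>n. g n \<in> mod_hom R (P n) (Q n)"
  shows "homotopic ground (\<lambda>n. tensor R M (P n)) (\<lambda>n. tensor_map R M (P n) (d n))
     (\<lambda>n. tensor R M (Q n)) (\<lambda>n. tensor_map R M (Q n) (d' n))
     (\<lambda>n. tensor_map R M (Q n) (f n)) (\<lambda>n. tensor_map R M (Q n) (g n))"
proof -
  interpret P: tensor_complex R M P d by fact
  interpret Q: tensor_complex R M Q d' by fact
  obtain s where s: "\<And>n. s n \<in> mod_hom R (P n) (Q (Suc n))"
    and s0: "\<And>x. x \<in> carrier (P 0) \<Longrightarrow> f 0 x = d' 0 (s 0 x) \<oplus>\<^bsub>Q 0\<^esub> g 0 x"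
    and sS: "\<And>n x. x \<in> carrier (P (Suc n)) \<Longrightarrow> f (Suc n) x =
        d' (Suc n) (s (Suc n) x) \<oplus>\<^bsub>Q (Suc n)\<^esub> s n (d n x) \<oplus>\<^bsub>Q (Suc n)\<^esub> g (Suc n) x"
    using fg unfolding homotopic_def by blast
  have T: "tensor_map R M (Q n) (f n) \<in> mod_hom ground (P.TP n) (Q.TP n)"
    "tensor_map R M (Q n) (g n) \<in> mod_hom ground (P.TP n) (Q.TP n)"
    "tensor_map R M (Q (Suc n)) (s n) \<in> mod_hom ground (P.TP n) (Q.TP (Suc n))" for n
    by (rule tensor_map_hom(1) [OF P.pair Q.pair] f g s)+
  have pm: "\<lbrakk>x \<in> carrier M; y \<in> carrier (P (Suc n))\<rbrakk> \<Longrightarrow> tensor_map R M (P n) (d n) (pure R M (P (Suc n)) x y) = pure R M (P n) x (d n y)"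
    "\<lbrakk>x \<in> carrier M; w \<in> carrier (Q (Suc n))\<rbrakk> \<Longrightarrow> tensor_map R M (Q n) (d' n) (pure R M (Q (Suc n)) x w) = pure R M (Q n) x (d' n w)"
    "\<lbrakk>x \<in> carrier M; z \<in> carrier (P n)\<rbrakk> \<Longrightarrow> tensor_map R M (Q n) (f n) (pure R M (P n) x z) = pure R M (Q n) x (f n z)"
    "\<lbrakk>x \<in> carrier M; z \<in> carrier (P n)\<rbrakk> \<Longrightarrow> tensor_map R M (Q n) (g n) (pure R M (P n) x z) = pure R M (Q n) x (g n z)"
    "\<lbrakk>x \<in> carrier M; z \<in> carrier (P n)\<rbrakk> \<Longrightarrow> tensor_map R M (Q (Suc n)) (s n) (pure R M (P n) x z) = pure R M (Q (Suc n)) x (s n z)"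
    for n x y z w
    by (rule tensor_map_hom(2) [OF P.pair P.pair P.d] tensor_map_hom(2) [OF Q.pair Q.pair Q.d]
      tensor_map_hom(2) [OF P.pair Q.pair f] tensor_map_hom(2) [OF P.pair Q.pair g]
      tensor_map_hom(2) [OF P.pair Q.pair s]; assumption)+
  have tp: "mod_hom_pair ground (P.TP i) (Q.TP j)" for i j
    by (simp add: mod_hom_pair_def tensor_pair.tensor_lmodule [OF P.pair] tensor_pair.tensor_lmodule [OF Q.pair])
  note cl = mod_hom_closed [OF s] mod_hom_closed [OF g] mod_hom_closed [OF P.d] mod_hom_closed [OF Q.d]
  have qa: "abelian_monoid (Q n)" for n
    using tensor_pair.N [OF Q.pair [of n]] by (simp add: lmodule_def abelian_group_def)
  note ac = abelian_monoid.a_closed [OF qa]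
  show ?thesis
    unfolding homotopic_def
  proof (intro exI [of _ "\<lambda>n. tensor_map R M (Q (Suc n)) (s n)"] conjI allI ballI T)
    fix x assume x: "x \<in> carrier (P.TP 0)"
    show "tensor_map R M (Q 0) (f 0) x = tensor_map R M (Q 0) (d' 0) (tensor_map R M (Q (Suc 0)) (s 0) x)
        \<oplus>\<^bsub>Q.TP 0\<^esub> tensor_map R M (Q 0) (g 0) x"
      by (rule tensor_pair.tensor_hom_eqI [OF P.pair tensor_pair.tensor_lmodule [OF Q.pair] T(1)
            mod_hom_pair.hom_plus_hom [OF tp mod_hom_comp [OF T(3) Q.Td_hom] T(2)] _ x])
        (simp add: pm cl s0 tensor_pair.pure_add_right [OF Q.pair])
  next
    fix n x assume x: "x \<in> carrier (P.TP (Suc n))"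
    show "tensor_map R M (Q (Suc n)) (f (Suc n)) x =
        tensor_map R M (Q (Suc n)) (d' (Suc n)) (tensor_map R M (Q (Suc (Suc n))) (s (Suc n)) x)
        \<oplus>\<^bsub>Q.TP (Suc n)\<^esub> tensor_map R M (Q (Suc n)) (s n) (tensor_map R M (P n) (d n) x)
        \<oplus>\<^bsub>Q.TP (Suc n)\<^esub> tensor_map R M (Q (Suc n)) (g (Suc n)) x"
      by (rule tensor_pair.tensor_hom_eqI [OF P.pair tensor_pair.tensor_lmodule [OF Q.pair] T(1)
            mod_hom_pair.hom_plus_hom [OF tp mod_hom_pair.hom_plus_hom [OF tp mod_hom_comp [OF T(3) Q.Td_hom]
            mod_hom_comp [OF P.Td_hom T(3)]] T(2)] _ x])
        (simp add: pm cl ac sS tensor_pair.pure_add_right [OF Q.pair])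
  qed
qed

lemma tensor_map_comp:
  assumes "tensor_pair R M N" "tensor_pair R M N'" "tensor_pair R M N''"
    and f: "f \<in> mod_hom R N N'" and g: "g \<in> mod_hom R N' N''" and x: "x \<in> carrier (tensor R M N)"
  shows "tensor_map R M N'' g (tensor_map R M N' f x) = tensor_map R M N'' (\<lambda>y. g (f y)) x"
  by (rule tensor_pair.tensor_hom_eqI [OF assms(1) tensor_pair.tensor_lmodule [OF assms(3)]
        mod_hom_comp [OF tensor_map_hom(1) [OF assms(1,2) f] tensor_map_hom(1) [OF assms(2,3) g]]
        tensor_map_hom(1) [OF assms(1,3) mod_hom_comp [OF f g]] _ x])
    (simp add: tensor_map_hom(2) [OF assms(1,2) f] tensor_map_hom(2) [OF assms(2,3) g]
      tensor_map_hom(2) [OF assms(1,3) mod_hom_comp [OF f g]] mod_hom_closed [OF f])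

lemma tensor_map_id:
  assumes "tensor_pair R M N" and x: "x \<in> carrier (tensor R M N)"
  shows "tensor_map R M N (\<lambda>y. y) x = x"
  by (rule tensor_pair.tensor_hom_eqI [OF assms(1) tensor_pair.tensor_lmodule [OF assms(1)]
        tensor_map_hom(1) [OF assms(1,1) mod_hom_id] mod_hom_id _ x])
    (simp add: tensor_map_hom(2) [OF assms(1,1) mod_hom_id])

lemma tensor_homotopic_id:
  assumes P: "tensor_complex R M P d" and Q: "tensor_complex R M Q d'"
    and f: "\<And>n. f n \<in> mod_hom R (P n) (Q n)" and g: "\<And>n. g n \<in> mod_hom R (Q n) (P n)"
    and h: "homotopic R P d P d (\<lambda>n x. g n (f n x)) (\<lambda>n x. x)"
  shows "homotopic ground (\<lambda>n. tensor R M (P n)) (\<lambda>n. tensor_map R M (P n) (d n))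
     (\<lambda>n. tensor R M (P n)) (\<lambda>n. tensor_map R M (P n) (d n))
     (\<lambda>n x. tensor_map R M (P n) (g n) (tensor_map R M (Q n) (f n) x)) (\<lambda>n x. x)"
  by (rule homotopic_cong [OF tensor_homotopic [OF P P h mod_hom_comp [OF f g] mod_hom_id]])
    (simp_all add: tensor_map_comp [OF tensor_complex.pair [OF P] tensor_complex.pair [OF Q] tensor_complex.pair [OF P] f g]
      tensor_map_id [OF tensor_complex.pair [OF P]])

lemma tensor_homotopy_equivalent:
  assumes P: "tensor_complex R M P d" and Q: "tensor_complex R M Q d'"
    and h: "homotopy_equivalent R P d Q d'"
  shows "homotopy_equivalent ground (\<lambda>n. tensor R M (P n)) (\<lambda>n. tensor_map R M (P n) (d n))
     (\<lambda>n. tensor R M (Q n)) (\<lambda>n. tensor_map R M (Q n) (d' n))"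
proof -
  obtain f g where f: "chain_map R P d Q d' f" and g: "chain_map R Q d' P d g"
    and h1: "homotopic R P d P d (\<lambda>n x. g n (f n x)) (\<lambda>n x. x)"
    and h2: "homotopic R Q d' Q d' (\<lambda>n x. f n (g n x)) (\<lambda>n x. x)"
    using h unfolding homotopy_equivalent_def by auto
  have fh: "f n \<in> mod_hom R (P n) (Q n)" and gh: "g n \<in> mod_hom R (Q n) (P n)" for n
    using f g by (auto simp: chain_map_def)
  show ?thesis
    unfolding homotopy_equivalent_def
    using tensor_chain_map [OF P Q f] tensor_chain_map [OF Q P g]
      tensor_homotopic_id [OF P Q fh gh h1] tensor_homotopic_id [OF Q P gh fh h2] by blast
qed

lemma tensor_chain_complex:
  assumes P: "tensor_complex R M P d" and dd: "\<And>n x. x \<in> carrier (P (Suc (Suc n))) \<Longrightarrow> d n (d (Suc n) x) = \<zero>\<^bsub>P n\<^esub>"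
  shows "chain_complex (\<lambda>n. tensor R M (P n)) (\<lambda>n. tensor_map R M (P n) (d n))"
proof -
  interpret tensor_complex R M P d by fact
  have "Td n (Td (Suc n) z) = \<zero>\<^bsub>TP n\<^esub>" if z: "z \<in> carrier (TP (Suc (Suc n)))" for n z
  proof (rule tensor_pair.tensor_hom_eqI [OF pair _ mod_hom_comp [OF Td_hom Td_hom] _ _ z])
    interpret p: tensor_pair R M "P n" by (rule pair)
    interpret t: lmodule ground "TP n" by (rule p.tensor_lmodule)
    show "lmodule ground (TP n)" by (rule p.tensor_lmodule)
    show "(\<lambda>_. \<zero>\<^bsub>TP n\<^esub>) \<in> mod_hom ground (TP (Suc (Suc n))) (TP n)"
      by (simp add: mod_hom_def t.smult_zero_right [simplified])
    fix x y assume x: "x \<in> carrier M" and y: "y \<in> carrier (P (Suc (Suc n)))"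
    have "Td n (Td (Suc n) (pure R M (P (Suc (Suc n))) x y)) = pure R M (P n) x \<zero>\<^bsub>P n\<^esub>"
      using x y by (simp add: tensor_map_hom(2) [OF pair pair d] mod_hom_closed [OF d] dd)
    also have "\<dots> = \<zero>\<^bsub>TP n\<^esub>"
      using p.pure_add_right [OF x, of "\<zero>\<^bsub>P n\<^esub>" "\<zero>\<^bsub>P n\<^esub>"] p.pure_closed [OF x, of "\<zero>\<^bsub>P n\<^esub>"] by simp
    finally show "Td n (Td (Suc n) (pure R M (P (Suc (Suc n))) x y)) = \<zero>\<^bsub>TP n\<^esub>" .
  qed
  then show ?thesis
    by (simp add: chain_complex_def Td_hom tensor_pair.tensor_vspace [OF pair])
qed

lemma resolution_tensor_complex:
  assumes "projective_resolution R N P d \<epsilon>" "lmodule (opposite R) M" "\<And>c. c \<odot>\<^bsub>R\<^esub> \<one>\<^bsub>R\<^esub> \<in> carrier R"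
  shows "tensor_complex R M P d"
  using assms(2,3) resolution_facts(3,4) [OF assms(1)]
  by (simp add: tensor_complex_def tensor_pair_def)

text \<open>
  The resolutions may consist of modules over different types.
\<close>

theorem Tor_independent:
  assumes P: "projective_resolution R N P d \<epsilon>" and Q: "projective_resolution R N Q d' \<epsilon>'"
    and M: "lmodule (opposite R) M" "\<And>c. c \<odot>\<^bsub>R\<^esub> \<one>\<^bsub>R\<^esub> \<in> carrier R"
  shows "Tor R M P d q \<cong>\<^sub>v Tor R M Q d' q"
  unfolding Tor_def
  by (intro homology_iso tensor_chain_complex tensor_homotopy_equivalent
      resolutions_homotopy_equivalent [OF P Q] resolution_tensor_complex [OF P M] resolution_tensor_complex [OF Q M]
      resolution_facts(9) [OF P] resolution_facts(9) [OF Q])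

section \<open>Free modules of finite rank\<close>

definition free_left_module :: "('r, 's) ring_scheme \<Rightarrow> nat \<Rightarrow> ('r, nat \<Rightarrow> 'r) module" where
  "free_left_module R k =
     \<lparr>carrier = {1..k} \<rightarrow>\<^sub>E carrier R, mult = undefined, one = undefined,
      zero = (\<lambda>i\<in>{1..k}. \<zero>\<^bsub>R\<^esub>), add = (\<lambda>v w. \<lambda>i\<in>{1..k}. v i \<oplus>\<^bsub>R\<^esub> w i),
      smult = (\<lambda>r v. \<lambda>i\<in>{1..k}. r \<otimes>\<^bsub>R\<^esub> v i)\<rparr>"

definition unit_vector :: "('r, 's) ring_scheme \<Rightarrow> nat \<Rightarrow> nat \<Rightarrow> nat \<Rightarrow> 'r" where
  "unit_vector R k j = (\<lambda>i\<in>{1..k}. if i = j then \<one>\<^bsub>R\<^esub> else \<zero>\<^bsub>R\<^esub>)"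

definition row_combination where
  "row_combination N k y v = (\<Oplus>\<^bsub>N\<^esub>i\<in>{1..k}. v i \<odot>\<^bsub>N\<^esub> y i)"

lemma free_left_module_simps [simp]:
  "carrier (free_left_module R k) = {1..k} \<rightarrow>\<^sub>E carrier R"
  "\<zero>\<^bsub>free_left_module R k\<^esub> = (\<lambda>i\<in>{1..k}. \<zero>\<^bsub>R\<^esub>)"
  "v \<oplus>\<^bsub>free_left_module R k\<^esub> w = (\<lambda>i\<in>{1..k}. v i \<oplus>\<^bsub>R\<^esub> w i)"
  "r \<odot>\<^bsub>free_left_module R k\<^esub> v = (\<lambda>i\<in>{1..k}. r \<otimes>\<^bsub>R\<^esub> v i)"
  by (simp_all add: free_left_module_def)

lemma PiE_eqI: "\<lbrakk>f \<in> PiE I A; g \<in> PiE I B; \<And>i. i \<in> I \<Longrightarrow> f i = g i\<rbrakk> \<Longrightarrow> f = g"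
  by (rule PiE_ext) auto

context ring
begin

lemma lmodule_free_left_module: "lmodule R (free_left_module R k)"
proof -
  have "abelian_group (free_left_module R k)"
  proof (rule abelian_groupI)
    fix v assume v: "v \<in> carrier (free_left_module R k)"
    show "\<exists>w\<in>carrier (free_left_module R k). w \<oplus>\<^bsub>free_left_module R k\<^esub> v = \<zero>\<^bsub>free_left_module R k\<^esub>"
      by (rule bexI [of _ "\<lambda>i\<in>{1..k}. \<ominus> v i"]) (use v in \<open>auto simp: PiE_iff l_neg intro!: restrict_ext\<close>)
    show "\<zero>\<^bsub>free_left_module R k\<^esub> \<oplus>\<^bsub>free_left_module R k\<^esub> v = v"
      using v by (intro PiE_eqI [of _ "{1..k}" "\<lambda>_. carrier R" _ "\<lambda>_. carrier R"]) (auto simp: PiE_iff)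
  qed (auto simp: PiE_iff a_ac intro!: restrict_ext)
  moreover have "\<one> \<odot>\<^bsub>free_left_module R k\<^esub> v = v" if "v \<in> carrier (free_left_module R k)" for v
    using that by (intro PiE_eqI [of _ "{1..k}" "\<lambda>_. carrier R" _ "\<lambda>_. carrier R"]) (auto simp: PiE_iff)
  ultimately show ?thesis
    unfolding lmodule_def lmodule_axioms_def
    by (auto simp: ring_axioms PiE_iff l_distr r_distr m_assoc intro!: restrict_ext)
qed

lemma unit_vector_closed [simp]: "unit_vector R k j \<in> carrier (free_left_module R k)"
  by (auto simp: unit_vector_def)

end

context lmodule
begin

lemma row_combination_hom:
  assumes y: "y \<in> {1..k} \<rightarrow> carrier M"
  shows "row_combination M k y \<in> mod_hom R (free_left_module R k) M"
proof (rule mod_homI)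
  fix v assume v: "v \<in> carrier (free_left_module R k)"
  have c: "v i \<in> carrier R" "y i \<in> carrier M" if "i \<in> {1..k}" for i
    using v y that by (auto simp del: atLeastAtMost_iff)
  show "row_combination M k y v \<in> carrier M"
    unfolding row_combination_def using c by (intro M.finsum_closed) auto
  fix w assume w: "w \<in> carrier (free_left_module R k)"
  have d: "w i \<in> carrier R" if "i \<in> {1..k}" for i
    using w that by (auto simp del: atLeastAtMost_iff)
  have "row_combination M k y (v \<oplus>\<^bsub>free_left_module R k\<^esub> w) = (\<Oplus>\<^bsub>M\<^esub>i\<in>{1..k}. v i \<odot>\<^bsub>M\<^esub> y i \<oplus>\<^bsub>M\<^esub> w i \<odot>\<^bsub>M\<^esub> y i)"
    unfolding row_combination_def using c d
    by (intro M.finsum_cong') (auto simp: smult_l_distr simp del: atLeastAtMost_iff)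
  then show "row_combination M k y (v \<oplus>\<^bsub>free_left_module R k\<^esub> w) = row_combination M k y v \<oplus>\<^bsub>M\<^esub> row_combination M k y w"
    unfolding row_combination_def using c d by (subst M.finsum_addf [symmetric]) auto
next
  fix r v assume r: "r \<in> carrier R" and v: "v \<in> carrier (free_left_module R k)"
  have c: "v i \<in> carrier R" "y i \<in> carrier M" if "i \<in> {1..k}" for i
    using v y that by (auto simp del: atLeastAtMost_iff)
  have "row_combination M k y (r \<odot>\<^bsub>free_left_module R k\<^esub> v) = (\<Oplus>\<^bsub>M\<^esub>i\<in>{1..k}. r \<odot>\<^bsub>M\<^esub> (v i \<odot>\<^bsub>M\<^esub> y i))"
    unfolding row_combination_def using c r
    by (intro M.finsum_cong') (auto simp: smult_assoc simp del: atLeastAtMost_iff)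
  then show "row_combination M k y (r \<odot>\<^bsub>free_left_module R k\<^esub> v) = r \<odot>\<^bsub>M\<^esub> row_combination M k y v"
    unfolding row_combination_def using c r by (subst smult_finsum_right) auto
qed

lemma row_combination_cong:
  "(\<And>i. i \<in> {1..k} \<Longrightarrow> v i \<odot>\<^bsub>M\<^esub> y i = w i \<odot>\<^bsub>M\<^esub> z i) \<Longrightarrow> (\<And>i. i \<in> {1..k} \<Longrightarrow> w i \<odot>\<^bsub>M\<^esub> z i \<in> carrier M) \<Longrightarrow>
    row_combination M k y v = row_combination M k z w"
  unfolding row_combination_def by (rule M.finsum_cong') auto

lemma row_combination_unit:
  assumes y: "y \<in> {1..k} \<rightarrow> carrier M" and j: "j \<in> {1..k}"
  shows "row_combination M k y (unit_vector R k j) = y j"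
proof -
  have c: "y i \<in> carrier M" if "i \<in> {1..k}" for i using y that by auto
  have "row_combination M k y (unit_vector R k j) = (\<Oplus>\<^bsub>M\<^esub>i\<in>{1..k}. if j = i then y i else \<zero>\<^bsub>M\<^esub>)"
    unfolding row_combination_def
    by (rule M.finsum_cong') (use c in \<open>auto simp: unit_vector_def\<close>)
  also have "\<dots> = y j"
    by (rule M.finsum_singleton) (use j c in auto)
  finally show ?thesis .
qed

end

lemma (in ring) component_row_combination:
  assumes "I \<subseteq> {1..n::nat}" "finite I" "y \<in> I \<rightarrow> carrier (free_left_module R k)" "j \<in> {1..k}"
  shows "(\<Oplus>\<^bsub>free_left_module R k\<^esub>i\<in>I. y i) j = (\<Oplus>i\<in>I. y i j)"
proof -
  interpret F: lmodule R "free_left_module R k" by (rule lmodule_free_left_module)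
  show ?thesis using assms(2,1,3)
  proof (induct I rule: finite_induct)
    case empty
    then show ?case using assms(4) by simp
  next
    case (insert i I)
    have c: "y i j \<in> carrier R" "\<And>i. i \<in> I \<Longrightarrow> y i j \<in> carrier R"
      using insert(5) assms(4) by (auto simp: Pi_def PiE_iff)
    have "(\<Oplus>\<^bsub>free_left_module R k\<^esub>i\<in>insert i I. y i) =
        y i \<oplus>\<^bsub>free_left_module R k\<^esub> (\<Oplus>\<^bsub>free_left_module R k\<^esub>i\<in>I. y i)"
      using insert by (intro F.M.finsum_insert) (auto simp del: free_left_module_simps)
    then show ?case using insert assms(4) c by (simp add: Pi_def)
  qed
qed

lemma (in ring) unit_vector_expansion:
  assumes v: "v \<in> carrier (free_left_module R k)"
  shows "row_combination (free_left_module R k) k (unit_vector R k) v = v"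
proof (rule PiE_eqI [of _ "{1..k}" "\<lambda>_. carrier R" _ "\<lambda>_. carrier R"])
  interpret F: lmodule R "free_left_module R k" by (rule lmodule_free_left_module)
  have u: "unit_vector R k \<in> {1..k} \<rightarrow> carrier (free_left_module R k)" using unit_vector_closed by blast
  show "row_combination (free_left_module R k) k (unit_vector R k) v \<in> {1..k} \<rightarrow>\<^sub>E carrier R"
    using mod_hom_closed [OF F.row_combination_hom [OF u] v] by simp
  show "v \<in> {1..k} \<rightarrow>\<^sub>E carrier R" using v by simp
  fix j assume j: "j \<in> {1..k}"
  have c: "v i \<in> carrier R" if "i \<in> {1..k}" for i using v that by (auto simp del: atLeastAtMost_iff)
  have "row_combination (free_left_module R k) k (unit_vector R k) v j =
      (\<Oplus>i\<in>{1..k}. (v i \<odot>\<^bsub>free_left_module R k\<^esub> unit_vector R k i) j)"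
    unfolding row_combination_def
    by (rule component_row_combination [OF subset_refl _ _ j])
      (use c in \<open>auto simp: unit_vector_def\<close>)
  also have "\<dots> = (\<Oplus>i\<in>{1..k}. if j = i then v i else \<zero>)"
    by (rule finsum_cong') (use c j in \<open>auto simp: unit_vector_def\<close>)
  also have "\<dots> = v j"
    by (rule finsum_singleton) (use j c in auto)
  finally show "row_combination (free_left_module R k) k (unit_vector R k) v j = v j" .
qed

text \<open>
  A homomorphism from a free module is determined by the images of the basis vectors: it is given by
  a matrix.
\<close>

lemma (in ring) free_hom_expansion:
  assumes N: "lmodule R N" and h: "h \<in> mod_hom R (free_left_module R k) N"
    and v: "v \<in> carrier (free_left_module R k)"
  shows "h v = row_combination N k (\<lambda>i. h (unit_vector R k i)) v"
proof -
  interpret p: mod_hom_pair R "free_left_module R k" N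
    by (simp add: mod_hom_pair_def N lmodule_free_left_module)
  have c: "v i \<in> carrier R" if "i \<in> {1..k}" for i using v that by (auto simp del: atLeastAtMost_iff)
  have "h v = h (row_combination (free_left_module R k) k (unit_vector R k) v)"
    by (simp only: unit_vector_expansion [OF v])
  also have "\<dots> = (\<Oplus>\<^bsub>N\<^esub>i\<in>{1..k}. h (v i \<odot>\<^bsub>free_left_module R k\<^esub> unit_vector R k i))"
    unfolding row_combination_def using c by (intro p.hom_finsum [OF h] Pi_I p.M.smult_closed unit_vector_closed)
  also have "\<dots> = row_combination N k (\<lambda>i. h (unit_vector R k i)) v"
    unfolding row_combination_def
    by (rule p.N.M.finsum_cong') (use c in \<open>auto simp: mod_hom_smult [OF h _ unit_vector_closed]
      simp del: free_left_module_simps intro!: p.N.smult_closed mod_hom_closed [OF h]\<close>)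
  finally show ?thesis .
qed

lemma (in ring) projective_free_left_module: "projective_module R (free_left_module R k)"
  unfolding projective_module_def left_module_iff
proof (intro conjI allI impI)
  show L: "lmodule R (free_left_module R k)" by (rule lmodule_free_left_module)
  fix M :: "('a, (nat \<Rightarrow> 'a) \<Rightarrow> 'a) module" and N :: "('a, nat \<Rightarrow> 'a) module" and g f
  assume "lmodule R M \<and> lmodule R N \<and> g \<in> mod_hom R M N \<and> g ` carrier M = carrier N \<and>
    f \<in> mod_hom R (free_left_module R k) N"
  then have M: "lmodule R M" and N: "lmodule R N" and g: "g \<in> mod_hom R M N"
    and gs: "g ` carrier M = carrier N" and f: "f \<in> mod_hom R (free_left_module R k) N" by auto
  interpret p: mod_hom_pair R M N by (simp add: mod_hom_pair_def M N)
  have "\<forall>i. \<exists>m\<in>carrier M. g m = f (unit_vector R k i)"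
    using gs mod_hom_closed [OF f unit_vector_closed] by (metis imageE)
  then obtain y where y: "\<And>i. y i \<in> carrier M" "\<And>i. g (y i) = f (unit_vector R k i)" by metis
  have gy: "(\<lambda>v. g (row_combination M k y v)) \<in> mod_hom R (free_left_module R k) N"
    using y by (intro mod_hom_comp [OF p.M.row_combination_hom g]) auto
  show "\<exists>h\<in>mod_hom R (free_left_module R k) M. \<forall>x\<in>carrier (free_left_module R k). g (h x) = f x"
  proof (intro bexI ballI)
    show "row_combination M k y \<in> mod_hom R (free_left_module R k) M"
      using y by (intro p.M.row_combination_hom) auto
    fix v assume v: "v \<in> carrier (free_left_module R k)"
    have c: "v i \<in> carrier R" if "i \<in> {1..k}" for i using v that by (auto simp del: atLeastAtMost_iff)
    show "g (row_combination M k y v) = f v"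
      unfolding free_hom_expansion [OF N f v] free_hom_expansion [OF N gy v]
    proof (rule p.N.row_combination_cong)
      fix i assume i: "i \<in> {1..k}"
      have "row_combination M k y (unit_vector R k i) = y i"
        by (rule p.M.row_combination_unit) (use y i in auto)
      then show "v i \<odot>\<^bsub>N\<^esub> g (row_combination M k y (unit_vector R k i)) = v i \<odot>\<^bsub>N\<^esub> f (unit_vector R k i)"
        by (simp add: y)
      show "v i \<odot>\<^bsub>N\<^esub> f (unit_vector R k i) \<in> carrier N"
        by (rule p.N.smult_closed [OF c [OF i] mod_hom_closed [OF f unit_vector_closed]])
    qed
  qed
qed

section \<open>Tensoring with free modules\<close>

lemma vpower_simps [simp]:
  "carrier (vpower V k) = {1..k} \<rightarrow>\<^sub>E carrier V"
  "\<zero>\<^bsub>vpower V k\<^esub> = (\<lambda>i\<in>{1..k}. \<zero>\<^bsub>V\<^esub>)"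
  "v \<oplus>\<^bsub>vpower V k\<^esub> w = (\<lambda>i\<in>{1..k}. v i \<oplus>\<^bsub>V\<^esub> w i)"
  "r \<odot>\<^bsub>vpower V k\<^esub> v = (\<lambda>i\<in>{1..k}. r \<odot>\<^bsub>V\<^esub> v i)"
  by (simp_all add: vpower_def)

context vspace
begin

lemma lmodule_vpower: "lmodule ground (vpower V k)"
proof -
  have "abelian_group (vpower V k)"
  proof (rule abelian_groupI)
    fix v assume v: "v \<in> carrier (vpower V k)"
    show "\<exists>w\<in>carrier (vpower V k). w \<oplus>\<^bsub>vpower V k\<^esub> v = \<zero>\<^bsub>vpower V k\<^esub>"
      by (rule bexI [of _ "\<lambda>i\<in>{1..k}. \<ominus>\<^bsub>V\<^esub> v i"]) (use v in \<open>auto simp: PiE_iff M.l_neg intro!: restrict_ext\<close>)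
    show "\<zero>\<^bsub>vpower V k\<^esub> \<oplus>\<^bsub>vpower V k\<^esub> v = v"
      using v by (intro PiE_eqI [of _ "{1..k}" "\<lambda>_. carrier V" _ "\<lambda>_. carrier V"]) (auto simp: PiE_iff)
  qed (auto simp: PiE_iff M.a_ac intro!: restrict_ext)
  moreover have "1 \<odot>\<^bsub>vpower V k\<^esub> v = v" if "v \<in> carrier (vpower V k)" for v
    using that smult_one by (intro PiE_eqI [of _ "{1..k}" "\<lambda>_. carrier V" _ "\<lambda>_. carrier V"]) (auto simp: PiE_iff)
  ultimately show ?thesis
    unfolding lmodule_def lmodule_axioms_def
    using smult_l_distr smult_r_distr smult_assoc smult_closed
    by (auto simp: cring.axioms(1) [OF cring_ground] PiE_iff intro!: restrict_ext)
qed

lemma vpower_component_hom: "j \<in> {1..k} \<Longrightarrow> (\<lambda>v. v j) \<in> mod_hom ground (vpower V k) V"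
  by (intro mod_homI) auto

lemma vpower_hom:
  assumes "\<And>j. j \<in> {1..k} \<Longrightarrow> h j \<in> mod_hom ground U V"
  shows "(\<lambda>x. \<lambda>j\<in>{1..k}. h j x) \<in> mod_hom ground U (vpower V k)"
proof (rule mod_homI)
  fix x assume "x \<in> carrier U"
  then show "(\<lambda>j\<in>{1..k}. h j x) \<in> carrier (vpower V k)"
    using mod_hom_closed [OF assms] by (auto simp del: atLeastAtMost_iff)
qed (use mod_hom_add [OF assms] mod_hom_smult [OF assms] in \<open>auto simp del: atLeastAtMost_iff intro!: restrict_ext\<close>)

end

lemma homotopic_identity:
  fixes C :: "nat \<Rightarrow> ('k::field, 'a) module"
  assumes C: "chain_complex C \<delta>" and h: "\<And>n x. x \<in> carrier (C n) \<Longrightarrow> h n x = x"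
  shows "homotopic ground C \<delta> C \<delta> h (\<lambda>n x. x)"
proof -
  have l: "lmodule ground (C n)" and dh: "\<delta> n \<in> mod_hom ground (C (Suc n)) (C n)" for n
    using C by (simp_all add: chain_complex_def vspace_def)
  have z: "(\<lambda>x. \<zero>\<^bsub>C j\<^esub>) \<in> mod_hom ground (C i) (C j)" for i j
    by (rule mod_hom_pair.hom_zero_hom) (simp add: mod_hom_pair_def l)
  have d0: "\<delta> n \<zero>\<^bsub>C (Suc n)\<^esub> = \<zero>\<^bsub>C n\<^esub>" for n
    using mod_hom_pair.hom_zero [OF _ dh] l by (simp add: mod_hom_pair_def)
  have m: "abelian_monoid (C n)" for n using l [of n] by (simp add: lmodule_def abelian_group_def)
  show ?thesis
    unfolding homotopic_def
    by (intro exI [of _ "\<lambda>n x. \<zero>\<^bsub>C (Suc n)\<^esub>"])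
      (simp add: z d0 h abelian_monoid.l_zero [OF m] abelian_monoid.zero_closed [OF m])
qed

text \<open>
  An isomorphism of complexes is treated as a homotopy equivalence with zero homotopies, so that
  the invariance of homology has to be proved only once.
\<close>

lemma chain_iso_homotopy_equivalent:
  assumes C: "chain_complex C \<delta>" and C': "chain_complex C' \<delta>'"
    and f: "chain_map ground C \<delta> C' \<delta>' f"
    and gc: "\<And>n y. y \<in> carrier (C' n) \<Longrightarrow> g n y \<in> carrier (C n)"
    and gf: "\<And>n x. x \<in> carrier (C n) \<Longrightarrow> g n (f n x) = x"
    and fg: "\<And>n y. y \<in> carrier (C' n) \<Longrightarrow> f n (g n y) = y"
  shows "homotopy_equivalent ground C \<delta> C' \<delta>'"
proof -
  have v: "lmodule ground (C n)" "lmodule ground (C' n)"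
    and d: "\<delta> n \<in> mod_hom ground (C (Suc n)) (C n)" "\<delta>' n \<in> mod_hom ground (C' (Suc n)) (C' n)" for n
    using C C' by (simp_all add: chain_complex_def vspace_def)
  have fh: "f n \<in> mod_hom ground (C n) (C' n)"
    and fd: "\<And>x. x \<in> carrier (C (Suc n)) \<Longrightarrow> \<delta>' n (f (Suc n) x) = f n (\<delta> n x)" for n
    using f by (simp_all add: chain_map_def)
  have ac: "x \<oplus>\<^bsub>C n\<^esub> y \<in> carrier (C n)" if "x \<in> carrier (C n)" "y \<in> carrier (C n)" for n x y
  proof -
    interpret lmodule ground "C n" by (rule v)
    show ?thesis using that by simp
  qed
  have sc: "c \<odot>\<^bsub>C n\<^esub> x \<in> carrier (C n)" if "x \<in> carrier (C n)" for n x c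
  proof -
    interpret lmodule ground "C n" by (rule v)
    show ?thesis using that smult_closed by simp
  qed
  have gh: "g n \<in> mod_hom ground (C' n) (C n)" for n
  proof (rule mod_homI)
    fix x y c assume x: "x \<in> carrier (C' n)"
    have "c \<odot>\<^bsub>C' n\<^esub> x = f n (c \<odot>\<^bsub>C n\<^esub> g n x)"
      using mod_hom_smult [OF fh, of c "g n x" n] gc [OF x] by (simp add: fg x)
    then show "g n (c \<odot>\<^bsub>C' n\<^esub> x) = c \<odot>\<^bsub>C n\<^esub> g n x"
      using gf sc gc x by simp
    assume y: "y \<in> carrier (C' n)"
    have "x \<oplus>\<^bsub>C' n\<^esub> y = f n (g n x \<oplus>\<^bsub>C n\<^esub> g n y)"
      using mod_hom_add [OF fh, of "g n x" n "g n y"] gc x y by (simp add: fg)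
    then show "g n (x \<oplus>\<^bsub>C' n\<^esub> y) = g n x \<oplus>\<^bsub>C n\<^esub> g n y"
      using gf ac gc x y by simp
  qed (rule gc)
  have "\<delta> n (g (Suc n) y) = g n (\<delta>' n y)" if y: "y \<in> carrier (C' (Suc n))" for n y
    using fd [OF gc [OF y]] gf [OF mod_hom_closed [OF d(1) gc [OF y]]] fg [OF y] by metis
  then have g: "chain_map ground C' \<delta>' C \<delta> g"
    by (simp add: chain_map_def gh)
  show ?thesis
    unfolding homotopy_equivalent_def
    using f g homotopic_identity [OF C, of "\<lambda>n x. g n (f n x)"]
      homotopic_identity [OF C', of "\<lambda>n x. f n (g n x)"] gf fg by blast
qed

text \<open>
  The map \<open>id \<otimes> \<phi>\<close> from \<open>M \<otimes> R\<^sup>k\<close> to \<open>M \<otimes> R\<^sup>l\<close> in coordinates: the matrix of \<open>\<phi>\<close>, whose entry at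
  \<open>(i, j)\<close> is \<open>\<phi> (unit_vector R k i) j\<close>, acts on a row with entries in the right module \<open>M\<close>.
\<close>

definition induced_map :: "('k::field, 'r) module \<Rightarrow> ('r, 'a) module \<Rightarrow> ('k, 'a) module \<Rightarrow> nat \<Rightarrow> nat
    \<Rightarrow> ((nat \<Rightarrow> 'r) \<Rightarrow> nat \<Rightarrow> 'r) \<Rightarrow> (nat \<Rightarrow> 'a) \<Rightarrow> nat \<Rightarrow> 'a" where
  "induced_map R M V k l \<phi> a =
     (\<lambda>j\<in>{1..l}. \<Oplus>\<^bsub>V\<^esub>i\<in>{1..k}. \<phi> (unit_vector R k i) j \<odot>\<^bsub>M\<^esub> a i)"

text \<open>
  The right module \<open>M\<close> and the vector space \<open>V\<close> are the same abelian group, with scalars from \<open>R\<close> and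
  from the ground field.  Powers of \<open>V\<close> are to be compared with tensor products over \<open>R\<close>, which are
  vector spaces.
\<close>

locale free_tensor = M: lmodule "opposite R" M + V: vspace V
  for R :: "('k::field, 'r) module" and M :: "('r, 'a) module" and V :: "('k, 'a) module" +
  assumes R: "ring R"
    and scalar_closed: "\<And>c. c \<odot>\<^bsub>R\<^esub> \<one>\<^bsub>R\<^esub> \<in> carrier R"
    and scalar_central: "\<And>c r. r \<in> carrier R \<Longrightarrow> (c \<odot>\<^bsub>R\<^esub> \<one>\<^bsub>R\<^esub>) \<otimes>\<^bsub>R\<^esub> r = r \<otimes>\<^bsub>R\<^esub> (c \<odot>\<^bsub>R\<^esub> \<one>\<^bsub>R\<^esub>)"
    and carrier_eq: "carrier V = carrier M" and add_eq: "\<And>x y. x \<oplus>\<^bsub>V\<^esub> y = x \<oplus>\<^bsub>M\<^esub> y"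
    and scalar_eq: "\<And>c x. x \<in> carrier M \<Longrightarrow> (c \<odot>\<^bsub>R\<^esub> \<one>\<^bsub>R\<^esub>) \<odot>\<^bsub>M\<^esub> x = c \<odot>\<^bsub>V\<^esub> x"
begin

sublocale R: ring R by (rule R)

abbreviation "Fr k \<equiv> free_left_module R k"

lemma tensor_pair_free: "tensor_pair R M (Fr k)"
  by (simp add: tensor_pair_def M.lmodule_axioms R.lmodule_free_left_module scalar_closed)

sublocale P: tensor_pair R M "Fr k" for k by (rule tensor_pair_free)
sublocale VP: lmodule ground "vpower V k" for k by (rule V.lmodule_vpower)
sublocale T: lmodule ground "tensor R M (Fr k)" for k by (rule P.tensor_lmodule)

lemma zero_eq: "\<zero>\<^bsub>V\<^esub> = \<zero>\<^bsub>M\<^esub>"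
  using V.M.r_zero [of "\<zero>\<^bsub>M\<^esub>"] M.M.l_zero [of "\<zero>\<^bsub>V\<^esub>"] V.M.zero_closed M.M.zero_closed
  by (simp add: carrier_eq add_eq)

lemma act_closed: "\<lbrakk>r \<in> carrier R; x \<in> carrier V\<rbrakk> \<Longrightarrow> r \<odot>\<^bsub>M\<^esub> x \<in> carrier V"
  using M.smult_closed by (simp add: carrier_eq opposite_def)

lemma act_add_left: "\<lbrakk>r \<in> carrier R; s \<in> carrier R; x \<in> carrier V\<rbrakk> \<Longrightarrow>
    (r \<oplus>\<^bsub>R\<^esub> s) \<odot>\<^bsub>M\<^esub> x = r \<odot>\<^bsub>M\<^esub> x \<oplus>\<^bsub>V\<^esub> s \<odot>\<^bsub>M\<^esub> x"
  using M.smult_l_distr [of r s x] by (simp add: carrier_eq add_eq opposite_def)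

lemma act_add_right: "\<lbrakk>r \<in> carrier R; x \<in> carrier V; y \<in> carrier V\<rbrakk> \<Longrightarrow>
    r \<odot>\<^bsub>M\<^esub> (x \<oplus>\<^bsub>V\<^esub> y) = r \<odot>\<^bsub>M\<^esub> x \<oplus>\<^bsub>V\<^esub> r \<odot>\<^bsub>M\<^esub> y"
  using M.smult_r_distr [of r x y] by (simp add: carrier_eq add_eq opposite_def)

lemma act_mult: "\<lbrakk>r \<in> carrier R; s \<in> carrier R; x \<in> carrier V\<rbrakk> \<Longrightarrow>
    (r \<otimes>\<^bsub>R\<^esub> s) \<odot>\<^bsub>M\<^esub> x = s \<odot>\<^bsub>M\<^esub> (r \<odot>\<^bsub>M\<^esub> x)"
  using M.smult_assoc [of s r x] by (simp add: carrier_eq opposite_def)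

lemma act_one: "x \<in> carrier V \<Longrightarrow> \<one>\<^bsub>R\<^esub> \<odot>\<^bsub>M\<^esub> x = x"
  using M.smult_one [of x] by (simp add: carrier_eq opposite_def)

lemma act_zero: "x \<in> carrier V \<Longrightarrow> \<zero>\<^bsub>R\<^esub> \<odot>\<^bsub>M\<^esub> x = \<zero>\<^bsub>V\<^esub>"
  using M.smult_zero_left [of x] by (simp add: carrier_eq zero_eq opposite_def)

lemma act_hom: "r \<in> carrier R \<Longrightarrow> (\<lambda>x. r \<odot>\<^bsub>M\<^esub> x) \<in> mod_hom ground V V"
proof (rule mod_homI)
  fix c x assume r: "r \<in> carrier R" and x: "x \<in> carrier V"
  have "r \<odot>\<^bsub>M\<^esub> (c \<odot>\<^bsub>V\<^esub> x) = ((c \<odot>\<^bsub>R\<^esub> \<one>\<^bsub>R\<^esub>) \<otimes>\<^bsub>R\<^esub> r) \<odot>\<^bsub>M\<^esub> x"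
    using r x scalar_closed scalar_eq by (simp add: act_mult carrier_eq)
  also have "\<dots> = c \<odot>\<^bsub>V\<^esub> (r \<odot>\<^bsub>M\<^esub> x)"
    using r x scalar_closed scalar_eq act_closed by (simp add: scalar_central act_mult carrier_eq)
  finally show "r \<odot>\<^bsub>M\<^esub> (c \<odot>\<^bsub>V\<^esub> x) = c \<odot>\<^bsub>V\<^esub> (r \<odot>\<^bsub>M\<^esub> x)" .
qed (simp_all add: act_closed act_add_right)

lemma act_finsum: "\<lbrakk>x \<in> carrier V; f \<in> I \<rightarrow> carrier R\<rbrakk> \<Longrightarrow>
    (\<Oplus>\<^bsub>R\<^esub>i\<in>I. f i) \<odot>\<^bsub>M\<^esub> x = (\<Oplus>\<^bsub>V\<^esub>i\<in>I. f i \<odot>\<^bsub>M\<^esub> x)"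
  by (induct I rule: infinite_finite_induct) (auto simp: act_zero act_add_left act_closed Pi_iff)

lemma free_component: "\<lbrakk>v \<in> carrier (Fr k); i \<in> {1..k}\<rbrakk> \<Longrightarrow> v i \<in> carrier R"
  by (auto simp del: atLeastAtMost_iff)

text \<open>
  The isomorphism from \<open>M \<otimes> R\<^sup>k\<close> to \<open>V\<^sup>k\<close>, given by \<open>x \<otimes> v \<mapsto> (x v\<^sub>1, \<dots>, x v\<^sub>k)\<close>.
\<close>

definition coordinates where "coordinates k = on_coset (linear_extension (vpower V k) (\<lambda>(x, v). \<lambda>i\<in>{1..k}. v i \<odot>\<^bsub>M\<^esub> x))"

lemma coordinates:
  shows coordinates_hom: "coordinates k \<in> mod_hom ground (tensor R M (Fr k)) (vpower V k)"
    and coordinates_pure: "\<lbrakk>x \<in> carrier V; v \<in> carrier (Fr k)\<rbrakk> \<Longrightarrow> coordinates k (pure R M (Fr k) x v) = (\<lambda>i\<in>{1..k}. v i \<odot>\<^bsub>M\<^esub> x)"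
proof -
  let ?\<beta> = "\<lambda>x v. \<lambda>i\<in>{1..k}. v i \<odot>\<^bsub>M\<^esub> x"
  have cl: "?\<beta> x v \<in> carrier (vpower V k)" if "x \<in> carrier M" "v \<in> carrier (Fr k)" for x v
    using that free_component act_closed carrier_eq by (auto simp del: atLeastAtMost_iff)
  have al: "?\<beta> (x \<oplus>\<^bsub>M\<^esub> x') v = ?\<beta> x v \<oplus>\<^bsub>vpower V k\<^esub> ?\<beta> x' v"
    if "x \<in> carrier M" "x' \<in> carrier M" "v \<in> carrier (Fr k)" for x x' v
    using that free_component act_add_right
    by (auto simp: add_eq carrier_eq simp del: atLeastAtMost_iff free_left_module_simps intro!: restrict_ext)
  have ar: "?\<beta> x (v \<oplus>\<^bsub>Fr k\<^esub> w) = ?\<beta> x v \<oplus>\<^bsub>vpower V k\<^esub> ?\<beta> x w"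
    if "x \<in> carrier M" "v \<in> carrier (Fr k)" "w \<in> carrier (Fr k)" for x v w
    using that free_component [OF that(2)] free_component [OF that(3)] act_add_left
    by (auto simp: carrier_eq simp del: atLeastAtMost_iff intro!: restrict_ext)
  have b: "?\<beta> (r \<odot>\<^bsub>M\<^esub> x) v = ?\<beta> x (r \<odot>\<^bsub>Fr k\<^esub> v)"
    if "r \<in> carrier R" "x \<in> carrier M" "v \<in> carrier (Fr k)" for r x v
    using that free_component [OF that(3)] act_mult
    by (auto simp: carrier_eq simp del: atLeastAtMost_iff intro!: restrict_ext)
  have s: "?\<beta> ((c \<odot>\<^bsub>R\<^esub> \<one>\<^bsub>R\<^esub>) \<odot>\<^bsub>M\<^esub> x) v = c \<odot>\<^bsub>vpower V k\<^esub> ?\<beta> x v"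
    if "x \<in> carrier M" "v \<in> carrier (Fr k)" for c x v
    using that free_component [OF that(2)] mod_hom_smult [OF act_hom]
    by (auto simp: carrier_eq scalar_eq simp del: atLeastAtMost_iff intro!: restrict_ext)
  show "coordinates k \<in> mod_hom ground (tensor R M (Fr k)) (vpower V k)"
    unfolding coordinates_def by (rule P.tensor_extend(1) [OF VP.lmodule_axioms cl al ar b s])
  show "\<lbrakk>x \<in> carrier V; v \<in> carrier (Fr k)\<rbrakk> \<Longrightarrow> coordinates k (pure R M (Fr k) x v) = (\<lambda>i\<in>{1..k}. v i \<odot>\<^bsub>M\<^esub> x)"
    unfolding coordinates_def carrier_eq by (rule P.tensor_extend(2) [OF VP.lmodule_axioms cl al ar b s])
qed

definition from_coordinates where "from_coordinates k a = (\<Oplus>\<^bsub>tensor R M (Fr k)\<^esub>i\<in>{1..k}. pure R M (Fr k) (a i) (unit_vector R k i))"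

lemma vpower_component: "\<lbrakk>a \<in> carrier (vpower V k); i \<in> {1..k}\<rbrakk> \<Longrightarrow> a i \<in> carrier V"
  by (auto simp del: atLeastAtMost_iff)

lemma from_coordinates_closed: "a \<in> carrier (vpower V k) \<Longrightarrow> from_coordinates k a \<in> carrier (tensor R M (Fr k))"
  unfolding from_coordinates_def
  by (intro T.M.finsum_closed Pi_I P.pure_closed R.unit_vector_closed) (simp only: vpower_component flip: carrier_eq)

lemma pure_finsum_right:
  assumes x: "x \<in> carrier M" and f: "f \<in> I \<rightarrow> carrier (Fr k)"
  shows "pure R M (Fr k) x (\<Oplus>\<^bsub>Fr k\<^esub>i\<in>I. f i) = (\<Oplus>\<^bsub>tensor R M (Fr k)\<^esub>i\<in>I. pure R M (Fr k) x (f i))"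
proof -
  have z: "pure R M (Fr k) x \<zero>\<^bsub>Fr k\<^esub> = \<zero>\<^bsub>tensor R M (Fr k)\<^esub>"
    using P.pure_add_right [OF x P.N.M.zero_closed P.N.M.zero_closed]
      P.pure_closed [OF x P.N.M.zero_closed] by (simp del: free_left_module_simps)
  show ?thesis using f
  proof (induct I rule: infinite_finite_induct)
    case (insert i I)
    then have c: "f i \<in> carrier (Fr k)" "f \<in> I \<rightarrow> carrier (Fr k)" by blast+
    have "pure R M (Fr k) x (\<Oplus>\<^bsub>Fr k\<^esub>i\<in>insert i I. f i) = pure R M (Fr k) x (f i \<oplus>\<^bsub>Fr k\<^esub> (\<Oplus>\<^bsub>Fr k\<^esub>i\<in>I. f i))"
      by (simp only: P.N.M.finsum_insert [OF insert(1,2) c(2,1)])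
    also have "\<dots> = pure R M (Fr k) x (f i) \<oplus>\<^bsub>tensor R M (Fr k)\<^esub> (\<Oplus>\<^bsub>tensor R M (Fr k)\<^esub>i\<in>I. pure R M (Fr k) x (f i))"
      using insert(3) [OF c(2)] P.pure_add_right [OF x c(1) P.N.M.finsum_closed [OF c(2)]] by simp
    also have "\<dots> = (\<Oplus>\<^bsub>tensor R M (Fr k)\<^esub>i\<in>insert i I. pure R M (Fr k) x (f i))"
      using insert(1,2) c x by (subst T.M.finsum_insert) (auto intro!: P.pure_closed simp del: free_left_module_simps)
    finally show ?case .
  qed (simp_all only: P.N.M.finsum_empty T.M.finsum_empty P.N.M.finsum_infinite T.M.finsum_infinite z not_False_eq_True)
qed

lemma from_coordinates_coordinates:
  assumes z: "z \<in> carrier (tensor R M (Fr k))"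
  shows "from_coordinates k (coordinates k z) = z"
proof -
  have "(\<lambda>z. from_coordinates k (coordinates k z)) \<in> mod_hom ground (tensor R M (Fr k)) (tensor R M (Fr k))"
  proof -
    have p: "(\<lambda>x. pure R M (Fr k) x (unit_vector R k i)) \<in> mod_hom ground V (tensor R M (Fr k))" for i
      by (intro mod_homI) (simp_all add: P.pure_closed P.pure_add_left carrier_eq add_eq
          P.pure_scalar [symmetric] scalar_eq del: free_left_module_simps)
    interpret tt: mod_hom_pair ground "tensor R M (Fr k)" "tensor R M (Fr k)"
      by (simp add: mod_hom_pair_def T.lmodule_axioms)
    show ?thesis
      unfolding from_coordinates_def
      by (intro tt.hom_finsum_hom mod_hom_comp [OF mod_hom_comp [OF coordinates_hom V.vpower_component_hom] p])
  qed
  then show ?thesis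
  proof (rule P.tensor_hom_eqI [OF T.lmodule_axioms _ mod_hom_id _ z])
    fix x v assume x: "x \<in> carrier M" and v: "v \<in> carrier (Fr k)"
    have "from_coordinates k (coordinates k (pure R M (Fr k) x v)) =
        (\<Oplus>\<^bsub>tensor R M (Fr k)\<^esub>i\<in>{1..k}. pure R M (Fr k) x (v i \<odot>\<^bsub>Fr k\<^esub> unit_vector R k i))"
      unfolding from_coordinates_def
    proof (rule T.M.finsum_cong')
      fix i assume i: "i \<in> {1..k}"
      have "coordinates k (pure R M (Fr k) x v) i = v i \<odot>\<^bsub>M\<^esub> x"
        using coordinates_pure x v i by (simp add: carrier_eq)
      then show "pure R M (Fr k) (coordinates k (pure R M (Fr k) x v) i) (unit_vector R k i) =
          pure R M (Fr k) x (v i \<odot>\<^bsub>Fr k\<^esub> unit_vector R k i)"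
        using P.pure_balanced [OF free_component [OF v i] x R.unit_vector_closed] by simp
    qed (use x free_component [OF v] in \<open>auto intro!: P.pure_closed P.N.smult_closed R.unit_vector_closed
        simp del: free_left_module_simps\<close>)
    also have "\<dots> = pure R M (Fr k) x (row_combination (Fr k) k (unit_vector R k) v)"
      unfolding row_combination_def
      by (rule pure_finsum_right [OF x, symmetric]) (intro Pi_I P.N.smult_closed free_component [OF v] R.unit_vector_closed)
    also have "\<dots> = pure R M (Fr k) x v" by (simp only: R.unit_vector_expansion [OF v])
    finally show "from_coordinates k (coordinates k (pure R M (Fr k) x v)) = pure R M (Fr k) x v" .
  qed
qed

lemma coordinates_from_coordinates:
  assumes a: "a \<in> carrier (vpower V k)"
  shows "coordinates k (from_coordinates k a) = a"
proof (rule PiE_eqI [of _ "{1..k}" "\<lambda>_. carrier V" _ "\<lambda>_. carrier V"])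
  show "coordinates k (from_coordinates k a) \<in> {1..k} \<rightarrow>\<^sub>E carrier V"
    using mod_hom_closed [OF coordinates_hom from_coordinates_closed [OF a]] by simp
  show "a \<in> {1..k} \<rightarrow>\<^sub>E carrier V" using a by simp
  fix j assume j: "j \<in> {1..k}"
  interpret tv: mod_hom_pair ground "tensor R M (Fr k)" V
    by (simp add: mod_hom_pair_def T.lmodule_axioms V.lmodule_axioms)
  have ac: "a i \<in> carrier V" if "i \<in> {1..k}" for i using vpower_component [OF a that] .
  have "coordinates k (from_coordinates k a) j = (\<Oplus>\<^bsub>V\<^esub>i\<in>{1..k}. coordinates k (pure R M (Fr k) (a i) (unit_vector R k i)) j)"
    unfolding from_coordinates_def
    by (rule tv.hom_finsum [OF mod_hom_comp [OF coordinates_hom V.vpower_component_hom [OF j]]])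
      (intro Pi_I P.pure_closed R.unit_vector_closed, simp only: ac flip: carrier_eq)
  also have "\<dots> = (\<Oplus>\<^bsub>V\<^esub>i\<in>{1..k}. if j = i then a i else \<zero>\<^bsub>V\<^esub>)"
  proof (rule V.M.finsum_cong')
    fix i assume i: "i \<in> {1..k}"
    show "coordinates k (pure R M (Fr k) (a i) (unit_vector R k i)) j = (if j = i then a i else \<zero>\<^bsub>V\<^esub>)"
      unfolding coordinates_pure [OF ac [OF i] R.unit_vector_closed]
      using i j ac [OF i] by (simp add: unit_vector_def act_one act_zero)
  qed (use ac in auto)
  also have "\<dots> = a j"
    by (rule V.M.finsum_singleton) (use j ac in auto)
  finally show "coordinates k (from_coordinates k a) j = a j" .
qed

lemma induced_map_hom:
  assumes \<phi>: "\<phi> \<in> mod_hom R (Fr k) (Fr l)"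
  shows "induced_map R M V k l \<phi> \<in> mod_hom ground (vpower V k) (vpower V l)"
proof -
  have "(\<lambda>a. \<Oplus>\<^bsub>V\<^esub>i\<in>{1..k}. \<phi> (unit_vector R k i) j \<odot>\<^bsub>M\<^esub> a i) \<in> mod_hom ground (vpower V k) V"
    if j: "j \<in> {1..l}" for j
  proof -
    interpret vv: mod_hom_pair ground "vpower V k" V
      by (simp add: mod_hom_pair_def VP.lmodule_axioms V.lmodule_axioms)
    show ?thesis
      by (intro vv.hom_finsum_hom mod_hom_comp [OF V.vpower_component_hom act_hom]
          free_component [OF mod_hom_closed [OF \<phi> R.unit_vector_closed] j])
  qed
  then have "(\<lambda>a. \<lambda>j\<in>{1..l}. \<Oplus>\<^bsub>V\<^esub>i\<in>{1..k}. \<phi> (unit_vector R k i) j \<odot>\<^bsub>M\<^esub> a i)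
      \<in> mod_hom ground (vpower V k) (vpower V l)"
    by (rule V.vpower_hom)
  then show ?thesis
    by (simp add: induced_map_def [abs_def])
qed

lemma coordinates_natural:
  assumes \<phi>: "\<phi> \<in> mod_hom R (Fr k) (Fr l)" and z: "z \<in> carrier (tensor R M (Fr k))"
  shows "induced_map R M V k l \<phi> (coordinates k z) = coordinates l (tensor_map R M (Fr l) \<phi> z)"
proof (rule P.tensor_hom_eqI [OF VP.lmodule_axioms mod_hom_comp [OF coordinates_hom induced_map_hom [OF \<phi>]]
        mod_hom_comp [OF tensor_map_hom(1) [OF tensor_pair_free tensor_pair_free \<phi>] coordinates_hom] _ z])
  fix x v assume x: "x \<in> carrier M" and v: "v \<in> carrier (Fr k)"
  have x': "x \<in> carrier V" using x by (simp add: carrier_eq)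
  note \<phi>e = mod_hom_closed [OF \<phi> R.unit_vector_closed]
  have "induced_map R M V k l \<phi> (\<lambda>i\<in>{1..k}. v i \<odot>\<^bsub>M\<^esub> x) = (\<lambda>j\<in>{1..l}. \<phi> v j \<odot>\<^bsub>M\<^esub> x)"
    unfolding induced_map_def
  proof (rule restrict_ext)
    fix j assume j: "j \<in> {1..l}"
    have "\<phi> v j = (\<Oplus>\<^bsub>R\<^esub>i\<in>{1..k}. (v i \<odot>\<^bsub>Fr l\<^esub> \<phi> (unit_vector R k i)) j)"
      unfolding R.free_hom_expansion [OF P.N.lmodule_axioms \<phi> v] row_combination_def
      by (rule R.component_row_combination [OF subset_refl _ _ j])
        (auto intro!: P.N.smult_closed free_component [OF v] \<phi>e simp del: free_left_module_simps)
    also have "\<dots> = (\<Oplus>\<^bsub>R\<^esub>i\<in>{1..k}. v i \<otimes>\<^bsub>R\<^esub> \<phi> (unit_vector R k i) j)"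
      by (rule R.finsum_cong') (use j in \<open>auto intro!: free_component [OF v] free_component [OF \<phi>e]\<close>)
    finally have e: "\<phi> v j = (\<Oplus>\<^bsub>R\<^esub>i\<in>{1..k}. v i \<otimes>\<^bsub>R\<^esub> \<phi> (unit_vector R k i) j)" .
    have "\<phi> v j \<odot>\<^bsub>M\<^esub> x = (\<Oplus>\<^bsub>V\<^esub>i\<in>{1..k}. (v i \<otimes>\<^bsub>R\<^esub> \<phi> (unit_vector R k i) j) \<odot>\<^bsub>M\<^esub> x)"
      unfolding e by (rule act_finsum [OF x']) (intro Pi_I R.m_closed free_component [OF v] free_component [OF \<phi>e j])
    also have "\<dots> = (\<Oplus>\<^bsub>V\<^esub>i\<in>{1..k}. \<phi> (unit_vector R k i) j \<odot>\<^bsub>M\<^esub> (\<lambda>i\<in>{1..k}. v i \<odot>\<^bsub>M\<^esub> x) i)"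
      by (rule V.M.finsum_cong') (use free_component [OF v] free_component [OF \<phi>e j] x' act_closed in \<open>auto simp: act_mult\<close>)
    finally show "(\<Oplus>\<^bsub>V\<^esub>i\<in>{1..k}. \<phi> (unit_vector R k i) j \<odot>\<^bsub>M\<^esub> (\<lambda>i\<in>{1..k}. v i \<odot>\<^bsub>M\<^esub> x) i) = \<phi> v j \<odot>\<^bsub>M\<^esub> x" by simp
  qed
  then show "induced_map R M V k l \<phi> (coordinates k (pure R M (Fr k) x v)) = coordinates l (tensor_map R M (Fr l) \<phi> (pure R M (Fr k) x v))"
    using tensor_map_hom(2) [OF tensor_pair_free tensor_pair_free \<phi> x v] coordinates_pure [OF x' v]
      coordinates_pure [OF x' mod_hom_closed [OF \<phi> v]] by simp
qed

text \<open>
  The coordinates are natural, so they form an isomorphism of complexes.  It also transports the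
  identity \<open>\<delta> \<delta> = 0\<close>, which would be awkward to check on matrices.
\<close>

theorem Tor_free:
  assumes d: "\<And>n. d n \<in> mod_hom R (Fr (k (Suc n))) (Fr (k n))"
    and dd: "\<And>n x. x \<in> carrier (Fr (k (Suc (Suc n)))) \<Longrightarrow> d n (d (Suc n) x) = \<zero>\<^bsub>Fr (k n)\<^esub>"
  defines "C \<equiv> \<lambda>n. vpower V (k n)" and "\<delta> \<equiv> \<lambda>n. induced_map R M V (k (Suc n)) (k n) (d n)"
  shows "chain_complex C \<delta>"
    and "Tor R M (\<lambda>n. Fr (k n)) d q \<cong>\<^sub>v homology C \<delta> q"
proof -
  let ?T = "\<lambda>n. tensor R M (Fr (k n))" and ?Td = "\<lambda>n. tensor_map R M (Fr (k n)) (d n)"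
  have tc: "tensor_complex R M (\<lambda>n. Fr (k n)) d"
    by (simp only: tensor_complex_def tensor_pair_free d) simp
  have cc: "chain_complex ?T ?Td"
    by (rule tensor_chain_complex [OF tc dd])
  have nat: "\<delta> n (coordinates (k (Suc n)) z) = coordinates (k n) (?Td n z)" if "z \<in> carrier (?T (Suc n))" for n z
    unfolding \<delta>_def by (rule coordinates_natural [OF d that])
  have Tdc: "?Td n z \<in> carrier (?T n)" if "z \<in> carrier (?T (Suc n))" for n z
  proof (rule mod_hom_closed [OF _ that])
    show "?Td n \<in> mod_hom ground (?T (Suc n)) (?T n)" using cc by (simp add: chain_complex_def)
  qed
  show C: "chain_complex C \<delta>"
    unfolding chain_complex_def
  proof (intro conjI allI ballI)
    show "vspace (C n)" for n by (simp add: C_def vspace_def VP.lmodule_axioms)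
    show "\<delta> n \<in> mod_hom ground (C (Suc n)) (C n)" for n
      unfolding \<delta>_def C_def by (rule induced_map_hom [OF d])
    fix n a assume a: "a \<in> carrier (C (Suc (Suc n)))"
    let ?z = "from_coordinates (k (Suc (Suc n))) a"
    have z: "?z \<in> carrier (?T (Suc (Suc n)))" by (rule from_coordinates_closed) (use a in \<open>simp add: C_def\<close>)
    have "\<delta> n (\<delta> (Suc n) a) = \<delta> n (\<delta> (Suc n) (coordinates (k (Suc (Suc n))) ?z))"
      using a by (simp add: C_def coordinates_from_coordinates)
    also have "\<dots> = coordinates (k n) (?Td n (?Td (Suc n) ?z))"
      using z Tdc by (simp only: nat)
    also have "\<dots> = coordinates (k n) \<zero>\<^bsub>?T n\<^esub>"
      using z cc by (simp add: chain_complex_def)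
    also have "\<dots> = \<zero>\<^bsub>C n\<^esub>"
      unfolding C_def
      by (rule mod_hom_pair.hom_zero [OF _ coordinates_hom]) (simp add: mod_hom_pair_def VP.lmodule_axioms T.lmodule_axioms)
    finally show "\<delta> n (\<delta> (Suc n) a) = \<zero>\<^bsub>C n\<^esub>" .
  qed
  have "homotopy_equivalent ground ?T ?Td C \<delta>"
  proof (rule chain_iso_homotopy_equivalent [OF cc C, where f = "\<lambda>n. coordinates (k n)" and g = "\<lambda>n. from_coordinates (k n)"])
    show "chain_map ground ?T ?Td C \<delta> (\<lambda>n. coordinates (k n))"
      unfolding chain_map_def using nat coordinates_hom by (simp add: C_def)
  qed (simp_all only: C_def from_coordinates_closed from_coordinates_coordinates coordinates_from_coordinates)
  then show "Tor R M (\<lambda>n. Fr (k n)) d q \<cong>\<^sub>v homology C \<delta> q"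
    unfolding Tor_def by (rule homology_iso [OF cc C])
qed

end

section \<open>Algebras over the ground field\<close>

locale kalgebra = vspace A + A?: ring A for A :: "('k::field, 'a) module" (structure) +
  assumes smult_mult_left: "\<lbrakk>x \<in> carrier A; y \<in> carrier A\<rbrakk> \<Longrightarrow> (c \<odot>\<^bsub>A\<^esub> x) \<otimes>\<^bsub>A\<^esub> y = c \<odot>\<^bsub>A\<^esub> (x \<otimes>\<^bsub>A\<^esub> y)"
    and smult_mult_right: "\<lbrakk>x \<in> carrier A; y \<in> carrier A\<rbrakk> \<Longrightarrow> x \<otimes>\<^bsub>A\<^esub> (c \<odot>\<^bsub>A\<^esub> y) = c \<odot>\<^bsub>A\<^esub> (x \<otimes>\<^bsub>A\<^esub> y)"
begin

lemma sc_closed [simp]: "x \<in> carrier A \<Longrightarrow> c \<odot>\<^bsub>A\<^esub> x \<in> carrier A"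
  using smult_closed by simp

lemma ideal_submodule:
  assumes "ideal I A"
  shows "submodule I ground A"
proof -
  interpret I: ideal I A by fact
  have "c \<odot>\<^bsub>A\<^esub> x \<in> I" if x: "x \<in> I" for c x
    using I.I_l_closed [OF x, of "c \<odot>\<^bsub>A\<^esub> \<one>\<^bsub>A\<^esub>"] smult_mult_left [of "\<one>\<^bsub>A\<^esub>" x c] x I.a_Hcarr by simp
  then show ?thesis
    by (intro lmodule_ground_submoduleI lmodule_axioms) (auto simp: I.a_subset I.a_Hcarr)
qed

lemma mult_hom_left: "y \<in> carrier A \<Longrightarrow> (\<lambda>x. x \<otimes>\<^bsub>A\<^esub> y) \<in> mod_hom ground A A"
  by (rule mod_homI) (simp_all add: A.l_distr smult_mult_left)

lemma mult_hom_right: "y \<in> carrier A \<Longrightarrow> (\<lambda>x. y \<otimes>\<^bsub>A\<^esub> x) \<in> mod_hom ground A A"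
  by (rule mod_homI) (simp_all add: A.r_distr smult_mult_right)

lemma vsubspace_ideal: "ideal I A \<Longrightarrow> vsubspace I A"
  by (simp add: vsubspace_def vspace_axioms vsubspace_axioms_def ideal_submodule)

lemma vquot_mult:
  assumes "ideal I A" "x \<in> carrier A" "y \<in> carrier A"
  shows "(I +>\<^bsub>A\<^esub> x) \<otimes>\<^bsub>A /\<^sub>v I\<^esub> (I +>\<^bsub>A\<^esub> y) = I +>\<^bsub>A\<^esub> (x \<otimes>\<^bsub>A\<^esub> y)"
  using ideal.rcoset_mult_add [OF assms] by (simp add: vquot_def ring.defs module.defs FactRing_def)

lemma vquot_one: "\<one>\<^bsub>A /\<^sub>v I\<^esub> = I +>\<^bsub>A\<^esub> \<one>\<^bsub>A\<^esub>"
  by (simp add: vquot_def ring.defs module.defs FactRing_def)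

lemma kalgebra_vquot:
  assumes "ideal I A"
  shows "kalgebra (A /\<^sub>v I)"
proof -
  interpret q: vsubspace I A by (rule vsubspace_ideal [OF assms])
  note m = vquot_mult [OF assms]
  have "ring (A /\<^sub>v I)"
  proof (rule ringI)
    show "abelian_group (A /\<^sub>v I)" using q.vquot_lmodule by (simp add: lmodule_def)
    show "monoid (A /\<^sub>v I)"
      by (rule monoidI) (auto simp: q.vquot_simps(2) m vquot_one A.m_assoc)
  qed (auto simp: q.vquot_simps(2) m q.vquot_add A.l_distr A.r_distr)
  then show ?thesis
    by (simp add: kalgebra_def kalgebra_axioms_def q.vspace_vquot)
      (auto simp: q.vquot_simps(2) m q.vquot_smult smult_mult_left smult_mult_right)
qed

end

lemma opposite_simps [simp]:
  "carrier (opposite A) = carrier A" "x \<oplus>\<^bsub>opposite A\<^esub> y = x \<oplus>\<^bsub>A\<^esub> y" "\<zero>\<^bsub>opposite A\<^esub> = \<zero>\<^bsub>A\<^esub>"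
  "x \<otimes>\<^bsub>opposite A\<^esub> y = y \<otimes>\<^bsub>A\<^esub> x" "\<one>\<^bsub>opposite A\<^esub> = \<one>\<^bsub>A\<^esub>" "c \<odot>\<^bsub>opposite A\<^esub> x = c \<odot>\<^bsub>A\<^esub> x"
  by (simp_all add: opposite_def)

lemma abelian_group_cong:
  fixes V :: "('a, 'b) ring_scheme" and W :: "('a, 'c) ring_scheme"
  assumes "abelian_group V" "carrier W = carrier V" "zero W = zero V" "add W = add V"
  shows "abelian_group W"
proof -
  interpret V: abelian_group V by fact
  show ?thesis
    by (rule abelian_groupI) (auto simp: assms(2-4) V.a_ac V.l_neg intro!: bexI [where x = "\<ominus>\<^bsub>V\<^esub> x" for x])
qed

lemma lmodule_cong:
  fixes V W :: "('r, 'a, 'b) module_scheme"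
  assumes "lmodule R V" "carrier W = carrier V" "zero W = zero V" "add W = add V" "smult W = smult V"
  shows "lmodule R W"
  using assms abelian_group_cong [of V W] by (simp add: lmodule_def lmodule_axioms_def)

lemma (in kalgebra) kalgebra_opposite: "kalgebra (opposite A)"
proof -
  have l: "lmodule ground (opposite A)"
    by (rule lmodule_cong [OF lmodule_axioms]) (simp_all add: opposite_def)
  have "ring (opposite A)"
  proof (rule ringI)
    show "abelian_group (opposite A)" using l by (simp add: lmodule_def)
    show "monoid (opposite A)" by (rule monoidI) (auto simp: A.m_assoc)
  qed (auto simp: A.l_distr A.r_distr)
  then show ?thesis
    using l by (simp add: kalgebra_def vspace_def kalgebra_axioms_def smult_mult_left smult_mult_right)
qed

section \<open>Monoid algebras\<close>

lemma monoid_algebra_simps [simp]: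
  "carrier (monoid_algebra G) = {f. Poly_Mapping.keys f \<subseteq> carrier G}" "\<zero>\<^bsub>monoid_algebra G\<^esub> = 0"
  "f \<oplus>\<^bsub>monoid_algebra G\<^esub> g = f + g" "c \<odot>\<^bsub>monoid_algebra G\<^esub> f = Poly_Mapping.map ((*) c) f"
  "\<one>\<^bsub>monoid_algebra G\<^esub> = Poly_Mapping.single \<one>\<^bsub>G\<^esub> 1"
  by (simp_all add: monoid_algebra_def free_space_def)

lemma monoid_algebra_mult_superset:
  assumes "finite S" "Poly_Mapping.keys f \<subseteq> S" "finite T" "Poly_Mapping.keys g \<subseteq> T"
  shows "f \<otimes>\<^bsub>monoid_algebra G\<^esub> g = (\<Sum>u\<in>S. \<Sum>v\<in>T.
     Poly_Mapping.single (u \<otimes>\<^bsub>G\<^esub> v) (Poly_Mapping.lookup f u * Poly_Mapping.lookup g v))"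
proof -
  have "f \<otimes>\<^bsub>monoid_algebra G\<^esub> g = (\<Sum>u\<in>Poly_Mapping.keys f. \<Sum>v\<in>Poly_Mapping.keys g.
     Poly_Mapping.single (u \<otimes>\<^bsub>G\<^esub> v) (Poly_Mapping.lookup f u * Poly_Mapping.lookup g v))"
    by (simp add: monoid_algebra_def)
  also have "\<dots> = (\<Sum>u\<in>Poly_Mapping.keys f. \<Sum>v\<in>T.
     Poly_Mapping.single (u \<otimes>\<^bsub>G\<^esub> v) (Poly_Mapping.lookup f u * Poly_Mapping.lookup g v))"
    by (intro sum.cong refl sum.mono_neutral_left assms) (auto simp: in_keys_iff)
  also have "\<dots> = (\<Sum>u\<in>S. \<Sum>v\<in>T.
     Poly_Mapping.single (u \<otimes>\<^bsub>G\<^esub> v) (Poly_Mapping.lookup f u * Poly_Mapping.lookup g v))"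
    by (intro sum.mono_neutral_left assms) (auto simp: in_keys_iff)
  finally show ?thesis .
qed

lemma monoid_algebra_single:
  "Poly_Mapping.single u a \<otimes>\<^bsub>monoid_algebra G\<^esub> Poly_Mapping.single v b = Poly_Mapping.single (u \<otimes>\<^bsub>G\<^esub> v) (a * b)"
  by (subst monoid_algebra_mult_superset [of "{u}" _ "{v}"]) auto

lemma monoid_algebra_distrib_left:
  "f \<otimes>\<^bsub>monoid_algebra G\<^esub> (g + h) = f \<otimes>\<^bsub>monoid_algebra G\<^esub> g + f \<otimes>\<^bsub>monoid_algebra G\<^esub> h"
proof -
  let ?T = "Poly_Mapping.keys g \<union> Poly_Mapping.keys h"
  note s = monoid_algebra_mult_superset [of "Poly_Mapping.keys f" f ?T]
  show ?thesis
    using keys_add [of g h]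
    by (simp add: s lookup_add distrib_left single_add sum.distrib)
qed

lemma monoid_algebra_distrib_right:
  "(f + g) \<otimes>\<^bsub>monoid_algebra G\<^esub> h = f \<otimes>\<^bsub>monoid_algebra G\<^esub> h + g \<otimes>\<^bsub>monoid_algebra G\<^esub> h"
proof -
  let ?S = "Poly_Mapping.keys f \<union> Poly_Mapping.keys g"
  note s = monoid_algebra_mult_superset [of ?S _ "Poly_Mapping.keys h" h]
  show ?thesis
    using keys_add [of f g]
    by (simp add: s lookup_add distrib_right single_add sum.distrib)
qed

lemma map_scale_sum: "Poly_Mapping.map ((*) (c::'k::field)) (\<Sum>i\<in>I. f i) = (\<Sum>i\<in>I. Poly_Mapping.map ((*) c) (f i))"
  by (rule poly_mapping_eqI) (simp add: lookup_sum sum_distrib_left)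

lemma monoid_algebra_scale_left:
  "Poly_Mapping.map ((*) c) f \<otimes>\<^bsub>monoid_algebra G\<^esub> g = Poly_Mapping.map ((*) c) (f \<otimes>\<^bsub>monoid_algebra G\<^esub> g)"
  using keys_scale [of c f]
  by (simp add: monoid_algebra_mult_superset [of "Poly_Mapping.keys f" _ "Poly_Mapping.keys g" g]
    map_scale_sum mult.assoc)

lemma monoid_algebra_scale_right:
  "f \<otimes>\<^bsub>monoid_algebra G\<^esub> Poly_Mapping.map ((*) c) g = Poly_Mapping.map ((*) c) (f \<otimes>\<^bsub>monoid_algebra G\<^esub> g)"
  using keys_scale [of c g]
  by (simp add: monoid_algebra_mult_superset [of "Poly_Mapping.keys f" f "Poly_Mapping.keys g"]
    map_scale_sum mult.left_commute)

lemma monoid_algebra_zero [simp]: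
  "0 \<otimes>\<^bsub>monoid_algebra G\<^esub> g = 0" "f \<otimes>\<^bsub>monoid_algebra G\<^esub> 0 = 0"
  by (simp_all add: monoid_algebra_def)

lemma monoid_algebra_closed:
  assumes "monoid G" "Poly_Mapping.keys f \<subseteq> carrier G" "Poly_Mapping.keys g \<subseteq> carrier G"
  shows "Poly_Mapping.keys (f \<otimes>\<^bsub>monoid_algebra G\<^esub> g) \<subseteq> carrier G"
proof -
  interpret monoid G by fact
  have "f \<in> carrier (free_space (carrier G))" using assms by simp
  then show ?thesis
  proof (induct f rule: free_space_induct)
    case (single u a f)
    have "g \<in> carrier (free_space (carrier G))" using assms by simp
    then have "Poly_Mapping.keys (Poly_Mapping.single u a \<otimes>\<^bsub>monoid_algebra G\<^esub> g) \<subseteq> carrier G"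
    proof (induct g rule: free_space_induct)
      case (single v b g)
      show ?case
        unfolding monoid_algebra_distrib_left monoid_algebra_single
        by (rule order_trans [OF keys_add]) (use single \<open>u \<in> carrier G\<close> in \<open>auto split: if_splits\<close>)
    qed simp
    then show ?case
      unfolding monoid_algebra_distrib_right
      by (intro order_trans [OF keys_add]) (use single in auto)
  qed simp
qed

lemma monoid_algebra_assoc:
  assumes "monoid G" and f: "Poly_Mapping.keys f \<subseteq> carrier G" and g: "Poly_Mapping.keys g \<subseteq> carrier G"
    and h: "Poly_Mapping.keys h \<subseteq> carrier G"
  shows "(f \<otimes>\<^bsub>monoid_algebra G\<^esub> g) \<otimes>\<^bsub>monoid_algebra G\<^esub> h = f \<otimes>\<^bsub>monoid_algebra G\<^esub> (g \<otimes>\<^bsub>monoid_algebra G\<^esub> h)"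
proof -
  interpret monoid G by fact
  have fc: "f \<in> carrier (free_space (carrier G))" and gc: "g \<in> carrier (free_space (carrier G))"
    and hc: "h \<in> carrier (free_space (carrier G))" using f g h by simp_all
  note d = monoid_algebra_distrib_left monoid_algebra_distrib_right monoid_algebra_single
  from fc show ?thesis
  proof (induct f rule: free_space_induct)
    case (single u a f)
    from gc have "(Poly_Mapping.single u a \<otimes>\<^bsub>monoid_algebra G\<^esub> g) \<otimes>\<^bsub>monoid_algebra G\<^esub> h =
      Poly_Mapping.single u a \<otimes>\<^bsub>monoid_algebra G\<^esub> (g \<otimes>\<^bsub>monoid_algebra G\<^esub> h)"
    proof (induct g rule: free_space_induct)
      case (single v b g)
      from hc have "(Poly_Mapping.single u a \<otimes>\<^bsub>monoid_algebra G\<^esub> Poly_Mapping.single v b) \<otimes>\<^bsub>monoid_algebra G\<^esub> h =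
        Poly_Mapping.single u a \<otimes>\<^bsub>monoid_algebra G\<^esub> (Poly_Mapping.single v b \<otimes>\<^bsub>monoid_algebra G\<^esub> h)"
      proof (induct h rule: free_space_induct)
        case (single w c h)
        then show ?case
          using \<open>u \<in> carrier G\<close> \<open>v \<in> carrier G\<close> by (simp add: d m_assoc mult.assoc)
      qed simp
      with single show ?case by (simp add: d)
    qed simp
    with single show ?case by (simp add: d)
  qed simp
qed

lemma monoid_algebra_unit:
  assumes "monoid G" and f: "Poly_Mapping.keys f \<subseteq> carrier G"
  shows "Poly_Mapping.single \<one>\<^bsub>G\<^esub> 1 \<otimes>\<^bsub>monoid_algebra G\<^esub> f = f" "f \<otimes>\<^bsub>monoid_algebra G\<^esub> Poly_Mapping.single \<one>\<^bsub>G\<^esub> 1 = f"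
proof -
  interpret monoid G by fact
  have fc: "f \<in> carrier (free_space (carrier G))" using f by simp
  note d = monoid_algebra_distrib_left monoid_algebra_distrib_right monoid_algebra_single
  from fc show "Poly_Mapping.single \<one>\<^bsub>G\<^esub> 1 \<otimes>\<^bsub>monoid_algebra G\<^esub> f = f"
    by (induct f rule: free_space_induct) (simp_all add: d)
  from fc show "f \<otimes>\<^bsub>monoid_algebra G\<^esub> Poly_Mapping.single \<one>\<^bsub>G\<^esub> 1 = f"
    by (induct f rule: free_space_induct) (simp_all add: d)
qed

lemma kalgebra_monoid_algebra:
  fixes G :: "('g, 's) monoid_scheme"
  assumes "monoid G"
  shows "kalgebra (monoid_algebra G :: ('k::field, 'g \<Rightarrow>\<^sub>0 'k) module)" (is "kalgebra ?A")
proof -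
  interpret monoid G by fact
  have l: "lmodule ground ?A"
    by (rule lmodule_cong [OF lmodule_free_space [of "carrier G"]]) (simp_all add: monoid_algebra_def)
  have "ring ?A"
  proof (rule ringI)
    show "abelian_group ?A" using l by (simp add: lmodule_def)
    show "monoid ?A"
      by (rule monoidI)
        (use assms in \<open>simp_all add: monoid_algebra_closed monoid_algebra_assoc monoid_algebra_unit\<close>)
  qed (simp_all add: monoid_algebra_distrib_left monoid_algebra_distrib_right)
  then show ?thesis
    using l by (simp add: kalgebra_def vspace_def kalgebra_axioms_def monoid_algebra_scale_left monoid_algebra_scale_right)
qed

section \<open>The enveloping algebra\<close>

lemma opposite_ground: "opposite ground = (ground :: ('k::field, 'k) module)"
  by (simp add: opposite_def ground_def fun_eq_iff mult.commute)

lemma ground_smult [simp]: "c \<odot>\<^bsub>ground\<^esub> a = c * a"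
  by (simp add: ground_def)

text \<open>
  A locale distinct from that of algebras: the enveloping algebra is interpreted inside it as an
  algebra, and the two would otherwise refer to each other without end.
\<close>

locale enveloping_algebra = kalgebra A for A :: "('k::field, 'a) module" (structure)
begin

definition ten :: "'a \<Rightarrow> 'a \<Rightarrow> ('a \<times> 'a \<Rightarrow>\<^sub>0 'k) set" where
  "ten = pure ground A (opposite A)"

abbreviation "E \<equiv> enveloping A"
abbreviation "MA \<equiv> monoid_algebra (A \<times>\<times> opposite A) :: ('k, 'a \<times> 'a \<Rightarrow>\<^sub>0 'k) module"
abbreviation "TN \<equiv> tensor_null ground A (opposite A)"
abbreviation "FS \<equiv> free_space (carrier A \<times> carrier A) :: ('k, 'a \<times> 'a \<Rightarrow>\<^sub>0 'k) module"

lemma opp: "kalgebra (opposite A)" by (rule kalgebra_opposite)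

sublocale TP: tensor_pair ground A "opposite A"
  using opp by (simp add: tensor_pair_def opposite_ground lmodule_axioms kalgebra_def vspace_def)

lemma monoid_AA: "monoid (A \<times>\<times> opposite A)"
  using opp by (intro DirProd_monoid) (auto simp: A.monoid_axioms kalgebra_def ring_def)

lemma AA_simps [simp]: "carrier (A \<times>\<times> opposite A) = carrier A \<times> carrier A"
  "(a, b) \<otimes>\<^bsub>A \<times>\<times> opposite A\<^esub> (a', b') = (a \<otimes>\<^bsub>A\<^esub> a', b' \<otimes>\<^bsub>A\<^esub> b)"
  "\<one>\<^bsub>A \<times>\<times> opposite A\<^esub> = (\<one>\<^bsub>A\<^esub>, \<one>\<^bsub>A\<^esub>)"
  by (simp_all add: DirProd_def)

sublocale MA: kalgebra MA by (rule kalgebra_monoid_algebra [OF monoid_AA])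

lemma ten_props:
  shows ten_add_left: "\<lbrakk>a \<in> carrier A; a' \<in> carrier A; b \<in> carrier A\<rbrakk> \<Longrightarrow> ten (a \<oplus>\<^bsub>A\<^esub> a') b = ten a b \<oplus>\<^bsub>tensor ground A (opposite A)\<^esub> ten a' b"
    and ten_add_right: "\<lbrakk>a \<in> carrier A; b \<in> carrier A; b' \<in> carrier A\<rbrakk> \<Longrightarrow> ten a (b \<oplus>\<^bsub>A\<^esub> b') = ten a b \<oplus>\<^bsub>tensor ground A (opposite A)\<^esub> ten a b'"
    and ten_scale_left: "\<lbrakk>a \<in> carrier A; b \<in> carrier A\<rbrakk> \<Longrightarrow> ten (c \<odot>\<^bsub>A\<^esub> a) b = c \<odot>\<^bsub>tensor ground A (opposite A)\<^esub> ten a b"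
    and ten_scale_right: "\<lbrakk>a \<in> carrier A; b \<in> carrier A\<rbrakk> \<Longrightarrow> ten a (c \<odot>\<^bsub>A\<^esub> b) = c \<odot>\<^bsub>tensor ground A (opposite A)\<^esub> ten a b"
    and ten_closed': "\<lbrakk>a \<in> carrier A; b \<in> carrier A\<rbrakk> \<Longrightarrow> ten a b \<in> carrier (tensor ground A (opposite A))"
  using TP.pure_add_left [of a a' b] TP.pure_add_right [of a b b'] TP.pure_scalar [of a b c]
    TP.pure_balanced [of c a b] TP.pure_closed [of a b]
  by (simp_all add: ten_def)

text \<open>
  The left and right multiplications by a basis element \<open>(a, b)\<close> of the monoid algebra turn the class
  of a pair into \<open>a x \<otimes> y b\<close> and \<open>x a \<otimes> b y\<close>.  Both expressions are bilinear in \<open>(x, y)\<close>, hence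
  the universal property shows that these multiplications preserve the relations.
\<close>

lemma tensor_null_ideal: "ideal TN MA"
proof -
  have sub: "submodule TN ground FS" using TP.T.sub by simp
  note sc = submodule_closed [OF sub, simplified]
  have coset0: "z \<in> TN" if "TN +>\<^bsub>FS\<^esub> z = \<zero>\<^bsub>tensor ground A (opposite A)\<^esub>" "Poly_Mapping.keys z \<subseteq> carrier A \<times> carrier A" for z
    using that TP.T.coset_eq_sub_iff [of z] TP.T.vquot_simps(1) by (simp add: tensor_def)
  have ten_coset: "TN +>\<^bsub>FS\<^esub> Poly_Mapping.single (a, b) 1 = ten a b" for a b
    by (simp add: ten_def pure_def)
  have h: "(\<lambda>z. TN +>\<^bsub>FS\<^esub> z) \<in> mod_hom ground FS (tensor ground A (opposite A))"
    using TP.T.coset_hom by (simp add: tensor_def)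
  have l: "Poly_Mapping.single u c \<otimes>\<^bsub>MA\<^esub> z \<in> TN \<and> z \<otimes>\<^bsub>MA\<^esub> Poly_Mapping.single u c \<in> TN"
    if u: "u \<in> carrier A \<times> carrier A" and z: "z \<in> TN" for u c z
  proof -
    obtain a b where ab: "u = (a, b)" "a \<in> carrier A" "b \<in> carrier A" using u by blast
    have zc: "z \<in> carrier FS" using sc(1) z by auto
    have s1: "Poly_Mapping.keys (Poly_Mapping.single (a, b) c) \<subseteq> carrier A \<times> carrier A" using ab by simp
    have L: "(\<lambda>z. Poly_Mapping.single (a, b) c \<otimes>\<^bsub>MA\<^esub> z) \<in> mod_hom ground FS FS"
      "(\<lambda>z. z \<otimes>\<^bsub>MA\<^esub> Poly_Mapping.single (a, b) c) \<in> mod_hom ground FS FS"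
      by (rule mod_homI; simp add: monoid_algebra_distrib_left monoid_algebra_distrib_right
        monoid_algebra_scale_left monoid_algebra_scale_right monoid_algebra_closed [OF monoid_AA, simplified] s1
        del: keys_single)+
    let ?\<beta> = "\<lambda>x y. c \<odot>\<^bsub>tensor ground A (opposite A)\<^esub> ten (a \<otimes>\<^bsub>A\<^esub> x) (y \<otimes>\<^bsub>A\<^esub> b)"
    let ?\<gamma> = "\<lambda>x y. c \<odot>\<^bsub>tensor ground A (opposite A)\<^esub> ten (x \<otimes>\<^bsub>A\<^esub> a) (b \<otimes>\<^bsub>A\<^esub> y)"
    interpret t: lmodule ground "tensor ground A (opposite A)" by (rule TP.tensor_lmodule)
    note tl = t.smult_closed [simplified] t.smult_r_distr [simplified] t.smult_assoc [simplified, symmetric]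
    have n1: "linear_extension (tensor ground A (opposite A)) (case_prod ?\<beta>) z = \<zero>\<^bsub>tensor ground A (opposite A)\<^esub>"
      by (rule TP.tensor_extend(3) [OF TP.tensor_lmodule _ _ _ _ _ z])
        (use ab in \<open>simp_all add: A.l_distr A.r_distr ten_add_left ten_add_right ten_closed' tl
          smult_mult_left smult_mult_right ten_scale_left ten_scale_right mult.commute\<close>)
    have n2: "linear_extension (tensor ground A (opposite A)) (case_prod ?\<gamma>) z = \<zero>\<^bsub>tensor ground A (opposite A)\<^esub>"
      by (rule TP.tensor_extend(3) [OF TP.tensor_lmodule _ _ _ _ _ z])
        (use ab in \<open>simp_all add: A.l_distr A.r_distr ten_add_left ten_add_right ten_closed' tl
          smult_mult_left smult_mult_right ten_scale_left ten_scale_right mult.commute\<close>)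
    interpret tv: vspace "tensor ground A (opposite A)" by (rule TP.tensor_vspace)
    have hs: "TN +>\<^bsub>FS\<^esub> Poly_Mapping.single (x, y) r = r \<odot>\<^bsub>tensor ground A (opposite A)\<^esub> ten x y"
      if "x \<in> carrier A" "y \<in> carrier A" for x y r
      using mod_hom_smult [OF h, of r "Poly_Mapping.single (x, y) 1"] that by (simp add: ten_coset)
    have lh: "linear_extension (tensor ground A (opposite A)) (case_prod ?\<beta>) \<in> mod_hom ground FS (tensor ground A (opposite A))"
      "linear_extension (tensor ground A (opposite A)) (case_prod ?\<gamma>) \<in> mod_hom ground FS (tensor ground A (opposite A))"
      by (rule tv.linear_extension_hom; use ab ten_closed' tl in auto)+
    have "TN +>\<^bsub>FS\<^esub> (Poly_Mapping.single (a, b) c \<otimes>\<^bsub>MA\<^esub> z) = linear_extension (tensor ground A (opposite A)) (case_prod ?\<beta>) z"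
      by (rule free_space_hom_eqI [OF t.lmodule_axioms mod_hom_comp [OF L(1) h] lh(1) _ zc])
        (use ab in \<open>auto simp: monoid_algebra_single hs ten_closed' tl tv.linear_extension_one\<close>)
    moreover have "TN +>\<^bsub>FS\<^esub> (z \<otimes>\<^bsub>MA\<^esub> Poly_Mapping.single (a, b) c) = linear_extension (tensor ground A (opposite A)) (case_prod ?\<gamma>) z"
      by (rule free_space_hom_eqI [OF t.lmodule_axioms mod_hom_comp [OF L(2) h] lh(2) _ zc])
        (use ab in \<open>auto simp: monoid_algebra_single hs ten_closed' tl tv.linear_extension_one\<close>)
    ultimately show ?thesis
      using n1 n2 coset0 mod_hom_closed [OF L(1) zc] mod_hom_closed [OF L(2) zc] ab(1) by simp
  qed
  show ?thesis
  proof (rule idealI [OF MA.A.ring_axioms])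
    have "submodule TN ground MA"
      by (rule lmodule_ground_submoduleI [OF MA.lmodule_axioms]) (use sc in auto)
    then show "subgroup TN (add_monoid MA)" by (rule submodule.axioms(1))
    fix z x assume z: "z \<in> TN" and x: "x \<in> carrier MA"
    from x have x: "x \<in> carrier FS" by simp
    show "x \<otimes>\<^bsub>MA\<^esub> z \<in> TN"
      using x by (induct x rule: free_space_induct) (use sc l z in \<open>auto simp: monoid_algebra_distrib_right\<close>)
    show "z \<otimes>\<^bsub>MA\<^esub> x \<in> TN"
      using x by (induct x rule: free_space_induct) (use sc l z in \<open>auto simp: monoid_algebra_distrib_left\<close>)
  qed
qed

lemma enveloping_eq: "E = MA /\<^sub>v TN"
  by (simp add: enveloping_def tensor_algebra_def)

sublocale E: kalgebra E
  unfolding enveloping_eq by (rule MA.kalgebra_vquot [OF tensor_null_ideal])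

text \<open>
  \<open>E\<close> is a quotient of the monoid algebra, the tensor product one of the free vector space; the
  linear structures agree, and so do the linear maps out of the two.
\<close>

lemma enveloping_tensor:
  "carrier E = carrier (tensor ground A (opposite A))" "zero E = zero (tensor ground A (opposite A))"
  "add E = add (tensor ground A (opposite A))" "smult E = smult (tensor ground A (opposite A))"
  by (simp_all add: enveloping_eq tensor_def vquot_def ring.defs module.defs FactRing_def A_RCOSETS_def'
    a_r_coset_def r_coset_def set_add_def set_mult_def fun_eq_iff)

lemma mod_hom_enveloping: "mod_hom ground E U = mod_hom ground (tensor ground A (opposite A)) U"
  by (simp add: mod_hom_def enveloping_tensor)

lemma ten_closed [simp]: "\<lbrakk>a \<in> carrier A; b \<in> carrier A\<rbrakk> \<Longrightarrow> ten a b \<in> carrier E"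
  by (simp add: enveloping_tensor ten_closed')

lemmas ten_add = ten_add_left [folded enveloping_tensor] ten_add_right [folded enveloping_tensor]
lemmas ten_scale = ten_scale_left [folded enveloping_tensor] ten_scale_right [folded enveloping_tensor]

lemma ten_coset: "ten a b = TN +>\<^bsub>MA\<^esub> Poly_Mapping.single (a, b) 1"
  by (simp add: ten_def pure_def a_r_coset_def r_coset_def)

lemma ten_mult:
  "\<lbrakk>a \<in> carrier A; b \<in> carrier A; a' \<in> carrier A; b' \<in> carrier A\<rbrakk> \<Longrightarrow>
    ten a b \<otimes>\<^bsub>E\<^esub> ten a' b' = ten (a \<otimes>\<^bsub>A\<^esub> a') (b' \<otimes>\<^bsub>A\<^esub> b)"
  unfolding enveloping_eq ten_coset
  by (subst MA.vquot_mult [OF tensor_null_ideal]) (simp_all add: monoid_algebra_single)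

lemma ten_one: "\<one>\<^bsub>E\<^esub> = ten \<one>\<^bsub>A\<^esub> \<one>\<^bsub>A\<^esub>"
  unfolding enveloping_eq ten_coset MA.vquot_one by simp

lemma enveloping_hom_eqI:
  assumes "lmodule ground U" "f \<in> mod_hom ground E U" "g \<in> mod_hom ground E U"
    and "\<And>a b. \<lbrakk>a \<in> carrier A; b \<in> carrier A\<rbrakk> \<Longrightarrow> f (ten a b) = g (ten a b)"
    and "e \<in> carrier E"
  shows "f e = g e"
  by (rule TP.tensor_hom_eqI [OF assms(1-3)[unfolded mod_hom_enveloping]])
    (use assms(4,5) in \<open>simp_all add: ten_def enveloping_tensor\<close>)

lemma enveloping_extend:
  assumes "lmodule ground U"
    and "\<And>a b. \<lbrakk>a \<in> carrier A; b \<in> carrier A\<rbrakk> \<Longrightarrow> \<beta> a b \<in> carrier U"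
    and "\<And>a a' b. \<lbrakk>a \<in> carrier A; a' \<in> carrier A; b \<in> carrier A\<rbrakk> \<Longrightarrow> \<beta> (a \<oplus>\<^bsub>A\<^esub> a') b = \<beta> a b \<oplus>\<^bsub>U\<^esub> \<beta> a' b"
    and "\<And>a b b'. \<lbrakk>a \<in> carrier A; b \<in> carrier A; b' \<in> carrier A\<rbrakk> \<Longrightarrow> \<beta> a (b \<oplus>\<^bsub>A\<^esub> b') = \<beta> a b \<oplus>\<^bsub>U\<^esub> \<beta> a b'"
    and "\<And>c a b. \<lbrakk>a \<in> carrier A; b \<in> carrier A\<rbrakk> \<Longrightarrow> \<beta> (c \<odot>\<^bsub>A\<^esub> a) b = c \<odot>\<^bsub>U\<^esub> \<beta> a b"
    and "\<And>c a b. \<lbrakk>a \<in> carrier A; b \<in> carrier A\<rbrakk> \<Longrightarrow> \<beta> a (c \<odot>\<^bsub>A\<^esub> b) = c \<odot>\<^bsub>U\<^esub> \<beta> a b"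
  shows "on_coset (linear_extension U (case_prod \<beta>)) \<in> mod_hom ground E U"
    and "\<And>a b. \<lbrakk>a \<in> carrier A; b \<in> carrier A\<rbrakk> \<Longrightarrow> on_coset (linear_extension U (case_prod \<beta>)) (ten a b) = \<beta> a b"
  unfolding mod_hom_enveloping ten_def
  by (rule TP.tensor_extend(1) [OF assms(1)]; simp add: assms)
    (rule TP.tensor_extend(2) [OF assms(1)]; simp add: assms)

abbreviation "L \<equiv> left_enveloping_module A"
abbreviation "Rt \<equiv> right_enveloping_module A"

lemma enveloping_module_simps [simp]:
  "carrier L = carrier A" "x \<oplus>\<^bsub>L\<^esub> y = x \<oplus>\<^bsub>A\<^esub> y" "\<zero>\<^bsub>L\<^esub> = \<zero>\<^bsub>A\<^esub>"
  "carrier Rt = carrier A" "x \<oplus>\<^bsub>Rt\<^esub> y = x \<oplus>\<^bsub>A\<^esub> y" "\<zero>\<^bsub>Rt\<^esub> = \<zero>\<^bsub>A\<^esub>"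
  by (simp_all add: left_enveloping_module_def right_enveloping_module_def ring.defs module.defs)

lemma left_act:
  assumes x: "x \<in> carrier A"
  shows left_act_hom: "(\<lambda>e. e \<odot>\<^bsub>L\<^esub> x) \<in> mod_hom ground E A"
    and left_act_ten: "\<lbrakk>a \<in> carrier A; b \<in> carrier A\<rbrakk> \<Longrightarrow> ten a b \<odot>\<^bsub>L\<^esub> x = a \<otimes>\<^bsub>A\<^esub> x \<otimes>\<^bsub>A\<^esub> b"
proof -
  have e: "(\<lambda>e. e \<odot>\<^bsub>L\<^esub> x) = on_coset (linear_extension A (case_prod (\<lambda>a b. a \<otimes>\<^bsub>A\<^esub> x \<otimes>\<^bsub>A\<^esub> b)))"
    by (simp add: left_enveloping_module_def ring.defs module.defs linear_extension_def [abs_def] case_prod_beta')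
  show "(\<lambda>e. e \<odot>\<^bsub>L\<^esub> x) \<in> mod_hom ground E A"
    unfolding e using x
    by (intro enveloping_extend(1) lmodule_axioms) (simp_all add: A.l_distr A.r_distr smult_mult_left smult_mult_right)
  have "on_coset (linear_extension A (case_prod (\<lambda>a b. a \<otimes>\<^bsub>A\<^esub> x \<otimes>\<^bsub>A\<^esub> b))) (ten a b) = a \<otimes>\<^bsub>A\<^esub> x \<otimes>\<^bsub>A\<^esub> b"
    if "a \<in> carrier A" "b \<in> carrier A"
    using that x
    by (intro enveloping_extend(2) lmodule_axioms) (simp_all add: A.l_distr A.r_distr smult_mult_left smult_mult_right)
  then show "\<lbrakk>a \<in> carrier A; b \<in> carrier A\<rbrakk> \<Longrightarrow> ten a b \<odot>\<^bsub>L\<^esub> x = a \<otimes>\<^bsub>A\<^esub> x \<otimes>\<^bsub>A\<^esub> b"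
    using fun_cong [OF e, of "ten a b"] by simp
qed

lemma right_act:
  assumes x: "x \<in> carrier A"
  shows right_act_hom: "(\<lambda>e. e \<odot>\<^bsub>Rt\<^esub> x) \<in> mod_hom ground E A"
    and right_act_ten: "\<lbrakk>a \<in> carrier A; b \<in> carrier A\<rbrakk> \<Longrightarrow> ten a b \<odot>\<^bsub>Rt\<^esub> x = b \<otimes>\<^bsub>A\<^esub> x \<otimes>\<^bsub>A\<^esub> a"
proof -
  have e: "(\<lambda>e. e \<odot>\<^bsub>Rt\<^esub> x) = on_coset (linear_extension A (case_prod (\<lambda>a b. b \<otimes>\<^bsub>A\<^esub> x \<otimes>\<^bsub>A\<^esub> a)))"
    by (simp add: right_enveloping_module_def ring.defs module.defs linear_extension_def [abs_def] case_prod_beta')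
  show "(\<lambda>e. e \<odot>\<^bsub>Rt\<^esub> x) \<in> mod_hom ground E A"
    unfolding e using x
    by (intro enveloping_extend(1) lmodule_axioms) (simp_all add: A.l_distr A.r_distr smult_mult_left smult_mult_right)
  have "on_coset (linear_extension A (case_prod (\<lambda>a b. b \<otimes>\<^bsub>A\<^esub> x \<otimes>\<^bsub>A\<^esub> a))) (ten a b) = b \<otimes>\<^bsub>A\<^esub> x \<otimes>\<^bsub>A\<^esub> a"
    if "a \<in> carrier A" "b \<in> carrier A"
    using that x
    by (intro enveloping_extend(2) lmodule_axioms) (simp_all add: A.l_distr A.r_distr smult_mult_left smult_mult_right)
  then show "\<lbrakk>a \<in> carrier A; b \<in> carrier A\<rbrakk> \<Longrightarrow> ten a b \<odot>\<^bsub>Rt\<^esub> x = b \<otimes>\<^bsub>A\<^esub> x \<otimes>\<^bsub>A\<^esub> a"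
    using fun_cong [OF e, of "ten a b"] by simp
qed

lemma act_closed: "\<lbrakk>e \<in> carrier E; x \<in> carrier A\<rbrakk> \<Longrightarrow> e \<odot>\<^bsub>L\<^esub> x \<in> carrier A"
  "\<lbrakk>e \<in> carrier E; x \<in> carrier A\<rbrakk> \<Longrightarrow> e \<odot>\<^bsub>Rt\<^esub> x \<in> carrier A"
  using mod_hom_closed [OF left_act_hom] mod_hom_closed [OF right_act_hom] by blast+

lemma act_add: "\<lbrakk>e \<in> carrier E; x \<in> carrier A; y \<in> carrier A\<rbrakk> \<Longrightarrow> e \<odot>\<^bsub>L\<^esub> (x \<oplus>\<^bsub>A\<^esub> y) = e \<odot>\<^bsub>L\<^esub> x \<oplus>\<^bsub>A\<^esub> e \<odot>\<^bsub>L\<^esub> y"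
  "\<lbrakk>e \<in> carrier E; x \<in> carrier A; y \<in> carrier A\<rbrakk> \<Longrightarrow> e \<odot>\<^bsub>Rt\<^esub> (x \<oplus>\<^bsub>A\<^esub> y) = e \<odot>\<^bsub>Rt\<^esub> x \<oplus>\<^bsub>A\<^esub> e \<odot>\<^bsub>Rt\<^esub> y"
  "\<lbrakk>e \<in> carrier E; x \<in> carrier A\<rbrakk> \<Longrightarrow> e \<odot>\<^bsub>L\<^esub> (c \<odot>\<^bsub>A\<^esub> x) = c \<odot>\<^bsub>A\<^esub> (e \<odot>\<^bsub>L\<^esub> x)"
  "\<lbrakk>e \<in> carrier E; x \<in> carrier A\<rbrakk> \<Longrightarrow> e \<odot>\<^bsub>Rt\<^esub> (c \<odot>\<^bsub>A\<^esub> x) = c \<odot>\<^bsub>A\<^esub> (e \<odot>\<^bsub>Rt\<^esub> x)"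
proof -
  interpret EA: mod_hom_pair ground E A
    by (simp add: mod_hom_pair_def lmodule_axioms E.lmodule_axioms)
  have scale: "(\<lambda>x. c \<odot>\<^bsub>A\<^esub> x) \<in> mod_hom ground A A" for c
    by (rule mod_homI) (simp_all add: smult_r_distr [simplified] smult_assoc [simplified, symmetric] mult.commute)
  show "e \<odot>\<^bsub>L\<^esub> (x \<oplus>\<^bsub>A\<^esub> y) = e \<odot>\<^bsub>L\<^esub> x \<oplus>\<^bsub>A\<^esub> e \<odot>\<^bsub>L\<^esub> y" "e \<odot>\<^bsub>Rt\<^esub> (x \<oplus>\<^bsub>A\<^esub> y) = e \<odot>\<^bsub>Rt\<^esub> x \<oplus>\<^bsub>A\<^esub> e \<odot>\<^bsub>Rt\<^esub> y"
    if e: "e \<in> carrier E" and x: "x \<in> carrier A" and y: "y \<in> carrier A"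
    by (rule enveloping_hom_eqI [OF lmodule_axioms left_act_hom EA.hom_plus_hom [OF left_act_hom left_act_hom] _ e];
        use x y in \<open>simp add: left_act_ten A.l_distr A.r_distr\<close>)
      (rule enveloping_hom_eqI [OF lmodule_axioms right_act_hom EA.hom_plus_hom [OF right_act_hom right_act_hom] _ e];
        use x y in \<open>simp add: right_act_ten A.l_distr A.r_distr\<close>)
  show "e \<odot>\<^bsub>L\<^esub> (c \<odot>\<^bsub>A\<^esub> x) = c \<odot>\<^bsub>A\<^esub> (e \<odot>\<^bsub>L\<^esub> x)" "e \<odot>\<^bsub>Rt\<^esub> (c \<odot>\<^bsub>A\<^esub> x) = c \<odot>\<^bsub>A\<^esub> (e \<odot>\<^bsub>Rt\<^esub> x)"
    if e: "e \<in> carrier E" and x: "x \<in> carrier A"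
    by (rule enveloping_hom_eqI [OF lmodule_axioms left_act_hom mod_hom_comp [OF left_act_hom scale] _ e];
        use x in \<open>simp add: left_act_ten smult_mult_left smult_mult_right\<close>)
      (rule enveloping_hom_eqI [OF lmodule_axioms right_act_hom mod_hom_comp [OF right_act_hom scale] _ e];
        use x in \<open>simp add: right_act_ten smult_mult_left smult_mult_right\<close>)
qed

lemma act_hom:
  "e \<in> carrier E \<Longrightarrow> (\<lambda>x. e \<odot>\<^bsub>L\<^esub> x) \<in> mod_hom ground A A"
  "e \<in> carrier E \<Longrightarrow> (\<lambda>x. e \<odot>\<^bsub>Rt\<^esub> x) \<in> mod_hom ground A A"
  by (auto intro!: mod_homI simp: act_closed act_add)

text \<open>
  Both sides are linear in \<open>r\<close> and in \<open>s\<close>, so pure tensors are enough.  In the right module the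
  factors change their order.
\<close>

lemma act_mult:
  assumes r: "r \<in> carrier E" and s: "s \<in> carrier E" and x: "x \<in> carrier A"
  shows "(r \<otimes>\<^bsub>E\<^esub> s) \<odot>\<^bsub>L\<^esub> x = r \<odot>\<^bsub>L\<^esub> (s \<odot>\<^bsub>L\<^esub> x)" "(r \<otimes>\<^bsub>E\<^esub> s) \<odot>\<^bsub>Rt\<^esub> x = s \<odot>\<^bsub>Rt\<^esub> (r \<odot>\<^bsub>Rt\<^esub> x)"
proof -
  have *: "(ten a b \<otimes>\<^bsub>E\<^esub> s) \<odot>\<^bsub>L\<^esub> x = ten a b \<odot>\<^bsub>L\<^esub> (s \<odot>\<^bsub>L\<^esub> x)" if "a \<in> carrier A" "b \<in> carrier A" for a b
    by (rule enveloping_hom_eqI [OF lmodule_axioms mod_hom_comp [OF E.mult_hom_right left_act_hom]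
          mod_hom_comp [OF left_act_hom act_hom(1)] _ s])
      (use x that in \<open>simp_all add: left_act_ten ten_mult A.m_assoc\<close>)
  show "(r \<otimes>\<^bsub>E\<^esub> s) \<odot>\<^bsub>L\<^esub> x = r \<odot>\<^bsub>L\<^esub> (s \<odot>\<^bsub>L\<^esub> x)"
    by (rule enveloping_hom_eqI [OF lmodule_axioms mod_hom_comp [OF E.mult_hom_left left_act_hom] left_act_hom _ r])
      (use x s * in \<open>simp_all add: act_closed\<close>)
  have *: "(ten a b \<otimes>\<^bsub>E\<^esub> s) \<odot>\<^bsub>Rt\<^esub> x = s \<odot>\<^bsub>Rt\<^esub> (ten a b \<odot>\<^bsub>Rt\<^esub> x)" if "a \<in> carrier A" "b \<in> carrier A" for a b
    by (rule enveloping_hom_eqI [OF lmodule_axioms mod_hom_comp [OF E.mult_hom_right right_act_hom]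
          right_act_hom _ s])
      (use x that in \<open>simp_all add: right_act_ten ten_mult A.m_assoc\<close>)
  show "(r \<otimes>\<^bsub>E\<^esub> s) \<odot>\<^bsub>Rt\<^esub> x = s \<odot>\<^bsub>Rt\<^esub> (r \<odot>\<^bsub>Rt\<^esub> x)"
    by (rule enveloping_hom_eqI [OF lmodule_axioms mod_hom_comp [OF E.mult_hom_left right_act_hom]
          mod_hom_comp [OF right_act_hom act_hom(2)] _ r])
      (use x s * in \<open>simp_all add: act_closed\<close>)
qed

lemma lmodule_left_enveloping: "lmodule E L"
proof -
  have "abelian_group L"
    by (rule abelian_group_cong [OF M.abelian_group_axioms])
      (simp_all add: left_enveloping_module_def ring.defs module.defs)
  then show ?thesis
    unfolding lmodule_def lmodule_axioms_def
    using E.A.ring_axioms by (simp add: act_closed act_add act_mult mod_hom_add [OF left_act_hom] ten_one left_act_ten)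
qed

lemma lmodule_right_enveloping: "lmodule (opposite E) Rt"
proof -
  interpret o: kalgebra "opposite E" by (rule E.kalgebra_opposite)
  have "abelian_group Rt"
    by (rule abelian_group_cong [OF M.abelian_group_axioms])
      (simp_all add: right_enveloping_module_def ring.defs module.defs)
  then show ?thesis
    unfolding lmodule_def lmodule_axioms_def
    using o.A.ring_axioms by (simp add: act_closed act_add act_mult mod_hom_add [OF right_act_hom] ten_one right_act_ten)
qed

lemma free_tensor_enveloping: "free_tensor E Rt A"
proof -
  have "(c \<odot>\<^bsub>E\<^esub> \<one>\<^bsub>E\<^esub>) \<odot>\<^bsub>Rt\<^esub> x = c \<odot>\<^bsub>A\<^esub> x" if "x \<in> carrier A" for c x
    using that mod_hom_smult [OF right_act_hom [OF that], of c "\<one>\<^bsub>E\<^esub>"] by (simp add: ten_one right_act_ten)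
  then show ?thesis
    by (simp add: free_tensor_def free_tensor_axioms_def lmodule_right_enveloping vspace_axioms
      E.A.ring_axioms E.smult_mult_left E.smult_mult_right)
qed

end

context enveloping_algebra
begin

sublocale AE: mod_hom_pair ground A E
  by (simp add: mod_hom_pair_def lmodule_axioms E.lmodule_axioms)
sublocale EA: mod_hom_pair ground E A
  by (simp add: mod_hom_pair_def lmodule_axioms E.lmodule_axioms)
sublocale EE: mod_hom_pair ground E E
  by (simp add: mod_hom_pair_def E.lmodule_axioms)
sublocale AA: mod_hom_pair ground A A
  by (simp add: mod_hom_pair_def lmodule_axioms)

lemma ten_hom: "b \<in> carrier A \<Longrightarrow> (\<lambda>a. ten a b) \<in> mod_hom ground A E"
  "a \<in> carrier A \<Longrightarrow> (\<lambda>b. ten a b) \<in> mod_hom ground A E"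
  by (rule mod_homI; simp add: ten_add ten_scale)+

lemma ten_zero: "b \<in> carrier A \<Longrightarrow> ten \<zero>\<^bsub>A\<^esub> b = \<zero>\<^bsub>E\<^esub>" "a \<in> carrier A \<Longrightarrow> ten a \<zero>\<^bsub>A\<^esub> = \<zero>\<^bsub>E\<^esub>"
  using AE.hom_zero [OF ten_hom(1)] AE.hom_zero [OF ten_hom(2)] by auto

lemma enveloping_induct [consumes 1, case_names zero ten add]:
  assumes "e \<in> carrier E" "P \<zero>\<^bsub>E\<^esub>" "\<And>a b. \<lbrakk>a \<in> carrier A; b \<in> carrier A\<rbrakk> \<Longrightarrow> P (ten a b)"
    and "\<And>x y. \<lbrakk>x \<in> carrier E; y \<in> carrier E; P x; P y\<rbrakk> \<Longrightarrow> P (x \<oplus>\<^bsub>E\<^esub> y)"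
  shows "P e"
proof -
  interpret q: vsubspace TN MA by (rule MA.vsubspace_ideal [OF tensor_null_ideal])
  obtain z where z: "z \<in> carrier MA" "e = TN +>\<^bsub>MA\<^esub> z"
    using assms(1) unfolding enveloping_eq q.vquot_simps by blast
  have h: "(\<lambda>z. TN +>\<^bsub>MA\<^esub> z) \<in> mod_hom ground MA E"
    unfolding enveloping_eq by (rule q.coset_hom)
  have "z \<in> carrier FS" using z(1) by simp
  then have "P (TN +>\<^bsub>MA\<^esub> z)"
  proof (induct z rule: free_space_induct)
    case zero
    then show ?case using q.coset_zero assms(2) q.vquot_simps(1) by (simp add: enveloping_eq)
  next
    case (single p c g)
    obtain a b where p: "p = (a, b)" "a \<in> carrier A" "b \<in> carrier A" using single(1) by blast
    have s: "Poly_Mapping.single p c \<in> carrier MA" "g \<in> carrier MA" using single p by auto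
    have "TN +>\<^bsub>MA\<^esub> Poly_Mapping.single p c = ten (c \<odot>\<^bsub>A\<^esub> a) b"
      using mod_hom_smult [OF h, of c "Poly_Mapping.single p 1"] p by (simp add: ten_coset [symmetric] ten_scale)
    then have "P (TN +>\<^bsub>MA\<^esub> Poly_Mapping.single p c)" using assms(3) p by simp
    then show ?case
      using assms(4) [OF mod_hom_closed [OF h s(1)] mod_hom_closed [OF h s(2)]] single(3)
        mod_hom_add [OF h s] by simp
  qed
  then show ?thesis using z(2) by simp
qed

end

lemma (in enveloping_algebra) enveloping_extend_hom:
  assumes "lmodule ground U" "\<And>b. b \<in> carrier A \<Longrightarrow> (\<lambda>a. \<beta> a b) \<in> mod_hom ground A U"
    "\<And>a. a \<in> carrier A \<Longrightarrow> \<beta> a \<in> mod_hom ground A U"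
  shows "on_coset (linear_extension U (case_prod \<beta>)) \<in> mod_hom ground E U"
    and "\<And>a b. \<lbrakk>a \<in> carrier A; b \<in> carrier A\<rbrakk> \<Longrightarrow> on_coset (linear_extension U (case_prod \<beta>)) (ten a b) = \<beta> a b"
proof -
  have c: "\<beta> a b \<in> carrier U" if "a \<in> carrier A" "b \<in> carrier A" for a b
    using mod_hom_closed [OF assms(3) [OF that(1)] that(2)] .
  have l: "\<beta> (a \<oplus>\<^bsub>A\<^esub> a') b = \<beta> a b \<oplus>\<^bsub>U\<^esub> \<beta> a' b" if "a \<in> carrier A" "a' \<in> carrier A" "b \<in> carrier A" for a a' b
    using mod_hom_add [OF assms(2) [OF that(3)] that(1,2)] .
  have r: "\<beta> a (b \<oplus>\<^bsub>A\<^esub> b') = \<beta> a b \<oplus>\<^bsub>U\<^esub> \<beta> a b'" if "a \<in> carrier A" "b \<in> carrier A" "b' \<in> carrier A" for a b b'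
    using mod_hom_add [OF assms(3) [OF that(1)] that(2,3)] .
  have sl: "\<beta> (c \<odot>\<^bsub>A\<^esub> a) b = c \<odot>\<^bsub>U\<^esub> \<beta> a b" if "a \<in> carrier A" "b \<in> carrier A" for c a b
    using mod_hom_smult [OF assms(2) [OF that(2)], of c a] that(1) by simp
  have sr: "\<beta> a (c \<odot>\<^bsub>A\<^esub> b) = c \<odot>\<^bsub>U\<^esub> \<beta> a b" if "a \<in> carrier A" "b \<in> carrier A" for c a b
    using mod_hom_smult [OF assms(3) [OF that(1)], of c b] that(2) by simp
  show "on_coset (linear_extension U (case_prod \<beta>)) \<in> mod_hom ground E U"
    by (rule enveloping_extend(1) [OF assms(1) c l r sl sr])
  show "on_coset (linear_extension U (case_prod \<beta>)) (ten a b) = \<beta> a b" if "a \<in> carrier A" "b \<in> carrier A" for a b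
    by (rule enveloping_extend(2) [OF assms(1) c l r sl sr that])
qed

section \<open>The free algebra as a ring type\<close>

text \<open>
  With the words as an additive monoid, the finitely supported functions on words form a ring under
  convolution, and identities in the free algebra become identities in a type of class \<open>ring_1\<close>.
\<close>

instantiation list :: (type) monoid_add
begin
definition zero_list_def: "0 = []"
definition plus_list_def: "xs + ys = xs @ (ys :: 'a list)"
instance by standard (simp_all add: zero_list_def plus_list_def)
end

abbreviation word :: "nat list \<Rightarrow> (nat list \<Rightarrow>\<^sub>0 'k::field)" where "word w \<equiv> Poly_Mapping.single w 1"
abbreviation scalar :: "'k::field \<Rightarrow> (nat list \<Rightarrow>\<^sub>0 'k)" where "scalar c \<equiv> Poly_Mapping.single [] c"

lemma scale_eq: "Poly_Mapping.map ((*) c) f = scalar c * (f :: nat list \<Rightarrow>\<^sub>0 'k::field)"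
  using mult_map_scale_conv_mult [of c f] by (simp add: zero_list_def)

lemma word_mult: "Poly_Mapping.single u a * Poly_Mapping.single v b = Poly_Mapping.single (u @ v) (a * (b::'k::field))"
  by (simp add: mult_single plus_list_def)

lemma word_one: "word [] = 1"
  by (metis single_one zero_list_def)

lemma single_scalar: "Poly_Mapping.single w c = scalar c * word w"
  by (simp add: word_mult)

lemma sum_single: "(\<Sum>w\<in>Poly_Mapping.keys f. Poly_Mapping.single w (Poly_Mapping.lookup f w)) = f"
  by (rule poly_mapping_eqI) (auto simp: lookup_sum lookup_single when_def sum.delta in_keys_iff)

lemma word_induct [case_names zero single]:
  assumes "P 0" "\<And>w c g. P g \<Longrightarrow> P (scalar c * word w + g)"
  shows "P (f :: nat list \<Rightarrow>\<^sub>0 'k::field)"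
proof -
  have "f \<in> carrier (free_space UNIV)" by simp
  then show ?thesis
    by (induct f rule: free_space_induct) (use assms single_scalar in metis)+
qed

lemma scalar_commute: "f * scalar c = scalar c * (f :: nat list \<Rightarrow>\<^sub>0 'k::field)"
proof (induct f rule: word_induct)
  case (single w d g)
  have "scalar d * word w * scalar c = scalar c * (scalar d * word w)"
    by (simp add: word_mult mult.commute)
  with single show ?case by (simp add: distrib_left distrib_right)
qed simp

lemma scalar_left_commute: "f * (scalar c * g) = scalar c * (f * (g :: nat list \<Rightarrow>\<^sub>0 'k::field))"
  by (metis mult.assoc scalar_commute)

lemma free_algebra_simps [simp]:
  "carrier (free_algebra m) = {f. Poly_Mapping.keys f \<subseteq> lists {1..m}}" "\<zero>\<^bsub>free_algebra m\<^esub> = 0"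
  "f \<oplus>\<^bsub>free_algebra m\<^esub> g = f + g" "c \<odot>\<^bsub>free_algebra m\<^esub> f = scalar c * f" "\<one>\<^bsub>free_algebra m\<^esub> = 1"
  by (simp_all add: free_algebra_def word_monoid_def word_one scale_eq)

lemma free_algebra_mult [simp]: "f \<otimes>\<^bsub>free_algebra m\<^esub> g = f * g"
proof -
  have "f * g = (\<Sum>u\<in>Poly_Mapping.keys f. Poly_Mapping.single u (Poly_Mapping.lookup f u)) *
      (\<Sum>v\<in>Poly_Mapping.keys g. Poly_Mapping.single v (Poly_Mapping.lookup g v))"
    by (simp only: sum_single)
  also have "\<dots> = f \<otimes>\<^bsub>free_algebra m\<^esub> g"
    unfolding sum_product by (simp add: free_algebra_def monoid_algebra_def word_mult word_monoid_def)
  finally show ?thesis ..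
qed

lemma kalgebra_free_algebra: "kalgebra (free_algebra m :: ('k::field, nat list \<Rightarrow>\<^sub>0 'k) module)"
  unfolding free_algebra_def
  by (rule kalgebra_monoid_algebra, rule monoidI) (auto simp: word_monoid_def)

text \<open>
  The subalgebra generated by the letters in \<open>X\<close>.  Which letters occur is relevant because the last
  letter is treated differently from the others.
\<close>

definition poly_over :: "nat set \<Rightarrow> (nat list \<Rightarrow>\<^sub>0 'k::field) set" where
  "poly_over X = {f. Poly_Mapping.keys f \<subseteq> lists X}"

lemma poly_over_closed:
  shows poly_over_0: "0 \<in> poly_over X" and poly_over_1: "1 \<in> poly_over X"
    and poly_over_add: "\<lbrakk>f \<in> poly_over X; g \<in> poly_over X\<rbrakk> \<Longrightarrow> f + g \<in> poly_over X"
    and poly_over_diff: "\<lbrakk>f \<in> poly_over X; g \<in> poly_over X\<rbrakk> \<Longrightarrow> f - g \<in> poly_over X"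
    and poly_over_uminus: "f \<in> poly_over X \<Longrightarrow> - f \<in> poly_over X"
    and poly_over_mult: "\<lbrakk>f \<in> poly_over X; g \<in> poly_over X\<rbrakk> \<Longrightarrow> f * g \<in> poly_over X"
    and poly_over_word: "w \<in> lists X \<Longrightarrow> Poly_Mapping.single w c \<in> poly_over X"
proof -
  show "0 \<in> poly_over X" "1 \<in> poly_over X" "w \<in> lists X \<Longrightarrow> Poly_Mapping.single w c \<in> poly_over X"
    by (auto simp: poly_over_def zero_list_def)
  show "f + g \<in> poly_over X" if "f \<in> poly_over X" "g \<in> poly_over X"
    using that keys_add [of f g] by (auto simp: poly_over_def)
  show "f - g \<in> poly_over X" if "f \<in> poly_over X" "g \<in> poly_over X"
  proof -
    have "Poly_Mapping.keys (f - g) \<subseteq> Poly_Mapping.keys f \<union> Poly_Mapping.keys g"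
      by (auto simp: in_keys_iff lookup_minus)
    then show ?thesis using that by (auto simp: poly_over_def)
  qed
  show "- f \<in> poly_over X" if "f \<in> poly_over X"
    using that by (auto simp: poly_over_def in_keys_iff)
  show "f * g \<in> poly_over X" if "f \<in> poly_over X" "g \<in> poly_over X"
    using that keys_mult [of f g] by (force simp: poly_over_def plus_list_def)
qed

lemma poly_over_scalar: "scalar c \<in> poly_over X"
  by (rule poly_over_word) simp

lemma poly_over_sum: "(\<And>i. i \<in> I \<Longrightarrow> f i \<in> poly_over X) \<Longrightarrow> (\<Sum>i\<in>I. f i) \<in> poly_over X"
  by (induct I rule: infinite_finite_induct) (simp_all add: poly_over_0 poly_over_add)

lemma poly_over_mono: "X \<subseteq> Y \<Longrightarrow> poly_over X \<subseteq> poly_over Y"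
  unfolding poly_over_def using lists_mono by blast

lemma carrier_free_algebra: "carrier (free_algebra m) = poly_over {1..m}"
  by (simp add: poly_over_def)

lemma poly_over_induct [consumes 1, case_names zero single]:
  assumes "f \<in> poly_over X" "P 0"
    and "\<And>w c g. \<lbrakk>w \<in> lists X; g \<in> poly_over X; P g\<rbrakk> \<Longrightarrow> P (scalar c * word w + g)"
  shows "P (f :: nat list \<Rightarrow>\<^sub>0 'k::field)"
proof -
  have "f \<in> carrier (free_space (lists X))" using assms(1) by (simp add: poly_over_def)
  then show ?thesis
    by (induct f rule: free_space_induct)
      (use assms(2,3) in \<open>auto simp: poly_over_def single_scalar [symmetric] simp del: scale_single\<close>)
qed

section \<open>Linear maps given on words\<close>

definition on_words :: "(nat list \<Rightarrow> (nat list \<Rightarrow>\<^sub>0 'k)) \<Rightarrow> (nat list \<Rightarrow>\<^sub>0 'k::field) \<Rightarrow> (nat list \<Rightarrow>\<^sub>0 'k)" where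
  "on_words \<phi> f = (\<Sum>w\<in>Poly_Mapping.keys f. scalar (Poly_Mapping.lookup f w) * \<phi> w)"

lemma on_words_superset:
  assumes "finite S" "Poly_Mapping.keys f \<subseteq> S"
  shows "on_words \<phi> f = (\<Sum>w\<in>S. scalar (Poly_Mapping.lookup f w) * \<phi> w)"
  unfolding on_words_def by (rule sum.mono_neutral_left [OF assms]) (simp add: in_keys_iff)

lemma on_words_add: "on_words \<phi> (f + g) = on_words \<phi> f + on_words \<phi> g"
  using on_words_superset [of "Poly_Mapping.keys f \<union> Poly_Mapping.keys g" _ \<phi>] keys_add [of f g]
  by (simp add: lookup_add single_add distrib_right sum.distrib)

lemma on_words_0 [simp]: "on_words \<phi> 0 = 0"
  by (simp add: on_words_def)

lemma on_words_scale: "on_words \<phi> (scalar c * f) = scalar c * on_words \<phi> f"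
proof -
  have "on_words \<phi> (Poly_Mapping.map ((*) c) f) = scalar c * on_words \<phi> f"
    using on_words_superset [OF _ keys_scale [of c f]]
    by (simp add: on_words_def sum_distrib_left word_mult mult.assoc [symmetric])
  then show ?thesis by (simp only: scale_eq)
qed

lemma on_words_word [simp]: "on_words \<phi> (word w) = \<phi> w"
  by (simp add: on_words_def word_one)

lemma on_words_sum: "on_words \<phi> (\<Sum>i\<in>I. f i) = (\<Sum>i\<in>I. on_words \<phi> (f i))"
  by (induct I rule: infinite_finite_induct) (simp_all add: on_words_add)

lemma on_words_uminus: "on_words \<phi> (- f) = - on_words \<phi> f"
  using on_words_add [of \<phi> f "- f"] by (simp add: eq_neg_iff_add_eq_0 add.commute)

lemma on_words_diff: "on_words \<phi> (f - g) = on_words \<phi> f - on_words \<phi> g"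
  using on_words_add [of \<phi> f "- g"] by (simp add: on_words_uminus)

lemma on_words_closed:
  assumes "f \<in> poly_over X" "\<And>w. w \<in> lists X \<Longrightarrow> \<phi> w \<in> poly_over Y"
  shows "on_words \<phi> f \<in> poly_over Y"
  unfolding on_words_def
proof (intro poly_over_sum poly_over_mult poly_over_scalar assms(2))
  show "w \<in> lists X" if "w \<in> Poly_Mapping.keys f" for w
    using that assms(1) by (auto simp: poly_over_def)
qed

section \<open>Division by a polynomial with a leading word\<close>

text \<open>
  The quotient of the word \<open>w\<close> on right division by a polynomial \<open>u\<close> with leading word \<open>s\<close>.  If
  \<open>w = x s\<close>, then \<open>w = x u - \<Sum> u\<^sub>c x c\<close> with a sum over the words \<open>c\<close> of \<open>u\<close> shorter than \<open>s\<close>, and the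
  words \<open>x c\<close> are divided in their turn; if \<open>w\<close> does not end in \<open>s\<close>, it belongs to the remainder.
\<close>

function divide_word :: "(nat list \<Rightarrow>\<^sub>0 'k::field) \<Rightarrow> nat list \<Rightarrow> nat list \<Rightarrow> (nat list \<Rightarrow>\<^sub>0 'k)" where
  "divide_word u s w =
     (if length s \<le> length w \<and> drop (length w - length s) w = s then
        word (take (length w - length s) w) - (\<Sum>c\<in>{c \<in> Poly_Mapping.keys u. length c < length s}.
          scalar (Poly_Mapping.lookup u c) * divide_word u s (take (length w - length s) w @ c))
      else 0)"
  by auto
termination
  by (relation "measure (\<lambda>(u, s, w). length w)") auto

declare divide_word.simps [simp del]

definition right_divide where "right_divide u s = on_words (divide_word u s)"

text \<open>
  A left inverse of the multiplication by \<open>u\<close>: the first step of the division of \<open>w u\<close> splits off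
  \<open>w\<close>, and the recursive calls it makes are those that the lower terms of \<open>w u\<close> contribute.
\<close>

lemma right_divide_mult:
  assumes "Poly_Mapping.lookup u s = 1"
    and "\<And>c. c \<in> Poly_Mapping.keys u \<Longrightarrow> c = s \<or> length c < length s"
  shows "right_divide u s (x * u) = x"
proof (induct x rule: word_induct)
  case zero
  then show ?case by (simp add: right_divide_def)
next
  case (single w c x)
  let ?low = "{c \<in> Poly_Mapping.keys u. length c < length s}"
  have s: "s \<in> Poly_Mapping.keys u" using assms(1) by (simp add: in_keys_iff)
  have k: "Poly_Mapping.keys u = insert s ?low" "s \<notin> ?low" "finite ?low"
    using assms(2) s by auto
  have u: "u = word s + (\<Sum>c\<in>?low. scalar (Poly_Mapping.lookup u c) * word c)"
  proof -
    have "u = (\<Sum>w\<in>insert s ?low. Poly_Mapping.single w (Poly_Mapping.lookup u w))"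
      unfolding k(1) [symmetric] by (rule sum_single [symmetric])
    also have "\<dots> = word s + (\<Sum>c\<in>?low. Poly_Mapping.single c (Poly_Mapping.lookup u c))"
      using k(2,3) assms(1) by simp
    finally show ?thesis by (simp only: single_scalar [symmetric])
  qed
  have e: "word w * u = word (w @ s) + (\<Sum>c\<in>?low. scalar (Poly_Mapping.lookup u c) * word (w @ c))"
    by (subst u) (simp add: distrib_left sum_distrib_left word_mult)
  have "right_divide u s (word w * u) =
      divide_word u s (w @ s) + (\<Sum>c\<in>?low. scalar (Poly_Mapping.lookup u c) * divide_word u s (w @ c))"
    unfolding e right_divide_def by (simp only: on_words_add on_words_sum on_words_scale on_words_word)
  also have "\<dots> = word w"
    by (subst divide_word.simps) simp
  finally have w: "right_divide u s (word w * u) = word w" .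
  have "(scalar c * word w + x) * u = scalar c * (word w * u) + x * u"
    by (simp add: distrib_right mult.assoc)
  then show ?case
    using single w by (simp add: right_divide_def on_words_add on_words_scale)
qed

lemma divide_word_closed:
  assumes "u \<in> poly_over X"
  shows "w \<in> lists X \<Longrightarrow> divide_word u s w \<in> poly_over X"
  using assms
proof (induct u s w rule: divide_word.induct)
  case (1 u s w)
  have t: "take k w \<in> lists X" for k using 1(2) set_take_subset by (fastforce simp: in_lists_conv_set)
  have c: "c \<in> lists X" if "c \<in> Poly_Mapping.keys u" for c using that 1(3) by (auto simp: poly_over_def)
  show ?case
    by (subst divide_word.simps)
      (use 1 t c in \<open>auto intro!: poly_over_diff poly_over_sum poly_over_mult poly_over_scalar poly_over_word
        poly_over_0 simp del: lists.simps\<close>)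
qed

lemma right_divide_closed:
  "\<lbrakk>u \<in> poly_over X; x \<in> poly_over X\<rbrakk> \<Longrightarrow> right_divide u s x \<in> poly_over X"
  unfolding right_divide_def by (rule on_words_closed [where X = X], assumption) (rule divide_word_closed)

lemma right_divide_linear:
  "right_divide u s (x + y) = right_divide u s x + right_divide u s y"
  "right_divide u s (scalar c * x) = scalar c * right_divide u s x"
  by (simp_all add: right_divide_def on_words_add on_words_scale)

section \<open>Continuants\<close>

declare shifted_continuant.simps(3) [simp del]

lemma shifted_continuant_rec:
  "shifted_continuant m (Suc (Suc j)) = shifted_continuant m (Suc j) * word [Suc j] + shifted_continuant m j"
  by (simp add: shifted_continuant.simps(3))

text \<open>
  The longest word of \<open>K\<^sub>j\<close> is \<open>z\<^sub>1 \<dots> z\<^sub>j\<close>, with coefficient \<open>1\<close>, and all others are strictly shorter.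
  The last conjunct, about \<open>K\<^bsub>j-1\<^esub>\<close>, makes the recursion of depth two accessible to simple induction.
\<close>

lemma shifted_continuant_keys:
  "(c \<in> Poly_Mapping.keys (shifted_continuant m (Suc j) :: nat list \<Rightarrow>\<^sub>0 'k::field) \<longrightarrow>
      c \<in> lists {1..j} \<and> (c = [1..<Suc j] \<or> length c < j)) \<and>
    Poly_Mapping.lookup (shifted_continuant m (Suc j) :: nat list \<Rightarrow>\<^sub>0 'k) [1..<Suc j] = 1 \<and>
   (c \<in> Poly_Mapping.keys (shifted_continuant m j :: nat list \<Rightarrow>\<^sub>0 'k) \<longrightarrow> c \<in> lists {1..j} \<and> length c < j)"
proof (induct j arbitrary: c)
  case 0
  then show ?case by (simp add: zero_list_def lookup_one when_def)
next
  case (Suc j)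
  let ?K = "shifted_continuant m :: nat \<Rightarrow> nat list \<Rightarrow>\<^sub>0 'k"
  have l: "lists {1..j} \<subseteq> lists {1..Suc j}" by (intro lists_mono) auto
  have A: "c \<in> lists {1..Suc j} \<and> (c = [1..<Suc (Suc j)] \<or> length c < Suc j)"
    if "c \<in> Poly_Mapping.keys (?K (Suc (Suc j)))"
  proof -
    from that consider "c \<in> Poly_Mapping.keys (?K (Suc j) * word [Suc j])" | "c \<in> Poly_Mapping.keys (?K j)"
      unfolding shifted_continuant_rec using keys_add [of "?K (Suc j) * word [Suc j]" "?K j"] by blast
    then show ?thesis
    proof cases
      case 1
      then obtain a where a: "a \<in> Poly_Mapping.keys (?K (Suc j))" "c = a @ [Suc j]"
        using keys_mult [of "?K (Suc j)" "word [Suc j]"] by (auto simp: plus_list_def split: if_splits)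
      then have "a \<in> lists {1..j}" "a = [1..<Suc j] \<or> length a < j" using Suc by auto
      then show ?thesis using a l by auto
    next
      case 2
      then show ?thesis using Suc l by fastforce
    qed
  qed
  have "Poly_Mapping.lookup (?K (Suc j) * word [Suc j]) ([1..<Suc j] @ [Suc j]) = 1"
  proof -
    have "Poly_Mapping.lookup (f * word [i]) (c @ [i]) = Poly_Mapping.lookup f c" for f :: "nat list \<Rightarrow>\<^sub>0 'k" and c i
      by (induct f rule: word_induct)
        (auto simp: distrib_right mult.assoc word_mult lookup_add lookup_single when_def)
    then show ?thesis using Suc by simp
  qed
  moreover have "Poly_Mapping.lookup (?K j) ([1..<Suc j] @ [Suc j]) = 0"
    using Suc [of "[1..<Suc j] @ [Suc j]"] by (auto simp: in_keys_iff)
  ultimately have B: "Poly_Mapping.lookup (?K (Suc (Suc j))) [1..<Suc (Suc j)] = 1"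
    by (simp add: shifted_continuant_rec lookup_add)
  show ?case using A B Suc l by fastforce
qed

lemma shifted_continuant_over: "shifted_continuant m (Suc j) \<in> poly_over {1..j}"
  "shifted_continuant m j \<in> poly_over {1..j}"
  using shifted_continuant_keys [of _ m j] by (auto simp: poly_over_def)

section \<open>The twisted action\<close>

text \<open>
  The cofactor \<open>K\<^bsub>m-1\<^esub>\<close> of \<open>z\<^sub>m\<close> in \<open>r = 1 + K\<^bsub>m-1\<^esub> z\<^sub>m + K\<^bsub>m-2\<^esub>\<close>.  Because of the shift of the indices,
  \<open>K\<^bsub>m-2\<^esub>\<close> is \<open>shifted_continuant m (m - 1)\<close>.
\<close>

abbreviation cofactor :: "nat \<Rightarrow> (nat list \<Rightarrow>\<^sub>0 'k::field)" where
  "cofactor m \<equiv> shifted_continuant m m"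

text \<open>
  The list \<open>[1..<m]\<close> is the leading word \<open>z\<^sub>1 \<dots> z\<^bsub>m-1\<^esub>\<close> of the cofactor.
\<close>

abbreviation quotient_by_cofactor :: "nat \<Rightarrow> (nat list \<Rightarrow>\<^sub>0 'k::field) \<Rightarrow> (nat list \<Rightarrow>\<^sub>0 'k)" where
  "quotient_by_cofactor m \<equiv> right_divide (cofactor m) [1..<m]"

lemma relator_eq:
  "0 < m \<Longrightarrow> relator m = 1 + cofactor m * word [m] + shifted_continuant m (m - 1)"
  by (cases m) (simp_all add: relator_def shifted_continuant_rec add.assoc)

lemma cofactor_over: "0 < m \<Longrightarrow> cofactor m \<in> poly_over {1..<m}"
  by (cases m) (use shifted_continuant_over(1) in \<open>auto simp: atLeastLessThanSuc_atLeastAtMost\<close>)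

lemma lower_over: "0 < m \<Longrightarrow> shifted_continuant m (m - 1) \<in> poly_over {1..<m}"
  by (cases m) (use shifted_continuant_over(2) in \<open>auto simp: atLeastLessThanSuc_atLeastAtMost\<close>)

lemma quotient_cofactor:
  assumes "0 < m"
  shows "quotient_by_cofactor m (x * cofactor m) = (x :: nat list \<Rightarrow>\<^sub>0 'k::field)"
proof -
  obtain n where m: "m = Suc n" using assms by (cases m) auto
  have len: "length [1..<Suc n] = n" by simp
  show ?thesis
    unfolding m
  proof (rule right_divide_mult)
    show "Poly_Mapping.lookup (shifted_continuant (Suc n) (Suc n) :: nat list \<Rightarrow>\<^sub>0 'k) [1..<Suc n] = 1"
      using shifted_continuant_keys by blast
    show "c = [1..<Suc n] \<or> length c < length [1..<Suc n]"
      if "c \<in> Poly_Mapping.keys (shifted_continuant (Suc n) (Suc n) :: nat list \<Rightarrow>\<^sub>0 'k)" for c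
      using that shifted_continuant_keys unfolding len by blast
  qed
qed

text \<open>
  The operator by which a letter acts.  With \<open>u = K\<^bsub>m-1\<^esub>\<close> and \<open>x = q u + y\<close>, where \<open>q\<close> is the
  quotient of \<open>x\<close> by \<open>u\<close>, the letter \<open>z\<^sub>m\<close> sends \<open>x\<close> to \<open>q (- 1 - K\<^bsub>m-2\<^esub>) + y z\<^sub>m\<close>.  This is
  \<open>x z\<^sub>m - q r\<close>: the part of \<open>x\<close> to which the relation applies is rewritten by means of
  \<open>u z\<^sub>m = - 1 - K\<^bsub>m-2\<^esub>\<close>.
\<close>

definition twisted_step :: "nat \<Rightarrow> nat \<Rightarrow> (nat list \<Rightarrow>\<^sub>0 'k::field) \<Rightarrow> (nat list \<Rightarrow>\<^sub>0 'k)" where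
  "twisted_step m i x =
     (if i = m then quotient_by_cofactor m x * (- 1 - shifted_continuant m (m - 1))
        + (x - quotient_by_cofactor m x * cofactor m) * word [m]
      else x * word [i])"

text \<open>
  The free algebra is free, so any choice of operators for the letters extends to a right action.
\<close>

definition twisted_action :: "nat \<Rightarrow> (nat list \<Rightarrow>\<^sub>0 'k::field) \<Rightarrow> (nat list \<Rightarrow>\<^sub>0 'k) \<Rightarrow> (nat list \<Rightarrow>\<^sub>0 'k)" where
  "twisted_action m x f = on_words (\<lambda>w. fold (twisted_step m) w x) f"

lemma twisted_step_linear:
  "twisted_step m i (x + y) = twisted_step m i x + twisted_step m i y"
  "twisted_step m i (scalar c * x) = scalar c * twisted_step m i x"
  by (simp_all add: twisted_step_def right_divide_linear algebra_simps)

lemma twisted_fold_linear: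
  "fold (twisted_step m) w (x + y) = fold (twisted_step m) w x + fold (twisted_step m) w y"
  "fold (twisted_step m) w (scalar c * x) = scalar c * fold (twisted_step m) w x"
  by (induct w arbitrary: x y) (simp_all add: twisted_step_linear)

lemma twisted_action_right:
  "twisted_action m x (f + g) = twisted_action m x f + twisted_action m x g"
  "twisted_action m x (f - g) = twisted_action m x f - twisted_action m x g"
  "twisted_action m x (scalar c * f) = scalar c * twisted_action m x f"
  "twisted_action m x 0 = 0" "twisted_action m x 1 = x"
  "twisted_action m x (word w) = fold (twisted_step m) w x"
proof -
  have "on_words (\<lambda>w. fold (twisted_step m) w x) (word []) = x" by (simp only: on_words_word) simp
  then show "twisted_action m x 1 = x" by (simp add: twisted_action_def word_one)
qed (simp_all add: twisted_action_def on_words_add on_words_diff on_words_scale)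

lemma twisted_action_left:
  "twisted_action m (x + y) f = twisted_action m x f + twisted_action m y f"
  "twisted_action m (scalar c * x) f = scalar c * twisted_action m x f"
proof -
  show "twisted_action m (x + y) f = twisted_action m x f + twisted_action m y f"
    by (induct f rule: word_induct) (simp_all add: twisted_action_right twisted_fold_linear algebra_simps)
  show "twisted_action m (scalar c * x) f = scalar c * twisted_action m x f"
    by (induct f rule: word_induct)
      (simp_all add: twisted_action_right twisted_fold_linear distrib_left scalar_left_commute [of "scalar _"])
qed

lemma twisted_action_zero: "twisted_action m 0 f = 0"
  using twisted_action_left(2) [of m 0 0 f] by simp

lemma twisted_action_mult:
  "twisted_action m x (f * g) = twisted_action m (twisted_action m x f) g"
proof (induct f rule: word_induct)
  case zero
  then show ?case by (simp add: twisted_action_right twisted_action_zero)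
next
  case (single v c f)
  have "twisted_action m x (word v * g) = twisted_action m (fold (twisted_step m) v x) g"
  proof (induct g rule: word_induct)
    case zero
    then show ?case by (simp add: twisted_action_right)
  next
    case (single w d g)
    have "word v * (scalar d * word w + g) = scalar d * word (v @ w) + word v * g"
      by (simp add: distrib_left scalar_left_commute word_mult)
    then show ?case using single by (simp add: twisted_action_right del: mult_1_right)
  qed
  with single show ?case
    by (simp add: distrib_right mult.assoc twisted_action_right twisted_action_left)
qed

lemma twisted_action_below:
  assumes "f \<in> poly_over {1..<m}"
  shows "twisted_action m x f = x * f"
proof -
  have w: "fold (twisted_step m) w x = x * word w" if "w \<in> lists {1..<m}" for w x
    using that
  proof (induct w arbitrary: x)
    case (Cons i w)
    then show ?case by (simp add: twisted_step_def mult.assoc word_mult)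
  qed (simp add: word_one)
  show ?thesis
    using assms by (induct f rule: poly_over_induct)
      (simp_all add: twisted_action_right w distrib_left scalar_left_commute)
qed

text \<open>
  The words of \<open>K\<^bsub>m-1\<^esub>\<close> and \<open>K\<^bsub>m-2\<^esub>\<close> do not contain \<open>z\<^sub>m\<close> and act by multiplication.  Dividing
  \<open>x K\<^bsub>m-1\<^esub>\<close> by \<open>K\<^bsub>m-1\<^esub>\<close> gives \<open>x\<close> with remainder \<open>0\<close>, so \<open>K\<^bsub>m-1\<^esub> z\<^sub>m\<close> sends \<open>x\<close> to
  \<open>x (- 1 - K\<^bsub>m-2\<^esub>)\<close>.
\<close>

lemma twisted_action_relator:
  assumes "0 < m"
  shows "twisted_action m x (relator m) = (0 :: nat list \<Rightarrow>\<^sub>0 'k::field)"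
proof -
  have "twisted_action m x (cofactor m * word [m]) = x * (- 1 - shifted_continuant m (m - 1))"
    by (simp add: twisted_action_mult twisted_action_below [OF cofactor_over [OF assms]] twisted_action_right
      twisted_step_def quotient_cofactor [OF assms, simplified])
  then have "twisted_action m x (relator m) =
      x + x * (- 1 - shifted_continuant m (m - 1)) + x * shifted_continuant m (m - 1)"
    by (simp only: relator_eq [OF assms] twisted_action_right twisted_action_below [OF lower_over [OF assms]])
  then show ?thesis by (simp add: algebra_simps)
qed

lemma relator_closed: "relator m \<in> carrier (free_algebra m)"
proof -
  have "shifted_continuant m (Suc m) \<in> poly_over {1..m}" by (rule shifted_continuant_over)
  then have "(1 + shifted_continuant m (Suc m)) \<in> poly_over {1..m}"
    by (rule poly_over_add [OF poly_over_1])
  then show ?thesis unfolding carrier_free_algebra by (simp add: relator_def)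
qed

lemma relator_ideal: "ideal (relator_ideal m) (free_algebra m :: ('k::field, nat list \<Rightarrow>\<^sub>0 'k) module)"
proof -
  interpret F: kalgebra "free_algebra m :: ('k, nat list \<Rightarrow>\<^sub>0 'k) module" by (rule kalgebra_free_algebra)
  show ?thesis unfolding relator_ideal_def
    by (rule F.A.genideal_ideal) (use relator_closed in blast)
qed

lemma relator_ideal_closed:
  fixes f g :: "nat list \<Rightarrow>\<^sub>0 'k::field"
  shows "relator m \<in> (relator_ideal m :: (nat list \<Rightarrow>\<^sub>0 'k) set)" "(0 :: nat list \<Rightarrow>\<^sub>0 'k) \<in> relator_ideal m"
    "f \<in> relator_ideal m \<Longrightarrow> f \<in> poly_over {1..m}"
    "\<lbrakk>f \<in> relator_ideal m; g \<in> relator_ideal m\<rbrakk> \<Longrightarrow> f + g \<in> relator_ideal m"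
    "\<lbrakk>f \<in> relator_ideal m; g \<in> poly_over {1..m}\<rbrakk> \<Longrightarrow> f * g \<in> relator_ideal m"
    "\<lbrakk>f \<in> relator_ideal m; g \<in> poly_over {1..m}\<rbrakk> \<Longrightarrow> g * f \<in> relator_ideal m"
    "\<lbrakk>J \<subseteq> poly_over {1..m}; relator m \<in> J; 0 \<in> J; \<And>f g. \<lbrakk>f \<in> J; g \<in> J\<rbrakk> \<Longrightarrow> f + g \<in> J;
       \<And>f g. \<lbrakk>f \<in> J; g \<in> poly_over {1..m}\<rbrakk> \<Longrightarrow> f * g \<in> J;
       \<And>f g. \<lbrakk>f \<in> J; g \<in> poly_over {1..m}\<rbrakk> \<Longrightarrow> g * f \<in> J\<rbrakk> \<Longrightarrow> relator_ideal m \<subseteq> (J :: (nat list \<Rightarrow>\<^sub>0 'k) set)"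
proof -
  let ?F = "free_algebra m :: ('k, nat list \<Rightarrow>\<^sub>0 'k) module"
  interpret F: kalgebra ?F by (rule kalgebra_free_algebra)
  interpret I: ideal "relator_ideal m" ?F by (rule relator_ideal)
  show "relator m \<in> (relator_ideal m :: (nat list \<Rightarrow>\<^sub>0 'k) set)"
    unfolding relator_ideal_def by (rule F.A.genideal_self' [OF relator_closed])
  show "(0 :: nat list \<Rightarrow>\<^sub>0 'k) \<in> relator_ideal m" using I.zero_closed by simp
  show "f \<in> relator_ideal m \<Longrightarrow> f \<in> poly_over {1..m}" using I.a_Hcarr carrier_free_algebra by blast
  show "\<lbrakk>f \<in> relator_ideal m; g \<in> relator_ideal m\<rbrakk> \<Longrightarrow> f + g \<in> relator_ideal m"
    using I.a_closed [of f g] by simp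
  show "\<lbrakk>f \<in> relator_ideal m; g \<in> poly_over {1..m}\<rbrakk> \<Longrightarrow> f * g \<in> relator_ideal m"
    "\<lbrakk>f \<in> relator_ideal m; g \<in> poly_over {1..m}\<rbrakk> \<Longrightarrow> g * f \<in> relator_ideal m"
    using I.I_r_closed [of f g] I.I_l_closed [of f g] by (simp_all add: poly_over_def)
  assume J: "J \<subseteq> poly_over {1..m}" "relator m \<in> J" "0 \<in> J" "\<And>f g. \<lbrakk>f \<in> J; g \<in> J\<rbrakk> \<Longrightarrow> f + g \<in> J"
    "\<And>f g. \<lbrakk>f \<in> J; g \<in> poly_over {1..m}\<rbrakk> \<Longrightarrow> f * g \<in> J" "\<And>f g. \<lbrakk>f \<in> J; g \<in> poly_over {1..m}\<rbrakk> \<Longrightarrow> g * f \<in> J"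
  have "ideal J ?F"
  proof (rule idealI [OF F.A.ring_axioms])
    have "submodule J ground ?F"
    proof (rule lmodule_ground_submoduleI [OF F.lmodule_axioms])
      show "J \<subseteq> carrier ?F" using J(1) by (simp only: carrier_free_algebra)
      show "c \<odot>\<^bsub>?F\<^esub> x \<in> J" if "x \<in> J" for c x
        using J(6) [OF that poly_over_scalar] by simp
    qed (simp_all add: J)
    then show "subgroup J (add_monoid ?F)" by (rule submodule.axioms(1))
  qed (use J in \<open>simp_all add: poly_over_def\<close>)
  then show "relator_ideal m \<subseteq> J"
    unfolding relator_ideal_def by (rule F.A.genideal_minimal) (use J in simp)
qed

lemma twisted_action_ideal:
  assumes "0 < m" "f \<in> relator_ideal m"
  shows "twisted_action m x f = (0 :: nat list \<Rightarrow>\<^sub>0 'k::field)"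
proof -
  have "relator_ideal m \<subseteq> {f \<in> poly_over {1..m}. \<forall>x. twisted_action m x f = (0 :: nat list \<Rightarrow>\<^sub>0 'k)}"
    by (rule relator_ideal_closed(7))
      (use relator_closed [unfolded carrier_free_algebra] in \<open>auto simp: poly_over_closed twisted_action_right twisted_action_mult
        twisted_action_zero twisted_action_relator [OF assms(1)]\<close>)
  then show ?thesis using assms(2) by blast
qed

text \<open>
  Modulo the ideal, the action is ordinary multiplication, because each letter acts as usual up to
  a multiple of the relator.
\<close>

lemma twisted_action_closed:
  assumes "0 < m" and x: "x \<in> poly_over {1..m}" and f: "f \<in> poly_over {1..m}"
  shows "twisted_action m x f \<in> poly_over {1..m}"
    and "twisted_action m x f - x * f \<in> relator_ideal m"
proof -
  have sub: "poly_over {1..<m} \<subseteq> poly_over {1..m}" by (rule poly_over_mono) auto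
  have u: "cofactor m \<in> poly_over {1..m}" and l: "shifted_continuant m (m - 1) \<in> poly_over {1..m}"
    using cofactor_over [OF assms(1)] lower_over [OF assms(1)] sub by blast+
  have wm: "word [i] \<in> poly_over {1..m}" if "i \<in> {1..m}" for i by (rule poly_over_word) (use that in simp)
  have q: "quotient_by_cofactor m x \<in> poly_over {1..m}" if "x \<in> poly_over {1..m}" for x
    by (rule right_divide_closed [OF u that])
  have s: "twisted_step m i x \<in> poly_over {1..m}" if "x \<in> poly_over {1..m}" "i \<in> {1..m}" for i x
    unfolding twisted_step_def using that u l q wm assms(1)
    by (auto intro!: poly_over_add poly_over_mult poly_over_diff poly_over_uminus poly_over_1)
  have d: "twisted_step m i x - x * word [i] \<in> relator_ideal m" if x: "x \<in> poly_over {1..m}" for i x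
  proof (cases "i = m")
    case True
    have "twisted_step m i x - x * word [i] = (- quotient_by_cofactor m x) * relator m"
      unfolding True twisted_step_def relator_eq [OF assms(1)] by (simp add: algebra_simps)
    then show ?thesis
      using relator_ideal_closed(6) [OF relator_ideal_closed(1) poly_over_uminus [OF q [OF x]]] by simp
  qed (simp add: twisted_step_def relator_ideal_closed)
  have w: "fold (twisted_step m) w x \<in> poly_over {1..m} \<and> fold (twisted_step m) w x - x * word w \<in> relator_ideal m"
    if "w \<in> lists {1..m}" "x \<in> poly_over {1..m}" for w x
    using that
  proof (induct w arbitrary: x)
    case Nil
    then show ?case by (simp add: word_one relator_ideal_closed)
  next
    case (Cons i w)
    have ww: "word w \<in> poly_over {1..m}" by (rule poly_over_word) (use Cons in simp)
    have IH: "fold (twisted_step m) w (twisted_step m i x) \<in> poly_over {1..m}"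
      "fold (twisted_step m) w (twisted_step m i x) - twisted_step m i x * word w \<in> relator_ideal m"
      using Cons s by auto
    have "x * word (i # w) = x * word [i] * word w" by (simp add: mult.assoc word_mult)
    then have e: "fold (twisted_step m) (i # w) x - x * word (i # w) =
        (fold (twisted_step m) w (twisted_step m i x) - twisted_step m i x * word w)
        + (twisted_step m i x - x * word [i]) * word w"
      by (simp add: algebra_simps)
    have "fold (twisted_step m) (i # w) x - x * word (i # w) \<in> relator_ideal m"
      unfolding e by (rule relator_ideal_closed(4) [OF IH(2) relator_ideal_closed(5) [OF d [OF Cons(4)] ww]])
    moreover have "fold (twisted_step m) (i # w) x \<in> poly_over {1..m}" using IH(1) by simp
    ultimately show ?case by blast
  qed
  from f show "twisted_action m x f \<in> poly_over {1..m}"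
    by (induct f rule: poly_over_induct)
      (use w x in \<open>auto simp: twisted_action_right poly_over_0 intro!: poly_over_add poly_over_mult poly_over_scalar\<close>)
  from f show "twisted_action m x f - x * f \<in> relator_ideal m"
  proof (induct f rule: poly_over_induct)
    case zero
    then show ?case by (simp add: twisted_action_right relator_ideal_closed)
  next
    case (single v c g)
    have "twisted_action m x (scalar c * word v + g) - x * (scalar c * word v + g) =
        scalar c * (fold (twisted_step m) v x - x * word v) + (twisted_action m x g - x * g)"
      by (simp add: twisted_action_right algebra_simps scalar_left_commute)
    then show ?case
      using relator_ideal_closed(4) [OF relator_ideal_closed(6) [OF conjunct2 [OF w [OF single(1) x]] poly_over_scalar] single(3)]
      by simp
  qed
qed

text \<open>
  A representative of the class of \<open>f\<close> in the quotient, chosen linearly.  Since the ideal acts as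
  zero, the value at \<open>f\<close> depends only on that class.  This replaces an analysis of irreducible words.
\<close>

definition normal_form :: "nat \<Rightarrow> (nat list \<Rightarrow>\<^sub>0 'k::field) \<Rightarrow> (nat list \<Rightarrow>\<^sub>0 'k)" where
  "normal_form m = twisted_action m 1"

text \<open>
  The last conclusion is the reason for the whole construction: passing to representatives commutes
  with the multiplication by \<open>K\<^bsub>m-1\<^esub>\<close>, which acts by multiplication, so division by \<open>K\<^bsub>m-1\<^esub>\<close> remains
  a left inverse.
\<close>

lemma normal_form:
  assumes "0 < m"
  shows "normal_form m (f + g) = normal_form m f + normal_form m g"
    "normal_form m (f - g) = normal_form m f - normal_form m g"
    "normal_form m (scalar c * f) = scalar c * normal_form m f"
    "f \<in> relator_ideal m \<Longrightarrow> normal_form m f = 0"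
    "f \<in> poly_over {1..m} \<Longrightarrow> normal_form m f \<in> poly_over {1..m}"
    "f \<in> poly_over {1..m} \<Longrightarrow> normal_form m f - f \<in> relator_ideal m"
    "quotient_by_cofactor m (normal_form m (f * cofactor m)) = normal_form m f"
proof -
  show "quotient_by_cofactor m (normal_form m (f * cofactor m)) = normal_form m f"
    unfolding normal_form_def twisted_action_mult twisted_action_below [OF cofactor_over [OF assms]]
    by (rule quotient_cofactor [OF assms])
qed (use twisted_action_closed [OF assms poly_over_1, of f] in
    \<open>simp_all add: normal_form_def twisted_action_right twisted_action_ideal [OF assms]\<close>)

section \<open>The continuant algebra\<close>

lemma kalgebra_continuant_algebra: "kalgebra (continuant_algebra m)"
  unfolding continuant_algebra_def by (rule kalgebra.kalgebra_vquot [OF kalgebra_free_algebra relator_ideal])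

locale continuant_quotient =
  fixes m :: nat and A :: "('k::field, (nat list \<Rightarrow>\<^sub>0 'k) set) module"
  assumes m_pos: "0 < m" and A_eq: "A = continuant_algebra m"
begin

sublocale enveloping_algebra A
  by (simp add: enveloping_algebra_def A_eq kalgebra_continuant_algebra)

abbreviation "F \<equiv> free_algebra m :: ('k, nat list \<Rightarrow>\<^sub>0 'k) module"
abbreviation "I \<equiv> relator_ideal m :: (nat list \<Rightarrow>\<^sub>0 'k) set"
abbreviation "P \<equiv> poly_over {1..m} :: (nat list \<Rightarrow>\<^sub>0 'k) set"

sublocale F: kalgebra F by (rule kalgebra_free_algebra)
sublocale Q: vsubspace I F by (rule F.vsubspace_ideal [OF relator_ideal])

lemma A_quotient: "A = F /\<^sub>v I" by (simp add: A_eq continuant_algebra_def)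

definition cls :: "(nat list \<Rightarrow>\<^sub>0 'k) \<Rightarrow> (nat list \<Rightarrow>\<^sub>0 'k) set" where
  "cls f = I +>\<^bsub>F\<^esub> f"

abbreviation "z i \<equiv> cls (word [i])"

lemma word_class_eq: "word_class m w = cls (word w)"
  by (simp add: word_class_def cls_def)

lemma P_carrier: "f \<in> P \<longleftrightarrow> f \<in> carrier F" by (simp only: carrier_free_algebra)

lemma cls_hom: "cls \<in> mod_hom ground F A"
  using Q.coset_hom by (simp add: A_quotient cls_def [abs_def])

lemma cls_closed [simp]: "f \<in> P \<Longrightarrow> cls f \<in> carrier A"
  using mod_hom_closed [OF cls_hom] P_carrier by blast

lemma cls_add: "\<lbrakk>f \<in> P; g \<in> P\<rbrakk> \<Longrightarrow> cls (f + g) = cls f \<oplus>\<^bsub>A\<^esub> cls g"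
  using mod_hom_add [OF cls_hom] P_carrier by simp

lemma cls_scale: "f \<in> P \<Longrightarrow> cls (scalar c * f) = c \<odot>\<^bsub>A\<^esub> cls f"
  using mod_hom_smult [OF cls_hom, of c f] P_carrier by simp

lemma cls_mult: "\<lbrakk>f \<in> P; g \<in> P\<rbrakk> \<Longrightarrow> cls (f * g) = cls f \<otimes>\<^bsub>A\<^esub> cls g"
  using F.vquot_mult [OF relator_ideal, of f g] P_carrier by (simp add: A_quotient cls_def)

lemma cls_one: "cls 1 = \<one>\<^bsub>A\<^esub>"
  using F.vquot_one [of I] by (simp add: A_quotient cls_def)

lemma cls_ideal: "f \<in> I \<Longrightarrow> cls f = \<zero>\<^bsub>A\<^esub>"
  using Q.coset_eq_sub_iff [of f] relator_ideal_closed(3) [of f m] Q.vquot_simps(1) P_carrier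
  by (simp add: A_quotient cls_def)

lemma cls_surj: assumes "a \<in> carrier A" obtains f where "f \<in> P" "a = cls f"
  using assms Q.vquot_simps(2) P_carrier by (auto simp: A_quotient cls_def)

lemma word_P: "w \<in> lists {1..m} \<Longrightarrow> word w \<in> P"
  by (rule poly_over_word)

lemma z_P: "i \<in> {1..m} \<Longrightarrow> word [i] \<in> P"
  by (rule word_P) simp

lemma cls_append: "\<lbrakk>v \<in> lists {1..m}; w \<in> lists {1..m}\<rbrakk> \<Longrightarrow> cls (word (v @ w)) = cls (word v) \<otimes>\<^bsub>A\<^esub> cls (word w)"
  using cls_mult [OF word_P word_P, of v w] by (simp add: word_mult)

text \<open>
  A linear section of the quotient map from the free algebra to \<open>A\<close>.
\<close>

definition sec :: "(nat list \<Rightarrow>\<^sub>0 'k) set \<Rightarrow> (nat list \<Rightarrow>\<^sub>0 'k)" where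
  "sec = on_coset (normal_form m)"

lemma sec_cls:
  assumes "f \<in> P" shows "sec (cls f) = normal_form m f"
  unfolding sec_def cls_def
proof (rule Q.on_coset_const)
  show f: "f \<in> carrier F" using assms P_carrier by simp
  fix g assume g: "g \<in> carrier F" "g \<ominus>\<^bsub>F\<^esub> f \<in> I"
  interpret fs: lmodule ground "free_space (lists {1..m})" by (rule lmodule_free_space)
  have "g = (g \<ominus>\<^bsub>F\<^esub> f) + f"
    using F.M.minus_eq_iff [of g f "g \<ominus>\<^bsub>F\<^esub> f"] f g(1) F.M.minus_closed [OF g(1) f] by simp
  then have "normal_form m g = normal_form m (g \<ominus>\<^bsub>F\<^esub> f) + normal_form m f"
    by (metis normal_form(1) [OF m_pos])
  then show "normal_form m g = normal_form m f"
    using normal_form(4) [OF m_pos g(2)] by simp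
qed

lemma cls_normal_form: "f \<in> P \<Longrightarrow> cls (normal_form m f) = cls f"
proof -
  assume f: "f \<in> P"
  note n = normal_form(5) [OF m_pos f] normal_form(6) [OF m_pos f]
  have "cls (normal_form m f) = cls ((normal_form m f - f) + f)" by simp
  also have "\<dots> = cls f"
    using cls_add [OF relator_ideal_closed(3) [OF n(2)] f] cls_ideal [OF n(2)] f by simp
  finally show ?thesis .
qed

lemma sec_P: "a \<in> carrier A \<Longrightarrow> sec a \<in> P"
  by (metis cls_surj sec_cls normal_form(5) m_pos)

lemma cls_sec: "a \<in> carrier A \<Longrightarrow> cls (sec a) = a"
  by (metis cls_surj sec_cls cls_normal_form)

lemma sec_hom: "sec \<in> mod_hom ground A F"
proof (rule mod_homI)
  show "sec a \<in> carrier F" if "a \<in> carrier A" for a using sec_P [OF that] P_carrier by simp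
  fix a b c assume a: "a \<in> carrier A"
  obtain f where f: "f \<in> P" "a = cls f" using cls_surj [OF a] .
  show "sec (c \<odot>\<^bsub>A\<^esub> a) = c \<odot>\<^bsub>F\<^esub> sec a"
    using f by (simp add: cls_scale [symmetric] sec_cls poly_over_mult poly_over_scalar normal_form [OF m_pos])
  assume b: "b \<in> carrier A"
  obtain g where g: "g \<in> P" "b = cls g" using cls_surj [OF b] .
  show "sec (a \<oplus>\<^bsub>A\<^esub> b) = sec a \<oplus>\<^bsub>F\<^esub> sec b"
    using f g by (simp add: cls_add [symmetric] sec_cls poly_over_add normal_form [OF m_pos])
qed

text \<open>
  A linear left inverse of the right multiplication by the class of \<open>K\<^bsub>m-1\<^esub>\<close> in \<open>A\<close>.
\<close>

definition cancel_cofactor :: "(nat list \<Rightarrow>\<^sub>0 'k) set \<Rightarrow> (nat list \<Rightarrow>\<^sub>0 'k) set" where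
  "cancel_cofactor a = cls (quotient_by_cofactor m (sec a))"

lemma below_P: "f \<in> poly_over {1..<m} \<Longrightarrow> f \<in> P"
  by (erule subsetD [OF poly_over_mono, rotated]) auto

lemma cofactor_P: "cofactor m \<in> P"
  by (rule below_P [OF cofactor_over [OF m_pos]])

lemma lower_P: "shifted_continuant m (m - 1) \<in> P"
  by (rule below_P [OF lower_over [OF m_pos]])

lemma cancel_cofactor_hom: "cancel_cofactor \<in> mod_hom ground A A"
proof -
  have "quotient_by_cofactor m \<in> mod_hom ground F F"
    using right_divide_closed [OF cofactor_P] P_carrier
    by (intro mod_homI) (simp_all add: right_divide_linear del: free_algebra_simps(1))
  then show ?thesis
    using mod_hom_comp [OF mod_hom_comp [OF sec_hom] cls_hom] by (simp add: cancel_cofactor_def [abs_def])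
qed

lemma cancel_cofactor_mult:
  assumes "a \<in> carrier A" shows "cancel_cofactor (a \<otimes>\<^bsub>A\<^esub> cls (cofactor m)) = a"
proof -
  obtain f where f: "f \<in> P" "a = cls f" using cls_surj [OF assms] .
  have "cancel_cofactor (a \<otimes>\<^bsub>A\<^esub> cls (cofactor m)) = cls (quotient_by_cofactor m (normal_form m (f * cofactor m)))"
    using f cofactor_P by (simp add: cancel_cofactor_def cls_mult [symmetric] sec_cls poly_over_mult)
  also have "\<dots> = a"
    using f by (simp only: normal_form(7) [OF m_pos] cls_normal_form)
  finally show ?thesis .
qed

section \<open>The universal derivation\<close>

text \<open>
  The \<open>i\<close>-th partial derivative of a word, with values in \<open>E\<close>: each occurrence \<open>p z\<^sub>i q\<close> of the letter
  contributes \<open>p \<otimes> q\<close>.  Left multiplication by \<open>a \<otimes> b\<close> in \<open>E\<close> sends \<open>p \<otimes> q\<close> to \<open>a p \<otimes> q b\<close>,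
  so \<open>E\<close> carries the outer bimodule structure.
\<close>

definition D_word :: "nat \<Rightarrow> nat list \<Rightarrow> ((nat list \<Rightarrow>\<^sub>0 'k) set \<times> (nat list \<Rightarrow>\<^sub>0 'k) set \<Rightarrow>\<^sub>0 'k) set" where
  "D_word i w = (\<Oplus>\<^bsub>E\<^esub>j\<in>{j. j < length w \<and> w ! j = i}. ten (cls (word (take j w))) (cls (word (drop (Suc j) w))))"

definition D :: "nat \<Rightarrow> (nat list \<Rightarrow>\<^sub>0 'k) \<Rightarrow> ((nat list \<Rightarrow>\<^sub>0 'k) set \<times> (nat list \<Rightarrow>\<^sub>0 'k) set \<Rightarrow>\<^sub>0 'k) set" where
  "D i = linear_extension E (D_word i)"

lemma take_drop_lists: "w \<in> lists X \<Longrightarrow> take j w \<in> lists X" "w \<in> lists X \<Longrightarrow> drop j w \<in> lists X"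
  by (auto dest: in_set_takeD in_set_dropD)

lemma D_word_term: "w \<in> lists {1..m} \<Longrightarrow> ten (cls (word (take j w))) (cls (word (drop k w))) \<in> carrier E"
  by (intro ten_closed cls_closed word_P take_drop_lists)

lemma D_word_closed: "w \<in> lists {1..m} \<Longrightarrow> D_word i w \<in> carrier E"
  unfolding D_word_def by (intro E.M.finsum_closed Pi_I D_word_term)

lemma mod_hom_F: "mod_hom ground F U = mod_hom ground (free_space (lists {1..m})) U"
  by (simp add: mod_hom_def scale_eq)

lemma D_hom: "D i \<in> mod_hom ground F E"
  unfolding D_def mod_hom_F by (rule E.linear_extension_hom) (simp add: D_word_closed)

lemma D_closed: "f \<in> P \<Longrightarrow> D i f \<in> carrier E"
  using mod_hom_closed [OF D_hom] P_carrier by blast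

lemma D_of_word: "w \<in> lists {1..m} \<Longrightarrow> D i (word w) = D_word i w"
  unfolding D_def by (rule E.linear_extension_one) (rule D_word_closed)

lemma F_hom_eqI:
  assumes "lmodule ground U" "f \<in> mod_hom ground F U" "g \<in> mod_hom ground F U"
    and "\<And>w. w \<in> lists {1..m} \<Longrightarrow> f (word w) = g (word w)" "p \<in> P"
  shows "f p = g p"
  by (rule free_space_hom_eqI [OF assms(1-3)[unfolded mod_hom_F] assms(4)])
    (use assms(5) in \<open>simp_all add: poly_over_def\<close>)

lemma D_word_append:
  assumes v: "v \<in> lists {1..m}" and w: "w \<in> lists {1..m}"
  shows "D_word i (v @ w) = ten \<one>\<^bsub>A\<^esub> (cls (word w)) \<otimes>\<^bsub>E\<^esub> D_word i v \<oplus>\<^bsub>E\<^esub> ten (cls (word v)) \<one>\<^bsub>A\<^esub> \<otimes>\<^bsub>E\<^esub> D_word i w"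
proof -
  let ?J = "\<lambda>w. {j. j < length w \<and> w ! j = i}" and ?s = "\<lambda>j. length v + j"
  let ?t = "\<lambda>w j. ten (cls (word (take j w))) (cls (word (drop (Suc j) w)))"
  have vw: "v @ w \<in> lists {1..m}" using v w by simp
  have J: "?J (v @ w) = ?J v \<union> ?s ` ?J w"
  proof (intro Set.set_eqI iffI)
    fix j assume "j \<in> ?J (v @ w)"
    then show "j \<in> ?J v \<union> ?s ` ?J w"
      by (cases "j < length v") (auto simp: nth_append intro!: image_eqI [of _ _ "j - length v"])
  qed (auto simp: nth_append)
  have W: "cls (word w) \<in> carrier A" "cls (word v) \<in> carrier A" using v w word_P by simp_all
  note tl = cls_closed [OF word_P [OF take_drop_lists(1) [OF v]]] cls_closed [OF word_P [OF take_drop_lists(2) [OF v]]]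
    cls_closed [OF word_P [OF take_drop_lists(1) [OF w]]] cls_closed [OF word_P [OF take_drop_lists(2) [OF w]]]
  have "D_word i (v @ w) = (\<Oplus>\<^bsub>E\<^esub>j\<in>?J v. ?t (v @ w) j) \<oplus>\<^bsub>E\<^esub> (\<Oplus>\<^bsub>E\<^esub>j\<in>?s ` ?J w. ?t (v @ w) j)"
    unfolding D_word_def J by (rule E.M.finsum_Un_disjoint) (use D_word_term [OF vw] in auto)
  also have "(\<Oplus>\<^bsub>E\<^esub>j\<in>?s ` ?J w. ?t (v @ w) j) = (\<Oplus>\<^bsub>E\<^esub>j\<in>?J w. ?t (v @ w) (?s j))"
    by (rule E.M.finsum_reindex) (use D_word_term [OF vw] in \<open>auto simp: inj_on_def\<close>)
  also have "\<dots> = (\<Oplus>\<^bsub>E\<^esub>j\<in>?J w. ten (cls (word v)) \<one>\<^bsub>A\<^esub> \<otimes>\<^bsub>E\<^esub> ?t w j)"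
    by (rule E.M.finsum_cong')
      (use W tl in \<open>auto simp: ten_mult cls_append [OF v take_drop_lists(1) [OF w]]\<close>)
  also have "\<dots> = ten (cls (word v)) \<one>\<^bsub>A\<^esub> \<otimes>\<^bsub>E\<^esub> D_word i w"
    unfolding D_word_def by (rule E.A.finsum_rdistr [symmetric]) (use W D_word_term [OF w] in auto)
  also have "(\<Oplus>\<^bsub>E\<^esub>j\<in>?J v. ?t (v @ w) j) = (\<Oplus>\<^bsub>E\<^esub>j\<in>?J v. ten \<one>\<^bsub>A\<^esub> (cls (word w)) \<otimes>\<^bsub>E\<^esub> ?t v j)"
    by (rule E.M.finsum_cong')
      (use W tl in \<open>auto simp: ten_mult cls_append [OF take_drop_lists(2) [OF v] w]\<close>)
  also have "\<dots> = ten \<one>\<^bsub>A\<^esub> (cls (word w)) \<otimes>\<^bsub>E\<^esub> D_word i v"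
    unfolding D_word_def by (rule E.A.finsum_rdistr [symmetric]) (use W D_word_term [OF v] in auto)
  finally show ?thesis .
qed

sublocale FE: mod_hom_pair ground F E
  by (simp add: mod_hom_pair_def F.lmodule_axioms E.lmodule_axioms)

lemma ten_cls_hom: "e \<in> carrier E \<Longrightarrow> (\<lambda>f. ten (cls f) \<one>\<^bsub>A\<^esub> \<otimes>\<^bsub>E\<^esub> e) \<in> mod_hom ground F E"
  "e \<in> carrier E \<Longrightarrow> (\<lambda>f. ten \<one>\<^bsub>A\<^esub> (cls f) \<otimes>\<^bsub>E\<^esub> e) \<in> mod_hom ground F E"
  by (rule mod_hom_comp [OF mod_hom_comp [OF cls_hom ten_hom(1)] E.mult_hom_left]; simp)
    (rule mod_hom_comp [OF mod_hom_comp [OF cls_hom ten_hom(2)] E.mult_hom_left]; simp)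

lemma F_mult_hom: "g \<in> P \<Longrightarrow> (\<lambda>f. f * g) \<in> mod_hom ground F F" "g \<in> P \<Longrightarrow> (\<lambda>f. g * f) \<in> mod_hom ground F F"
  using F.mult_hom_left [of g] F.mult_hom_right [of g] P_carrier by simp_all

text \<open>
  The Leibniz rule \<open>D (f g) = D f \<cdot> g + f \<cdot> D g\<close>: an occurrence of a letter in a product of two words
  lies in the first word or in the second.
\<close>

lemma D_mult:
  assumes f: "f \<in> P" and g: "g \<in> P"
  shows "D i (f * g) = ten \<one>\<^bsub>A\<^esub> (cls g) \<otimes>\<^bsub>E\<^esub> D i f \<oplus>\<^bsub>E\<^esub> ten (cls f) \<one>\<^bsub>A\<^esub> \<otimes>\<^bsub>E\<^esub> D i g"
proof -
  have w: "D i (word v * g) = ten \<one>\<^bsub>A\<^esub> (cls g) \<otimes>\<^bsub>E\<^esub> D i (word v) \<oplus>\<^bsub>E\<^esub> ten (cls (word v)) \<one>\<^bsub>A\<^esub> \<otimes>\<^bsub>E\<^esub> D i g"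
    if v: "v \<in> lists {1..m}" for v
  proof (rule F_hom_eqI [OF E.lmodule_axioms mod_hom_comp [OF F_mult_hom(2) D_hom]
        FE.hom_plus_hom [OF ten_cls_hom(2) mod_hom_comp [OF D_hom E.mult_hom_right]] _ g])
    fix w assume w: "w \<in> lists {1..m}"
    have "v @ w \<in> lists {1..m}" using v w by simp
    then show "D i (word v * word w) = ten \<one>\<^bsub>A\<^esub> (cls (word w)) \<otimes>\<^bsub>E\<^esub> D i (word v) \<oplus>\<^bsub>E\<^esub> ten (cls (word v)) \<one>\<^bsub>A\<^esub> \<otimes>\<^bsub>E\<^esub> D i (word w)"
      using D_of_word v w D_word_append by (simp add: word_mult del: append_in_lists_conv)
  qed (use v word_P D_closed in auto)
  show ?thesis
    by (rule F_hom_eqI [OF E.lmodule_axioms mod_hom_comp [OF F_mult_hom(1) D_hom]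
        FE.hom_plus_hom [OF mod_hom_comp [OF D_hom E.mult_hom_right] ten_cls_hom(1)] _ f])
      (use g w D_closed in auto)
qed

lemma D_letter: "j \<in> {1..m} \<Longrightarrow> D i (word [j]) = (if j = i then \<one>\<^bsub>E\<^esub> else \<zero>\<^bsub>E\<^esub>)"
proof -
  assume j: "j \<in> {1..m}"
  have "{k. k < length [j] \<and> [j] ! k = i} = (if j = i then {0} else {})" by auto
  then show ?thesis
    using j by (subst D_of_word) (simp_all add: D_word_def word_one cls_one ten_one)
qed

lemma D_one: "D i 1 = \<zero>\<^bsub>E\<^esub>"
  using D_of_word [of "[]" i] by (simp add: D_word_def word_one)

abbreviation "Z i \<equiv> ten (z i) \<one>\<^bsub>A\<^esub> \<ominus>\<^bsub>E\<^esub> ten \<one>\<^bsub>A\<^esub> (z i)"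

lemma Z_closed: "i \<in> {1..m} \<Longrightarrow> Z i \<in> carrier E"
  using z_P by simp

text \<open>
  For a word, the sum telescopes along the positions: an occurrence \<open>p z\<^sub>i q\<close> contributes
  \<open>p z\<^sub>i \<otimes> q - p \<otimes> z\<^sub>i q\<close>.
\<close>

lemma D_fundamental:
  assumes f: "f \<in> P"
  shows "(\<Oplus>\<^bsub>E\<^esub>i\<in>{1..m}. D i f \<otimes>\<^bsub>E\<^esub> Z i) = ten (cls f) \<one>\<^bsub>A\<^esub> \<ominus>\<^bsub>E\<^esub> ten \<one>\<^bsub>A\<^esub> (cls f)"
proof -
  let ?G = "\<lambda>f. \<Oplus>\<^bsub>E\<^esub>i\<in>{1..m}. D i f \<otimes>\<^bsub>E\<^esub> Z i"
  have G_closed: "?G f \<in> carrier E" if "f \<in> P" for f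
    by (intro E.M.finsum_closed Pi_I E.A.m_closed D_closed that Z_closed)
  have mult: "?G (f * g) = ten \<one>\<^bsub>A\<^esub> (cls g) \<otimes>\<^bsub>E\<^esub> ?G f \<oplus>\<^bsub>E\<^esub> ten (cls f) \<one>\<^bsub>A\<^esub> \<otimes>\<^bsub>E\<^esub> ?G g" if f: "f \<in> P" and g: "g \<in> P" for f g
  proof -
    have c: "D i f \<in> carrier E" "D i g \<in> carrier E" "ten \<one>\<^bsub>A\<^esub> (cls g) \<in> carrier E" "ten (cls f) \<one>\<^bsub>A\<^esub> \<in> carrier E" for i
      using f g D_closed by simp_all
    have "?G (f * g) = (\<Oplus>\<^bsub>E\<^esub>i\<in>{1..m}. ten \<one>\<^bsub>A\<^esub> (cls g) \<otimes>\<^bsub>E\<^esub> (D i f \<otimes>\<^bsub>E\<^esub> Z i) \<oplus>\<^bsub>E\<^esub> ten (cls f) \<one>\<^bsub>A\<^esub> \<otimes>\<^bsub>E\<^esub> (D i g \<otimes>\<^bsub>E\<^esub> Z i))"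
    proof (rule E.M.finsum_cong' [OF refl])
      fix i assume "i \<in> {1..m}"
      then have "Z i \<in> carrier E" by (rule Z_closed)
      then show "D i (f * g) \<otimes>\<^bsub>E\<^esub> Z i = ten \<one>\<^bsub>A\<^esub> (cls g) \<otimes>\<^bsub>E\<^esub> (D i f \<otimes>\<^bsub>E\<^esub> Z i) \<oplus>\<^bsub>E\<^esub> ten (cls f) \<one>\<^bsub>A\<^esub> \<otimes>\<^bsub>E\<^esub> (D i g \<otimes>\<^bsub>E\<^esub> Z i)"
        unfolding D_mult [OF f g] using c by (simp only: E.A.l_distr E.A.m_assoc E.A.m_closed)
    qed (intro Pi_I E.M.a_closed E.A.m_closed c Z_closed)
    also have "\<dots> = ten \<one>\<^bsub>A\<^esub> (cls g) \<otimes>\<^bsub>E\<^esub> ?G f \<oplus>\<^bsub>E\<^esub> ten (cls f) \<one>\<^bsub>A\<^esub> \<otimes>\<^bsub>E\<^esub> ?G g"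
      by (subst E.M.finsum_addf, (intro Pi_I E.A.m_closed c Z_closed, assumption)+,
          subst (1 2) E.A.finsum_rdistr) (auto intro!: E.A.m_closed c Z_closed)
    finally show ?thesis .
  qed
  have letter: "?G (word [j]) = Z j" if j: "j \<in> {1..m}" for j
  proof -
    have "?G (word [j]) = (\<Oplus>\<^bsub>E\<^esub>i\<in>{1..m}. if j = i then Z i else \<zero>\<^bsub>E\<^esub>)"
    proof (rule E.M.finsum_cong' [OF refl])
      fix i assume "i \<in> {1..m}"
      then have "Z i \<in> carrier E" by (rule Z_closed)
      then show "D i (word [j]) \<otimes>\<^bsub>E\<^esub> Z i = (if j = i then Z i else \<zero>\<^bsub>E\<^esub>)"
        by (simp add: D_letter [OF j])
    qed (use Z_closed in auto)
    also have "\<dots> = Z j" by (rule E.M.finsum_singleton) (use j Z_closed in auto)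
    finally show ?thesis .
  qed
  have word: "?G (word w) = ten (cls (word w)) \<one>\<^bsub>A\<^esub> \<ominus>\<^bsub>E\<^esub> ten \<one>\<^bsub>A\<^esub> (cls (word w))" if "w \<in> lists {1..m}" for w
    using that
  proof (induct w)
    case Nil
    have "?G (word []) = (\<Oplus>\<^bsub>E\<^esub>i\<in>{1..m}. \<zero>\<^bsub>E\<^esub>)"
      by (rule E.M.finsum_cong' [OF refl]) (use Z_closed in \<open>auto simp: word_one D_one\<close>)
    then show ?case by (simp add: word_one cls_one E.M.finsum_zero)
  next
    case (Cons j w)
    have c: "z j \<in> carrier A" "cls (word w) \<in> carrier A" using Cons z_P word_P by auto
    have e: "word (j # w) = word [j] * word w" by (simp add: word_mult)
    have "?G (word (j # w)) = ten \<one>\<^bsub>A\<^esub> (cls (word w)) \<otimes>\<^bsub>E\<^esub> Z j \<oplus>\<^bsub>E\<^esub>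
        ten (z j) \<one>\<^bsub>A\<^esub> \<otimes>\<^bsub>E\<^esub> (ten (cls (word w)) \<one>\<^bsub>A\<^esub> \<ominus>\<^bsub>E\<^esub> ten \<one>\<^bsub>A\<^esub> (cls (word w)))"
      unfolding e mult [OF z_P [OF Cons(1)] word_P [OF Cons(2)]] letter [OF Cons(1)] Cons(3) ..
    also have "\<dots> = (ten (z j) (cls (word w)) \<ominus>\<^bsub>E\<^esub> ten \<one>\<^bsub>A\<^esub> (z j \<otimes>\<^bsub>A\<^esub> cls (word w))) \<oplus>\<^bsub>E\<^esub>
        (ten (z j \<otimes>\<^bsub>A\<^esub> cls (word w)) \<one>\<^bsub>A\<^esub> \<ominus>\<^bsub>E\<^esub> ten (z j) (cls (word w)))"
      using c by (simp add: EE.hom_minus [OF E.mult_hom_right] ten_mult)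
    also have "\<dots> = ten (cls (word (j # w))) \<one>\<^bsub>A\<^esub> \<ominus>\<^bsub>E\<^esub> ten \<one>\<^bsub>A\<^esub> (cls (word (j # w)))"
      unfolding e cls_mult [OF z_P [OF Cons(1)] word_P [OF Cons(2)]]
      using c by (intro E.M.minus_telescope) simp_all
    finally show ?case .
  qed
  show ?thesis
  proof (rule F_hom_eqI [OF E.lmodule_axioms _ FE.hom_minus_hom _ f])
    show "?G \<in> mod_hom ground F E"
      by (intro FE.hom_finsum_hom mod_hom_comp [OF D_hom E.mult_hom_left] Z_closed)
    show "(\<lambda>f. ten (cls f) \<one>\<^bsub>A\<^esub>) \<in> mod_hom ground F E" "(\<lambda>f. ten \<one>\<^bsub>A\<^esub> (cls f)) \<in> mod_hom ground F E"
      by (rule mod_hom_comp [OF cls_hom ten_hom(1)] mod_hom_comp [OF cls_hom ten_hom(2)]; simp)+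
  qed (rule word)
qed

section \<open>The contracting homotopy\<close>

abbreviation "rel \<equiv> relator m :: nat list \<Rightarrow>\<^sub>0 'k"

lemma rel_P: "rel \<in> P" using relator_closed P_carrier by blast

lemma cls_rel: "cls rel = \<zero>\<^bsub>A\<^esub>" by (rule cls_ideal [OF relator_ideal_closed(1)])

lemma cls_0: "cls 0 = \<zero>\<^bsub>A\<^esub>" by (rule cls_ideal [OF relator_ideal_closed(2)])

lemma D_rel_closed: "D i rel \<in> carrier E" by (rule D_closed [OF rel_P])

text \<open>
  For \<open>f\<close> in the ideal and any \<open>g\<close>, one of the two terms of the Leibniz rule contains the class of
  \<open>f\<close>, which is zero; the multiples of \<open>D r\<close> therefore survive multiplication by \<open>g\<close> from both sides.
\<close>

lemma D_ideal:
  assumes "f \<in> I"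
  shows "\<exists>e\<in>carrier E. \<forall>i. D i f = e \<otimes>\<^bsub>E\<^esub> D i rel"
proof -
  let ?J = "{f \<in> P. cls f = \<zero>\<^bsub>A\<^esub> \<and> (\<exists>e\<in>carrier E. \<forall>i. D i f = e \<otimes>\<^bsub>E\<^esub> D i rel)}"
  have "I \<subseteq> ?J"
  proof (rule relator_ideal_closed(7))
    show "rel \<in> ?J"
      using rel_P cls_rel D_rel_closed by (auto intro!: bexI [of _ "\<one>\<^bsub>E\<^esub>"])
    show "0 \<in> ?J"
      using cls_0 FE.hom_zero [OF D_hom] D_rel_closed by (auto simp: poly_over_0 intro!: bexI [of _ "\<zero>\<^bsub>E\<^esub>"])
  next
    fix f g assume "f \<in> ?J" "g \<in> ?J"
    then obtain e e' where f: "f \<in> P" "cls f = \<zero>\<^bsub>A\<^esub>" "e \<in> carrier E" "\<And>i. D i f = e \<otimes>\<^bsub>E\<^esub> D i rel"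
      and g: "g \<in> P" "cls g = \<zero>\<^bsub>A\<^esub>" "e' \<in> carrier E" "\<And>i. D i g = e' \<otimes>\<^bsub>E\<^esub> D i rel" by blast
    have "D i (f + g) = (e \<oplus>\<^bsub>E\<^esub> e') \<otimes>\<^bsub>E\<^esub> D i rel" for i
      using mod_hom_add [OF D_hom, of f g i] f g P_carrier D_rel_closed by (simp add: E.A.l_distr)
    then show "f + g \<in> ?J"
      using f g by (auto simp: poly_over_add cls_add intro!: bexI [of _ "e \<oplus>\<^bsub>E\<^esub> e'"])
  next
    fix f g assume "f \<in> ?J" and g: "g \<in> P"
    then obtain e where f: "f \<in> P" "cls f = \<zero>\<^bsub>A\<^esub>" "e \<in> carrier E" "\<And>i. D i f = e \<otimes>\<^bsub>E\<^esub> D i rel" by blast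
    have "D i (f * g) = (ten \<one>\<^bsub>A\<^esub> (cls g) \<otimes>\<^bsub>E\<^esub> e) \<otimes>\<^bsub>E\<^esub> D i rel"
      "D i (g * f) = (ten (cls g) \<one>\<^bsub>A\<^esub> \<otimes>\<^bsub>E\<^esub> e) \<otimes>\<^bsub>E\<^esub> D i rel" for i
      using f g D_rel_closed D_closed by (simp_all add: D_mult ten_zero E.A.m_assoc)
    moreover have "ten \<one>\<^bsub>A\<^esub> (cls g) \<otimes>\<^bsub>E\<^esub> e \<in> carrier E" "ten (cls g) \<one>\<^bsub>A\<^esub> \<otimes>\<^bsub>E\<^esub> e \<in> carrier E"
      using f g by simp_all
    moreover have "f * g \<in> P" "g * f \<in> P" "cls (f * g) = \<zero>\<^bsub>A\<^esub>" "cls (g * f) = \<zero>\<^bsub>A\<^esub>"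
      using f g by (simp_all add: poly_over_mult cls_mult)
    ultimately show "f * g \<in> ?J" "g * f \<in> ?J" by blast+
  qed auto
  then show ?thesis using assms by blast
qed

lemma D_below:
  assumes "f \<in> poly_over {1..<m}" shows "D m f = \<zero>\<^bsub>E\<^esub>"
proof -
  have w: "D m (word w) = \<zero>\<^bsub>E\<^esub>" if w: "w \<in> lists {1..<m}" for w
  proof -
    have "{j. j < length w \<and> w ! j = m} = {}" using w nth_mem by fastforce
    moreover have "w \<in> lists {1..m}" using w by auto
    ultimately show ?thesis by (simp only: D_of_word D_word_def E.M.finsum_empty)
  qed
  from assms show ?thesis
  proof (induct f rule: poly_over_induct)
    case zero
    then show ?case using FE.hom_zero [OF D_hom] by simp
  next
    case (single w c g)
    have c: "word w \<in> carrier F" "g \<in> carrier F" "scalar c * word w \<in> carrier F"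
      using below_P [OF poly_over_word [OF single(1)]] below_P [OF single(2)] poly_over_scalar poly_over_mult P_carrier by blast+
    have "D m (scalar c * word w) = \<zero>\<^bsub>E\<^esub>"
      using mod_hom_smult [OF D_hom, of c "word w" m] c(1) w [OF single(1)] E.smult_zero_right by simp
    then show ?case
      using mod_hom_add [OF D_hom c(3,2), of m] single(3) by simp
  qed
qed

text \<open>
  In \<open>r = 1 + K\<^bsub>m-1\<^esub> z\<^sub>m + K\<^bsub>m-2\<^esub>\<close> the letter \<open>z\<^sub>m\<close> occurs only where it is displayed.
\<close>

lemma D_rel: "D m rel = ten (cls (cofactor m)) \<one>\<^bsub>A\<^esub>"
proof -
  have mm: "m \<in> {1..m}" using m_pos by simp
  have P: "cofactor m * word [m] \<in> P" by (rule poly_over_mult [OF cofactor_P z_P [OF mm]])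
  have c: "1 + cofactor m * word [m] \<in> carrier F" "cofactor m * word [m] \<in> carrier F"
    "(1 :: nat list \<Rightarrow>\<^sub>0 'k) \<in> carrier F" "shifted_continuant m (m - 1) \<in> carrier F"
    using P poly_over_add [OF poly_over_1 P] poly_over_1 lower_P P_carrier by blast+
  have "D m rel = D m (1 + cofactor m * word [m]) \<oplus>\<^bsub>E\<^esub> D m (shifted_continuant m (m - 1))"
    unfolding relator_eq [OF m_pos] using mod_hom_add [OF D_hom c(1,4)] by simp
  also have "D m (1 + cofactor m * word [m]) = D m 1 \<oplus>\<^bsub>E\<^esub> D m (cofactor m * word [m])"
    using mod_hom_add [OF D_hom c(3,2)] by simp
  also have "D m (cofactor m * word [m]) = ten (cls (cofactor m)) \<one>\<^bsub>A\<^esub>"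
    unfolding D_mult [OF cofactor_P z_P [OF mm]] D_below [OF cofactor_over [OF m_pos]] D_letter [OF mm]
    using cofactor_P z_P [OF mm] by simp
  finally show ?thesis
    using cofactor_P by (simp only: D_below [OF lower_over [OF m_pos]] D_one) simp
qed

text \<open>
  The multiplication by \<open>K\<^bsub>m-1\<^esub> \<otimes> 1\<close> sends \<open>a \<otimes> b\<close> to \<open>a K\<^bsub>m-1\<^esub> \<otimes> b\<close>.  A linear left inverse on
  \<open>A\<close>, rather than mere injectivity there, is what passes to the tensor product.
\<close>

lemma mult_D_rel_injective:
  assumes e: "e \<in> carrier E" and "e \<otimes>\<^bsub>E\<^esub> D m rel = \<zero>\<^bsub>E\<^esub>"
  shows "e = \<zero>\<^bsub>E\<^esub>"
proof -
  let ?L = "on_coset (linear_extension E (case_prod (\<lambda>a b. ten (cancel_cofactor a) b)))"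
  have h: "(\<lambda>a. ten (cancel_cofactor a) b) \<in> mod_hom ground A E" "(\<lambda>a. ten (cancel_cofactor b) a) \<in> mod_hom ground A E" if "b \<in> carrier A" for b
    by (rule mod_hom_comp [OF cancel_cofactor_hom ten_hom(1) [OF that]], rule ten_hom(2) [OF mod_hom_closed [OF cancel_cofactor_hom that]])
  have L: "?L \<in> mod_hom ground E E"
    "\<And>a b. \<lbrakk>a \<in> carrier A; b \<in> carrier A\<rbrakk> \<Longrightarrow> ?L (ten a b) = ten (cancel_cofactor a) b"
    by (rule enveloping_extend_hom [OF E.lmodule_axioms h]; assumption)+
  have "?L (e \<otimes>\<^bsub>E\<^esub> D m rel) = e"
  proof (rule enveloping_hom_eqI [OF E.lmodule_axioms mod_hom_comp [OF E.mult_hom_left L(1)] mod_hom_id _ e])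
    show "D m rel \<in> carrier E" by (rule D_rel_closed)
    show "?L (ten a b \<otimes>\<^bsub>E\<^esub> D m rel) = ten a b" if "a \<in> carrier A" "b \<in> carrier A" for a b
      using that cofactor_P by (simp add: D_rel ten_mult L(2) cancel_cofactor_mult)
  qed
  then show ?thesis using assms(2) EE.hom_zero [OF L(1)] by simp
qed

text \<open>
  The contracting homotopy \<open>a \<otimes> b \<mapsto> (1 \<otimes> b) D (sec a)\<close>, linear over the right factor only.
\<close>

definition contraction :: "nat \<Rightarrow> ((nat list \<Rightarrow>\<^sub>0 'k) set \<times> (nat list \<Rightarrow>\<^sub>0 'k) set \<Rightarrow>\<^sub>0 'k) set \<Rightarrow> ((nat list \<Rightarrow>\<^sub>0 'k) set \<times> (nat list \<Rightarrow>\<^sub>0 'k) set \<Rightarrow>\<^sub>0 'k) set" where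
  "contraction i = on_coset (linear_extension E (case_prod (\<lambda>a b. ten \<one>\<^bsub>A\<^esub> b \<otimes>\<^bsub>E\<^esub> D i (sec a))))"

lemma contraction: shows contraction_hom: "contraction i \<in> mod_hom ground E E"
    and contraction_ten: "\<And>a b. \<lbrakk>a \<in> carrier A; b \<in> carrier A\<rbrakk> \<Longrightarrow> contraction i (ten a b) = ten \<one>\<^bsub>A\<^esub> b \<otimes>\<^bsub>E\<^esub> D i (sec a)"
proof -
  have h1: "(\<lambda>a. ten \<one>\<^bsub>A\<^esub> b \<otimes>\<^bsub>E\<^esub> D i (sec a)) \<in> mod_hom ground A E" if "b \<in> carrier A" for b
    using that by (intro mod_hom_comp [OF mod_hom_comp [OF sec_hom D_hom] E.mult_hom_right]) simp
  have h2: "(\<lambda>b. ten \<one>\<^bsub>A\<^esub> b \<otimes>\<^bsub>E\<^esub> D i (sec a)) \<in> mod_hom ground A E" if "a \<in> carrier A" for a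
    using D_closed [OF sec_P [OF that]] by (intro mod_hom_comp [OF ten_hom(2) E.mult_hom_left]) auto
  show "contraction i \<in> mod_hom ground E E" unfolding contraction_def by (rule enveloping_extend_hom(1) [OF E.lmodule_axioms h1 h2])
  show "contraction i (ten a b) = ten \<one>\<^bsub>A\<^esub> b \<otimes>\<^bsub>E\<^esub> D i (sec a)" if "a \<in> carrier A" "b \<in> carrier A" for a b
    unfolding contraction_def by (rule enveloping_extend_hom(2) [OF E.lmodule_axioms h1 h2 that])
qed

lemma contraction_closed: "e \<in> carrier E \<Longrightarrow> contraction i e \<in> carrier E"
  by (rule mod_hom_closed [OF contraction_hom])

text \<open>
  This is \<open>D_fundamental\<close> for \<open>sec a\<close>, multiplied by \<open>1 \<otimes> b\<close>.
\<close>

lemma homotopy_degree_0: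
  assumes e: "e \<in> carrier E"
  shows "e = ten \<one>\<^bsub>A\<^esub> (e \<odot>\<^bsub>L\<^esub> \<one>\<^bsub>A\<^esub>) \<oplus>\<^bsub>E\<^esub> (\<Oplus>\<^bsub>E\<^esub>i\<in>{1..m}. contraction i e \<otimes>\<^bsub>E\<^esub> Z i)"
proof (rule enveloping_hom_eqI [OF E.lmodule_axioms mod_hom_id _ _ e])
  show "(\<lambda>e. ten \<one>\<^bsub>A\<^esub> (e \<odot>\<^bsub>L\<^esub> \<one>\<^bsub>A\<^esub>) \<oplus>\<^bsub>E\<^esub> (\<Oplus>\<^bsub>E\<^esub>i\<in>{1..m}. contraction i e \<otimes>\<^bsub>E\<^esub> Z i)) \<in> mod_hom ground E E"
    by (intro EE.hom_plus_hom EE.hom_finsum_hom mod_hom_comp [OF left_act_hom ten_hom(2)]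
        mod_hom_comp [OF contraction_hom E.mult_hom_left] Z_closed A.one_closed)
  fix a b assume a: "a \<in> carrier A" and b: "b \<in> carrier A"
  have D: "D i (sec a) \<in> carrier E" for i by (rule D_closed [OF sec_P [OF a]])
  have "(\<Oplus>\<^bsub>E\<^esub>i\<in>{1..m}. contraction i (ten a b) \<otimes>\<^bsub>E\<^esub> Z i) = (\<Oplus>\<^bsub>E\<^esub>i\<in>{1..m}. ten \<one>\<^bsub>A\<^esub> b \<otimes>\<^bsub>E\<^esub> (D i (sec a) \<otimes>\<^bsub>E\<^esub> Z i))"
  proof (rule E.M.finsum_cong' [OF refl])
    fix i assume "i \<in> {1..m}"
    then have "Z i \<in> carrier E" by (rule Z_closed)
    then show "contraction i (ten a b) \<otimes>\<^bsub>E\<^esub> Z i = ten \<one>\<^bsub>A\<^esub> b \<otimes>\<^bsub>E\<^esub> (D i (sec a) \<otimes>\<^bsub>E\<^esub> Z i)"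
      using a b D by (simp only: contraction_ten E.A.m_assoc ten_closed A.one_closed)
  qed (use a b D Z_closed in auto)
  also have "\<dots> = ten \<one>\<^bsub>A\<^esub> b \<otimes>\<^bsub>E\<^esub> (\<Oplus>\<^bsub>E\<^esub>i\<in>{1..m}. D i (sec a) \<otimes>\<^bsub>E\<^esub> Z i)"
    by (rule E.A.finsum_rdistr [symmetric]) (use b D Z_closed in auto)
  also have "\<dots> = ten a b \<ominus>\<^bsub>E\<^esub> ten \<one>\<^bsub>A\<^esub> (a \<otimes>\<^bsub>A\<^esub> b)"
    unfolding D_fundamental [OF sec_P [OF a]] cls_sec [OF a]
    using a b by (simp add: EE.hom_minus [OF E.mult_hom_right] ten_mult)
  finally have eq: "(\<Oplus>\<^bsub>E\<^esub>i\<in>{1..m}. contraction i (ten a b) \<otimes>\<^bsub>E\<^esub> Z i) = ten a b \<ominus>\<^bsub>E\<^esub> ten \<one>\<^bsub>A\<^esub> (a \<otimes>\<^bsub>A\<^esub> b)" .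
  have tl: "ten a b \<odot>\<^bsub>L\<^esub> \<one>\<^bsub>A\<^esub> = a \<otimes>\<^bsub>A\<^esub> b"
    using a b by (simp add: left_act_ten)
  have "ten a b \<in> carrier E" "ten \<one>\<^bsub>A\<^esub> (a \<otimes>\<^bsub>A\<^esub> b) \<in> carrier E" using a b by auto
  then show "ten a b = ten \<one>\<^bsub>A\<^esub> (ten a b \<odot>\<^bsub>L\<^esub> \<one>\<^bsub>A\<^esub>) \<oplus>\<^bsub>E\<^esub> (\<Oplus>\<^bsub>E\<^esub>i\<in>{1..m}. contraction i (ten a b) \<otimes>\<^bsub>E\<^esub> Z i)"
    unfolding eq tl by (simp add: a_minus_def E.M.a_lcomm E.M.r_neg)
qed

text \<open>
  If \<open>sec\<close> were multiplicative, the homotopy would be exact here and \<open>e\<close> would be zero.  The defect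
  \<open>sec (a z\<^sub>i) - sec a z\<^sub>i\<close> lies in the ideal, and its derivative is a multiple of \<open>D r\<close>: this is how
  the relation enters the resolution.
\<close>

lemma homotopy_degree_1:
  assumes r: "r \<in> carrier E" and i: "i \<in> {1..m}"
  shows "\<exists>e\<in>carrier E. \<forall>j. contraction j (r \<otimes>\<^bsub>E\<^esub> Z i) = (if i = j then r else \<zero>\<^bsub>E\<^esub>) \<oplus>\<^bsub>E\<^esub> e \<otimes>\<^bsub>E\<^esub> D j rel"
  using r
proof (induct r rule: enveloping_induct)
  case zero
  have "contraction j (\<zero>\<^bsub>E\<^esub> \<otimes>\<^bsub>E\<^esub> Z i) = (if i = j then \<zero>\<^bsub>E\<^esub> else \<zero>\<^bsub>E\<^esub>) \<oplus>\<^bsub>E\<^esub> \<zero>\<^bsub>E\<^esub> \<otimes>\<^bsub>E\<^esub> D j rel" for j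
    using Z_closed [OF i] EE.hom_zero [OF contraction_hom] D_rel_closed by (simp del: E.M.minus_eq_iff)
  then show ?case by blast
next
  case (ten a b)
  have zi: "z i \<in> carrier A" and zP: "word [i] \<in> P" using z_P [OF i] by auto
  have az: "a \<otimes>\<^bsub>A\<^esub> z i \<in> carrier A" using ten zi by simp
  let ?f = "sec (a \<otimes>\<^bsub>A\<^esub> z i) - sec a * word [i]"
  have sP: "sec (a \<otimes>\<^bsub>A\<^esub> z i) \<in> P" "sec a \<in> P" "sec a * word [i] \<in> P"
    using sec_P [OF az] sec_P [OF ten(1)] zP poly_over_mult by blast+
  \<comment> \<open>Both representatives of \<open>a z\<^sub>i\<close> have the same normal form.\<close>
  have "sec (a \<otimes>\<^bsub>A\<^esub> z i) = normal_form m (sec a * word [i])"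
    using sec_cls [OF sP(3)] cls_mult [OF sP(2) zP] cls_sec [OF ten(1)] by simp
  then have "?f \<in> I" using normal_form(6) [OF m_pos sP(3)] by simp
  then obtain e where e: "e \<in> carrier E" "\<And>j. D j ?f = e \<otimes>\<^bsub>E\<^esub> D j rel" using D_ideal by blast
  have fP: "?f \<in> P" using sP poly_over_diff by blast
  have t: "ten \<one>\<^bsub>A\<^esub> b \<in> carrier E" "ten \<one>\<^bsub>A\<^esub> (z i) \<in> carrier E" "ten a \<one>\<^bsub>A\<^esub> \<in> carrier E"
    using ten zi by simp_all
  show ?case
  proof (intro bexI allI)
    show "ten \<one>\<^bsub>A\<^esub> b \<otimes>\<^bsub>E\<^esub> e \<in> carrier E" using t e by simp
    fix j
    let ?\<delta> = "if i = j then \<one>\<^bsub>E\<^esub> else \<zero>\<^bsub>E\<^esub>"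
    have Dc: "D j (sec a) \<in> carrier E" "D j rel \<in> carrier E" "?\<delta> \<in> carrier E" using D_closed sP rel_P by auto
    have "D j (sec (a \<otimes>\<^bsub>A\<^esub> z i)) = D j ?f \<oplus>\<^bsub>E\<^esub> D j (sec a * word [i])"
      using mod_hom_add [OF D_hom, of ?f "sec a * word [i]" j] fP sP P_carrier by simp
    also have "D j (sec a * word [i]) = ten \<one>\<^bsub>A\<^esub> (z i) \<otimes>\<^bsub>E\<^esub> D j (sec a) \<oplus>\<^bsub>E\<^esub> ten a \<one>\<^bsub>A\<^esub> \<otimes>\<^bsub>E\<^esub> ?\<delta>"
      unfolding D_mult [OF sP(2) zP] cls_sec [OF ten(1)] D_letter [OF i] ..
    finally have "D j (sec (a \<otimes>\<^bsub>A\<^esub> z i)) =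
        e \<otimes>\<^bsub>E\<^esub> D j rel \<oplus>\<^bsub>E\<^esub> (ten \<one>\<^bsub>A\<^esub> (z i) \<otimes>\<^bsub>E\<^esub> D j (sec a) \<oplus>\<^bsub>E\<^esub> ten a \<one>\<^bsub>A\<^esub> \<otimes>\<^bsub>E\<^esub> ?\<delta>)"
      by (simp only: e(2))
    then have "ten \<one>\<^bsub>A\<^esub> b \<otimes>\<^bsub>E\<^esub> D j (sec (a \<otimes>\<^bsub>A\<^esub> z i)) =
        ten \<one>\<^bsub>A\<^esub> b \<otimes>\<^bsub>E\<^esub> e \<otimes>\<^bsub>E\<^esub> D j rel \<oplus>\<^bsub>E\<^esub> (ten \<one>\<^bsub>A\<^esub> b \<otimes>\<^bsub>E\<^esub> ten \<one>\<^bsub>A\<^esub> (z i) \<otimes>\<^bsub>E\<^esub> D j (sec a)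
          \<oplus>\<^bsub>E\<^esub> ten \<one>\<^bsub>A\<^esub> b \<otimes>\<^bsub>E\<^esub> ten a \<one>\<^bsub>A\<^esub> \<otimes>\<^bsub>E\<^esub> ?\<delta>)"
      using t e(1) Dc by (simp only: E.A.r_distr E.A.m_assoc E.A.m_closed E.M.a_closed)
    also have "ten \<one>\<^bsub>A\<^esub> b \<otimes>\<^bsub>E\<^esub> ten a \<one>\<^bsub>A\<^esub> \<otimes>\<^bsub>E\<^esub> ?\<delta> = (if i = j then ten a b else \<zero>\<^bsub>E\<^esub>)"
      using ten by (simp add: ten_mult)
    also have "ten \<one>\<^bsub>A\<^esub> b \<otimes>\<^bsub>E\<^esub> ten \<one>\<^bsub>A\<^esub> (z i) = ten \<one>\<^bsub>A\<^esub> (z i \<otimes>\<^bsub>A\<^esub> b)"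
      using ten zi by (simp add: ten_mult)
    finally have X: "ten \<one>\<^bsub>A\<^esub> b \<otimes>\<^bsub>E\<^esub> D j (sec (a \<otimes>\<^bsub>A\<^esub> z i)) =
        ten \<one>\<^bsub>A\<^esub> b \<otimes>\<^bsub>E\<^esub> e \<otimes>\<^bsub>E\<^esub> D j rel \<oplus>\<^bsub>E\<^esub> (ten \<one>\<^bsub>A\<^esub> (z i \<otimes>\<^bsub>A\<^esub> b) \<otimes>\<^bsub>E\<^esub> D j (sec a)
          \<oplus>\<^bsub>E\<^esub> (if i = j then ten a b else \<zero>\<^bsub>E\<^esub>))" .
    have "ten a b \<otimes>\<^bsub>E\<^esub> Z i = ten (a \<otimes>\<^bsub>A\<^esub> z i) b \<ominus>\<^bsub>E\<^esub> ten a (z i \<otimes>\<^bsub>A\<^esub> b)"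
      using ten zi by (simp add: EE.hom_minus [OF E.mult_hom_right] ten_mult)
    then have "contraction j (ten a b \<otimes>\<^bsub>E\<^esub> Z i) = contraction j (ten (a \<otimes>\<^bsub>A\<^esub> z i) b) \<ominus>\<^bsub>E\<^esub> contraction j (ten a (z i \<otimes>\<^bsub>A\<^esub> b))"
      using ten zi by (simp add: EE.hom_minus [OF contraction_hom])
    also have "\<dots> = ten \<one>\<^bsub>A\<^esub> b \<otimes>\<^bsub>E\<^esub> D j (sec (a \<otimes>\<^bsub>A\<^esub> z i)) \<ominus>\<^bsub>E\<^esub> ten \<one>\<^bsub>A\<^esub> (z i \<otimes>\<^bsub>A\<^esub> b) \<otimes>\<^bsub>E\<^esub> D j (sec a)"
      using ten zi by (simp add: contraction_ten)
    also have "\<dots> = (if i = j then ten a b else \<zero>\<^bsub>E\<^esub>) \<oplus>\<^bsub>E\<^esub> ten \<one>\<^bsub>A\<^esub> b \<otimes>\<^bsub>E\<^esub> e \<otimes>\<^bsub>E\<^esub> D j rel"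
      unfolding X by (rule E.M.minus_cancel_middle) (use ten zi t e(1) Dc in auto)
    finally show "contraction j (ten a b \<otimes>\<^bsub>E\<^esub> Z i) = (if i = j then ten a b else \<zero>\<^bsub>E\<^esub>) \<oplus>\<^bsub>E\<^esub> ten \<one>\<^bsub>A\<^esub> b \<otimes>\<^bsub>E\<^esub> e \<otimes>\<^bsub>E\<^esub> D j rel" .
  qed
next
  case (add x y)
  obtain e e' where e: "e \<in> carrier E" "\<And>j. contraction j (x \<otimes>\<^bsub>E\<^esub> Z i) = (if i = j then x else \<zero>\<^bsub>E\<^esub>) \<oplus>\<^bsub>E\<^esub> e \<otimes>\<^bsub>E\<^esub> D j rel"
    and e': "e' \<in> carrier E" "\<And>j. contraction j (y \<otimes>\<^bsub>E\<^esub> Z i) = (if i = j then y else \<zero>\<^bsub>E\<^esub>) \<oplus>\<^bsub>E\<^esub> e' \<otimes>\<^bsub>E\<^esub> D j rel"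
    using add(3,4) by blast
  show ?case
  proof (intro bexI allI)
    show "e \<oplus>\<^bsub>E\<^esub> e' \<in> carrier E" using e e' by simp
    fix j
    have c: "x \<otimes>\<^bsub>E\<^esub> Z i \<in> carrier E" "y \<otimes>\<^bsub>E\<^esub> Z i \<in> carrier E" using add Z_closed [OF i] E.A.m_closed by blast+
    have "contraction j ((x \<oplus>\<^bsub>E\<^esub> y) \<otimes>\<^bsub>E\<^esub> Z i) = contraction j (x \<otimes>\<^bsub>E\<^esub> Z i) \<oplus>\<^bsub>E\<^esub> contraction j (y \<otimes>\<^bsub>E\<^esub> Z i)"
      unfolding E.A.l_distr [OF add(1,2) Z_closed [OF i]] by (rule mod_hom_add [OF contraction_hom c])
    also have "\<dots> = (if i = j then x \<oplus>\<^bsub>E\<^esub> y else \<zero>\<^bsub>E\<^esub>) \<oplus>\<^bsub>E\<^esub> (e \<oplus>\<^bsub>E\<^esub> e') \<otimes>\<^bsub>E\<^esub> D j rel"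
      unfolding e(2) e'(2) using add e(1) e'(1) D_rel_closed [of j] by (simp add: E.A.l_distr E.M.a_ac)
    finally show "contraction j ((x \<oplus>\<^bsub>E\<^esub> y) \<otimes>\<^bsub>E\<^esub> Z i) = (if i = j then x \<oplus>\<^bsub>E\<^esub> y else \<zero>\<^bsub>E\<^esub>) \<oplus>\<^bsub>E\<^esub> (e \<oplus>\<^bsub>E\<^esub> e') \<otimes>\<^bsub>E\<^esub> D j rel" .
  qed
qed

text \<open>
  Apply the homotopy to the vanishing sum: it returns \<open>v\<close> up to a multiple of \<open>D r\<close>.
\<close>

lemma exact_degree_1:
  assumes v: "\<And>i. i \<in> {1..m} \<Longrightarrow> v i \<in> carrier E" and 0: "(\<Oplus>\<^bsub>E\<^esub>i\<in>{1..m}. v i \<otimes>\<^bsub>E\<^esub> Z i) = \<zero>\<^bsub>E\<^esub>"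
  shows "\<exists>e\<in>carrier E. \<forall>j\<in>{1..m}. v j = e \<otimes>\<^bsub>E\<^esub> D j rel"
proof -
  have "\<forall>i\<in>{1..m}. \<exists>e. e \<in> carrier E \<and> (\<forall>j. contraction j (v i \<otimes>\<^bsub>E\<^esub> Z i) = (if i = j then v i else \<zero>\<^bsub>E\<^esub>) \<oplus>\<^bsub>E\<^esub> e \<otimes>\<^bsub>E\<^esub> D j rel)"
    using homotopy_degree_1 v by blast
  then obtain e where e: "\<And>i. i \<in> {1..m} \<Longrightarrow> e i \<in> carrier E"
    "\<And>i j. i \<in> {1..m} \<Longrightarrow> contraction j (v i \<otimes>\<^bsub>E\<^esub> Z i) = (if i = j then v i else \<zero>\<^bsub>E\<^esub>) \<oplus>\<^bsub>E\<^esub> e i \<otimes>\<^bsub>E\<^esub> D j rel"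
    using bchoice [of "{1..m}"] by metis
  let ?e = "\<Oplus>\<^bsub>E\<^esub>i\<in>{1..m}. e i"
  have ec: "?e \<in> carrier E" by (intro E.M.finsum_closed Pi_I e(1))
  have "v j \<oplus>\<^bsub>E\<^esub> ?e \<otimes>\<^bsub>E\<^esub> D j rel = \<zero>\<^bsub>E\<^esub>" if j: "j \<in> {1..m}" for j
  proof -
    have "\<zero>\<^bsub>E\<^esub> = contraction j (\<Oplus>\<^bsub>E\<^esub>i\<in>{1..m}. v i \<otimes>\<^bsub>E\<^esub> Z i)"
      unfolding 0 by (rule EE.hom_zero [OF contraction_hom, symmetric])
    also have "\<dots> = (\<Oplus>\<^bsub>E\<^esub>i\<in>{1..m}. contraction j (v i \<otimes>\<^bsub>E\<^esub> Z i))"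
      by (rule EE.hom_finsum [OF contraction_hom]) (intro Pi_I E.A.m_closed v Z_closed)
    also have "\<dots> = (\<Oplus>\<^bsub>E\<^esub>i\<in>{1..m}. (if j = i then v i else \<zero>\<^bsub>E\<^esub>) \<oplus>\<^bsub>E\<^esub> e i \<otimes>\<^bsub>E\<^esub> D j rel)"
      by (rule E.M.finsum_cong' [OF refl]) (use v e D_rel_closed in auto)
    also have "\<dots> = (\<Oplus>\<^bsub>E\<^esub>i\<in>{1..m}. if j = i then v i else \<zero>\<^bsub>E\<^esub>) \<oplus>\<^bsub>E\<^esub> (\<Oplus>\<^bsub>E\<^esub>i\<in>{1..m}. e i \<otimes>\<^bsub>E\<^esub> D j rel)"
      by (rule E.M.finsum_addf) (use v e(1) D_rel_closed in auto)
    also have "(\<Oplus>\<^bsub>E\<^esub>i\<in>{1..m}. if j = i then v i else \<zero>\<^bsub>E\<^esub>) = v j"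
      by (rule E.M.finsum_singleton) (use j v in auto)
    also have "(\<Oplus>\<^bsub>E\<^esub>i\<in>{1..m}. e i \<otimes>\<^bsub>E\<^esub> D j rel) = ?e \<otimes>\<^bsub>E\<^esub> D j rel"
      by (rule E.A.finsum_ldistr [symmetric]) (use e(1) D_rel_closed in auto)
    finally show ?thesis ..
  qed
  then have "v j = (\<ominus>\<^bsub>E\<^esub> ?e) \<otimes>\<^bsub>E\<^esub> D j rel" if "j \<in> {1..m}" for j
    using E.M.minus_equality [of "v j" "?e \<otimes>\<^bsub>E\<^esub> D j rel"] E.A.l_minus [OF ec D_rel_closed] v that ec D_rel_closed
    by simp
  then show ?thesis using ec E.M.a_inv_closed by blast
qed

text \<open>
  \<open>D_fundamental\<close> for \<open>f = r\<close>, whose class is zero.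
\<close>

lemma composite_zero:
  assumes e: "e \<in> carrier E"
  shows "(\<Oplus>\<^bsub>E\<^esub>i\<in>{1..m}. (e \<otimes>\<^bsub>E\<^esub> D i rel) \<otimes>\<^bsub>E\<^esub> Z i) = \<zero>\<^bsub>E\<^esub>"
proof -
  have "(\<Oplus>\<^bsub>E\<^esub>i\<in>{1..m}. (e \<otimes>\<^bsub>E\<^esub> D i rel) \<otimes>\<^bsub>E\<^esub> Z i) = (\<Oplus>\<^bsub>E\<^esub>i\<in>{1..m}. e \<otimes>\<^bsub>E\<^esub> (D i rel \<otimes>\<^bsub>E\<^esub> Z i))"
  proof (rule E.M.finsum_cong' [OF refl])
    show "(e \<otimes>\<^bsub>E\<^esub> D i rel) \<otimes>\<^bsub>E\<^esub> Z i = e \<otimes>\<^bsub>E\<^esub> (D i rel \<otimes>\<^bsub>E\<^esub> Z i)" if "i \<in> {1..m}" for i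
      by (rule E.A.m_assoc [OF e D_rel_closed Z_closed [OF that]])
  qed (intro Pi_I E.A.m_closed e D_rel_closed Z_closed)
  also have "\<dots> = e \<otimes>\<^bsub>E\<^esub> (\<Oplus>\<^bsub>E\<^esub>i\<in>{1..m}. D i rel \<otimes>\<^bsub>E\<^esub> Z i)"
    by (rule E.A.finsum_rdistr [symmetric]) (use e D_rel_closed Z_closed in auto)
  also have "\<dots> = \<zero>\<^bsub>E\<^esub>"
    unfolding D_fundamental [OF rel_P] cls_rel using e by (simp add: ten_zero)
  finally show ?thesis .
qed

section \<open>The resolution\<close>

abbreviation "Fr k \<equiv> free_left_module E k"

sublocale Fr: lmodule E "Fr k" for k by (rule E.A.lmodule_free_left_module)

text \<open>
  \<open>E\<close> as a free module of rank one: tuples indexed by \<open>{1..1}\<close>, so that all terms of the resolution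
  have the same type.
\<close>

definition vec1 :: "'x \<Rightarrow> nat \<Rightarrow> 'x" where "vec1 x = (\<lambda>_\<in>{1..1}. x)"

lemma vec1_simps [simp]: "vec1 x 1 = x" "vec1 x (Suc 0) = x" "vec1 x = vec1 y \<longleftrightarrow> x = y"
  "vec1 x \<in> {1..1} \<rightarrow>\<^sub>E X \<longleftrightarrow> x \<in> X"
proof -
  show a: "vec1 x 1 = x" "vec1 x (Suc 0) = x" for x by (simp_all add: vec1_def)
  show "vec1 x = vec1 y \<longleftrightarrow> x = y" using a(1) by metis
  show "vec1 x \<in> {1..1} \<rightarrow>\<^sub>E X \<longleftrightarrow> x \<in> X" by (auto simp: vec1_def PiE_iff)
qed

lemma vec1_cases:
  assumes "v \<in> {1..1} \<rightarrow>\<^sub>E X" obtains x where "x \<in> X" "v = vec1 x"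
proof
  show "v 1 \<in> X" using assms by (auto simp: PiE_iff)
  show "v = vec1 (v 1)"
    by (rule PiE_eqI [OF assms, of _ "\<lambda>_. UNIV"]) (auto simp: vec1_def)
qed

text \<open>
  The ranks in the resolution \<open>0 \<rightarrow> E \<rightarrow> E\<^sup>m \<rightarrow> E\<close>.
\<close>

definition rank :: "nat \<Rightarrow> nat" where
  "rank n = (if n = 0 then 1 else if n = 1 then m else if n = 2 then 1 else 0)"

definition boundary where
  "boundary n v = (if n = 0 then vec1 (\<Oplus>\<^bsub>E\<^esub>i\<in>{1..m}. v i \<otimes>\<^bsub>E\<^esub> Z i)
     else if n = 1 then (\<lambda>i\<in>{1..m}. v 1 \<otimes>\<^bsub>E\<^esub> D i rel) else \<zero>\<^bsub>Fr (rank n)\<^esub>)"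

definition augmentation where "augmentation v = v 1 \<odot>\<^bsub>L\<^esub> \<one>\<^bsub>A\<^esub>"

lemma Fr_component: "\<lbrakk>v \<in> carrier (Fr k); i \<in> {1..k}\<rbrakk> \<Longrightarrow> v i \<in> carrier E"
  by (auto simp del: atLeastAtMost_iff)

lemma boundary_hom: "boundary n \<in> mod_hom E (Fr (rank (Suc n))) (Fr (rank n))"
proof -
  consider "n = 0" | "n = 1" | "n > 1" by linarith
  then show ?thesis
  proof cases
    case 1
    show ?thesis
    proof (rule mod_homI)
      fix v assume "v \<in> carrier (Fr (rank (Suc n)))"
      then have v: "v i \<in> carrier E" if "i \<in> {1..m}" for i
        using Fr_component that 1 by (simp add: rank_def del: free_left_module_simps)
      have vZ: "v i \<otimes>\<^bsub>E\<^esub> Z i \<in> carrier E" if "i \<in> {1..m}" for i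
        by (rule E.A.m_closed [OF v [OF that] Z_closed [OF that]])
      have "(\<Oplus>\<^bsub>E\<^esub>i\<in>{1..m}. v i \<otimes>\<^bsub>E\<^esub> Z i) \<in> carrier E"
        by (intro E.M.finsum_closed Pi_I vZ)
      then show "boundary n v \<in> carrier (Fr (rank n))"
        using 1 by (simp add: boundary_def rank_def vec1_simps(4) [simplified])
      {
        fix r assume r: "r \<in> carrier E"
        have "(\<Oplus>\<^bsub>E\<^esub>i\<in>{1..m}. (r \<odot>\<^bsub>Fr m\<^esub> v) i \<otimes>\<^bsub>E\<^esub> Z i) = (\<Oplus>\<^bsub>E\<^esub>i\<in>{1..m}. r \<otimes>\<^bsub>E\<^esub> (v i \<otimes>\<^bsub>E\<^esub> Z i))"
        proof (rule E.M.finsum_cong' [OF refl])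
          show "(r \<odot>\<^bsub>Fr m\<^esub> v) i \<otimes>\<^bsub>E\<^esub> Z i = r \<otimes>\<^bsub>E\<^esub> (v i \<otimes>\<^bsub>E\<^esub> Z i)" if "i \<in> {1..m}" for i
            using E.A.m_assoc [OF r v [OF that] Z_closed [OF that]] that by simp
        qed (intro Pi_I E.A.m_closed r v Z_closed)
        also have "\<dots> = r \<otimes>\<^bsub>E\<^esub> (\<Oplus>\<^bsub>E\<^esub>i\<in>{1..m}. v i \<otimes>\<^bsub>E\<^esub> Z i)"
          by (rule E.A.finsum_rdistr [symmetric]) (use r vZ in auto)
        finally show "boundary n (r \<odot>\<^bsub>Fr (rank (Suc n))\<^esub> v) = r \<odot>\<^bsub>Fr (rank n)\<^esub> boundary n v"
          using 1 by (simp add: boundary_def rank_def) (simp add: vec1_def fun_eq_iff)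
      }
      fix w assume "w \<in> carrier (Fr (rank (Suc n)))"
      then have w: "w i \<in> carrier E" if "i \<in> {1..m}" for i
        using Fr_component that 1 by (simp add: rank_def del: free_left_module_simps)
      have wZ: "w i \<otimes>\<^bsub>E\<^esub> Z i \<in> carrier E" if "i \<in> {1..m}" for i
        by (rule E.A.m_closed [OF w [OF that] Z_closed [OF that]])
      have "(\<Oplus>\<^bsub>E\<^esub>i\<in>{1..m}. (v \<oplus>\<^bsub>Fr m\<^esub> w) i \<otimes>\<^bsub>E\<^esub> Z i) = (\<Oplus>\<^bsub>E\<^esub>i\<in>{1..m}. v i \<otimes>\<^bsub>E\<^esub> Z i \<oplus>\<^bsub>E\<^esub> w i \<otimes>\<^bsub>E\<^esub> Z i)"
      proof (rule E.M.finsum_cong' [OF refl])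
        show "(v \<oplus>\<^bsub>Fr m\<^esub> w) i \<otimes>\<^bsub>E\<^esub> Z i = v i \<otimes>\<^bsub>E\<^esub> Z i \<oplus>\<^bsub>E\<^esub> w i \<otimes>\<^bsub>E\<^esub> Z i" if "i \<in> {1..m}" for i
          using E.A.l_distr [OF v [OF that] w [OF that] Z_closed [OF that]] that by simp
      qed (intro Pi_I E.M.a_closed vZ wZ)
      also have "\<dots> = (\<Oplus>\<^bsub>E\<^esub>i\<in>{1..m}. v i \<otimes>\<^bsub>E\<^esub> Z i) \<oplus>\<^bsub>E\<^esub> (\<Oplus>\<^bsub>E\<^esub>i\<in>{1..m}. w i \<otimes>\<^bsub>E\<^esub> Z i)"
        by (rule E.M.finsum_addf) (use vZ wZ in auto)
      finally show "boundary n (v \<oplus>\<^bsub>Fr (rank (Suc n))\<^esub> w) = boundary n v \<oplus>\<^bsub>Fr (rank n)\<^esub> boundary n w"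
        using 1 by (simp add: boundary_def rank_def) (simp add: vec1_def fun_eq_iff)
    qed
  next
    case 2
    have "rank (Suc n) = 1" "rank n = m" using 2 by (simp_all add: rank_def)
    moreover have "v 1 \<in> carrier E" if "v \<in> carrier (Fr 1)" for v using Fr_component [OF that] by simp
    ultimately show ?thesis
      using 2 D_rel_closed by (intro mod_homI) (auto simp: boundary_def E.A.l_distr E.A.m_assoc intro!: restrict_ext)
  next
    case 3
    have z: "(\<lambda>v. \<zero>\<^bsub>Fr (rank n)\<^esub>) \<in> mod_hom E (Fr (rank (Suc n))) (Fr (rank n))"
      by (rule mod_hom_pair.hom_zero_hom) (simp add: mod_hom_pair_def Fr.lmodule_axioms)
    moreover have "boundary n = (\<lambda>v. \<zero>\<^bsub>Fr (rank n)\<^esub>)"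
      using 3 by (simp add: boundary_def [abs_def])
    ultimately show ?thesis by (simp only:)
  qed
qed

text \<open>
  Exactness at \<open>E\<close> in degree \<open>0\<close> is \<open>homotopy_degree_0\<close>, at \<open>E\<^sup>m\<close> it is \<open>exact_degree_1\<close> together with
  \<open>composite_zero\<close>, and at \<open>E\<close> in degree \<open>2\<close> it is \<open>mult_D_rel_injective\<close>.
\<close>

lemma resolution:
  "projective_resolution E L (\<lambda>n. Fr (rank n)) boundary augmentation"
proof -
  have r: "rank 0 = 1" "rank 1 = m" "rank (Suc 0) = m" "rank (Suc (Suc 0)) = 1" "rank (Suc (Suc (Suc n))) = 0" for n
    by (simp_all add: rank_def)
  have one: "\<one>\<^bsub>A\<^esub> \<in> carrier A" by simp
  note La = left_act_hom [OF one]
  have eps: "augmentation \<in> mod_hom E (Fr 1) L"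
    using Fr_component [of _ 1 1] one
    by (intro mod_homI) (simp_all add: augmentation_def act_closed act_mult mod_hom_add [OF La] del: One_nat_def)
  have vec: "x \<in> carrier E" if "vec1 x \<in> carrier (Fr 1)" for x using that by (simp only: free_left_module_simps vec1_simps)
  have vec': "vec1 x \<in> carrier (Fr 1)" if "x \<in> carrier E" for x using that by (simp only: free_left_module_simps vec1_simps)
  have zero1: "\<zero>\<^bsub>Fr 1\<^esub> = vec1 \<zero>\<^bsub>E\<^esub>" by (simp add: vec1_def)
  have surj: "augmentation ` carrier (Fr 1) = carrier L"
  proof
    show "augmentation ` carrier (Fr 1) \<subseteq> carrier L" using mod_hom_closed [OF eps] by blast
    show "carrier L \<subseteq> augmentation ` carrier (Fr 1)"
    proof
      fix a assume "a \<in> carrier L"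
      then have a: "a \<in> carrier A" by simp
      have "augmentation (vec1 (ten a \<one>\<^bsub>A\<^esub>)) = a" using a by (simp add: augmentation_def left_act_ten)
      then show "a \<in> augmentation ` carrier (Fr 1)"
        by (intro image_eqI [of _ _ "vec1 (ten a \<one>\<^bsub>A\<^esub>)"] vec') (use a in simp_all)
    qed
  qed
  have ex0: "boundary 0 ` carrier (Fr m) = {x \<in> carrier (Fr 1). augmentation x = \<zero>\<^bsub>L\<^esub>}"
  proof (intro equalityI subsetI)
    fix x assume "x \<in> boundary 0 ` carrier (Fr m)"
    then obtain v where v: "v \<in> carrier (Fr m)" "x = boundary 0 v" by blast
    have vc: "v i \<in> carrier E" if "i \<in> {1..m}" for i by (rule Fr_component [OF v(1) that])
    have x: "x \<in> carrier (Fr 1)" using mod_hom_closed [OF boundary_hom, of v 0] v r by simp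
    have "augmentation x = (\<Oplus>\<^bsub>A\<^esub>i\<in>{1..m}. (v i \<otimes>\<^bsub>E\<^esub> Z i) \<odot>\<^bsub>L\<^esub> \<one>\<^bsub>A\<^esub>)"
      unfolding v(2) augmentation_def boundary_def
      using EA.hom_finsum [OF La, of "\<lambda>i. v i \<otimes>\<^bsub>E\<^esub> Z i" "{1..m}"] vc Z_closed by (simp del: One_nat_def)
    also have "\<dots> = (\<Oplus>\<^bsub>A\<^esub>i\<in>{1..m}. \<zero>\<^bsub>A\<^esub>)"
    proof (rule M.finsum_cong' [OF refl])
      fix i assume i: "i \<in> {1..m}"
      have zi: "z i \<in> carrier A" using z_P [OF i] by simp
      have "Z i \<odot>\<^bsub>L\<^esub> \<one>\<^bsub>A\<^esub> = \<zero>\<^bsub>A\<^esub>"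
        using EA.hom_minus [OF La, of "ten (z i) \<one>\<^bsub>A\<^esub>" "ten \<one>\<^bsub>A\<^esub> (z i)"] zi by (simp add: left_act_ten)
      moreover have "v i \<odot>\<^bsub>L\<^esub> \<zero>\<^bsub>A\<^esub> = \<zero>\<^bsub>A\<^esub>" using AA.hom_zero [OF act_hom(1) [OF vc [OF i]]] .
      ultimately show "(v i \<otimes>\<^bsub>E\<^esub> Z i) \<odot>\<^bsub>L\<^esub> \<one>\<^bsub>A\<^esub> = \<zero>\<^bsub>A\<^esub>"
        using act_mult(1) [OF vc [OF i] Z_closed [OF i] one] by simp
    qed simp
    finally show "x \<in> {x \<in> carrier (Fr 1). augmentation x = \<zero>\<^bsub>L\<^esub>}" using x by simp
  next
    fix x assume x: "x \<in> {x \<in> carrier (Fr 1). augmentation x = \<zero>\<^bsub>L\<^esub>}"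
    then obtain e where e: "e \<in> carrier E" "x = vec1 e"
      using vec1_cases [of x "carrier E"] by (auto simp del: One_nat_def)
    have "e \<odot>\<^bsub>L\<^esub> \<one>\<^bsub>A\<^esub> = \<zero>\<^bsub>A\<^esub>" using x e by (simp add: augmentation_def)
    then have "e = ten \<one>\<^bsub>A\<^esub> \<zero>\<^bsub>A\<^esub> \<oplus>\<^bsub>E\<^esub> (\<Oplus>\<^bsub>E\<^esub>i\<in>{1..m}. contraction i e \<otimes>\<^bsub>E\<^esub> Z i)" using homotopy_degree_0 [OF e(1)] by simp
    moreover have "(\<Oplus>\<^bsub>E\<^esub>i\<in>{1..m}. contraction i e \<otimes>\<^bsub>E\<^esub> Z i) \<in> carrier E"
      by (intro E.M.finsum_closed Pi_I E.A.m_closed contraction_closed e(1) Z_closed)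
    ultimately have es: "e = (\<Oplus>\<^bsub>E\<^esub>i\<in>{1..m}. contraction i e \<otimes>\<^bsub>E\<^esub> Z i)" by (simp add: ten_zero)
    have "(\<Oplus>\<^bsub>E\<^esub>i\<in>{1..m}. (\<lambda>i\<in>{1..m}. contraction i e) i \<otimes>\<^bsub>E\<^esub> Z i) = (\<Oplus>\<^bsub>E\<^esub>i\<in>{1..m}. contraction i e \<otimes>\<^bsub>E\<^esub> Z i)"
      by (rule E.M.finsum_cong' [OF refl]) (use contraction_closed [OF e(1)] Z_closed in auto)
    then have "boundary 0 (\<lambda>i\<in>{1..m}. contraction i e) = x"
      unfolding boundary_def e(2) using es by (simp only: simp_thms if_True)
    moreover have "(\<lambda>i\<in>{1..m}. contraction i e) \<in> carrier (Fr m)" using contraction_closed [OF e(1)] by simp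
    ultimately show "x \<in> boundary 0 ` carrier (Fr m)" by blast
  qed
  have ex1: "boundary 1 ` carrier (Fr 1) = {x \<in> carrier (Fr m). boundary 0 x = \<zero>\<^bsub>Fr 1\<^esub>}"
  proof (intro equalityI subsetI)
    fix x assume "x \<in> boundary 1 ` carrier (Fr 1)"
    then obtain v where v: "v \<in> carrier (Fr 1)" "x = boundary 1 v" by blast
    have x: "x \<in> carrier (Fr m)" using mod_hom_closed [OF boundary_hom, of v 1] v r by simp
    have v1: "v 1 \<in> carrier E" using Fr_component [OF v(1), of 1] by simp
    have "(\<Oplus>\<^bsub>E\<^esub>i\<in>{1..m}. x i \<otimes>\<^bsub>E\<^esub> Z i) = (\<Oplus>\<^bsub>E\<^esub>i\<in>{1..m}. (v 1 \<otimes>\<^bsub>E\<^esub> D i rel) \<otimes>\<^bsub>E\<^esub> Z i)"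
      by (rule E.M.finsum_cong' [OF refl]) (use v1 D_rel_closed Z_closed in \<open>auto simp: v(2) boundary_def\<close>)
    then show "x \<in> {x \<in> carrier (Fr m). boundary 0 x = \<zero>\<^bsub>Fr 1\<^esub>}"
      using x unfolding boundary_def zero1 composite_zero [OF v1] by simp
  next
    fix x assume x: "x \<in> {x \<in> carrier (Fr m). boundary 0 x = \<zero>\<^bsub>Fr 1\<^esub>}"
    then have xc: "x \<in> carrier (Fr m)" by blast
    have "(\<Oplus>\<^bsub>E\<^esub>i\<in>{1..m}. x i \<otimes>\<^bsub>E\<^esub> Z i) = \<zero>\<^bsub>E\<^esub>"
      using x unfolding boundary_def zero1 by simp
    then obtain e where e: "e \<in> carrier E" "\<forall>j\<in>{1..m}. x j = e \<otimes>\<^bsub>E\<^esub> D j rel"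
      using exact_degree_1 [of x] Fr_component [OF xc] by blast
    have "boundary 1 (vec1 e) = x"
    proof (rule PiE_eqI [of _ "{1..m}" "\<lambda>_. carrier E" _ "\<lambda>_. carrier E"])
      show "x \<in> {1..m} \<rightarrow>\<^sub>E carrier E" using xc by simp
      show "boundary 1 (vec1 e) \<in> {1..m} \<rightarrow>\<^sub>E carrier E"
        using e(1) D_rel_closed by (auto simp: boundary_def)
    qed (use e(2) in \<open>auto simp: boundary_def\<close>)
    then show "x \<in> boundary 1 ` carrier (Fr 1)" using vec' [OF e(1)] by blast
  qed
  have ex2: "boundary (Suc (Suc 0)) ` carrier (Fr 0) = {x \<in> carrier (Fr 1). boundary 1 x = \<zero>\<^bsub>Fr m\<^esub>}"
  proof -
    have "x = \<zero>\<^bsub>Fr 1\<^esub>" if x: "x \<in> carrier (Fr 1)" "boundary 1 x = \<zero>\<^bsub>Fr m\<^esub>" for x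
    proof -
      obtain e where e: "e \<in> carrier E" "x = vec1 e"
        using vec1_cases [of x "carrier E"] x(1) by (auto simp del: One_nat_def)
      have "e \<otimes>\<^bsub>E\<^esub> D m rel = \<zero>\<^bsub>E\<^esub>"
        using fun_cong [OF x(2), of m] m_pos by (simp add: e(2) boundary_def)
      then show ?thesis using mult_D_rel_injective [OF e(1)] e(2) zero1 by simp
    qed
    moreover have "boundary 1 \<zero>\<^bsub>Fr 1\<^esub> = \<zero>\<^bsub>Fr m\<^esub>"
      unfolding zero1 using D_rel_closed by (auto simp: boundary_def intro!: restrict_ext)
    moreover have "\<zero>\<^bsub>Fr 1\<^esub> \<in> carrier (Fr 1)" by simp
    ultimately have "{x \<in> carrier (Fr 1). boundary 1 x = \<zero>\<^bsub>Fr m\<^esub>} = {\<zero>\<^bsub>Fr 1\<^esub>}" by blast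
    moreover have "boundary (Suc (Suc 0)) ` carrier (Fr 0) = {\<zero>\<^bsub>Fr 1\<^esub>}"
      using r(4) by (auto simp: boundary_def numeral_2_eq_2)
    ultimately show ?thesis by simp
  qed
  have ex3: "boundary (Suc (Suc (Suc n))) ` carrier (Fr 0) = {x \<in> carrier (Fr 0). boundary (Suc (Suc n)) x = \<zero>\<^bsub>Fr (rank (Suc (Suc n)))\<^esub>}" for n
    by (auto simp: boundary_def r)
  have exS: "boundary (Suc n) ` carrier (Fr (rank (Suc (Suc n)))) = {x \<in> carrier (Fr (rank (Suc n))). boundary n x = \<zero>\<^bsub>Fr (rank n)\<^esub>}" for n
  proof -
    consider "n = 0" | "n = 1" | k where "n = Suc (Suc k)" by (metis One_nat_def not0_implies_Suc)
    then show ?thesis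
      by cases (use ex1 ex2 ex3 in \<open>simp_all only: r One_nat_def\<close>)
  qed
  show ?thesis
    unfolding projective_resolution_def left_module_iff
    using lmodule_left_enveloping E.A.projective_free_left_module boundary_hom eps surj ex0 exS
    by (simp only: r(1,2) simp_thms)
qed

end

section \<open>Hochschild homology\<close>

lemma vs_iso_trivial:
  assumes "V \<cong>\<^sub>v W" "carrier W = {x}" "lmodule ground V"
  shows "carrier V = {\<zero>\<^bsub>V\<^esub>}"
proof -
  interpret lmodule ground V by fact
  obtain h where "bij_betw h (carrier V) {x}" using assms(1,2) unfolding vs_iso_def by auto
  then have "inj_on h (carrier V)" "h ` carrier V = {x}" by (auto simp: bij_betw_def)
  then have "y = \<zero>\<^bsub>V\<^esub>" if "y \<in> carrier V" for y
    using that M.zero_closed by (metis imageI inj_onD singletonD)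
  then show ?thesis by auto
qed

lemma homology_trivial:
  assumes C: "chain_complex C \<delta>"
    and inj: "\<And>x. \<lbrakk>x \<in> carrier (C (Suc n)); \<delta> n x = \<zero>\<^bsub>C n\<^esub>\<rbrakk> \<Longrightarrow> x = \<zero>\<^bsub>C (Suc n)\<^esub>"
  shows "\<exists>X. carrier (homology C \<delta> (Suc n)) = {X}"
proof -
  interpret vsubspace "\<delta> (Suc n) ` carrier (C (Suc (Suc n)))" "vkernel (C (Suc n)) (C n) (\<delta> n)"
    by (rule chain_complex_vkernel(2) [OF C])
  have "carrier (vkernel (C (Suc n)) (C n) (\<delta> n)) = {\<zero>\<^bsub>vkernel (C (Suc n)) (C n) (\<delta> n)\<^esub>}"
    using inj M.zero_closed by auto
  then show ?thesis by (simp add: vquot_simps(2) del: vkernel_simps)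
qed

lemma lmodule_homology:
  assumes "chain_complex C \<delta>" shows "lmodule ground (homology C \<delta> q)"
  using vsubspace.vquot_lmodule [OF chain_complex_vkernel(1) [OF assms]]
    vsubspace.vquot_lmodule [OF chain_complex_vkernel(2) [OF assms]]
  by (cases q) simp_all

text \<open>
  Both spaces consist of the cosets of those \<open>x\<close> with \<open>f x = 0\<close>, and the identity is an isomorphism.
\<close>

lemma vkernel_vquot_iso:
  assumes W: "vsubspace W V" and U: "lmodule ground U" and f: "f \<in> mod_hom ground V U"
    and fW: "\<And>w. w \<in> W \<Longrightarrow> f w = \<zero>\<^bsub>U\<^esub>"
  shows "vkernel V U f /\<^sub>v W \<cong>\<^sub>v vkernel (V /\<^sub>v W) U (on_coset f)"
proof -
  interpret V: vsubspace W V by fact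
  have p: "mod_hom_pair ground V U" by (simp add: mod_hom_pair_def U V.lmodule_axioms)
  have k: "lmodule ground (vkernel V U f)" by (rule lmodule_vkernel [OF p f])
  have "submodule W ground (vkernel V U f)"
    by (rule lmodule_ground_submoduleI [OF k]) (use submodule_closed [OF V.sub] fW in auto)
  then interpret K: vsubspace W "vkernel V U f"
    using k by (simp add: vsubspace_def vspace_def vsubspace_axioms_def)
  note bar = V.on_coset_hom(1) [OF U f fW]
  have eq: "carrier (vkernel V U f /\<^sub>v W) = carrier (vkernel (V /\<^sub>v W) U (on_coset f))"
    by (auto simp: K.vquot_simps(2) V.vquot_simps(2) coset_vkernel bar)
  have h: "(\<lambda>X. X) \<in> mod_hom ground (vkernel V U f /\<^sub>v W) (vkernel (V /\<^sub>v W) U (on_coset f))"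
  proof (rule mod_homI)
    fix X assume X: "X \<in> carrier (vkernel V U f /\<^sub>v W)"
    then show "X \<in> carrier (vkernel (V /\<^sub>v W) U (on_coset f))" by (simp only: eq)
    obtain x where x: "x \<in> carrier V" "f x = \<zero>\<^bsub>U\<^esub>" "X = W +>\<^bsub>V\<^esub> x"
      using X by (auto simp: K.vquot_simps(2) coset_vkernel)
    show "c \<odot>\<^bsub>vkernel V U f /\<^sub>v W\<^esub> X = c \<odot>\<^bsub>vkernel (V /\<^sub>v W) U (on_coset f)\<^esub> X" for c
      using x K.vquot_smult [of x c] V.vquot_smult [of x c] by (simp add: coset_vkernel)
    fix Y assume "Y \<in> carrier (vkernel V U f /\<^sub>v W)"
    then obtain y where y: "y \<in> carrier V" "f y = \<zero>\<^bsub>U\<^esub>" "Y = W +>\<^bsub>V\<^esub> y"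
      by (auto simp: K.vquot_simps(2) coset_vkernel)
    show "X \<oplus>\<^bsub>vkernel V U f /\<^sub>v W\<^esub> Y = X \<oplus>\<^bsub>vkernel (V /\<^sub>v W) U (on_coset f)\<^esub> Y"
      using x y K.vquot_add [of x y] V.vquot_add [of x y] by (simp add: coset_vkernel)
  qed
  show ?thesis
    by (rule vs_isoI [OF h, of "\<lambda>X. X"]) (simp_all add: eq)
qed

context continuant_quotient
begin

sublocale FT: free_tensor E Rt A by (rule free_tensor_enveloping)

abbreviation "C \<equiv> \<lambda>n. vpower A (rank n)"
abbreviation "\<delta> \<equiv> \<lambda>n. induced_map E Rt A (rank (Suc n)) (rank n) (boundary n)"

text \<open>
  The commutator \<open>[a\<^sub>i, z\<^sub>i]\<close> is the right action of \<open>z\<^sub>i \<otimes> 1 - 1 \<otimes> z\<^sub>i\<close> on \<open>a\<^sub>i\<close>.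
\<close>

lemma b_map_eq:
  assumes a: "\<And>i. i \<in> {1..m} \<Longrightarrow> a i \<in> carrier A"
  shows "b_map m a = (\<Oplus>\<^bsub>A\<^esub>i\<in>{1..m}. Z i \<odot>\<^bsub>Rt\<^esub> a i)"
proof -
  have e: "Z i \<odot>\<^bsub>Rt\<^esub> a i = a i \<otimes>\<^bsub>A\<^esub> z i \<ominus>\<^bsub>A\<^esub> z i \<otimes>\<^bsub>A\<^esub> a i" if i: "i \<in> {1..m}" for i
  proof -
    have zi: "z i \<in> carrier A" using z_P [OF i] by simp
    show ?thesis
      using EA.hom_minus [OF right_act_hom [OF a [OF i]], of "ten (z i) \<one>\<^bsub>A\<^esub>" "ten \<one>\<^bsub>A\<^esub> (z i)"] zi a [OF i]
      by (simp add: right_act_ten)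
  qed
  have "b_map m a = (\<Oplus>\<^bsub>A\<^esub>i\<in>{1..m}. a i \<otimes>\<^bsub>A\<^esub> z i \<ominus>\<^bsub>A\<^esub> z i \<otimes>\<^bsub>A\<^esub> a i)"
    by (simp only: b_map_def Let_def A_eq [symmetric] word_class_eq)
  also have "\<dots> = (\<Oplus>\<^bsub>A\<^esub>i\<in>{1..m}. Z i \<odot>\<^bsub>Rt\<^esub> a i)"
    by (rule M.finsum_cong' [OF refl]) (simp_all only: e, intro Pi_I, simp only: e [symmetric] act_closed(2) a Z_closed)
  finally show ?thesis .
qed

text \<open>
  Under the right action \<open>p \<otimes> q\<close> sends \<open>a\<close> to \<open>q a p\<close>.
\<close>

lemma J_map_eq:
  assumes a: "a \<in> carrier A"
  shows "J_map m a = (\<lambda>i\<in>{1..m}. D i rel \<odot>\<^bsub>Rt\<^esub> a)"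
proof -
  have "(\<Oplus>\<^bsub>A\<^esub>w\<in>Poly_Mapping.keys rel. \<Oplus>\<^bsub>A\<^esub>j\<in>{j. j < length w \<and> w ! j = i}.
      Poly_Mapping.lookup rel w \<odot>\<^bsub>A\<^esub> (word_class m (drop (Suc j) w) \<otimes>\<^bsub>A\<^esub> a \<otimes>\<^bsub>A\<^esub> word_class m (take j w))) =
      D i rel \<odot>\<^bsub>Rt\<^esub> a" for i
  proof -
    note h = right_act_hom [OF a]
    have w: "w \<in> lists {1..m}" if "w \<in> Poly_Mapping.keys rel" for w
      using that rel_P by (auto simp: poly_over_def)
    have D: "D_word i w \<odot>\<^bsub>Rt\<^esub> a = (\<Oplus>\<^bsub>A\<^esub>j\<in>{j. j < length w \<and> w ! j = i}.
        word_class m (drop (Suc j) w) \<otimes>\<^bsub>A\<^esub> a \<otimes>\<^bsub>A\<^esub> word_class m (take j w))" if w: "w \<in> lists {1..m}" for w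
    proof -
      have "D_word i w \<odot>\<^bsub>Rt\<^esub> a = (\<Oplus>\<^bsub>A\<^esub>j\<in>{j. j < length w \<and> w ! j = i}.
          ten (cls (word (take j w))) (cls (word (drop (Suc j) w))) \<odot>\<^bsub>Rt\<^esub> a)"
        unfolding D_word_def by (rule EA.hom_finsum [OF h]) (intro Pi_I D_word_term w)
      also have "\<dots> = (\<Oplus>\<^bsub>A\<^esub>j\<in>{j. j < length w \<and> w ! j = i}.
          word_class m (drop (Suc j) w) \<otimes>\<^bsub>A\<^esub> a \<otimes>\<^bsub>A\<^esub> word_class m (take j w))"
        using right_act_ten [OF a cls_closed [OF word_P [OF take_drop_lists(1) [OF w]]] cls_closed [OF word_P [OF take_drop_lists(2) [OF w]]]]
          cls_closed [OF word_P [OF take_drop_lists(1) [OF w]]] cls_closed [OF word_P [OF take_drop_lists(2) [OF w]]] a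
        by (intro M.finsum_cong' [OF refl]) (auto simp: word_class_eq)
      finally show ?thesis .
    qed
    have t: "word_class m (drop (Suc j) w) \<otimes>\<^bsub>A\<^esub> a \<otimes>\<^bsub>A\<^esub> word_class m (take j w) \<in> carrier A" if "w \<in> lists {1..m}" for j w
      using cls_closed [OF word_P [OF take_drop_lists(1) [OF that]]] cls_closed [OF word_P [OF take_drop_lists(2) [OF that]]] a
      by (simp add: word_class_eq)
    have "D i rel \<odot>\<^bsub>Rt\<^esub> a = (\<Oplus>\<^bsub>A\<^esub>w\<in>Poly_Mapping.keys rel. (Poly_Mapping.lookup rel w \<odot>\<^bsub>E\<^esub> D_word i w) \<odot>\<^bsub>Rt\<^esub> a)"
      unfolding D_def linear_extension_def
      by (rule EA.hom_finsum [OF h]) (use D_word_closed w in auto)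
    also have "\<dots> = (\<Oplus>\<^bsub>A\<^esub>w\<in>Poly_Mapping.keys rel. \<Oplus>\<^bsub>A\<^esub>j\<in>{j. j < length w \<and> w ! j = i}.
      Poly_Mapping.lookup rel w \<odot>\<^bsub>A\<^esub> (word_class m (drop (Suc j) w) \<otimes>\<^bsub>A\<^esub> a \<otimes>\<^bsub>A\<^esub> word_class m (take j w)))"
    proof (rule M.finsum_cong' [OF refl])
      show "(\<lambda>w. \<Oplus>\<^bsub>A\<^esub>j\<in>{j. j < length w \<and> w ! j = i}.
          Poly_Mapping.lookup rel w \<odot>\<^bsub>A\<^esub> (word_class m (drop (Suc j) w) \<otimes>\<^bsub>A\<^esub> a \<otimes>\<^bsub>A\<^esub> word_class m (take j w)))
        \<in> Poly_Mapping.keys rel \<rightarrow> carrier A"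
        by (intro Pi_I M.finsum_closed sc_closed t w)
      fix v assume v: "v \<in> Poly_Mapping.keys rel"
      have "(Poly_Mapping.lookup rel v \<odot>\<^bsub>E\<^esub> D_word i v) \<odot>\<^bsub>Rt\<^esub> a = Poly_Mapping.lookup rel v \<odot>\<^bsub>A\<^esub> (D_word i v \<odot>\<^bsub>Rt\<^esub> a)"
        using mod_hom_smult [OF h _ D_word_closed [OF w [OF v]]] by simp
      also have "\<dots> = (\<Oplus>\<^bsub>A\<^esub>j\<in>{j. j < length v \<and> v ! j = i}.
          Poly_Mapping.lookup rel v \<odot>\<^bsub>A\<^esub> (word_class m (drop (Suc j) v) \<otimes>\<^bsub>A\<^esub> a \<otimes>\<^bsub>A\<^esub> word_class m (take j v)))"
        unfolding D [OF w [OF v]] by (rule smult_finsum_right) (use t [OF w [OF v]] in auto)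
      finally show "(Poly_Mapping.lookup rel v \<odot>\<^bsub>E\<^esub> D_word i v) \<odot>\<^bsub>Rt\<^esub> a = \<dots>" .
    qed
    finally show ?thesis ..
  qed
  then show ?thesis by (simp only: J_map_def Let_def A_eq [symmetric])
qed

lemma rank_simps: "rank 0 = 1" "rank 1 = m" "rank (Suc 0) = m" "rank (Suc (Suc 0)) = 1" "rank (Suc (Suc (Suc n))) = 0"
  by (simp_all add: rank_def)

lemma vpower_component: "\<lbrakk>a \<in> carrier (vpower A k); i \<in> {1..k}\<rbrakk> \<Longrightarrow> a i \<in> carrier A"
  by (auto simp del: atLeastAtMost_iff)

lemma \<delta>_0:
  assumes a: "a \<in> carrier (vpower A m)"
  shows "\<delta> 0 a = vec1 (b_map m a)"
proof -
  note ac = vpower_component [OF a]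
  have u: "boundary 0 (unit_vector E m i) 1 = Z i" if i: "i \<in> {1..m}" for i
  proof -
    have "(\<Oplus>\<^bsub>E\<^esub>j\<in>{1..m}. unit_vector E m i j \<otimes>\<^bsub>E\<^esub> Z j) = (\<Oplus>\<^bsub>E\<^esub>j\<in>{1..m}. if i = j then Z j else \<zero>\<^bsub>E\<^esub>)"
    proof (rule E.M.finsum_cong' [OF refl])
      fix j assume j: "j \<in> {1..m}"
      show "unit_vector E m i j \<otimes>\<^bsub>E\<^esub> Z j = (if i = j then Z j else \<zero>\<^bsub>E\<^esub>)"
        using j Z_closed [OF j] by (simp add: unit_vector_def)
    qed (use Z_closed in auto)
    also have "\<dots> = Z i" by (rule E.M.finsum_singleton) (use i Z_closed in auto)
    finally show ?thesis by (simp add: boundary_def)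
  qed
  have "(\<Oplus>\<^bsub>A\<^esub>i\<in>{1..m}. boundary 0 (unit_vector E m i) 1 \<odot>\<^bsub>Rt\<^esub> a i) = (\<Oplus>\<^bsub>A\<^esub>i\<in>{1..m}. Z i \<odot>\<^bsub>Rt\<^esub> a i)"
    by (rule M.finsum_cong' [OF refl]) (simp_all only: u, intro Pi_I act_closed(2) Z_closed ac)
  then have "(\<Oplus>\<^bsub>A\<^esub>i\<in>{1..m}. boundary 0 (unit_vector E m i) 1 \<odot>\<^bsub>Rt\<^esub> a i) = b_map m a"
    using b_map_eq ac by simp
  then show ?thesis
    by (simp add: induced_map_def rank_simps vec1_def del: One_nat_def) (simp add: fun_eq_iff)
qed

lemma \<delta>_1:
  assumes a: "a \<in> carrier A"
  shows "\<delta> 1 (vec1 a) = J_map m a"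
proof -
  have "boundary 1 (unit_vector E 1 1) i = D i rel" if "i \<in> {1..m}" for i
    using that D_rel_closed by (simp add: boundary_def unit_vector_def)
  then show ?thesis
    unfolding J_map_eq [OF a] induced_map_def
    using a D_rel_closed by (auto simp: rank_simps act_closed intro!: restrict_ext)
qed

lemma complex:
  shows C_complex: "chain_complex C \<delta>"
    and Tor_iso: "Tor E Rt (\<lambda>n. Fr (rank n)) boundary q \<cong>\<^sub>v homology C \<delta> q"
  by (rule FT.Tor_free [where d = boundary and k = rank, OF boundary_hom resolution_facts(9) [OF resolution]],
    assumption)+

lemma zero1: "\<zero>\<^bsub>vpower A 1\<^esub> = vec1 \<zero>\<^bsub>A\<^esub>"
  by (simp add: vec1_def)

lemma C_carrier: "carrier (C 0) = vec1 ` carrier A" "carrier (C (Suc (Suc 0))) = vec1 ` carrier A"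
proof -
  have "carrier (vpower A 1) = vec1 ` carrier A"
  proof (intro equalityI subsetI)
    fix v assume "v \<in> carrier (vpower A 1)"
    then have "v \<in> {1..1} \<rightarrow>\<^sub>E carrier A" by simp
    then show "v \<in> vec1 ` carrier A" using vec1_cases by blast
  next
    fix v assume "v \<in> vec1 ` carrier A"
    then obtain x where "x \<in> carrier A" "v = vec1 x" by blast
    then show "v \<in> carrier (vpower A 1)" by (simp only: vpower_simps vec1_simps)
  qed
  then show "carrier (C 0) = vec1 ` carrier A" "carrier (C (Suc (Suc 0))) = vec1 ` carrier A"
    by (simp_all only: rank_simps)
qed

lemma boundaries: "\<delta> 0 ` carrier (C 1) = vec1 ` b_map m ` carrier (vpower A m)"
  "\<delta> (Suc 0) ` carrier (C (Suc (Suc 0))) = J_map m ` carrier A"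
proof -
  have "\<delta> 0 ` carrier (vpower A m) = (\<lambda>a. vec1 (b_map m a)) ` carrier (vpower A m)"
    using \<delta>_0 by (intro image_cong refl)
  then show "\<delta> 0 ` carrier (C 1) = vec1 ` b_map m ` carrier (vpower A m)"
    by (simp only: rank_simps image_image)
  have "\<delta> 1 ` vec1 ` carrier A = J_map m ` carrier A"
    unfolding image_image using \<delta>_1 by (intro image_cong refl)
  then show "\<delta> (Suc 0) ` carrier (C (Suc (Suc 0))) = J_map m ` carrier A"
    by (simp only: C_carrier One_nat_def)
qed

text \<open>
  \<open>[a, b]\<close> is the right action of \<open>b \<otimes> 1 - 1 \<otimes> b\<close> on \<open>a\<close>, and \<open>D_fundamental\<close> for \<open>sec b\<close> writes
  this element as a combination of the elements \<open>z\<^sub>i \<otimes> 1 - 1 \<otimes> z\<^sub>i\<close>.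
\<close>

lemma commutator_b_map:
  assumes a: "a \<in> carrier A" and b: "b \<in> carrier A"
  shows "\<exists>v\<in>carrier (vpower A m). a \<otimes>\<^bsub>A\<^esub> b \<ominus>\<^bsub>A\<^esub> b \<otimes>\<^bsub>A\<^esub> a = b_map m v"
proof
  let ?v = "\<lambda>i\<in>{1..m}. D i (sec b) \<odot>\<^bsub>Rt\<^esub> a"
  have Dc: "D i (sec b) \<in> carrier E" for i by (rule D_closed [OF sec_P [OF b]])
  show "?v \<in> carrier (vpower A m)" using act_closed(2) [OF Dc a] by simp
  note h = right_act_hom [OF a]
  have vc: "?v i \<in> carrier A" if "i \<in> {1..m}" for i using act_closed(2) [OF Dc a] that by simp
  have "a \<otimes>\<^bsub>A\<^esub> b \<ominus>\<^bsub>A\<^esub> b \<otimes>\<^bsub>A\<^esub> a = (ten b \<one>\<^bsub>A\<^esub> \<ominus>\<^bsub>E\<^esub> ten \<one>\<^bsub>A\<^esub> b) \<odot>\<^bsub>Rt\<^esub> a"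
    using EA.hom_minus [OF h, of "ten b \<one>\<^bsub>A\<^esub>" "ten \<one>\<^bsub>A\<^esub> b"] a b by (simp add: right_act_ten)
  also have "\<dots> = (\<Oplus>\<^bsub>E\<^esub>i\<in>{1..m}. D i (sec b) \<otimes>\<^bsub>E\<^esub> Z i) \<odot>\<^bsub>Rt\<^esub> a"
    unfolding D_fundamental [OF sec_P [OF b]] cls_sec [OF b] ..
  also have "\<dots> = (\<Oplus>\<^bsub>A\<^esub>i\<in>{1..m}. (D i (sec b) \<otimes>\<^bsub>E\<^esub> Z i) \<odot>\<^bsub>Rt\<^esub> a)"
    by (rule EA.hom_finsum [OF h]) (intro Pi_I E.A.m_closed Dc Z_closed)
  also have "\<dots> = (\<Oplus>\<^bsub>A\<^esub>i\<in>{1..m}. Z i \<odot>\<^bsub>Rt\<^esub> ?v i)"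
  proof (rule M.finsum_cong' [OF refl])
    show "(D i (sec b) \<otimes>\<^bsub>E\<^esub> Z i) \<odot>\<^bsub>Rt\<^esub> a = Z i \<odot>\<^bsub>Rt\<^esub> ?v i" if "i \<in> {1..m}" for i
      using act_mult(2) [OF Dc Z_closed [OF that] a] that by simp
  qed (intro Pi_I act_closed(2) Z_closed vc)
  also have "\<dots> = b_map m ?v"
    by (rule b_map_eq [symmetric]) (rule vc)
  finally show "a \<otimes>\<^bsub>A\<^esub> b \<ominus>\<^bsub>A\<^esub> b \<otimes>\<^bsub>A\<^esub> a = b_map m ?v" .
qed

lemma b_map_commutator:
  assumes a: "a \<in> carrier (vpower A m)"
  shows "b_map m a \<in> commutator_space A"
proof -
  let ?K = "{a \<otimes>\<^bsub>A\<^esub> b \<ominus>\<^bsub>A\<^esub> b \<otimes>\<^bsub>A\<^esub> a | a b. a \<in> carrier A \<and> b \<in> carrier A}"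
  have K: "?K \<subseteq> carrier A" by auto
  note sub = submodule_closed [OF vspan_submodule [OF K]]
  have s: "(\<Oplus>\<^bsub>A\<^esub>i\<in>J. f i) \<in> vspan A ?K" if "\<And>i. i \<in> J \<Longrightarrow> f i \<in> vspan A ?K" for f and J :: "nat set"
    using that
  proof (induct J rule: infinite_finite_induct)
    case (insert i J)
    have "(\<Oplus>\<^bsub>A\<^esub>i\<in>insert i J. f i) = f i \<oplus>\<^bsub>A\<^esub> (\<Oplus>\<^bsub>A\<^esub>i\<in>J. f i)"
      using insert sub(1) by (intro M.finsum_insert) auto
    then show ?case using insert sub(3) by simp
  qed (use sub(2) in simp_all)
  have "b_map m a = (\<Oplus>\<^bsub>A\<^esub>i\<in>{1..m}. a i \<otimes>\<^bsub>A\<^esub> z i \<ominus>\<^bsub>A\<^esub> z i \<otimes>\<^bsub>A\<^esub> a i)"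
    by (simp only: b_map_def Let_def A_eq [symmetric] word_class_eq)
  also have "\<dots> \<in> vspan A ?K"
  proof (rule s)
    fix i assume i: "i \<in> {1..m}"
    have "a i \<otimes>\<^bsub>A\<^esub> z i \<ominus>\<^bsub>A\<^esub> z i \<otimes>\<^bsub>A\<^esub> a i \<in> ?K"
      using vpower_component [OF a i] cls_closed [OF z_P [OF i]] by blast
    then show "a i \<otimes>\<^bsub>A\<^esub> z i \<ominus>\<^bsub>A\<^esub> z i \<otimes>\<^bsub>A\<^esub> a i \<in> vspan A ?K" using subset_vspan [OF K] by blast
  qed
  finally show ?thesis by (simp add: commutator_space_def)
qed

lemma vec1_hom: "vec1 \<in> mod_hom ground A (vpower A 1)"
  by (rule mod_homI) (auto simp: vec1_def intro!: restrict_ext)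

text \<open>
  The image of \<open>b_map m\<close> is a subspace that contains all commutators and consists of sums of
  commutators, so it is the commutator space.
\<close>

lemma homology_0: "homology C \<delta> 0 \<cong>\<^sub>v A /\<^sub>v commutator_space A"
proof -
  let ?K = "{a \<otimes>\<^bsub>A\<^esub> b \<ominus>\<^bsub>A\<^esub> b \<otimes>\<^bsub>A\<^esub> a | a b. a \<in> carrier A \<and> b \<in> carrier A}"
  let ?W = "vec1 ` b_map m ` carrier (vpower A m)"
  have K: "?K \<subseteq> carrier A" by auto
  have W: "vsubspace ?W (vpower A 1)"
    using chain_complex_vkernel(1) [OF C_complex, unfolded boundaries(1)] by (simp only: rank_simps)
  interpret W: vsubspace ?W "vpower A 1" by (rule W)
  have com: "vsubspace (commutator_space A) A"
    unfolding commutator_space_def using vspan_submodule [OF K]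
    by (simp add: vsubspace_def vsubspace_axioms_def vspace_axioms)
  interpret c: vsubspace "commutator_space A" A by (rule com)
  have v1: "vec1 (v 1) = v \<and> v 1 \<in> carrier A" if "v \<in> carrier (vpower A 1)" for v
  proof -
    have "v \<in> {1..1} \<rightarrow>\<^sub>E carrier A" using that by simp
    then obtain x where "x \<in> carrier A" "v = vec1 x" using vec1_cases by blast
    then show ?thesis by simp
  qed
  have "vpower A 1 /\<^sub>v ?W \<cong>\<^sub>v A /\<^sub>v commutator_space A"
  proof (rule vquot_iso [OF W com vpower_component_hom vec1_hom])
    show "(1::nat) \<in> {1..1}" by simp
    show "v 1 \<in> commutator_space A" if "v \<in> ?W" for v
      using that b_map_commutator by auto
    show "vec1 a \<in> ?W" if "a \<in> commutator_space A" for a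
    proof -
      let ?U = "{a \<in> carrier A. vec1 a \<in> ?W}"
      have "submodule ?U ground A"
      proof (rule lmodule_ground_submoduleI [OF lmodule_axioms])
        show "\<zero>\<^bsub>A\<^esub> \<in> ?U"
          using submodule_closed(2) [OF W.sub] mod_hom_pair.hom_zero [OF _ vec1_hom]
          by (simp add: mod_hom_pair_def lmodule_axioms FT.VP.lmodule_axioms)
        show "x \<oplus>\<^bsub>A\<^esub> y \<in> ?U" if "x \<in> ?U" "y \<in> ?U" for x y
          using that submodule_closed(3) [OF W.sub, of "vec1 x" "vec1 y"] mod_hom_add [OF vec1_hom, of x y] by auto
        show "c \<odot>\<^bsub>A\<^esub> x \<in> ?U" if "x \<in> ?U" for c x
          using that submodule_closed(4) [OF W.sub, of "vec1 x" c] mod_hom_smult [OF vec1_hom, of c x] by auto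
      qed auto
      moreover have "?K \<subseteq> ?U"
      proof
        fix x assume "x \<in> ?K"
        then obtain a b where ab: "a \<in> carrier A" "b \<in> carrier A" "x = a \<otimes>\<^bsub>A\<^esub> b \<ominus>\<^bsub>A\<^esub> b \<otimes>\<^bsub>A\<^esub> a" by blast
        then have "x \<in> carrier A" by simp
        then show "x \<in> ?U" using commutator_b_map [OF ab(1,2)] ab(3) by blast
      qed
      ultimately have "commutator_space A \<subseteq> ?U"
        unfolding commutator_space_def by (rule vspan_least [OF K])
      then show ?thesis using that by blast
    qed
    show "vec1 (v 1) \<ominus>\<^bsub>vpower A 1\<^esub> v \<in> ?W" if "v \<in> carrier (vpower A 1)" for v
      using v1 [OF that] FT.VP.M.minus_self [OF that] submodule_closed(2) [OF W.sub] by simp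
    show "vec1 a 1 \<ominus>\<^bsub>A\<^esub> a \<in> commutator_space A" if "a \<in> carrier A" for a
      using that c.W.zero_closed by simp
  qed
  then show ?thesis
    unfolding homology.simps boundaries(1) by (simp only: rank_simps)
qed

lemma J_subspace: "vsubspace (J_map m ` carrier A) (vpower A m)"
  and J_boundary: "\<And>v. v \<in> J_map m ` carrier A \<Longrightarrow> b_map m v = \<zero>\<^bsub>A\<^esub>"
  and b_map_hom: "b_map m \<in> mod_hom ground (vpower A m) A"
proof -
  have d: "\<delta> n \<in> mod_hom ground (C (Suc n)) (C n)" and vs: "vspace (C n)" for n
    using C_complex by (simp_all add: chain_complex_def)
  have "submodule (\<delta> (Suc 0) ` carrier (C (Suc (Suc 0)))) ground (C (Suc 0))"
    by (rule image_submodule [OF _ d]) (use vs in \<open>simp add: mod_hom_pair_def vspace_def\<close>)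
  then show "vsubspace (J_map m ` carrier A) (vpower A m)"
    using vs [of "Suc 0"] unfolding boundaries(2) by (simp add: vsubspace_def vsubspace_axioms_def rank_simps)
  have "\<delta> 0 \<in> mod_hom ground (vpower A m) (vpower A 1)"
    using d [of 0] by (simp only: rank_simps)
  then have "(\<lambda>a. \<delta> 0 a 1) \<in> mod_hom ground (vpower A m) A"
    by (rule mod_hom_comp) (rule vpower_component_hom, simp)
  moreover have "\<delta> 0 a 1 = b_map m a" if "a \<in> carrier (vpower A m)" for a
    using \<delta>_0 [OF that] by (simp del: One_nat_def)
  ultimately show b: "b_map m \<in> mod_hom ground (vpower A m) A"
    unfolding mod_hom_def Pi_iff using FT.VP.M.a_closed FT.VP.smult_closed by (simp del: vpower_simps One_nat_def)
  fix v assume "v \<in> J_map m ` carrier A"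
  then obtain w where w: "w \<in> carrier (C (Suc (Suc 0)))" "v = \<delta> (Suc 0) w" unfolding boundaries(2) [symmetric] by blast
  have "v \<in> carrier (vpower A m)" using mod_hom_closed [OF d w(1)] w(2) by (simp only: rank_simps)
  then have "vec1 (b_map m v) = \<zero>\<^bsub>C 0\<^esub>"
    using C_complex w \<delta>_0 [of v] unfolding chain_complex_def by metis
  then show "b_map m v = \<zero>\<^bsub>A\<^esub>"
    unfolding rank_simps zero1 by simp
qed

lemma homology_1: "homology C \<delta> 1 \<cong>\<^sub>v vkernel (vpower A m /\<^sub>v (J_map m ` carrier A)) A (b_bar m)"
proof -
  have "vkernel (C (Suc 0)) (C 0) (\<delta> 0) = vkernel (vpower A m) A (b_map m)"
  proof -
    have "\<delta> 0 v = \<zero>\<^bsub>vpower A 1\<^esub> \<longleftrightarrow> b_map m v = \<zero>\<^bsub>A\<^esub>" if "v \<in> carrier (vpower A m)" for v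
      unfolding \<delta>_0 [OF that] zero1 by simp
    then have "{v \<in> carrier (vpower A m). \<delta> 0 v = \<zero>\<^bsub>vpower A 1\<^esub>} = {v \<in> carrier (vpower A m). b_map m v = \<zero>\<^bsub>A\<^esub>}"
      by blast
    then show ?thesis by (simp only: vkernel_def rank_simps)
  qed
  then have "homology C \<delta> 1 = vkernel (vpower A m) A (b_map m) /\<^sub>v (J_map m ` carrier A)"
    using boundaries(2) by (simp only: One_nat_def homology.simps)
  then show ?thesis
    using vkernel_vquot_iso [OF J_subspace lmodule_axioms b_map_hom J_boundary] by (simp only: b_bar_def)
qed

text \<open>
  The \<open>m\<close>-th component of \<open>J_map m a\<close> is \<open>a K\<^bsub>m-1\<^esub>\<close>, from which \<open>a\<close> can be recovered.
\<close>

lemma J_map_injective: "\<lbrakk>a \<in> carrier A; J_map m a = \<zero>\<^bsub>vpower A m\<^esub>\<rbrakk> \<Longrightarrow> a = \<zero>\<^bsub>A\<^esub>"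
proof -
  assume a: "a \<in> carrier A" and J: "J_map m a = \<zero>\<^bsub>vpower A m\<^esub>"
  have "D m rel \<odot>\<^bsub>Rt\<^esub> a = \<zero>\<^bsub>A\<^esub>"
    using fun_cong [OF J, of m] m_pos unfolding J_map_eq [OF a] by simp
  then have "a \<otimes>\<^bsub>A\<^esub> cls (cofactor m) = \<zero>\<^bsub>A\<^esub>"
    using a cofactor_P by (simp add: D_rel right_act_ten)
  then show "a = \<zero>\<^bsub>A\<^esub>"
    using cancel_cofactor_mult [OF a] AA.hom_zero [OF cancel_cofactor_hom] by simp
qed

text \<open>
  In degree \<open>2\<close> the differential is \<open>J_map m\<close>, and in all higher degrees the complex is zero.
\<close>

lemma homology_higher: "2 \<le> q \<Longrightarrow> \<exists>X. carrier (homology C \<delta> q) = {X}"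
proof -
  assume q: "2 \<le> q"
  then obtain n where n: "q = Suc (Suc n)" using nat_le_iff_add by (metis add_2_eq_Suc)
  show ?thesis
    unfolding n
  proof (rule homology_trivial [OF C_complex])
    fix x assume x: "x \<in> carrier (C (Suc (Suc n)))" "\<delta> (Suc n) x = \<zero>\<^bsub>C (Suc n)\<^esub>"
    show "x = \<zero>\<^bsub>C (Suc (Suc n))\<^esub>"
    proof (cases n)
      case 0
      obtain a where a: "a \<in> carrier A" "x = vec1 a" using x(1) 0 C_carrier(2) by auto
      have "J_map m a = \<zero>\<^bsub>vpower A m\<^esub>"
        using x(2) \<delta>_1 [OF a(1)] a(2) 0 by (simp only: One_nat_def rank_simps)
      then have "a = \<zero>\<^bsub>A\<^esub>" by (rule J_map_injective [OF a(1)])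
      then show ?thesis using a(2) 0 by (simp add: rank_simps vec1_def)
    next
      case (Suc k)
      then show ?thesis using x(1) by (simp add: rank_simps restrict_def)
    qed
  qed
qed

end

theorem proposition4p4:
  fixes m :: nat
    and A :: "('k::field, (nat list \<Rightarrow>\<^sub>0 'k) set) module"
    and P :: "nat \<Rightarrow> (((nat list \<Rightarrow>\<^sub>0 'k) set \<times> (nat list \<Rightarrow>\<^sub>0 'k) set \<Rightarrow>\<^sub>0 'k) set, 'p) module"
    and d :: "nat \<Rightarrow> 'p \<Rightarrow> 'p"
    and \<epsilon> :: "'p \<Rightarrow> (nat list \<Rightarrow>\<^sub>0 'k) set"
  assumes "odd m"
    and "A = continuant_algebra m"
    and "bimodule_resolution A P d \<epsilon>"
  shows "HH A P d 0 \<cong>\<^sub>v A /\<^sub>v commutator_space A \<and>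
    HH A P d 1 \<cong>\<^sub>v vkernel (vpower A m /\<^sub>v (J_map m ` carrier A)) A (b_bar m) \<and>
    (\<forall>q\<ge>2. carrier (HH A P d q) = {\<zero>\<^bsub>HH A P d q\<^esub>})"
proof -
  interpret continuant_quotient m A
    using assms(1,2) by unfold_locales (auto intro: odd_pos)
  have P: "projective_resolution E L P d \<epsilon>"
    using assms(3) by (simp only: bimodule_resolution_def)
  have sc: "c \<odot>\<^bsub>E\<^esub> \<one>\<^bsub>E\<^esub> \<in> carrier E" for c by simp
  have iso: "HH A P d q \<cong>\<^sub>v homology C \<delta> q" for q
    unfolding HH_def
    by (rule vs_iso_trans [OF Tor_independent [OF P resolution lmodule_right_enveloping sc] Tor_iso])
  have cc: "chain_complex (\<lambda>n. tensor E Rt (P n)) (\<lambda>n. tensor_map E Rt (P n) (d n))"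
    by (rule tensor_chain_complex [OF resolution_tensor_complex [OF P lmodule_right_enveloping sc]])
      (rule resolution_facts(9) [OF P])
  have l: "lmodule ground (HH A P d q)" for q
    using lmodule_homology [OF cc] by (simp only: HH_def Tor_def)
  have "carrier (HH A P d q) = {\<zero>\<^bsub>HH A P d q\<^esub>}" if q: "2 \<le> q" for q
  proof -
    obtain X where "carrier (homology C \<delta> q) = {X}" using homology_higher [OF q] ..
    then show ?thesis by (rule vs_iso_trivial [OF iso _ l])
  qed
  then show ?thesis
    using vs_iso_trans [OF iso homology_0] vs_iso_trans [OF iso homology_1] by (intro conjI allI impI)
qed

end
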